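(* Let $d\ge4$, and let $N$, $g$, $\phi^*$, $\chi$, $k$ be as in the context. Consider the following assertions. (i) The equator map $\phi\equiv\phi^*$ is the unique global minimizer of $E_e$ on $F_{\phi^*}$. (ii) The only weak solution of (EWM) which satisfies the energy inequality (EI) and has initial data $\phi_0=\phi^*$, $\phi_1=0$ is the one identically equal to $\phi^*$. (iii) There does not exist a blow-up profile $\psi:[0,1]\to\mathbb{R}$ such that $\psi(1)=\phi^*$ and $R_\chi\psi\in\mathcal{C}^\infty(\bar B_{\mathbb{R}^d}(0,1))$. Then (i) $\Rightarrow$ (ii) $\Rightarrow$ (iii).
   Context: Geometric setting. $N$ is a manifold embedded in $\mathbb{R}^K$ carrying coordinates $(\phi,\chi)\in\mathbb{R}\times\mathbb{S}^{M-1}$ (possibly periodic in $\phi$) in which its metric is $d\phi^2+g(\phi)^2d\chi^2$, where $g$ is a smooth odd function with $g'(0)=1$. There is $\phi^*>0$ with $g'(\phi^* )=0$, and $\phi^*$ is the smallest positive number with this property. Equivariance. $\chi:\mathbb{S}^{d-1}\to\mathbb{S}^{M-1}$ is an eigenmap: for a constant $k=\ell(\ell+d-2)$, $\ell\in\mathbb{N}$, one has $|\nabla\chi|^2=k$ and $\Delta_{\mathbb{S}^{d-1}}\chi+k\chi=0$. For a real function $\phi$ of $r$ (possibly also of $t$), $R_\chi\phi$ is the map into $N$ sending the point of $\mathbb{R}^d$ with polar coordinates $(r,\omega)$ to the point of $N$ with coordinates $(\phi(r),\chi(\omega))$. Energy. $E_e(\phi)=\int_0^1\left(\phi_r^2+\frac{k}{r^2}g^2(\phi)\right)r^{d-1}\,dr$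 and $F_\alpha=\{\phi:[0,1]\to\mathbb{R}:\ \phi_r\in L^2(r^{d-1}dr),\ \phi(1)=\alpha\}$. Wave maps. (EWM) is the problem $$\phi_{tt}-\phi_{rr}-\frac{d-1}{r}\phi_r+\frac{k}{r^2}g(\phi)g'(\phi)=0,\qquad \phi(t=0)=\phi_0,\quad \phi_t(t=0)=\phi_1 .$$ It is the form taken by the wave map equation (WM), $\partial_t^2u-\Delta u\perp T_uN$, for equivariant maps $u=R_\chi\phi$. A weak solution is a function $\phi(r,t)$, $t\ge 0$, such that $u=R_\chi\phi$ satisfies $(u,u_t)\in L^\infty_t(\dot H^1_{loc}\times L^2_{loc})$, the equation holds in the sense of distributions (with $\phi$ viewed as a radial function of $x\in\mathbb{R}^d$ and of $t>0$), and $(u,u_t)$ converges weakly (locally) in $\dot H^1\times L^2$ to the data as $t\to0$. Energy inequality (EI): for all $0\le T<R$, $$E(T,R-T,\phi)+\operatorname{flux}(0,T,R,\phi)\le E(0,R,\phi),$$ where $E(t,R,\phi)=\int_0^R\left(\phi_r^2+\frac{k}{r^2}g(\phi)^2+\phi_t^2\right)(r,t)\,r^{d-1}dr$ and $$\operatorname{flux}(0,T,R,\phi)=\int_0^T\left[\phi_t^2+\phi_r^2+\frac{k}{r^2}g(\phi)^2-2\phi_t\phi_r\right]_{r=R-s,\,t=s}(R-s)^{d-1}\,ds$$ is the flux through the lateral surface $\{r=R-s,\ 0\le s\le T\}$ of the truncated backward cone. Blow-up profile: a function $\psi:[0,1]\to\mathbb{R}$ such that $\phi(r,t)=\psi(r/t)$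 solves the (equivariant) wave map equation in $\{0\le r< t\}$, equivalently, such that on $(0,1)$ $$\rho^2(1-\rho^2)\psi''+\rho\big((d-1)-2\rho^2\big)\psi'-kg(\psi)g'(\psi)=0 .$$ *)

theory Defs
  imports "HOL-Analysis.Analysis"
begin

subsection \<open>Smooth functions and embedded submanifolds\<close>

definition dir_deriv :: "'a::real_normed_vector \<Rightarrow> ('a \<Rightarrow> 'b::real_normed_vector) \<Rightarrow> 'a \<Rightarrow> 'b"
  where "dir_deriv v f x = frechet_derivative f (at x) v"

text \<open>\<open>Ck_on n S f\<close>: \<open>f\<close> is of class \<open>C\<^sup>n\<close> on the open set \<open>S\<close>.\<close>

primrec Ck_on :: "nat \<Rightarrow> 'a::real_normed_vector set \<Rightarrow> ('a \<Rightarrow> 'b::real_normed_vector) \<Rightarrow> bool"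
  where
    "Ck_on 0 S f \<longleftrightarrow> continuous_on S f"
  | "Ck_on (Suc n) S f \<longleftrightarrow> (\<forall>x\<in>S. f differentiable (at x)) \<and> (\<forall>v. Ck_on n S (dir_deriv v f))"

definition smooth_on :: "'a::real_normed_vector set \<Rightarrow> ('a \<Rightarrow> 'b::real_normed_vector) \<Rightarrow> bool"
  where "smooth_on S f \<longleftrightarrow> (\<forall>n. Ck_on n S f)"

definition embedded_submanifold :: "nat \<Rightarrow> 'a::euclidean_space set \<Rightarrow> bool"
  where "embedded_submanifold m N \<longleftrightarrow>
    (\<forall>p\<in>N. \<exists>U V (h :: 'a \<Rightarrow> 'a) h' S.
      open U \<and> p \<in> U \<and> open V \<and> homeomorphism U V h h' \<and>
      smooth_on U h \<and> smooth_on V h' \<and>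
      subspace S \<and> dim S = m \<and> h ` (U \<inter> N) = V \<inter> S)"

subsection \<open>The target manifold\<close>

text \<open>The coordinates \<open>(\<phi>, \<chi>) \<in> \<real> \<times> \<S>\<close> are given by the parametrization \<open>P\<close>, which
  sends them to a point of \<open>N\<close>; only its values for \<open>\<chi>\<close> in the unit sphere matter. A number
  \<open>T\<close> is a period of the coordinate \<open>\<phi>\<close> if \<open>\<phi>\<close> and \<open>\<phi> + T\<close> describe the same points
  (\<open>T = 0\<close> always is one, and it is the only one if the coordinate is not periodic).\<close>

definition coord_period :: "(real \<Rightarrow> 'm::real_normed_vector \<Rightarrow> 'n) \<Rightarrow> real \<Rightarrow> bool"
  where "coord_period P T \<longleftrightarrow> (\<forall>s. \<forall>y\<in>sphere 0 1. P (s + T) y = P s y)"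

text \<open>The map \<open>\<lambda>(s, y). P s (sgn y)\<close>, with \<open>sgn y = y / |y|\<close>, extends \<open>P\<close> to
  \<open>y \<noteq> 0\<close> by homogeneity; its derivative on vectors \<open>(a, v)\<close> with \<open>v\<close> tangent to the sphere is
  the differential of \<open>P\<close>. The fifth condition says that the metric induced on \<open>N\<close> by the ambient
  space is \<open>d\<phi>\<^sup>2 + g(\<phi>)\<^sup>2 d\<chi>\<^sup>2\<close>. The last one says that the coordinates
  are unique away from the poles \<open>g(\<phi>) = 0\<close>, up to periods and up to the identification of
  \<open>(\<phi>, \<chi>)\<close> with \<open>(-\<phi>, -\<chi>)\<close> that comes with polar coordinates having a signed radius.\<close>

definition warped_coordinates ::
  "(real^'n) set \<Rightarrow> (real \<Rightarrow> real) \<Rightarrow> (real \<Rightarrow> real^'m \<Rightarrow> real^'n) \<Rightarrow> bool"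
  where "warped_coordinates N g P \<longleftrightarrow>
    embedded_submanifold CARD('m) N \<and>
    (\<lambda>(s, y). P s y) ` (UNIV \<times> sphere 0 1) = N \<and>
    smooth_on (UNIV \<times> (- {0})) (\<lambda>(s, y). P s (sgn y)) \<and>
    (\<forall>s. \<forall>y\<in>sphere 0 1. P (- s) (- y) = P s y) \<and>
    (\<forall>s. \<forall>y\<in>sphere 0 1. \<forall>a v. v \<bullet> y = 0 \<longrightarrow>
       (norm (dir_deriv (a, v) (\<lambda>(s, y). P s (sgn y)) (s, y)))\<^sup>2 = a\<^sup>2 + (g s)\<^sup>2 * (norm v)\<^sup>2) \<and>
    (\<forall>s s'. \<forall>y\<in>sphere 0 1. \<forall>y'\<in>sphere 0 1. P s y = P s' y' \<and> g s \<noteq> 0 \<longrightarrow>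
       (\<exists>T. coord_period P T \<and> (s' = s + T \<and> y' = y \<or> s' = T - s \<and> y' = - y)))"

text \<open>The gradient and Laplacian on the unit sphere are those of the homogeneous extension
  \<open>\<lambda>x. X (sgn x)\<close> of degree 0, restricted to the sphere.\<close>

definition eigenmap :: "real \<Rightarrow> (real^'d \<Rightarrow> real^'m) \<Rightarrow> bool"
  where "eigenmap k X \<longleftrightarrow>
    X ` sphere 0 1 \<subseteq> sphere 0 1 \<and>
    smooth_on (- {0}) (\<lambda>x. X (sgn x)) \<and>
    (\<forall>\<omega>\<in>sphere 0 1. (\<Sum>i\<in>Basis. (norm (dir_deriv i (\<lambda>x. X (sgn x)) \<omega>))\<^sup>2) = k) \<and>
    (\<forall>\<omega>\<in>sphere 0 1.
       (\<Sum>i\<in>Basis. dir_deriv i (dir_deriv i (\<lambda>x. X (sgn x))) \<omega>) + k *\<^sub>R X \<omega> = 0)"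

definition equivariant_map ::
  "(real \<Rightarrow> real^'m \<Rightarrow> real^'n) \<Rightarrow> (real^'d \<Rightarrow> real^'m) \<Rightarrow> (real \<Rightarrow> real) \<Rightarrow> real^'d \<Rightarrow> real^'n"
  where "equivariant_map P X \<phi> x = P (\<phi> (norm x)) (X (sgn x))"

subsection \<open>Weak derivatives and weak convergence\<close>

definition test_fun :: "'a::euclidean_space set \<Rightarrow> ('a \<Rightarrow> real) \<Rightarrow> bool"
  where "test_fun \<Omega> \<eta> \<longleftrightarrow>
    smooth_on UNIV \<eta> \<and> (\<exists>K. compact K \<and> K \<subseteq> \<Omega> \<and> (\<forall>x. x \<notin> K \<longrightarrow> \<eta> x = 0))"

definition loc_integrable :: "'a::euclidean_space set \<Rightarrow> ('a \<Rightarrow> 'b::euclidean_space) \<Rightarrow> bool"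
  where "loc_integrable \<Omega> f \<longleftrightarrow> (\<forall>K. compact K \<and> K \<subseteq> \<Omega> \<longrightarrow> set_integrable lborel K f)"

text \<open>\<open>w\<close> is the distributional derivative of \<open>u\<close> in direction \<open>v\<close> on the open set \<open>\<Omega>\<close>.\<close>

definition has_weak_deriv ::
  "'a::euclidean_space set \<Rightarrow> 'a \<Rightarrow> ('a \<Rightarrow> 'b::euclidean_space) \<Rightarrow> ('a \<Rightarrow> 'b) \<Rightarrow> bool"
  where "has_weak_deriv \<Omega> v u w \<longleftrightarrow>
    loc_integrable \<Omega> u \<and> loc_integrable \<Omega> w \<and>
    (\<forall>\<eta>. test_fun \<Omega> \<eta> \<longrightarrow>
      (\<integral>x. dir_deriv v \<eta> x *\<^sub>R u x \<partial>lborel) = - (\<integral>x. \<eta> x *\<^sub>R w x \<partial>lborel))"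

definition L2_on :: "'a::euclidean_space set \<Rightarrow> ('a \<Rightarrow> 'b::euclidean_space) \<Rightarrow> bool"
  where "L2_on A f \<longleftrightarrow>
    set_borel_measurable lborel A f \<and> (\<integral>\<^sup>+x\<in>A. ennreal ((norm (f x))\<^sup>2) \<partial>lborel) < \<infinity>"

text \<open>Weak convergence in \<open>L\<^sup>2\<^sub>l\<^sub>o\<^sub>c\<close> of \<open>F (\<cdot>, t)\<close> to \<open>f\<close> as \<open>t \<rightarrow> 0\<close>; since \<open>F\<close> is an
  element of a Lebesgue space in space-time, a null set \<open>Z\<close> of times is left out.\<close>

definition weakly_tendsto_initially ::
  "('a::euclidean_space \<times> real \<Rightarrow> 'b::euclidean_space) \<Rightarrow> ('a \<Rightarrow> 'b) \<Rightarrow> bool"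
  where "weakly_tendsto_initially F f \<longleftrightarrow>
    (\<forall>\<rho>>0. L2_on (cball 0 \<rho>) f \<and>
      (\<exists>Z\<in>null_sets lborel.
        (\<forall>t\<in>{0<..} - Z. L2_on (cball 0 \<rho>) (\<lambda>x. F (x, t))) \<and>
        (\<forall>\<zeta>. L2_on (cball 0 \<rho>) \<zeta> \<longrightarrow>
          ((\<lambda>t. LINT x:cball 0 \<rho>|lborel. F (x, t) \<bullet> \<zeta> x)
            \<longlongrightarrow> (LINT x:cball 0 \<rho>|lborel. f x \<bullet> \<zeta> x)) (at 0 within ({0<..} - Z)))))"

subsection \<open>The elliptic energy\<close>

text \<open>A function in \<open>F\<^sub>\<alpha>\<close> is accompanied by its (almost everywhere unique) weak derivative
  \<open>\<phi>r\<close>. It is taken continuous on \<open>(0, 1]\<close>, which selects the representative for which the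
  boundary value \<open>\<phi> 1\<close> is meaningful; the value at \<open>0\<close> is irrelevant.\<close>

definition F_space :: "nat \<Rightarrow> real \<Rightarrow> (real \<Rightarrow> real) \<Rightarrow> (real \<Rightarrow> real) \<Rightarrow> bool"
  where "F_space d \<alpha> \<phi> \<phi>r \<longleftrightarrow>
    continuous_on {0<..1} \<phi> \<and> has_weak_deriv {0<..<1} 1 \<phi> \<phi>r \<and>
    (\<integral>\<^sup>+r\<in>{0<..<1}. ennreal ((\<phi>r r)\<^sup>2 * r ^ (d - 1)) \<partial>lborel) < \<infinity> \<and>
    \<phi> 1 = \<alpha>"

definition elliptic_energy ::
  "nat \<Rightarrow> real \<Rightarrow> (real \<Rightarrow> real) \<Rightarrow> (real \<Rightarrow> real) \<Rightarrow> (real \<Rightarrow> real) \<Rightarrow> ennreal"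
  where "elliptic_energy d k g \<phi> \<phi>r =
    (\<integral>\<^sup>+r\<in>{0<..<1}. ennreal (((\<phi>r r)\<^sup>2 + k / r\<^sup>2 * (g (\<phi> r))\<^sup>2) * r ^ (d - 1)) \<partial>lborel)"

definition is_minimizer ::
  "nat \<Rightarrow> real \<Rightarrow> (real \<Rightarrow> real) \<Rightarrow> real \<Rightarrow> (real \<Rightarrow> real) \<Rightarrow> (real \<Rightarrow> real) \<Rightarrow> bool"
  where "is_minimizer d k g \<alpha> \<phi> \<phi>r \<longleftrightarrow>
    F_space d \<alpha> \<phi> \<phi>r \<and>
    (\<forall>\<psi> \<psi>r. F_space d \<alpha> \<psi> \<psi>r \<longrightarrow> elliptic_energy d k g \<phi> \<phi>r \<le> elliptic_energy d k g \<psi> \<psi>r)"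

definition equator_unique_minimizer :: "nat \<Rightarrow> real \<Rightarrow> (real \<Rightarrow> real) \<Rightarrow> real \<Rightarrow> bool"
  where "equator_unique_minimizer d k g \<phi>s \<longleftrightarrow>
    is_minimizer d k g \<phi>s (\<lambda>r. \<phi>s) (\<lambda>r. 0) \<and>
    (\<forall>\<phi> \<phi>r. is_minimizer d k g \<phi>s \<phi> \<phi>r \<longrightarrow> (\<forall>r\<in>{0<..1}. \<phi> r = \<phi>s))"

subsection \<open>Weak solutions and the energy inequality\<close>

definition has_energy_regularity ::
  "((real^'d) \<times> real \<Rightarrow> real^'n) \<Rightarrow> (real^'d \<Rightarrow> (real^'d) \<times> real \<Rightarrow> real^'n) \<Rightarrow>
   ((real^'d) \<times> real \<Rightarrow> real^'n) \<Rightarrow> bool"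
  where "has_energy_regularity u Du ut \<longleftrightarrow>
    (\<forall>i\<in>Basis. has_weak_deriv (UNIV \<times> {0<..}) (i, 0) u (Du i)) \<and>
    has_weak_deriv (UNIV \<times> {0<..}) (0, 1) u ut \<and>
    (\<forall>\<rho>>0. \<exists>C::real. AE t in lborel. 0 < t \<longrightarrow>
      (\<integral>\<^sup>+x\<in>cball 0 \<rho>. ennreal ((\<Sum>i\<in>Basis. (norm (Du i (x, t)))\<^sup>2) + (norm (ut (x, t)))\<^sup>2) \<partial>lborel)
        \<le> ennreal C)"

text \<open>Weak local convergence of \<open>(u, u\<^sub>t)\<close> in \<open>H\<^sup>1 \<times> L\<^sup>2\<close>: the functions converge
  along with their gradients, so that the limit of \<open>u\<close> is not merely determined up to a constant.\<close>

definition attains_data ::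
  "((real^'d) \<times> real \<Rightarrow> real^'n) \<Rightarrow> (real^'d \<Rightarrow> (real^'d) \<times> real \<Rightarrow> real^'n) \<Rightarrow>
   ((real^'d) \<times> real \<Rightarrow> real^'n) \<Rightarrow> (real^'d \<Rightarrow> real^'n) \<Rightarrow> (real^'d \<Rightarrow> real^'n) \<Rightarrow> bool"
  where "attains_data u Du ut u0 u1 \<longleftrightarrow>
    weakly_tendsto_initially u u0 \<and>
    (\<forall>i\<in>Basis. \<exists>w. has_weak_deriv UNIV i u0 w \<and> weakly_tendsto_initially (Du i) w) \<and>
    weakly_tendsto_initially ut u1"

text \<open>\<open>\<phi>\<close> is viewed as a radial function, so \<open>\<phi>\<^sub>r\<^sub>r + (d-1)/r \<phi>\<^sub>r\<close> is its Laplacian.\<close>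

definition ewm_distributional ::
  "'d::finite itself \<Rightarrow> real \<Rightarrow> (real \<Rightarrow> real) \<Rightarrow> (real \<times> real \<Rightarrow> real) \<Rightarrow> bool"
  where "ewm_distributional D k g \<phi> \<longleftrightarrow>
    loc_integrable (UNIV \<times> {0<..}) (\<lambda>(x :: real^'d, t). \<phi> (norm x, t)) \<and>
    loc_integrable (UNIV \<times> {0<..})
      (\<lambda>(x :: real^'d, t). k / (norm x)\<^sup>2 * g (\<phi> (norm x, t)) * deriv g (\<phi> (norm x, t))) \<and>
    (\<forall>\<eta> :: (real^'d) \<times> real \<Rightarrow> real. test_fun (UNIV \<times> {0<..}) \<eta> \<longrightarrow>
      (\<integral>(x, t). \<phi> (norm x, t) * (dir_deriv (0, 1) (dir_deriv (0, 1) \<eta>) (x, t)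
                     - (\<Sum>i\<in>Basis. dir_deriv (i, 0) (dir_deriv (i, 0) \<eta>) (x, t)))
               + k / (norm x)\<^sup>2 * g (\<phi> (norm x, t)) * deriv g (\<phi> (norm x, t)) * \<eta> (x, t) \<partial>lborel) = 0)"

text \<open>Functions of \<open>(r, t)\<close> are functions on \<open>real \<times> real\<close>. A weak solution \<open>\<phi>\<close> is accompanied
  by Borel representatives \<open>\<phi>r\<close>, \<open>\<phi>t\<close> of its weak partial derivatives; their values at
  \<open>t = 0\<close> (a null set) are by convention those of the initial data. The data for \<open>(u, u\<^sub>t)\<close>
  are the image of \<open>\<phi>0\<close> and the tangent vector with \<open>\<phi>\<close>-component \<open>\<phi>1\<close>.\<close>

definition weak_solution ::
  "(real \<Rightarrow> real^'m \<Rightarrow> real^'n) \<Rightarrow> (real^'d \<Rightarrow> real^'m) \<Rightarrow> real \<Rightarrow> (real \<Rightarrow> real) \<Rightarrow>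
   (real \<Rightarrow> real) \<Rightarrow> (real \<Rightarrow> real) \<Rightarrow>
   (real \<times> real \<Rightarrow> real) \<Rightarrow> (real \<times> real \<Rightarrow> real) \<Rightarrow> (real \<times> real \<Rightarrow> real) \<Rightarrow> bool"
  where "weak_solution P X k g \<phi>0 \<phi>1 \<phi> \<phi>r \<phi>t \<longleftrightarrow>
    \<phi> \<in> borel_measurable borel \<and> \<phi>r \<in> borel_measurable borel \<and> \<phi>t \<in> borel_measurable borel \<and>
    has_weak_deriv ({0<..} \<times> {0<..}) (1, 0) \<phi> \<phi>r \<and>
    has_weak_deriv ({0<..} \<times> {0<..}) (0, 1) \<phi> \<phi>t \<and>
    has_weak_deriv {0<..} 1 \<phi>0 (\<lambda>r. \<phi>r (r, 0)) \<and>
    (\<forall>r>0. \<phi> (r, 0) = \<phi>0 r \<and> \<phi>t (r, 0) = \<phi>1 r) \<and>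
    ewm_distributional TYPE('d) k g \<phi> \<and>
    (\<exists>Du ut.
      has_energy_regularity (\<lambda>(x, t). equivariant_map P X (\<lambda>r. \<phi> (r, t)) x) Du ut \<and>
      attains_data (\<lambda>(x, t). equivariant_map P X (\<lambda>r. \<phi> (r, t)) x) Du ut
        (equivariant_map P X \<phi>0)
        (\<lambda>x. \<phi>1 (norm x) *\<^sub>R
              vector_derivative (\<lambda>s. P s (X (sgn x))) (at (\<phi>0 (norm x)))))"

definition energy ::
  "nat \<Rightarrow> real \<Rightarrow> (real \<Rightarrow> real) \<Rightarrow> (real \<times> real \<Rightarrow> real) \<Rightarrow> (real \<times> real \<Rightarrow> real) \<Rightarrow>
   (real \<times> real \<Rightarrow> real) \<Rightarrow> real \<Rightarrow> real \<Rightarrow> ennreal"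
  where "energy d k g \<phi> \<phi>r \<phi>t t R =
    (\<integral>\<^sup>+r\<in>{0<..<R}. ennreal (((\<phi>r (r, t))\<^sup>2 + k / r\<^sup>2 * (g (\<phi> (r, t)))\<^sup>2 + (\<phi>t (r, t))\<^sup>2)
                            * r ^ (d - 1)) \<partial>lborel)"

definition cone_flux ::
  "nat \<Rightarrow> real \<Rightarrow> (real \<Rightarrow> real) \<Rightarrow> (real \<times> real \<Rightarrow> real) \<Rightarrow> (real \<times> real \<Rightarrow> real) \<Rightarrow>
   (real \<times> real \<Rightarrow> real) \<Rightarrow> real \<Rightarrow> real \<Rightarrow> ennreal"
  where "cone_flux d k g \<phi> \<phi>r \<phi>t T R =
    (\<integral>\<^sup>+s\<in>{0<..<T}. ennreal (((\<phi>t (R - s, s))\<^sup>2 + (\<phi>r (R - s, s))\<^sup>2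
                              + k / (R - s)\<^sup>2 * (g (\<phi> (R - s, s)))\<^sup>2
                              - 2 * \<phi>t (R - s, s) * \<phi>r (R - s, s)) * (R - s) ^ (d - 1)) \<partial>lborel)"

definition energy_inequality ::
  "nat \<Rightarrow> real \<Rightarrow> (real \<Rightarrow> real) \<Rightarrow> (real \<times> real \<Rightarrow> real) \<Rightarrow> (real \<times> real \<Rightarrow> real) \<Rightarrow>
   (real \<times> real \<Rightarrow> real) \<Rightarrow> bool"
  where "energy_inequality d k g \<phi> \<phi>r \<phi>t \<longleftrightarrow>
    (\<forall>T R. 0 \<le> T \<and> T < R \<longrightarrow>
      energy d k g \<phi> \<phi>r \<phi>t T (R - T) + cone_flux d k g \<phi> \<phi>r \<phi>t T R \<le> energy d k g \<phi> \<phi>r \<phi>t 0 R)"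

text \<open>Since a weak solution is constrained only through \<open>u\<close>, it is determined as a
  function with values in the coordinate line of \<open>N\<close>, that is, up to a period \<open>T\<close> of \<open>\<phi>\<close>
  (in the non-periodic case \<open>T = 0\<close>).\<close>

definition equator_unique_weak_solution ::
  "(real \<Rightarrow> real^'m \<Rightarrow> real^'n) \<Rightarrow> (real^'d \<Rightarrow> real^'m) \<Rightarrow> real \<Rightarrow> (real \<Rightarrow> real) \<Rightarrow> real \<Rightarrow> bool"
  where "equator_unique_weak_solution P X k g \<phi>s \<longleftrightarrow>
    weak_solution P X k g (\<lambda>r. \<phi>s) (\<lambda>r. 0) (\<lambda>p. \<phi>s) (\<lambda>p. 0) (\<lambda>p. 0) \<and>
    energy_inequality CARD('d) k g (\<lambda>p. \<phi>s) (\<lambda>p. 0) (\<lambda>p. 0) \<and>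
    (\<forall>\<phi> \<phi>r \<phi>t.
      weak_solution P X k g (\<lambda>r. \<phi>s) (\<lambda>r. 0) \<phi> \<phi>r \<phi>t \<and>
      energy_inequality CARD('d) k g \<phi> \<phi>r \<phi>t \<longrightarrow>
      (\<exists>T. coord_period P T \<and>
        (AE p in lborel. p \<in> {0<..} \<times> {0<..} \<longrightarrow> \<phi> p = \<phi>s + T)))"

subsection \<open>Blow-up profiles\<close>

definition blowup_profile :: "nat \<Rightarrow> real \<Rightarrow> (real \<Rightarrow> real) \<Rightarrow> (real \<Rightarrow> real) \<Rightarrow> bool"
  where "blowup_profile d k g \<psi> \<longleftrightarrow>
    (\<exists>\<psi>' \<psi>''. \<forall>\<rho>\<in>{0<..<1}.
      (\<psi> has_real_derivative \<psi>' \<rho>) (at \<rho>) \<and> (\<psi>' has_real_derivative \<psi>'' \<rho>) (at \<rho>) \<and>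
      \<rho>\<^sup>2 * (1 - \<rho>\<^sup>2) * \<psi>'' \<rho> + \<rho> * ((real d - 1) - 2 * \<rho>\<^sup>2) * \<psi>' \<rho>
        - k * g (\<psi> \<rho>) * deriv g (\<psi> \<rho>) = 0)"

text \<open>Smoothness up to the boundary means having a smooth extension to a neighbourhood of the
  closed ball. The origin, where polar coordinates are singular, is covered by the extension.\<close>

definition smooth_on_closed_unit_ball :: "(real^'d \<Rightarrow> real^'n) \<Rightarrow> bool"
  where "smooth_on_closed_unit_ball u \<longleftrightarrow>
    (\<exists>W U. open W \<and> cball 0 1 \<subseteq> W \<and> smooth_on W U \<and> (\<forall>x\<in>cball 0 1 - {0}. U x = u x))"

definition no_smooth_profile ::
  "(real \<Rightarrow> real^'m \<Rightarrow> real^'n) \<Rightarrow> (real^'d \<Rightarrow> real^'m) \<Rightarrow> real \<Rightarrow> (real \<Rightarrow> real) \<Rightarrow> real \<Rightarrow> bool"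
  where "no_smooth_profile P X k g \<phi>s \<longleftrightarrow>
    \<not> (\<exists>\<psi>. blowup_profile CARD('d) k g \<psi> \<and> \<psi> 1 = \<phi>s \<and>
           smooth_on_closed_unit_ball (equivariant_map P X \<psi>))"

end

theory Submission imports Defs begin

text \<open>
  (ii) implies (iii): continued by the constant \<open>\<phi>s\<close> outside the light cone, a smooth profile gives a
  self-similar solution. It has the data of the equator map, and the first integral of the
  profile equation (which bounds the profile at the vertex) turns its local energy balance into (EI).
  Uniqueness makes the profile a constant, and since the profile is regular at the origin while
  \<open>g(\<phi>s) \<noteq> 0\<close>, that is impossible.

  (i) implies (ii): letting the cone height tend to \<open>R\<close> in (EI), the flux through the full backward cone is at
  most the energy of the equator map. The flux is the elliptic energy of the restriction
  \<open>r \<mapsto> \<phi>(r, R - r)\<close> to the cone, so after rescaling this restriction is a minimizer, provided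
  that its value at \<open>r = R\<close> is \<open>\<phi>s\<close> up to a period. The latter holds because
  the flux and the energy make \<open>\<phi>\<close> Hoelder continuous along cones and at fixed times, so that \<open>\<phi>\<close> has an
  initial trace, which the weak convergence to the data identifies.\<close>

text \<open>Along the line r + t = R the derivative of \<phi> in r is \<phi>_r - \<phi>_t, whose
  square is exactly what the flux integrand contains besides the potential; hence the form of E_e.
  Under rescaling, energies and fluxes of cones of size R become R^(d-2) times quantities on the
  unit interval, so one minimization problem serves every cone. The obstacle is that \<phi> is known
  only almost everywhere in (r, t), while the argument lives on lines: after a shear of the plane a
  weak derivative yields a primitive on almost every line, and the trace is defined and compared off
  null sets throughout. Moreover, the data fix the trace only modulo periods of the coordinate;
  nonzero periods stay away from 0, so Hoelder continuity forces a single one. In the other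
  implication the profile equation degenerates at the vertex and on the light cone. In the variable
  q = (r/t)^2 it is a divergence identity, and a cutoff in q permits integration by parts before the
  singular sets are approached. The derivative term of the first integral carries the factor 1 -
  \<rho>^2, so no energy is created or lost across the cone.\<close>

section \<open>Smooth functions and their directional derivatives\<close>

lemma dir_deriv_eq: "(f has_derivative D) (at x) ==> dir_deriv v f x = D v"
 unfolding dir_deriv_def using frechet_derivative_at by metis

text \<open>At successor levels \<open>Ck_on\<close> does not mention continuity of f itself, so
  even this monotonicity takes an induction; differentiability supplies the base case.\<close>

lemma Ck_on_SucD: "Ck_on (Suc n) S f ==> Ck_on n S f"
proof (induction n arbitrary: f)
 case 0
 then show ?case
  using continuous_at_imp_continuous_on differentiable_imp_continuous_within by fastforce
next
 case (Suc n)
 then show ?case by (metis Ck_on.simps(2))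
qed

lemma smooth_on_dir_deriv: "smooth_on S f ==> smooth_on S (dir_deriv v f)"
 unfolding smooth_on_def by (metis Ck_on.simps(2))

lemma smooth_on_continuous: "smooth_on S f ==> continuous_on S f"
 unfolding smooth_on_def by (metis Ck_on.simps(1))

lemma smooth_on_has_derivative:
 assumes "smooth_on S f" "x \<in> S"
 shows "(f has_derivative (%v. dir_deriv v f x)) (at x)"
proof -
 have "f differentiable at x"
  using assms unfolding smooth_on_def by (metis Ck_on.simps(2))
 then show ?thesis unfolding dir_deriv_def by (simp add: frechet_derivative_works eta_contract_eq)
qed

lemma dir_deriv_linear:
 assumes "smooth_on S f" "x \<in> S"
 shows "linear (%v. dir_deriv v f x)"
 using smooth_on_has_derivative[OF assms] has_derivative_linear by blast

lemma dir_deriv_sum_Basis: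
 fixes f :: "'a::euclidean_space => 'b::real_normed_vector"
 assumes "smooth_on S f" "x \<in> S"
 shows "dir_deriv v f x = (\<Sum>b\<in>Basis. (v \<bullet> b) *\<^sub>R dir_deriv b f x)"
proof -
 interpret linear "%v. dir_deriv v f x" using dir_deriv_linear[OF assms] .
 have "dir_deriv v f x = dir_deriv (\<Sum>b\<in>Basis. (v \<bullet> b) *\<^sub>R b) f x"
  by (simp add: euclidean_representation)
 also have "\<dots> = (\<Sum>b\<in>Basis. (v \<bullet> b) *\<^sub>R dir_deriv b f x)"
  by (simp add: sum scaleR)
 finally show ?thesis .
qed

text \<open>Smoothness gives continuity of the directional derivative in x separately for each v.
  Expanding v in the finite basis makes the bound uniform in v.\<close>

lemma smooth_on_compact_deriv_bound:
 fixes f :: "'a::euclidean_space => 'b::real_normed_vector"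
 assumes "smooth_on S f" "compact K" "K \<subseteq> S"
 obtains C where "C \<ge> 0" "\<And>x v. x \<in> K ==> norm (dir_deriv v f x) \<le> C * norm v"
proof -
 have "\<exists>B\<ge>0. \<forall>x\<in>K. norm (dir_deriv b f x) \<le> B" for b
 proof -
  have "continuous_on K (dir_deriv b f)"
   using smooth_on_continuous[OF smooth_on_dir_deriv[OF assms(1)]] assms(3)
    continuous_on_subset by blast
  then have "bounded (dir_deriv b f ` K)"
   using assms(2) compact_continuous_image compact_imp_bounded by blast
  then show ?thesis
   by (meson bounded_pos imageI less_imp_le)
 qed
 then obtain B where B: "\<And>b. B b \<ge> 0" "\<And>b x. x\<in>K ==> norm (dir_deriv b f x) \<le> B b"
  by metis
 show ?thesis
 proof
  show "sum B Basis \<ge> 0" using B(1) by (simp add: sum_nonneg)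
  fix x v assume x: "x \<in> K"
  have "norm (dir_deriv v f x) \<le> (\<Sum>b\<in>Basis. norm ((v \<bullet> b) *\<^sub>R dir_deriv b f x))"
   using dir_deriv_sum_Basis[OF assms(1), of x v] x assms(3) norm_sum by (metis subsetD)
  also have "\<dots> \<le> (\<Sum>b\<in>Basis. norm v * B b)"
   by (intro sum_mono) (use B x in \<open>auto intro!: mult_mono simp: Basis_le_norm\<close>)
  finally show "norm (dir_deriv v f x) \<le> sum B Basis * norm v"
   by (simp add: sum_distrib_left mult.commute)
 qed
qed

lemma smooth_on_lipschitz:
 fixes f :: "'a::euclidean_space => 'b::real_normed_vector"
 assumes "smooth_on S f" "compact K" "convex K" "K \<subseteq> S"
 obtains C where "C-lipschitz_on K f" "\<And>x v. x \<in> K ==> norm (dir_deriv v f x) \<le> C * norm v"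
proof -
 obtain C where C: "C \<ge> 0" "\<And>x v. x \<in> K ==> norm (dir_deriv v f x) \<le> C * norm v"
  using smooth_on_compact_deriv_bound assms by metis
 have "C-lipschitz_on K f"
 proof (rule lipschitz_onI)
  fix x y assume "x \<in> K" "y \<in> K"
  have "norm (f x - f y) \<le> C * norm (x - y)"
  proof (rule differentiable_bound[OF assms(3)])
   fix z assume "z \<in> K"
   then show "(f has_derivative (%v. dir_deriv v f z)) (at z within K)"
    using smooth_on_has_derivative[OF assms(1)] assms(4) has_derivative_at_withinI by blast
   show "onorm (%v. dir_deriv v f z) \<le> C"
    using C \<open>z \<in> K\<close> by (intro onorm_le) auto
  qed fact+
  then show "dist (f x) (f y) \<le> C * dist x y" by (simp add: dist_norm)
 qed (use C in auto)
 then show ?thesis using C that by blast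
qed

text \<open>Brings differentiability into the form that the dominated-convergence arguments below
  consume: convergence of difference quotients in one fixed direction.\<close>

lemma has_derivative_quotient:
 assumes "(f has_derivative D) (at x)"
 shows "((%h::real. (f (x + h *\<^sub>R v) - f x) /\<^sub>R h) \<longlongrightarrow> D v) (at 0)"
proof -
 have "((%h. f (x + h *\<^sub>R v)) has_derivative (%h. D (h *\<^sub>R v))) (at 0)"
  by (rule has_derivative_compose[of "%h. x + h *\<^sub>R v" "%h. h *\<^sub>R v" 0 UNIV f D])
   (use assms in \<open>auto intro!: derivative_eq_intros\<close>)
 moreover have "(%h. D (h *\<^sub>R v)) = (%h. h *\<^sub>R D v)"
  using has_derivative_linear[OF assms] by (auto simp: linear_cmul)
 ultimately have "((%h. f (x + h *\<^sub>R v)) has_vector_derivative D v) (at 0)"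
  by (simp add: has_vector_derivative_def)
 then have "((%h. norm (f (x + h *\<^sub>R v) - f x - h *\<^sub>R D v) / norm h) \<longlongrightarrow> 0) (at 0)"
  by (simp add: has_vector_derivative_def has_derivative_at)
 moreover have "\<forall>\<^sub>F h::real in at 0. norm (f (x + h *\<^sub>R v) - f x - h *\<^sub>R D v) / norm h
   = norm ((f (x + h *\<^sub>R v) - f x) /\<^sub>R h - D v)"
 proof (rule eventually_at_ball'[OF zero_less_one, THEN eventually_mono], safe)
  fix h :: real assume "h \<noteq> 0"
  then have "(f (x + h *\<^sub>R v) - f x) /\<^sub>R h - D v = (f (x + h *\<^sub>R v) - f x - h *\<^sub>R D v) /\<^sub>R h"
   by (simp add: scaleR_diff_right)
  then show "norm (f (x + h *\<^sub>R v) - f x - h *\<^sub>R D v) / norm h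
   = norm ((f (x + h *\<^sub>R v) - f x) /\<^sub>R h - D v)" by (simp add: divide_inverse mult.commute)
 qed
 ultimately have "((%h. norm ((f (x + h *\<^sub>R v) - f x) /\<^sub>R h - D v)) \<longlongrightarrow> 0) (at 0)"
  by (rule Lim_transform_eventually)
 then show ?thesis by (simp add: tendsto_norm_zero_iff LIM_zero_iff)
qed

section \<open>Integration by parts and weak derivatives\<close>

lemma integral_translate:
 fixes f :: "'a::euclidean_space => 'b::{banach, second_countable_topology}"
 assumes [measurable]: "f \<in> borel_measurable borel"
 shows "(LBINT x. f (x + c)) = (LBINT x. f x)"
proof -
 have "(LBINT x. f x) = (\<integral>x. f x \<partial>distr lborel borel ((+) c))"
  by (simp add: lborel_distr_plus)
 also have "\<dots> = (LBINT x. f (c + x))"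
  by (subst integral_distr) auto
 finally show ?thesis by (simp add: add.commute)
qed

lemma integrable_translate:
 fixes f :: "'a::euclidean_space => 'b::{banach, second_countable_topology}"
 assumes "integrable lborel f"
 shows "integrable lborel (%x. f (x + c))"
proof -
 have "integrable (distr lborel borel ((+) c)) f"
  using assms by (simp add: lborel_distr_plus)
 moreover have "f \<in> borel_measurable borel" using borel_measurable_integrable[OF assms] by simp
 ultimately show ?thesis by (subst (asm) integrable_distr_eq) (auto simp: add.commute)
qed

text \<open>Translation invariance of Lebesgue measure makes the difference quotients integrate
 to \<open>0\<close>.\<close>

lemma integral_directional_derivative_eq_0:
 fixes f f' :: "'a::euclidean_space => 'b::euclidean_space"
 assumes "integrable lborel f" "f' \<in> borel_measurable borel"
  and lim: "AE x in lborel. ((%h::real. (f (x + h *\<^sub>R v) - f x) /\<^sub>R h) \<longlongrightarrow> f' x) (at 0)"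
  and B: "integrable lborel B" "e > 0"
   "AE x in lborel. \<forall>h. \<bar>h\<bar> < e --> norm (f (x + h *\<^sub>R v) - f x) \<le> \<bar>h\<bar> * B x"
 shows "integrable lborel f'" "(LBINT x. f' x) = 0"
proof -
 \<comment> \<open>Dominated convergence speaks of sequences, so the limit h \<rightarrow> 0 is
   taken along positive steps that stay below e.\<close>
 define hs where "hs n = e / 2 ^ Suc n" for n
 have hs: "hs n > 0" "hs n < e" for n 
 proof -
  show "hs n > 0" using B(2) by (simp add: hs_def)
  have "(1::real) < 2 ^ Suc n" by (rule one_less_power) auto
  then show "hs n < e" using B(2) by (simp add: hs_def divide_less_eq del: power_Suc)
 qed
 have "hs \<longlonglongrightarrow> 0" unfolding hs_def by (rule LIMSEQ_Suc[OF LIMSEQ_divide_realpow_zero]) auto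
 then have hs0: "filterlim hs (at 0) sequentially"
  using hs(1) by (simp add: filterlim_at less_imp_neq[symmetric])
 define q where "q n x = (f (x + hs n *\<^sub>R v) - f x) /\<^sub>R hs n" for n x
 have qi: "integrable lborel (q n)" for n
  unfolding q_def using integrable_translate[OF assms(1)] assms(1) by auto
 have q0: "integral\<^sup>L lborel (q n) = 0" for n
  unfolding q_def using integrable_translate[OF assms(1)] assms(1) borel_measurable_integrable[OF assms(1)]
  by (simp add: integral_translate)
 have qB: "AE x in lborel. norm (q n x) \<le> B x" for n
  using B(3)
 proof eventually_elim
  case (elim x)
  have "norm (q n x) = norm (f (x + hs n *\<^sub>R v) - f x) / hs n"
   using hs(1)[of n] by (simp add: q_def divide_inverse mult.commute)
  also have "\<dots> \<le> (hs n * B x) / hs n"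
   using elim[rule_format, of "hs n"] hs[of n] by (intro divide_right_mono) auto
  finally show ?case using hs(1)[of n] by simp
 qed
 have lim': "AE x in lborel. (%n. q n x) \<longlonglongrightarrow> f' x"
  using lim by eventually_elim (auto simp: q_def dest: filterlim_compose[OF _ hs0])
 have m: "f' \<in> borel_measurable lborel" "\<And>n. q n \<in> borel_measurable lborel"
  using assms(2) qi by auto
 show "integrable lborel f'"
  by (rule integrable_dominated_convergence[OF m B(1) lim']) (use qB in auto)
 have "(%n. integral\<^sup>L lborel (q n)) \<longlonglongrightarrow> integral\<^sup>L lborel f'"
  by (rule integral_dominated_convergence[OF m B(1) lim']) (use qB in auto)
 then show "(LBINT x. f' x) = 0" using q0 by (simp add: LIMSEQ_const_iff)
qed

text \<open>The complement of the compact set is open, so the derivatives vanish there as well; one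
  set K localizes the function and its first derivatives.\<close>

lemma test_funE:
 assumes "test_fun \<Omega> \<eta>"
 obtains K where "compact K" "K \<subseteq> \<Omega>" "\<And>x. x \<notin> K ==> \<eta> x = 0" "\<And>x v. x \<notin> K ==> dir_deriv v \<eta> x = 0"
proof -
 obtain K where K: "compact K" "K \<subseteq> \<Omega>" "\<And>x. x \<notin> K ==> \<eta> x = 0"
  using assms unfolding test_fun_def by blast
 have "dir_deriv v \<eta> x = 0" if "x \<notin> K" for x v
 proof -
  have "(\<eta> has_derivative (%_. 0)) (at x)"
   by (rule has_derivative_transform_within_open[of "%_. 0" _ _ _ "- K"])
    (use K that compact_imp_closed in auto)
  then show ?thesis by (simp add: dir_deriv_eq)
 qed
 then show ?thesis using K that by blast
qed

lemma test_fun_smooth: "test_fun \<Omega> \<eta> ==> smooth_on UNIV \<eta>"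
 unfolding test_fun_def by blast

lemma test_fun_mono: "test_fun \<Omega> \<eta> ==> \<Omega> \<subseteq> \<Omega>' ==> test_fun \<Omega>' \<eta>"
 unfolding test_fun_def by blast

lemma test_fun_dir_deriv:
 assumes "test_fun \<Omega> \<eta>" shows "test_fun \<Omega> (dir_deriv v \<eta>)"
proof -
 obtain K where "compact K" "K \<subseteq> \<Omega>" "\<And>x. x \<notin> K ==> dir_deriv v \<eta> x = 0"
  using test_funE[OF assms] by metis
 then show ?thesis
  using smooth_on_dir_deriv[OF test_fun_smooth[OF assms]] unfolding test_fun_def by blast
qed

lemma test_fun_continuous: "test_fun \<Omega> \<eta> ==> continuous_on UNIV \<eta>"
 using test_fun_smooth smooth_on_continuous by blast

lemma test_fun_measurable: "test_fun \<Omega> \<eta> ==> \<eta> \<in> borel_measurable borel"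
 using test_fun_continuous borel_measurable_continuous_onI by blast

lemma test_fun_bounded:
 fixes \<eta> :: "'a::euclidean_space => real"
 assumes "test_fun \<Omega> \<eta>"
 obtains M where "M \<ge> 0" "\<And>x. \<bar>\<eta> x\<bar> \<le> M"
proof -
 obtain K where K: "compact K" "\<And>x. x \<notin> K ==> \<eta> x = 0" using test_funE[OF assms] by metis
 have "bounded (\<eta> ` K)"
  by (rule compact_imp_bounded[OF compact_continuous_image[OF
     continuous_on_subset[OF test_fun_continuous[OF assms] subset_UNIV] K(1)]])
 then obtain M where "M > 0" "\<And>x. x \<in> K ==> \<bar>\<eta> x\<bar> \<le> M" by (auto simp: bounded_pos)
 then show ?thesis using K(2) that[of M] by (metis abs_zero less_imp_le)
qed

lemma test_fun_lipschitz:
 fixes \<eta> :: "'a::euclidean_space => real"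
 assumes "test_fun \<Omega> \<eta>"
 obtains M where "M-lipschitz_on UNIV \<eta>"
proof -
 obtain K where K: "compact K" "\<And>x v. x \<notin> K ==> dir_deriv v \<eta> x = 0" using test_funE[OF assms] by metis
 obtain C where C: "C \<ge> 0" "\<And>x v. x \<in> K ==> norm (dir_deriv v \<eta> x) \<le> C * norm v"
  using smooth_on_compact_deriv_bound[OF test_fun_smooth[OF assms] K(1)] by auto
 have C': "norm (dir_deriv v \<eta> x) \<le> C * norm v" for x v
  using C K(2) by (cases "x \<in> K") auto
 have "C-lipschitz_on UNIV \<eta>"
 proof (rule lipschitz_onI)
  fix x y :: 'a
  have "norm (\<eta> x - \<eta> y) \<le> C * norm (x - y)"
  proof (rule differentiable_bound[of UNIV])
   fix z :: 'a
   show "(\<eta> has_derivative (%v. dir_deriv v \<eta> z)) (at z within UNIV)"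
    using smooth_on_has_derivative[OF test_fun_smooth[OF assms]] by simp
   show "onorm (%v. dir_deriv v \<eta> z) \<le> C" using C' by (intro onorm_le) auto
  qed auto
  then show "dist (\<eta> x) (\<eta> y) \<le> C * dist x y" by (simp add: dist_norm)
 qed (rule C)
 then show ?thesis by (rule that)
qed

lemma loc_integrableD:
 "loc_integrable \<Omega> u ==> compact K ==> K \<subseteq> \<Omega> ==> set_integrable lborel K u"
 unfolding loc_integrable_def by simp

lemma integrable_test_scaleR:
 fixes u :: "'a::euclidean_space => 'b::euclidean_space"
 assumes "test_fun \<Omega> \<eta>" "loc_integrable \<Omega> u"
 shows "integrable lborel (%x. \<eta> x *\<^sub>R u x)"
proof -
 obtain K where K: "compact K" "K \<subseteq> \<Omega>" "\<And>x. x \<notin> K ==> \<eta> x = 0" using test_funE[OF assms(1)] by metis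
 obtain M where M: "\<And>x. \<bar>\<eta> x\<bar> \<le> M" using test_fun_bounded[OF assms(1)] by metis
 have i: "integrable lborel (%x. indicator K x *\<^sub>R u x)"
  using loc_integrableD[OF assms(2) K(1,2)] unfolding set_integrable_def .
 have [measurable]: "\<eta> \<in> borel_measurable borel" using test_fun_measurable[OF assms(1)] .
 have m: "(%x. indicator K x *\<^sub>R u x) \<in> borel_measurable lborel" using borel_measurable_integrable[OF i] .
 have e: "(%x. \<eta> x *\<^sub>R u x) = (%x. \<eta> x *\<^sub>R (indicator K x *\<^sub>R u x))"
  by (rule ext) (use K(3) in \<open>simp add: indicator_def of_bool_def\<close>)
 show ?thesis unfolding e
 proof (rule Bochner_Integration.integrable_bound)
  show "integrable lborel (%x. M *\<^sub>R (indicator K x *\<^sub>R u x))"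
   by (rule integrable_scaleR_right[OF i])
  show "(%x. \<eta> x *\<^sub>R indicator K x *\<^sub>R u x) \<in> borel_measurable lborel"
   using m by measurable
  show "AE x in lborel. norm (\<eta> x *\<^sub>R indicator K x *\<^sub>R u x) \<le> norm (M *\<^sub>R indicator K x *\<^sub>R u x)"
  proof (rule AE_I2)
   fix x show "norm (\<eta> x *\<^sub>R indicator K x *\<^sub>R u x) \<le> norm (M *\<^sub>R indicator K x *\<^sub>R u x)"
    unfolding norm_scaleR[of "\<eta> x"] norm_scaleR[of M]
    by (rule mult_right_mono[OF order_trans[OF M abs_ge_self]]) simp
  qed
 qed
qed

lemma loc_integrable_mono:
 assumes "loc_integrable \<Omega> u" "\<Omega>' \<subseteq> \<Omega>"
 shows "loc_integrable \<Omega>' u"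
 unfolding loc_integrable_def
proof (intro allI impI)
 fix K assume "compact K \<and> K \<subseteq> \<Omega>'"
 then have "compact K" "K \<subseteq> \<Omega>" using assms(2) by auto
 then show "set_integrable lborel K u"
  by (rule loc_integrableD[OF assms(1)])
qed

lemma has_weak_deriv_mono:
 assumes "has_weak_deriv \<Omega> v u w" "\<Omega>' \<subseteq> \<Omega>"
 shows "has_weak_deriv \<Omega>' v u w"
 unfolding has_weak_deriv_def
proof (intro conjI allI impI)
 show "loc_integrable \<Omega>' u" "loc_integrable \<Omega>' w"
  using assms(1) loc_integrable_mono[OF _ assms(2)] unfolding has_weak_deriv_def by blast+
 fix \<eta> assume "test_fun \<Omega>' \<eta>"
 then have "test_fun \<Omega> \<eta>" using assms(2) test_fun_mono by metis
 then show "(LBINT x. dir_deriv v \<eta> x *\<^sub>R u x) = - (LBINT x. \<eta> x *\<^sub>R w x)"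
  using assms(1) unfolding has_weak_deriv_def by simp
qed

lemma loc_integrable_cong_AE:
 fixes u :: "'a::euclidean_space => 'b::euclidean_space"
 assumes "loc_integrable \<Omega> u" and [measurable]: "u' \<in> borel_measurable borel"
  and ae: "AE x in lborel. x \<in> \<Omega> --> u x = u' x"
 shows "loc_integrable \<Omega> u'"
 unfolding loc_integrable_def
proof safe
 fix K :: "'a set" assume K: "compact K" "K \<subseteq> \<Omega>"
 then have [measurable]: "K \<in> sets borel" by (simp add: borel_compact)
 have i: "integrable lborel (%x. indicator K x *\<^sub>R u x)"
  using loc_integrableD[OF assms(1) K] unfolding set_integrable_def .
 have "AE x in lborel. indicator K x *\<^sub>R u x = indicator K x *\<^sub>R u' x"
  using ae by eventually_elim (use K(2) in \<open>auto simp: indicator_def\<close>)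
 then show "set_integrable lborel K u'"
  unfolding set_integrable_def
  by (rule integrable_cong_AE_imp[OF i, rotated]) (auto simp: eq_commute)
qed

text \<open>Weak derivatives are first computed for explicit formulas and then transferred by this
  lemma to the prescribed representatives.\<close>

lemma has_weak_deriv_cong_AE:
 fixes u :: "'a::euclidean_space => 'b::euclidean_space"
 assumes wd: "has_weak_deriv \<Omega> v u w"
  and m: "u' \<in> borel_measurable borel" "w' \<in> borel_measurable borel"
  and ae: "AE x in lborel. x \<in> \<Omega> --> u x = u' x" "AE x in lborel. x \<in> \<Omega> --> w x = w' x"
 shows "has_weak_deriv \<Omega> v u' w'"
proof -
 have li: "loc_integrable \<Omega> u" "loc_integrable \<Omega> w" "loc_integrable \<Omega> u'" "loc_integrable \<Omega> w'"
  using wd loc_integrable_cong_AE[OF _ m(1) ae(1)] loc_integrable_cong_AE[OF _ m(2) ae(2)]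
  unfolding has_weak_deriv_def by simp_all
 have "(LBINT x. dir_deriv v \<eta> x *\<^sub>R u' x) = - (LBINT x. \<eta> x *\<^sub>R w' x)"
  if t: "test_fun \<Omega> \<eta>" for \<eta>
 proof -
  obtain K where K: "K \<subseteq> \<Omega>" "\<And>x. x \<notin> K ==> \<eta> x = 0" "\<And>x v. x \<notin> K ==> dir_deriv v \<eta> x = 0"
   using test_funE[OF t] by metis
  have "(LBINT x. dir_deriv v \<eta> x *\<^sub>R u' x) = (LBINT x. dir_deriv v \<eta> x *\<^sub>R u x)"
  proof (rule integral_cong_AE)
   show "AE x in lborel. dir_deriv v \<eta> x *\<^sub>R u' x = dir_deriv v \<eta> x *\<^sub>R u x"
    
    using ae(1)
   proof eventually_elim
    case (elim x)
    then show ?case by (cases "x \<in> K") (use K(1) K(2,3)[of x] in auto)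
   qed
  qed (use borel_measurable_integrable[OF integrable_test_scaleR[OF test_fun_dir_deriv[OF t]]] li in auto)
  also have "\<dots> = - (LBINT x. \<eta> x *\<^sub>R w x)"
   using wd t unfolding has_weak_deriv_def by simp
  also have "(LBINT x. \<eta> x *\<^sub>R w x) = (LBINT x. \<eta> x *\<^sub>R w' x)"
  proof (rule integral_cong_AE)
   show "AE x in lborel. \<eta> x *\<^sub>R w x = \<eta> x *\<^sub>R w' x"
    
    using ae(2)
   proof eventually_elim
    case (elim x)
    then show ?case by (cases "x \<in> K") (use K(1) K(2,3)[of x] in auto)
   qed
  qed (use borel_measurable_integrable[OF integrable_test_scaleR[OF t]] li in auto)
  finally show ?thesis .
 qed
 then show ?thesis using li unfolding has_weak_deriv_def by simp
qed

text \<open>Applied to the product \<eta> u, the vanishing integral of a directional derivative is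
  the integration by parts formula. Pointwise difference quotients with a locally integrable bound
  cover both Lipschitz maps with a kink and maps with a singular origin.\<close>

lemma has_weak_derivI:
 fixes u w :: "'a::euclidean_space => 'b::euclidean_space"
 assumes \<Omega>: "open \<Omega>" and m[measurable]: "w \<in> borel_measurable borel"
  and lim: "AE x in lborel. x \<in> \<Omega> --> ((%h::real. (u (x + h *\<^sub>R v) - u x) /\<^sub>R h) \<longlongrightarrow> w x) (at 0)"
  and u: "loc_integrable \<Omega> u"
  and bd: "\<And>K. compact K ==> K \<subseteq> \<Omega> ==> \<exists>e>0. \<exists>B. set_integrable lborel K B \<and>
    (AE x in lborel. x \<in> K --> (\<forall>h. \<bar>h\<bar> < e --> norm (u (x + h *\<^sub>R v) - u x) \<le> \<bar>h\<bar> * B x))"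
 shows "has_weak_deriv \<Omega> v u w"
proof -
 have w: "loc_integrable \<Omega> w"
  unfolding loc_integrable_def
 proof safe
  fix K :: "'a set" assume K: "compact K" "K \<subseteq> \<Omega>"
  then have [measurable]: "K \<in> sets borel" by (simp add: borel_compact)
  obtain e B where e: "e > 0" and B: "set_integrable lborel K B"
   and eB: "AE x in lborel. x \<in> K --> (\<forall>h. \<bar>h\<bar> < e --> norm (u (x + h *\<^sub>R v) - u x) \<le> \<bar>h\<bar> * B x)"
   using bd[OF K] by (elim exE conjE bexE) blast
  show "set_integrable lborel K w"
   unfolding set_integrable_def
  proof (rule Bochner_Integration.integrable_bound)
   show "integrable lborel (%x. indicator K x *\<^sub>R B x)" using B unfolding set_integrable_def .
   show "(%x. indicator K x *\<^sub>R w x) \<in> borel_measurable lborel" by measurable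
   have nw: "norm (w x) \<le> B x" if eB: "\<And>h. \<bar>h\<bar> < e ==> norm (u (x + h *\<^sub>R v) - u x) \<le> \<bar>h\<bar> * B x" and x: "x \<in> K" 
    "((%h::real. (u (x + h *\<^sub>R v) - u x) /\<^sub>R h) \<longlongrightarrow> w x) (at 0)" for x
   proof (rule tendsto_upperbound[OF tendsto_norm[OF x(2)]])
    show "\<forall>\<^sub>F h in at 0. norm ((u (x + h *\<^sub>R v) - u x) /\<^sub>R h) \<le> B x"
     unfolding eventually_at
    proof (intro exI[of _ e] conjI ballI impI)
     fix h :: real assume "h \<noteq> 0 \<and> dist h 0 < e"
     then have "norm (u (x + h *\<^sub>R v) - u x) / \<bar>h\<bar> \<le> \<bar>h\<bar> * B x / \<bar>h\<bar>"
      by (intro divide_right_mono eB) auto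
     then show "norm ((u (x + h *\<^sub>R v) - u x) /\<^sub>R h) \<le> B x"
      using \<open>h \<noteq> 0 \<and> dist h 0 < e\<close>
      by (simp add: inverse_eq_divide divide_le_eq mult.commute)
    qed (use e in auto)
   qed auto
   show "AE x in lborel. norm (indicator K x *\<^sub>R w x) \<le> norm (indicator K x *\<^sub>R B x)"
    using lim eB
   proof eventually_elim
    case (elim x)
    then show ?case
     by (cases "x \<in> K") (use K(2) nw[of x] in auto)
   qed
  qed
 qed
 have "(LBINT x. dir_deriv v \<eta> x *\<^sub>R u x) = - (LBINT x. \<eta> x *\<^sub>R w x)"
  if t: "test_fun \<Omega> \<eta>" for \<eta>
 proof -
  obtain K where K: "compact K" "K \<subseteq> \<Omega>" "\<And>x. x \<notin> K ==> \<eta> x = 0" "\<And>x v. x \<notin> K ==> dir_deriv v \<eta> x = 0"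
   using test_funE[OF t] by metis
  obtain M where M: "M \<ge> 0" "\<And>x. \<bar>\<eta> x\<bar> \<le> M" using test_fun_bounded[OF t] by metis
  obtain C where C: "C-lipschitz_on UNIV \<eta>" using test_fun_lipschitz[OF t] by metis
  have C0: "C \<ge> 0" using C lipschitz_on_nonneg by blast
  obtain e0 where e0: "e0 > 0" "(\<Union>x\<in>K. cball x e0) \<subseteq> \<Omega>"
   using compact_subset_open_imp_cball_epsilon_subset[OF K(1) \<Omega> K(2)] by metis
  \<comment> \<open>The product \<eta> u can change at a point x outside K, because x + h v may lie
    in K. The closed e0-neighbourhood K' catches all such x.\<close>
  define K' where "K' = {x + y |x y. x \<in> K \<and> y \<in> cball 0 e0}"
  have cK': "compact K'" unfolding K'_def by (intro compact_sums K compact_cball)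
  have K': "K' \<subseteq> \<Omega>" 
  proof
   fix z assume "z \<in> K'"
   then obtain x y where "z = x + y" "x \<in> K" "norm y \<le> e0" by (auto simp: K'_def)
   then have "z \<in> (\<Union>x\<in>K. cball x e0)" by (auto simp: dist_norm intro!: bexI[of _ x])
   then show "z \<in> \<Omega>" using e0(2) by blast
  qed
  have KK': "K \<subseteq> K'" 
  proof
   fix z assume "z \<in> K"
   then show "z \<in> K'" unfolding K'_def using e0(1)
    by (intro CollectI exI[of _ z] exI[of _ 0]) auto
  qed
  have [measurable]: "K' \<in> sets borel" using cK' by (simp add: borel_compact)
  obtain e B where e: "e > 0" and B: "set_integrable lborel K' B"
   and eB: "AE x in lborel. x \<in> K' --> (\<forall>h. \<bar>h\<bar> < e --> norm (u (x + h *\<^sub>R v) - u x) \<le> \<bar>h\<bar> * B x)"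
   using bd[OF cK' K'] by (elim exE conjE bexE) blast
  define f where "f x = \<eta> x *\<^sub>R u x" for x
  define f' where "f' x = dir_deriv v \<eta> x *\<^sub>R u x + \<eta> x *\<^sub>R w x" for x
  \<comment> \<open>Product rule for differences: the sup bound M of \<eta> multiplies the increment
    of u, and the Lipschitz constant C of \<eta> multiplies u.\<close>
  define B' where "B' x = indicator K' x *\<^sub>R (M * B x + C * norm v * norm (u x))" for x
  have iu: "integrable lborel (%x. dir_deriv v \<eta> x *\<^sub>R u x)"
   by (rule integrable_test_scaleR[OF test_fun_dir_deriv[OF t] u])
  have iw: "integrable lborel (%x. \<eta> x *\<^sub>R w x)" by (rule integrable_test_scaleR[OF t w])
  have fi: "integrable lborel f" unfolding f_def by (rule integrable_test_scaleR[OF t u])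
  have f'm: "f' \<in> borel_measurable borel"
   using borel_measurable_integrable[OF iu] borel_measurable_integrable[OF iw] unfolding f'_def by simp
  have uK': "set_integrable lborel K' u" by (rule loc_integrableD[OF u cK' K'])
  have B'i: "integrable lborel B'"
  proof -
   have "set_integrable lborel K' (%x. M * B x + C * norm v * norm (u x))"
    using B set_integrable_norm[OF uK'] by (intro set_integral_add set_integrable_mult_right) auto
   then show ?thesis unfolding B'_def set_integrable_def .
  qed
  have lim': "AE x in lborel. ((%h::real. (f (x + h *\<^sub>R v) - f x) /\<^sub>R h) \<longlongrightarrow> f' x) (at 0)"
   using lim
  proof eventually_elim
   fix x assume lx: "x \<in> \<Omega> --> ((%h::real. (u (x + h *\<^sub>R v) - u x) /\<^sub>R h) \<longlongrightarrow> w x) (at 0)"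
   have xh: "((%h::real. x + h *\<^sub>R v) \<longlongrightarrow> x) (at 0)"
    by (auto intro!: tendsto_eq_intros)
   show "((%h::real. (f (x + h *\<^sub>R v) - f x) /\<^sub>R h) \<longlongrightarrow> f' x) (at 0)"
   proof (cases "x \<in> K")
    case True
    have 1: "((%h::real. \<eta> (x + h *\<^sub>R v)) \<longlongrightarrow> \<eta> x) (at 0)"
     using isCont_tendsto_compose[OF _ xh] test_fun_continuous[OF t]
     by (auto simp: continuous_on_eq_continuous_at)
    have 2: "((%h::real. (\<eta> (x + h *\<^sub>R v) - \<eta> x) /\<^sub>R h) \<longlongrightarrow> dir_deriv v \<eta> x) (at 0)"
     using has_derivative_quotient[OF smooth_on_has_derivative[OF test_fun_smooth[OF t]]] by auto
    have 3: "((%h::real. (u (x + h *\<^sub>R v) - u x) /\<^sub>R h) \<longlongrightarrow> w x) (at 0)"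
     using lx True K(2) by auto
    have "((%h::real. ((\<eta> (x + h *\<^sub>R v) - \<eta> x) /\<^sub>R h) *\<^sub>R u x
     + \<eta> (x + h *\<^sub>R v) *\<^sub>R ((u (x + h *\<^sub>R v) - u x) /\<^sub>R h)) \<longlongrightarrow> f' x) (at 0)"
     unfolding f'_def by (intro tendsto_intros 1 2 3)
    moreover have "((\<eta> (x + h *\<^sub>R v) - \<eta> x) /\<^sub>R h) *\<^sub>R u x
     + \<eta> (x + h *\<^sub>R v) *\<^sub>R ((u (x + h *\<^sub>R v) - u x) /\<^sub>R h) = (f (x + h *\<^sub>R v) - f x) /\<^sub>R h" for h
    proof -
     have "f (x + h *\<^sub>R v) - f x = (\<eta> (x + h *\<^sub>R v) - \<eta> x) *\<^sub>R u x
      + \<eta> (x + h *\<^sub>R v) *\<^sub>R (u (x + h *\<^sub>R v) - u x)"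
      by (simp add: f_def scaleR_diff_left scaleR_diff_right)
     then show ?thesis by (simp add: scaleR_add_right mult.commute)
    qed
    ultimately show ?thesis by simp
   next
    case False
    have "\<forall>\<^sub>F h::real in at 0. x + h *\<^sub>R v \<in> - K"
     by (rule topological_tendstoD[OF xh]) (use False K(1) compact_imp_closed in auto)
    then have "\<forall>\<^sub>F h::real in at 0. 0 = (f (x + h *\<^sub>R v) - f x) /\<^sub>R h"
     by eventually_elim (use K(3) False in \<open>auto simp: f_def\<close>)
    then have "((%h::real. (f (x + h *\<^sub>R v) - f x) /\<^sub>R h) \<longlongrightarrow> 0) (at 0)"
     by (rule Lim_transform_eventually[OF tendsto_const])
    then show ?thesis using K(3,4)[OF False] unfolding f'_def by simp
   qed
  qed
  \<comment> \<open>The second bound on h keeps |h| |v| below e0; the added 1 covers v = 0.\<close>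
  have bd': "norm (f (x + h *\<^sub>R v) - f x) \<le> \<bar>h\<bar> * B' x"
   if eB: "\<And>h. x \<in> K' ==> \<bar>h\<bar> < e ==> norm (u (x + h *\<^sub>R v) - u x) \<le> \<bar>h\<bar> * B x"
    and h: "\<bar>h\<bar> < min e (e0 / (norm v + 1))" for x h
  proof (cases "x \<in> K'")
   case True
   have "f (x + h *\<^sub>R v) - f x = \<eta> (x + h *\<^sub>R v) *\<^sub>R (u (x + h *\<^sub>R v) - u x)
    + (\<eta> (x + h *\<^sub>R v) - \<eta> x) *\<^sub>R u x"
    by (simp add: f_def scaleR_diff_left scaleR_diff_right)
   then have "norm (f (x + h *\<^sub>R v) - f x) \<le> \<bar>\<eta> (x + h *\<^sub>R v)\<bar> * norm (u (x + h *\<^sub>R v) - u x)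
    + \<bar>\<eta> (x + h *\<^sub>R v) - \<eta> x\<bar> * norm (u x)"
    by (metis norm_triangle_ineq norm_scaleR)
   also have "\<dots> \<le> M * (\<bar>h\<bar> * B x) + (C * (\<bar>h\<bar> * norm v)) * norm (u x)"
   proof (intro add_mono mult_mono M)
    show "norm (u (x + h *\<^sub>R v) - u x) \<le> \<bar>h\<bar> * B x" using eB[OF True, of h] h by auto
    show "\<bar>\<eta> (x + h *\<^sub>R v) - \<eta> x\<bar> \<le> C * (\<bar>h\<bar> * norm v)"
     using lipschitz_onD[OF C, of "x + h *\<^sub>R v" x] by (simp add: dist_norm)
   qed (use C0 in auto)
   finally show ?thesis using True by (simp add: B'_def algebra_simps)
  next
   case False
   have "x \<notin> K" using False KK' by auto
   have "x + h *\<^sub>R v \<notin> K"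
   proof
    assume a: "x + h *\<^sub>R v \<in> K"
    have "\<bar>h\<bar> * norm v \<le> \<bar>h\<bar> * (norm v + 1)" by (intro mult_left_mono) auto
    also have "\<dots> < e0" using h by (simp add: less_divide_eq add_nonneg_pos)
    finally have "x \<in> K'"
     unfolding K'_def using a
     by (intro CollectI exI[of _ "x + h *\<^sub>R v"] exI[of _ "- (h *\<^sub>R v)"]) auto
    then show False using False by simp
   qed
   then show ?thesis using \<open>x \<notin> K\<close> False K(3) by (simp add: f_def B'_def)
  qed
  have "integral\<^sup>L lborel f' = 0"
  proof (rule integral_directional_derivative_eq_0[OF fi f'm lim' B'i])
   show "min e (e0 / (norm v + 1)) > 0" using e e0(1) by (auto simp: add_nonneg_pos)
   show "AE x in lborel. \<forall>h. \<bar>h\<bar> < min e (e0 / (norm v + 1)) --> norm (f (x + h *\<^sub>R v) - f x) \<le> \<bar>h\<bar> * B' x"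
    using eB
   proof eventually_elim
    case (elim x)
    show ?case
     by (intro allI impI bd') (use elim in auto)
   qed
  qed
  then show ?thesis unfolding f'_def using iu iw by (simp add: add_eq_0_iff)
 qed
 then show ?thesis using u w unfolding has_weak_deriv_def by simp
qed

section \<open>Null sets in space-time and self-similar maps\<close>

lemma AE_lborel_pairI:
 fixes Q :: "'a::euclidean_space \<times> 'b::euclidean_space => bool"
 assumes "{p. Q p} \<in> sets borel" "AE x in lborel. AE y in lborel. Q (x, y)"
 shows "AE p in lborel. Q p"
proof -
 show ?thesis
  by (rule lborel_pair.AE_pair_measure[unfolded lborel_prod]) (use assms in auto)
qed

lemma AE_lborel_pairD:
 fixes Q :: "'a::euclidean_space \<times> 'b::euclidean_space => bool"
 assumes "AE p in lborel. Q p"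
 shows "AE x in lborel. AE y in lborel. Q (x, y)"
proof -
 show ?thesis
  by (rule lborel_pair.AE_pair[unfolded lborel_prod, OF assms])
qed

text \<open>The places where a self-similar map may fail to be differentiable: the axis x = 0, where
  polar coordinates are singular, and the light cone |x| = t, where the profile is glued to a
  constant.\<close>

lemma AE_off_cone: "AE p in lborel. fst p \<noteq> (0::'a::euclidean_space) \<and> norm (fst p) \<noteq> snd p"
proof (rule AE_lborel_pairI)
 have c: "closed {p::'a \<times> real. fst p = 0 \<or> norm (fst p) = snd p}"
  by (intro closed_Collect_disj closed_Collect_eq continuous_intros)
 have e: "{p::'a \<times> real. fst p \<noteq> 0 \<and> norm (fst p) \<noteq> snd p}
  = - {p. fst p = 0 \<or> norm (fst p) = snd p}" by auto
 show "{p::'a \<times> real. fst p \<noteq> 0 \<and> norm (fst p) \<noteq> snd p} \<in> sets borel"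
  unfolding e by (rule borel_open[OF open_Compl[OF c]])
 have h: "AE y::real in lborel. norm x \<noteq> y" for x :: 'a
  using AE_lborel_singleton[of "norm x"] by eventually_elim auto
 show "AE x::'a in lborel. AE y in lborel. fst (x, y) \<noteq> 0 \<and> norm (fst (x, y)) \<noteq> snd (x, y)"
  using AE_lborel_singleton[of "0::'a"] by eventually_elim (use h in auto)
qed

text \<open>The chain rule applies off the axis and the light cone, which form a null set. On a
  compact set t is bounded below and |x| above, so Lipschitz continuity of F bounds the difference
  quotients by a constant.\<close>

lemma has_weak_deriv_selfsimilar:
 fixes F :: "'e::euclidean_space => 'b::euclidean_space"
 assumes F: "L-lipschitz_on UNIV F"
  and F': "\<And>y. y \<noteq> 0 ==> norm y \<noteq> 1 ==> (F has_derivative F' y) (at y)"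
  and lin: "\<And>y. linear (F' y)"
  and m[measurable]: "\<And>b. (%y. F' y b) \<in> borel_measurable borel"
 shows "has_weak_deriv (UNIV \<times> {0<..}) (i, 0) (%(x, t). F (x /\<^sub>R t)) (%(x, t). F' (x /\<^sub>R t) (i /\<^sub>R t))"
  and "has_weak_deriv (UNIV \<times> {0<..}) (0, 1) (%(x, t). F (x /\<^sub>R t)) (%(x, t). F' (x /\<^sub>R t) (- (x /\<^sub>R t\<^sup>2)))"
proof -
 have L: "L \<ge> 0" using lipschitz_on_nonneg[OF F] .
 have Fc: "continuous_on UNIV F" using lipschitz_on_continuous_on[OF F] .
 have Fm[measurable]: "F \<in> borel_measurable borel" using borel_measurable_continuous_onI[OF Fc] .
 \<comment> \<open>Measurability of y \<mapsto> F' y b is given for fixed b; expanding in the basis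
   lets the direction depend on the point.\<close>
 have F'e: "F' y z = (\<Sum>b\<in>Basis. (z \<bullet> b) *\<^sub>R F' y b)" for y z
 proof -
  have "F' y z = F' y (\<Sum>b\<in>Basis. (z \<bullet> b) *\<^sub>R b)" by (simp add: euclidean_representation)
  then show ?thesis using lin[of y] by (simp add: linear_sum linear_cmul)
 qed
 have m1: "(%(x, t::real). F' (x /\<^sub>R t) (i /\<^sub>R t)) \<in> borel_measurable borel"
  "(%(x, t::real). F' (x /\<^sub>R t) (- (x /\<^sub>R t\<^sup>2))) \<in> borel_measurable borel"
 proof -
  have "(%p::'e\<times>real. F' (fst p /\<^sub>R snd p) (i /\<^sub>R snd p)) \<in> borel_measurable (borel \<Otimes>\<^sub>M borel)"
   "(%p::'e\<times>real. F' (fst p /\<^sub>R snd p) (- (fst p /\<^sub>R (snd p)\<^sup>2))) \<in> borel_measurable (borel \<Otimes>\<^sub>M borel)"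
   by (subst F'e, measurable)+
  then show "(%(x, t::real). F' (x /\<^sub>R t) (i /\<^sub>R t)) \<in> borel_measurable borel"
  "(%(x, t::real). F' (x /\<^sub>R t) (- (x /\<^sub>R t\<^sup>2))) \<in> borel_measurable borel"
   by (auto simp: borel_prod case_prod_beta)
 qed
 have der: "((%(x, t). F (x /\<^sub>R t)) has_derivative (%(a, b). F' (x /\<^sub>R t) (a /\<^sub>R t - b *\<^sub>R (x /\<^sub>R t\<^sup>2)))) (at (x, t))"
  if "x \<noteq> 0" "norm x \<noteq> t" "t > 0" for x and t :: real
 proof -
  have "((%p. F (fst p /\<^sub>R snd p)) has_derivative (%p. F' (x /\<^sub>R t) (fst p /\<^sub>R t - snd p *\<^sub>R (x /\<^sub>R t\<^sup>2)))) (at (x, t))"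
  proof (rule has_derivative_compose[of "%p. fst p /\<^sub>R snd p" _ "(x, t)" UNIV F])
   show "((%p. fst p /\<^sub>R snd p) has_derivative (%p. fst p /\<^sub>R t - snd p *\<^sub>R (x /\<^sub>R t\<^sup>2))) (at (x, t))"
    using that by (auto intro!: derivative_eq_intros ext simp: power2_eq_square)
   show "(F has_derivative F' (x /\<^sub>R t)) (at (fst (x, t) /\<^sub>R snd (x, t)))"
    using that by (auto intro!: F' simp: field_simps)
  qed
  then show ?thesis by (simp add: case_prod_beta')
 qed
 have lim1: "AE p in lborel. p \<in> UNIV \<times> {0<..} --> ((%h::real.
  ((%(x, t). F (x /\<^sub>R t)) (p + h *\<^sub>R v) - (%(x, t). F (x /\<^sub>R t)) p) /\<^sub>R h)
   \<longlongrightarrow> (%(x, t). F' (x /\<^sub>R t) (fst v /\<^sub>R t - snd v *\<^sub>R (x /\<^sub>R t\<^sup>2))) p) (at 0)" for v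
  using AE_off_cone
 proof eventually_elim
  fix p :: "'e \<times> real" assume a: "fst p \<noteq> 0 \<and> norm (fst p) \<noteq> snd p"
  show "p \<in> UNIV \<times> {0<..} --> ((%h::real.
  ((%(x, t). F (x /\<^sub>R t)) (p + h *\<^sub>R v) - (%(x, t). F (x /\<^sub>R t)) p) /\<^sub>R h)
   \<longlongrightarrow> (%(x, t). F' (x /\<^sub>R t) (fst v /\<^sub>R t - snd v *\<^sub>R (x /\<^sub>R t\<^sup>2))) p) (at 0)"
  proof
   assume "p \<in> UNIV \<times> {0<..}"
   then show "((%h::real.
   ((%(x, t). F (x /\<^sub>R t)) (p + h *\<^sub>R v) - (%(x, t). F (x /\<^sub>R t)) p) /\<^sub>R h)
    \<longlongrightarrow> (%(x, t). F' (x /\<^sub>R t) (fst v /\<^sub>R t - snd v *\<^sub>R (x /\<^sub>R t\<^sup>2))) p) (at 0)"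
    using has_derivative_quotient[OF der[of "fst p" "snd p"], of v] a
    by (auto simp: case_prod_beta)
  qed
 qed
 have li: "loc_integrable (UNIV \<times> {0<..}) (%(x, t::real). F (x /\<^sub>R t))"
  unfolding loc_integrable_def set_integrable_def
 proof (intro allI impI)
  fix K :: "('e \<times> real) set" assume K: "compact K \<and> K \<subseteq> UNIV \<times> {0<..}"
  have "continuous_on K (%p. F (fst p /\<^sub>R snd p))"
   by (rule continuous_on_compose2[OF Fc])
    (use K in \<open>auto intro!: continuous_intros\<close>)
  then show "integrable lborel (%p. indicator K p *\<^sub>R (case p of (x, t) => F (x /\<^sub>R t)))"
   using K by (auto intro: borel_integrable_compact simp: case_prod_beta')
 qed
 have kk: "\<exists>\<delta>>0. \<exists>M. \<forall>p\<in>K. snd p \<ge> \<delta> \<and> norm (fst p) \<le> M" 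
  if K: "compact K" "K \<subseteq> UNIV \<times> {0<..}" for K :: "('e \<times> real) set"
 proof (cases "K = {}")
  case False
  obtain q where q: "q \<in> K" "\<And>p. p \<in> K ==> snd q \<le> snd p"
   using continuous_attains_inf[OF K(1) False, of snd] continuous_on_snd[OF continuous_on_id] by metis
  obtain M where M: "\<And>p. p \<in> K ==> norm p \<le> M"
   using compact_imp_bounded[OF K(1)] by (auto simp: bounded_iff)
  show ?thesis
  proof (intro exI conjI ballI)
   show "snd q > 0" using q(1) K(2) by auto
   fix p assume "p \<in> K"
   then show "snd p \<ge> snd q" by (rule q(2))
   show "norm (fst p) \<le> M"
    using norm_fst_le[of "fst p" "snd p"] M[OF \<open>p \<in> K\<close>] unfolding prod.collapse by linarith
  qed
 qed (auto intro: exI[of _ 1])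
 have si: "set_integrable lborel K (%_. c::real)" if "compact K" for K :: "('e \<times> real) set" and c
  unfolding set_integrable_def using that by (intro borel_integrable_compact continuous_intros)
 show "has_weak_deriv (UNIV \<times> {0<..}) (i, 0) (%(x, t). F (x /\<^sub>R t)) (%(x, t). F' (x /\<^sub>R t) (i /\<^sub>R t))"
 proof (rule has_weak_derivI[OF _ m1(1) _ li])
  show "open (UNIV \<times> {0<..} :: ('e \<times> real) set)" by (intro open_Times) auto
  show "AE p in lborel. p \<in> UNIV \<times> {0<..} --> ((%h::real.
  ((%(x, t). F (x /\<^sub>R t)) (p + h *\<^sub>R (i, 0)) - (%(x, t). F (x /\<^sub>R t)) p) /\<^sub>R h)
   \<longlongrightarrow> (%(x, t). F' (x /\<^sub>R t) (i /\<^sub>R t)) p) (at 0)"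
   using lim1[of "(i, 0)"] by simp
  fix K :: "('e \<times> real) set" assume K: "compact K" "K \<subseteq> UNIV \<times> {0<..}"
  obtain \<delta> M where \<delta>: "\<delta> > 0" "\<And>p. p \<in> K ==> snd p \<ge> \<delta>" using kk[OF K] by blast
  show "\<exists>e>0. \<exists>B. set_integrable lborel K B \<and> (AE p in lborel. p \<in> K --> (\<forall>h. \<bar>h\<bar> < e -->
    norm ((%(x, t). F (x /\<^sub>R t)) (p + h *\<^sub>R (i, 0)) - (%(x, t). F (x /\<^sub>R t)) p) \<le> \<bar>h\<bar> * B p))"
  proof (intro exI[of _ 1] exI[of _ "%_. L * norm i / \<delta>"] conjI AE_I2 allI impI si K)
   fix p and h :: real assume p: "p \<in> K"
   obtain x t where pt: "p = (x, t)" by force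
   have t: "t \<ge> \<delta>" using \<delta>(2)[OF p] pt by simp
   have "norm (F ((x + h *\<^sub>R i) /\<^sub>R t) - F (x /\<^sub>R t)) \<le> L * norm ((x + h *\<^sub>R i) /\<^sub>R t - x /\<^sub>R t)"
    using lipschitz_onD[OF F] by (simp add: dist_norm)
   also have "(x + h *\<^sub>R i) /\<^sub>R t - x /\<^sub>R t = (h / t) *\<^sub>R i"
    by (simp add: scaleR_add_right divide_inverse mult.commute)
   also have "L * norm ((h / t) *\<^sub>R i) = \<bar>h\<bar> * (L * norm i / t)" using t \<delta>(1) by simp
   also have "\<dots> \<le> \<bar>h\<bar> * (L * norm i / \<delta>)"
    using t \<delta>(1) L by (intro mult_left_mono divide_left_mono) auto
   finally show "norm ((%(x, t). F (x /\<^sub>R t)) (p + h *\<^sub>R (i, 0)) - (%(x, t). F (x /\<^sub>R t)) p)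
    \<le> \<bar>h\<bar> * (L * norm i / \<delta>)"
    by (simp add: pt)
  qed auto
 qed
 show "has_weak_deriv (UNIV \<times> {0<..}) (0, 1) (%(x, t). F (x /\<^sub>R t)) (%(x, t). F' (x /\<^sub>R t) (- (x /\<^sub>R t\<^sup>2)))"
 proof (rule has_weak_derivI[OF _ m1(2) _ li])
  show "open (UNIV \<times> {0<..} :: ('e \<times> real) set)" by (intro open_Times) auto
  show "AE p in lborel. p \<in> UNIV \<times> {0<..} --> ((%h::real.
  ((%(x, t). F (x /\<^sub>R t)) (p + h *\<^sub>R (0, 1)) - (%(x, t). F (x /\<^sub>R t)) p) /\<^sub>R h)
   \<longlongrightarrow> (%(x, t). F' (x /\<^sub>R t) (- (x /\<^sub>R t\<^sup>2))) p) (at 0)"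
   using lim1[of "(0, 1)"] by simp
  fix K :: "('e \<times> real) set" assume K: "compact K" "K \<subseteq> UNIV \<times> {0<..}"
  obtain \<delta> M where \<delta>: "\<delta> > 0" "\<And>p. p \<in> K ==> snd p \<ge> \<delta> \<and> norm (fst p) \<le> M" using kk[OF K] by blast
  \<comment> \<open>Since t \<ge> \<delta> on K, steps below \<delta>/2 keep t + h \<ge> \<delta>/2.
    The increment of x / t is -h x / (t (t + h)), which gives the constant.\<close>
  show "\<exists>e>0. \<exists>B. set_integrable lborel K B \<and> (AE p in lborel. p \<in> K --> (\<forall>h. \<bar>h\<bar> < e -->
    norm ((%(x, t). F (x /\<^sub>R t)) (p + h *\<^sub>R (0, 1)) - (%(x, t). F (x /\<^sub>R t)) p) \<le> \<bar>h\<bar> * B p))"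
  proof (intro exI[of _ "\<delta>/2"] exI[of _ "%_. L * (M / (\<delta> * (\<delta>/2)))"] conjI AE_I2 allI impI si K)
   fix p and h :: real assume p: "p \<in> K" and h: "\<bar>h\<bar> < \<delta>/2"
   obtain x t where pt: "p = (x, t)" by force
   have t: "t \<ge> \<delta>" "norm x \<le> M" using \<delta>(2)[OF p] pt by auto
   have th: "t + h \<ge> \<delta> / 2" using h t by linarith
   have "norm (F (x /\<^sub>R (t + h)) - F (x /\<^sub>R t)) \<le> L * norm (x /\<^sub>R (t + h) - x /\<^sub>R t)"
    using lipschitz_onD[OF F] by (simp add: dist_norm)
   also have "x /\<^sub>R (t + h) - x /\<^sub>R t = (- h / (t * (t + h))) *\<^sub>R x"
   proof -
    have "inverse (t + h) - inverse t = - h / (t * (t + h))"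
     using t(1) th \<delta>(1) by (simp add: field_simps)
    then show ?thesis by (simp add: scaleR_diff_left[symmetric])
   qed
   also have "norm ((- h / (t * (t + h))) *\<^sub>R x) = \<bar>h\<bar> * (norm x / (t * (t + h)))"
    using t(1) th \<delta>(1) by (simp add: abs_mult)
   also have "L * (\<bar>h\<bar> * (norm x / (t * (t + h)))) \<le> L * (\<bar>h\<bar> * (M / (\<delta> * (\<delta>/2))))"
    using t th \<delta>(1) L order_trans[OF norm_ge_zero t(2)]
    by (intro mult_left_mono frac_le mult_mono) auto
   finally show "norm ((%(x, t). F (x /\<^sub>R t)) (p + h *\<^sub>R (0, 1)) - (%(x, t). F (x /\<^sub>R t)) p)
    \<le> \<bar>h\<bar> * (L * (M / (\<delta> * (\<delta>/2))))"
    by (simp add: pt mult_ac)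
  qed (use \<delta>(1) in auto)
 qed
qed

section \<open>Radial functions, square integrability and weak initial limits\<close>

lemma cball_measurable [measurable]: "cball (a::'a::euclidean_space) r \<in> sets borel"
 by (rule borel_closed[OF closed_cball])

text \<open>Both sides integrate f against a measure on the line: the image of Lebesgue measure on
  the ball under the norm, and a density. The two agree on the half-lines {a<..}, where both give
  the finite volume of a spherical shell, and are determined by these values.\<close>

lemma nn_integral_radial:
 fixes f :: "real => ennreal"
 assumes f[measurable]: "f \<in> borel_measurable borel" and M: "M > 0"
 shows "(\<integral>\<^sup>+x\<in>cball (0::'a::euclidean_space) M. f (norm x) \<partial>lborel)
   = (\<integral>\<^sup>+r\<in>{0..M}. f r * ennreal (unit_ball_vol (real DIM('a)) * (real DIM('a) * r ^ (DIM('a) - 1))) \<partial>lborel)"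
proof -
 define n where "n = DIM('a)"
 have n: "n > 0" by (simp add: n_def)
 define c where "c = unit_ball_vol (real n)"
 have c: "c \<ge> 0" by (simp add: c_def)
 define \<mu> where "\<mu> = distr (density lborel (indicator (cball (0::'a) M))) borel norm"
 define \<nu> where "\<nu> = density lborel (%r. indicator {0..M} r * ennreal (c * (real n * r ^ (n - 1))))"
 \<comment> \<open>The expression min M (max a 0) clips the inner radius of the shell to [0, M], so
   that one formula covers a < 0 and a > M.\<close>
 have mu: "emeasure \<mu> {a<..} = ennreal (c * M ^ n - c * (min M (max a 0)) ^ n)" for a
 proof -
  have "emeasure \<mu> {a<..} = emeasure (density lborel (indicator (cball (0::'a) M))) {x. norm x > a}"
   unfolding \<mu>_def by (subst emeasure_distr) (auto simp: vimage_def)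
  also have "\<dots> = emeasure lborel (cball (0::'a) M \<inter> {x. norm x > a})"
   by (subst emeasure_density) (auto simp: indicator_inter_arith[symmetric])
  also have "\<dots> = ennreal (c * M ^ n - c * (min M (max a 0)) ^ n)"
  proof (cases "a < 0")
   case True
   then have "cball (0::'a) M \<inter> {x. norm x > a} = cball 0 M"
    by (auto intro: less_le_trans)
   moreover have "min M (max a 0) = 0" using True M by auto
   ultimately show ?thesis using M n
    by (simp add: emeasure_cball n_def c_def)
  next
   case False
   have "cball (0::'a) M \<inter> {x. norm x > a} = cball 0 M - cball 0 (min M a)" by auto
   then have "emeasure lborel (cball (0::'a) M \<inter> {x. norm x > a})
    = emeasure lborel (cball (0::'a) M - cball 0 (min M a))" by (rule arg_cong)
   also have "\<dots> = emeasure lborel (cball (0::'a) M) - emeasure lborel (cball (0::'a) (min M a))"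
   proof (rule emeasure_Diff)
    show "emeasure lborel (cball (0::'a) (min M a)) \<noteq> \<infinity>"
     using False M by (subst emeasure_cball) auto
   qed auto
   also have "\<dots> = ennreal (c * M ^ n - c * (min M (max a 0)) ^ n)"
    using False M c by (simp add: emeasure_cball n_def c_def ennreal_minus max_absorb1)
   finally show ?thesis .
  qed
  finally show ?thesis .
 qed
 have nu: "emeasure \<nu> {a<..} = ennreal (c * M ^ n - c * (min M (max a 0)) ^ n)" for a
 proof -
  define b where "b = min M (max a 0)"
  have b: "0 \<le> b" "b \<le> M" using M by (auto simp: b_def)
  have "emeasure \<nu> {a<..} = (\<integral>\<^sup>+r. indicator {0..M} r * ennreal (c * (real n * r ^ (n - 1))) * indicator {a<..} r \<partial>lborel)"
   unfolding \<nu>_def by (subst emeasure_density) auto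
  also have "\<dots> = (\<integral>\<^sup>+r. ennreal (c * (real n * r ^ (n - 1))) * indicator {b..M} r \<partial>lborel)"
  proof (rule nn_integral_cong_AE)
   show "AE r in lborel. indicator {0..M} r * ennreal (c * (real n * r ^ (n - 1))) * indicator {a<..} r
    = ennreal (c * (real n * r ^ (n - 1))) * indicator {b..M} r"
    using AE_lborel_singleton[of b] AE_lborel_singleton[of M] by eventually_elim (auto simp: b_def indicator_def of_bool_def)
  qed
  also have "\<dots> = ennreal (c * M ^ n - c * b ^ n)"
   by (rule nn_integral_FTC_Icc) (use b c in \<open>auto intro!: derivative_eq_intros mult_nonneg_nonneg\<close>)
  finally show ?thesis by (simp add: b_def)
 qed
 have "\<mu> = \<nu>"
  by (rule measure_eqI_lessThan) (auto simp: mu nu, auto simp: \<mu>_def \<nu>_def)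
 then have "(\<integral>\<^sup>+r. f r \<partial>\<mu>) = (\<integral>\<^sup>+r. f r \<partial>\<nu>)" by simp
 then show ?thesis
  unfolding \<mu>_def \<nu>_def
  by (simp add: nn_integral_distr nn_integral_density mult_ac n_def c_def)
qed

text \<open>Applied to the indicator of a Borel null set of radii, the polar formula shows that the
  corresponding union of spheres meets every ball in a null set.\<close>

lemma AE_radial:
 assumes "AE r in lborel. Q r"
 shows "AE x in lborel. Q (norm (x::'a::euclidean_space))"
proof -
 obtain N where N: "{r. \<not> Q r} \<subseteq> N" "N \<in> sets lborel" "emeasure lborel N = 0"
  using assms by (auto elim!: AE_E)
 have [measurable]: "N \<in> sets borel" using N(2) by simp
 \<comment> \<open>The radii are Suc n because the polar formula requires a positive radius.\<close>
 have "AE x in lborel. x \<in> cball 0 (real (Suc n)) --> norm (x::'a) \<notin> N" for n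
 proof -
  have "(\<integral>\<^sup>+x\<in>cball (0::'a) (real (Suc n)). indicator N (norm x) \<partial>lborel) =
   (\<integral>\<^sup>+r\<in>{0..real (Suc n)}. indicator N r * ennreal (unit_ball_vol (real DIM('a)) * (real DIM('a) * r ^ (DIM('a) - 1))) \<partial>lborel)"
   by (rule nn_integral_radial) auto
  also have "\<dots> = 0"
  proof (subst nn_integral_0_iff_AE)
   have "AE r in lborel. r \<notin> N" by (rule AE_not_in) (use N in auto)
   then show "AE r in lborel. indicator N r * ennreal (unit_ball_vol (real DIM('a)) * (real DIM('a) * r ^ (DIM('a) - 1))) *
      indicator {0..real (Suc n)} r = 0"
    by eventually_elim auto
  qed auto
  finally have "AE x in lborel. indicator N (norm (x::'a)) * indicator (cball 0 (real (Suc n))) x = (0::ennreal)"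
   by (subst (asm) nn_integral_0_iff_AE) measurable
  then show ?thesis by eventually_elim (auto simp: indicator_def split: if_splits)
 qed
 then have "AE x in lborel. \<forall>n. x \<in> cball 0 (real (Suc n)) --> norm (x::'a) \<notin> N"
  by (subst AE_all_countable) blast
 then show ?thesis
 proof eventually_elim
  case (elim x)
  obtain n where "norm x \<le> real n" using real_arch_simple by blast
  then have "x \<in> cball 0 (real (Suc n))" by simp
  then show ?case using elim N(1) by blast
 qed
qed

text \<open>In polar coordinates the integrand becomes a multiple of r^(n-3), which is bounded on
  [0, \<rho>] once n \<ge> 3. This makes gradients of order 1/|x| locally square integrable.\<close>

lemma nn_integral_inverse_norm_square:
 assumes "DIM('a) \<ge> 3" "C \<ge> 0"
 shows "(\<integral>\<^sup>+x\<in>cball (0::'a::euclidean_space) \<rho>. ennreal (C / (norm x)\<^sup>2) \<partial>lborel) < \<infinity>"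
proof (cases "\<rho> > 0")
 case True
 define n where "n = DIM('a)"
 define c where "c = unit_ball_vol (real n)"
 have c: "c \<ge> 0" by (simp add: c_def)
 have "(\<integral>\<^sup>+x\<in>cball (0::'a) \<rho>. ennreal (C / (norm x)\<^sup>2) \<partial>lborel)
  = (\<integral>\<^sup>+r\<in>{0..\<rho>}. ennreal (C / r\<^sup>2) * ennreal (c * (real n * r ^ (n - 1))) \<partial>lborel)"
  unfolding n_def c_def by (rule nn_integral_radial) (use True in auto)
 also have "\<dots> \<le> (\<integral>\<^sup>+r\<in>{0..\<rho>}. ennreal (C * c * real n * \<rho> ^ (n - 3)) \<partial>lborel)"
 proof (rule nn_integral_mono)
  fix r
  show "ennreal (C / r\<^sup>2) * ennreal (c * (real n * r ^ (n - 1))) * indicator {0..\<rho>} r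
   \<le> ennreal (C * c * real n * \<rho> ^ (n - 3)) * indicator {0..\<rho>} r"
  proof (cases "0 < r \<and> r \<le> \<rho>")
   case True
   have "r ^ (n - 1) = r ^ (n - 3) * r\<^sup>2"
   proof -
    have "n - 1 = (n - 3) + 2" using assms(1) by (simp add: n_def)
    then show ?thesis by (metis power_add)
   qed
   then have "C / r\<^sup>2 * (c * (real n * r ^ (n - 1))) = C * c * real n * r ^ (n - 3)"
    using True by simp
   also have "\<dots> \<le> C * c * real n * \<rho> ^ (n - 3)"
    using True assms(2) c by (intro mult_left_mono power_mono) auto
   finally show ?thesis using True assms(2) c
    by (simp add: ennreal_mult[symmetric] ennreal_leI)
  qed (auto simp: indicator_def)
 qed
 also have "\<dots> < \<infinity>"
  by (simp add: nn_integral_cmult ennreal_mult_less_top True less_imp_le)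
 finally show ?thesis .
next
 case False
 then have "AE x in lborel. ennreal (C / (norm x)\<^sup>2) * indicator (cball (0::'a) \<rho>) x = 0"
 proof (intro AE_I2)
  fix x :: 'a
  show "ennreal (C / (norm x)\<^sup>2) * indicator (cball (0::'a) \<rho>) x = 0"
  proof (cases "norm x \<le> \<rho>")
   case True
   then have "norm x \<le> 0" using False by linarith
   then show ?thesis by simp
  qed simp
 qed
 then show ?thesis by (subst nn_integral_cong_AE[where v="%_. 0"]) auto
qed

lemma set_integrable_inverse_norm_square:
 assumes "DIM('a) \<ge> 3"
 shows "set_integrable lborel (cball (0::'a::euclidean_space) \<rho>) (%x. C / (norm x)\<^sup>2)"
 unfolding set_integrable_def
proof (rule integrableI_bounded)
 have "(\<integral>\<^sup>+x. ennreal (norm (indicator (cball (0::'a) \<rho>) x *\<^sub>R (C / (norm x)\<^sup>2))) \<partial>lborel)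
  = (\<integral>\<^sup>+x\<in>cball (0::'a) \<rho>. ennreal (\<bar>C\<bar> / (norm x)\<^sup>2) \<partial>lborel)"
  by (rule nn_integral_cong) (auto simp: indicator_def)
 also have "\<dots> < \<infinity>" by (rule nn_integral_inverse_norm_square) (use assms in auto)
 finally show "(\<integral>\<^sup>+x. ennreal (norm (indicator (cball (0::'a) \<rho>) x *\<^sub>R (C / (norm x)\<^sup>2))) \<partial>lborel) < \<infinity>" .
qed measurable

lemma L2_on_inverse_norm:
 assumes "DIM('a) \<ge> 3"
 shows "L2_on (cball (0::'a::euclidean_space) \<rho>) (%x. C / norm x)"
 using nn_integral_inverse_norm_square[OF assms, of "C\<^sup>2" \<rho>]
 unfolding L2_on_def set_borel_measurable_def
 by (intro conjI) (measurable, simp add: power_divide)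

lemma L2_on_const: "L2_on (cball (0::'a::euclidean_space) \<rho>) (%x. C::'b::euclidean_space)"
proof -
 have "emeasure lborel (cball (0::'a) \<rho>) < \<infinity>"
  by (rule emeasure_bounded_finite) auto
 then have "(\<integral>\<^sup>+x\<in>cball (0::'a) \<rho>. ennreal ((norm C)\<^sup>2) \<partial>lborel) < \<infinity>"
  by (subst nn_integral_cmult_indicator) (auto simp: ennreal_mult_less_top)
 then show ?thesis
  unfolding L2_on_def set_borel_measurable_def by (intro conjI) measurable
qed

lemma L2_on_mult_integrable:
 fixes f :: "'a::euclidean_space => 'b::euclidean_space" and g :: "'a => 'c::euclidean_space"
 assumes f: "L2_on A f" and g: "L2_on A g"
 shows "integrable lborel (%x. indicator A x *\<^sub>R (norm (f x) * norm (g x)))"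
proof (rule integrableI_bounded)
 have m: "(%x. indicator A x *\<^sub>R f x) \<in> borel_measurable lborel"
  "(%x. indicator A x *\<^sub>R g x) \<in> borel_measurable lborel"
  using f g by (auto simp: L2_on_def set_borel_measurable_def)
 have e: "indicator A x *\<^sub>R (norm (f x) * norm (g x)) = norm (indicator A x *\<^sub>R f x) * norm (indicator A x *\<^sub>R g x)" for x
  by (auto simp: indicator_def)
 show "(%x. indicator A x *\<^sub>R (norm (f x) * norm (g x))) \<in> borel_measurable lborel"
  unfolding e using m by measurable
 have m2: "(%x. ennreal ((norm (f x))\<^sup>2) * indicator A x) \<in> borel_measurable lborel"
  "(%x. ennreal ((norm (g x))\<^sup>2) * indicator A x) \<in> borel_measurable lborel"
 proof -
  have "(%x. ennreal ((norm (indicator A x *\<^sub>R f x))\<^sup>2)) \<in> borel_measurable lborel" 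
   "(%x. ennreal ((norm (indicator A x *\<^sub>R g x))\<^sup>2)) \<in> borel_measurable lborel" using m by measurable
  moreover have "(%x. ennreal ((norm (indicator A x *\<^sub>R f x))\<^sup>2)) = (%x. ennreal ((norm (f x))\<^sup>2) * indicator A x)"
  "(%x. ennreal ((norm (indicator A x *\<^sub>R g x))\<^sup>2)) = (%x. ennreal ((norm (g x))\<^sup>2) * indicator A x)"
   by (auto simp: indicator_def)
  ultimately show "(%x. ennreal ((norm (f x))\<^sup>2) * indicator A x) \<in> borel_measurable lborel"
  "(%x. ennreal ((norm (g x))\<^sup>2) * indicator A x) \<in> borel_measurable lborel" by metis+
 qed
 have "(\<integral>\<^sup>+x. ennreal (norm (indicator A x *\<^sub>R (norm (f x) * norm (g x)))) \<partial>lborel)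
  \<le> (\<integral>\<^sup>+x. ennreal ((norm (f x))\<^sup>2) * indicator A x + ennreal ((norm (g x))\<^sup>2) * indicator A x \<partial>lborel)"
 proof (rule nn_integral_mono)
  fix x
  have "2 * (norm (f x) * norm (g x)) \<le> (norm (f x))\<^sup>2 + (norm (g x))\<^sup>2"
   using sum_squares_bound[of "norm (f x)" "norm (g x)"] by (simp add: mult.assoc)
  moreover have "0 \<le> norm (f x) * norm (g x)" by simp
  ultimately have "norm (f x) * norm (g x) \<le> (norm (f x))\<^sup>2 + (norm (g x))\<^sup>2" by linarith
  then show "ennreal (norm (indicator A x *\<^sub>R (norm (f x) * norm (g x))))
   \<le> ennreal ((norm (f x))\<^sup>2) * indicator A x + ennreal ((norm (g x))\<^sup>2) * indicator A x"
   by (auto simp: indicator_def ennreal_plus[symmetric] abs_mult simp del: ennreal_plus intro!: ennreal_leI)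
 qed
 also have "\<dots> = (\<integral>\<^sup>+x\<in>A. ennreal ((norm (f x))\<^sup>2) \<partial>lborel) + (\<integral>\<^sup>+x\<in>A. ennreal ((norm (g x))\<^sup>2) \<partial>lborel)"
  by (rule nn_integral_add[OF m2])
 also have "\<dots> < \<infinity>" using f g by (simp add: L2_on_def)
 finally show "(\<integral>\<^sup>+x. ennreal (norm (indicator A x *\<^sub>R (norm (f x) * norm (g x)))) \<partial>lborel) < \<infinity>" .
qed

lemma L2_on_dominated:
 fixes f :: "'a::euclidean_space => 'b::euclidean_space"
 assumes "L2_on A B" "set_borel_measurable lborel A f" "AE x in lborel. x \<in> A --> norm (f x) \<le> norm (B x)"
 shows "L2_on A f"
proof -
 have "(\<integral>\<^sup>+x\<in>A. ennreal ((norm (f x))\<^sup>2) \<partial>lborel) \<le> (\<integral>\<^sup>+x\<in>A. ennreal ((norm (B x))\<^sup>2) \<partial>lborel)"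
  by (rule nn_integral_mono_AE, use assms(3) in eventually_elim)
   (auto simp: indicator_def intro!: ennreal_leI power_mono)
 then show ?thesis using assms(1,2) unfolding L2_on_def by (auto intro: le_less_trans)
qed

text \<open>For fixed x a self-similar map that is homogeneous outside the light cone takes its
  initial value as soon as t < |x|. Pointwise convergence is then trivial, and the time-independent
  bound B allows dominated convergence; the exceptional set of times is empty.\<close>

lemma weakly_tendsto_initiallyI:
 fixes F :: "'a::euclidean_space \<times> real => 'b::euclidean_space" and B :: "'a => real"
 assumes m[measurable]: "F \<in> borel_measurable borel" "f \<in> borel_measurable borel"
  and B: "\<And>\<rho>. L2_on (cball 0 \<rho>) B"
  and bd: "\<And>x t. x \<noteq> 0 ==> t > 0 ==> norm (F (x, t)) \<le> B x"
  and ev: "\<And>x. x \<noteq> 0 ==> \<forall>\<^sub>F t in at_right 0. F (x, t) = f x"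
 shows "weakly_tendsto_initially F f"
 unfolding weakly_tendsto_initially_def
proof (intro allI impI conjI)
 fix \<rho> :: real assume "\<rho> > 0"
 let ?A = "cball (0::'a) \<rho>"
 have m': "(%x. F (x, t)) \<in> borel_measurable borel" for t
  by (rule measurable_compose[OF _ m(1)]) (simp add: borel_prod[symmetric])
 have n0: "AE x in lborel. x \<noteq> (0::'a)" by (rule AE_lborel_singleton)
 have fB: "norm (f x) \<le> B x" if "x \<noteq> 0" for x
 proof -
  have "\<forall>\<^sub>F t in at_right (0::real). t > 0" by (simp add: eventually_at_right_less)
  with ev[OF that] have "\<forall>\<^sub>F t in at_right (0::real). norm (f x) \<le> B x"
   by eventually_elim (use bd[OF that] in metis)
  then show ?thesis by simp
 qed
 have L2F: "L2_on ?A (%x. F (x, t))" if "t > 0" for t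
 proof (rule L2_on_dominated[OF B])
  show "AE x in lborel. x \<in> ?A --> norm (F (x, t)) \<le> norm (B x)"
   using n0 by eventually_elim (use bd that in \<open>force intro: order_trans[OF _ abs_ge_self]\<close>)
  show "set_borel_measurable lborel ?A (%x. F (x, t))"
   unfolding set_borel_measurable_def using m'[of t] by measurable
 qed
 show L2f: "L2_on ?A f"
 proof (rule L2_on_dominated[OF B])
  show "AE x in lborel. x \<in> ?A --> norm (f x) \<le> norm (B x)"
   using n0 by eventually_elim (use fB in \<open>force intro: order_trans[OF _ abs_ge_self]\<close>)
  show "set_borel_measurable lborel ?A f"
   unfolding set_borel_measurable_def by measurable
 qed
 have lim: "((%t. LINT x:?A|lborel. F (x, t) \<bullet> \<zeta> x) \<longlongrightarrow> (LINT x:?A|lborel. f x \<bullet> \<zeta> x)) (at 0 within {0<..})"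
  if z: "L2_on ?A \<zeta>" for \<zeta>
  unfolding tendsto_at_iff_sequentially
 proof (intro allI impI)
  fix X :: "nat => real" assume X: "\<forall>i. X i \<in> {0<..} - {0}" "X \<longlonglongrightarrow> 0"
  have "X i \<noteq> 0" for i using X(1) by (metis DiffD2 singletonI)
  then have X0: "filterlim X (at_right 0) sequentially" using X by (simp add: filterlim_at)
  have mz: "(%x. indicator ?A x *\<^sub>R \<zeta> x) \<in> borel_measurable lborel"
   using z by (simp add: L2_on_def set_borel_measurable_def)
  have mm: "(%x. indicator ?A x *\<^sub>R (q x \<bullet> \<zeta> x)) \<in> borel_measurable lborel"
   if q: "q \<in> borel_measurable borel" for q
  proof -
   have "(%x. q x \<bullet> (indicator ?A x *\<^sub>R \<zeta> x)) \<in> borel_measurable lborel"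
    using q by (intro borel_measurable_inner mz) auto
   then show ?thesis by simp
  qed
  show "((%t. LINT x:?A|lborel. F (x, t) \<bullet> \<zeta> x) \<circ> X) \<longlonglongrightarrow> (LINT x:?A|lborel. f x \<bullet> \<zeta> x)"
   unfolding comp_def set_lebesgue_integral_def
  proof (rule integral_dominated_convergence)
   show "integrable lborel (%x. indicator ?A x *\<^sub>R (norm (B x) * norm (\<zeta> x)))"
    by (rule L2_on_mult_integrable[OF B z])
   show "AE x in lborel. (%i. indicator ?A x *\<^sub>R (F (x, X i) \<bullet> \<zeta> x)) \<longlonglongrightarrow> indicator ?A x *\<^sub>R (f x \<bullet> \<zeta> x)"
    using n0
   proof eventually_elim
    fix x :: 'a assume "x \<noteq> 0"
    then have "\<forall>\<^sub>F i in sequentially. F (x, X i) = f x"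
     using ev X0 by (auto simp: filterlim_iff)
    then have "\<forall>\<^sub>F i in sequentially. indicator ?A x *\<^sub>R (f x \<bullet> \<zeta> x) = indicator ?A x *\<^sub>R (F (x, X i) \<bullet> \<zeta> x)"
     by eventually_elim simp
    then show "(%i. indicator ?A x *\<^sub>R (F (x, X i) \<bullet> \<zeta> x)) \<longlonglongrightarrow> indicator ?A x *\<^sub>R (f x \<bullet> \<zeta> x)"
     by (rule Lim_transform_eventually[OF tendsto_const])
   qed
   show "AE x in lborel. norm (indicator ?A x *\<^sub>R (F (x, X i) \<bullet> \<zeta> x)) \<le> indicator ?A x *\<^sub>R (norm (B x) * norm (\<zeta> x))" for i
    using n0
   proof eventually_elim
    fix x :: 'a assume "x \<noteq> 0"
    have "\<bar>F (x, X i) \<bullet> \<zeta> x\<bar> \<le> norm (F (x, X i)) * norm (\<zeta> x)" by (rule Cauchy_Schwarz_ineq2)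
    also have "\<dots> \<le> norm (B x) * norm (\<zeta> x)"
     using bd[OF \<open>x \<noteq> 0\<close>, of "X i"] X by (intro mult_right_mono) auto
    finally show "norm (indicator ?A x *\<^sub>R (F (x, X i) \<bullet> \<zeta> x)) \<le> indicator ?A x *\<^sub>R (norm (B x) * norm (\<zeta> x))"
     by (auto simp: indicator_def)
   qed
  qed (use mm m' in auto)
 qed
 show "\<exists>Z\<in>null_sets lborel.
    (\<forall>t\<in>{0<..} - Z. L2_on ?A (%x. F (x, t))) \<and>
    (\<forall>\<zeta>. L2_on ?A \<zeta> -->
     ((%t. LINT x:?A|lborel. F (x, t) \<bullet> \<zeta> x)
      \<longlongrightarrow> (LINT x:?A|lborel. f x \<bullet> \<zeta> x)) (at 0 within ({0<..} - Z)))"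
  by (rule bexI[of _ "{}"]) (use L2F lim in auto)
qed

text \<open>Packages the checks on regularity and data for maps that are bounded, have derivatives
  O(1/|x|) uniformly in time, and agree with their data near t = 0 at each x \<noteq> 0.\<close>

lemma energy_regularity_attains_data:
 fixes u ut :: "(real^'d) \<times> real => real^'n" and Du :: "real^'d => (real^'d) \<times> real => real^'n"
 assumes d: "CARD('d) \<ge> 3"
  and wd: "\<And>i. i \<in> Basis ==> has_weak_deriv (UNIV \<times> {0<..}) (i, 0) u (Du i)"
   "has_weak_deriv (UNIV \<times> {0<..}) (0, 1) u ut"
   "\<And>i. i \<in> Basis ==> has_weak_deriv UNIV i u0 (w i)"
  and m[measurable]: "u \<in> borel_measurable borel" "\<And>i. Du i \<in> borel_measurable borel"
   "ut \<in> borel_measurable borel" "u0 \<in> borel_measurable borel" "\<And>i. w i \<in> borel_measurable borel"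
   "u1 \<in> borel_measurable borel"
  and bd: "\<And>x t. x \<noteq> 0 ==> t > 0 ==> norm (u (x, t)) \<le> C"
   "\<And>i x t. i \<in> Basis ==> x \<noteq> 0 ==> t > 0 ==> norm (Du i (x, t)) \<le> C / norm x"
   "\<And>x t. x \<noteq> 0 ==> t > 0 ==> norm (ut (x, t)) \<le> C / norm x"
  and ev: "\<And>x. x \<noteq> 0 ==> \<forall>\<^sub>F t in at_right 0. u (x, t) = u0 x"
   "\<And>i x. i \<in> Basis ==> x \<noteq> 0 ==> \<forall>\<^sub>F t in at_right 0. Du i (x, t) = w i x"
   "\<And>x. x \<noteq> 0 ==> \<forall>\<^sub>F t in at_right 0. ut (x, t) = u1 x"
 shows "has_energy_regularity u Du ut" "attains_data u Du ut u0 u1"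
proof -
 have d': "DIM(real^'d) \<ge> 3" using d by simp
 show "attains_data u Du ut u0 u1"
  unfolding attains_data_def
 proof (intro conjI ballI)
  show "weakly_tendsto_initially u u0"
   by (rule weakly_tendsto_initiallyI[where B="%_. C"]) (use m bd(1) ev(1) L2_on_const in auto)
  show "weakly_tendsto_initially ut u1"
   by (rule weakly_tendsto_initiallyI[where B="%x. C / norm x"])
    (use m bd(3) ev(3) L2_on_inverse_norm[OF d'] in auto)
  fix i :: "real^'d" assume i: "i \<in> Basis"
  have "weakly_tendsto_initially (Du i) (w i)"
   by (rule weakly_tendsto_initiallyI[where B="%x. C / norm x"])
    (use m bd(2)[OF i] ev(2)[OF i] L2_on_inverse_norm[OF d'] in auto)
  then show "\<exists>w. has_weak_deriv UNIV i u0 w \<and> weakly_tendsto_initially (Du i) w"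
   using wd(3)[OF i] by blast
 qed
 show "has_energy_regularity u Du ut"
  unfolding has_energy_regularity_def
 proof (intro conjI ballI allI impI wd)
  fix \<rho> :: real assume "\<rho> > 0"
  \<comment> \<open>One term C^2/|x|^2 for each of the CARD('d) spatial derivatives and one for the
    time derivative.\<close>
  define c where "c = (real CARD('d) + 1) * C\<^sup>2"
  define I where "I = (\<integral>\<^sup>+x\<in>cball (0::real^'d) \<rho>. ennreal (c / (norm x)\<^sup>2) \<partial>lborel)"
  have I: "I < \<infinity>" unfolding I_def
   by (rule nn_integral_inverse_norm_square[OF d']) (simp add: c_def)
  show "\<exists>C. AE t in lborel. 0 < t -->
   (\<integral>\<^sup>+x\<in>cball 0 \<rho>. ennreal ((\<Sum>i\<in>Basis. (norm (Du i (x, t)))\<^sup>2) + (norm (ut (x, t)))\<^sup>2) \<partial>lborel) \<le> ennreal C"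
  proof (intro exI[of _ "enn2real I"] AE_I2 impI)
   fix t :: real assume t: "0 < t"
   have "(\<integral>\<^sup>+x\<in>cball 0 \<rho>. ennreal ((\<Sum>i\<in>Basis. (norm (Du i (x, t)))\<^sup>2) + (norm (ut (x, t)))\<^sup>2) \<partial>lborel) \<le> I"
    unfolding I_def
   proof (rule nn_integral_mono_AE)
    show "AE x in lborel. ennreal ((\<Sum>i\<in>Basis. (norm (Du i (x, t)))\<^sup>2) + (norm (ut (x, t)))\<^sup>2) * indicator (cball 0 \<rho>) x
     \<le> ennreal (c / (norm x)\<^sup>2) * indicator (cball (0::real^'d) \<rho>) x"
     using AE_lborel_singleton[of "0::real^'d"]
    proof eventually_elim
     fix x :: "real^'d" assume x: "x \<noteq> 0"
     have 1: "(norm (Du i (x, t)))\<^sup>2 \<le> (C / norm x)\<^sup>2" if "i \<in> Basis" for i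
      using bd(2)[OF that x t] by (rule power_mono) auto
     have 2: "(norm (ut (x, t)))\<^sup>2 \<le> (C / norm x)\<^sup>2"
      using bd(3)[OF x t] by (rule power_mono) auto
     have "(\<Sum>i\<in>Basis. (norm (Du i (x, t)))\<^sup>2) \<le> (\<Sum>i\<in>(Basis::(real^'d) set). (C / norm x)\<^sup>2)"
      using 1 by (rule sum_mono)
     then have "(\<Sum>i\<in>Basis. (norm (Du i (x, t)))\<^sup>2) + (norm (ut (x, t)))\<^sup>2 \<le> real CARD('d) * (C / norm x)\<^sup>2 + (C / norm x)\<^sup>2"
      using 2 by (intro add_mono) auto
     also have "\<dots> = c / (norm x)\<^sup>2" by (simp add: c_def power_divide add_divide_distrib ring_distribs)
     finally show "ennreal ((\<Sum>i\<in>Basis. (norm (Du i (x, t)))\<^sup>2) + (norm (ut (x, t)))\<^sup>2) * indicator (cball 0 \<rho>) x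
     \<le> ennreal (c / (norm x)\<^sup>2) * indicator (cball (0::real^'d) \<rho>) x"
      by (intro mult_right_mono ennreal_leI) auto
    qed
   qed
   then show "(\<integral>\<^sup>+x\<in>cball 0 \<rho>. ennreal ((\<Sum>i\<in>Basis. (norm (Du i (x, t)))\<^sup>2) + (norm (ut (x, t)))\<^sup>2) \<partial>lborel) \<le> ennreal (enn2real I)"
    using I by simp
  qed
 qed
qed

section \<open>Geometry of the coordinates and of the eigenmap\<close>

abbreviation hom_ext :: "(real => 'm::real_normed_vector => 'n) => real \<times> 'm => 'n"
 where "hom_ext P \<equiv> (%(s, y). P s (sgn y))"

lemma sgn_sphere: "x \<noteq> 0 ==> sgn x \<in> sphere 0 1" for x :: "'a::real_normed_vector"
 by (simp add: norm_sgn)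

lemma sgn_on_sphere: "x \<in> sphere 0 1 ==> sgn x = x" for x :: "'a::real_normed_vector"
 by (simp add: sgn_div_norm)

lemma sphere_nonzero: "x \<in> sphere 0 1 ==> x \<noteq> 0" for x :: "'a::real_normed_vector"
 by auto

context
 fixes N :: "(real^'n) set" and g :: "real => real" and P :: "real => real^'m => real^'n"
 assumes W: "warped_coordinates N g P"
begin

lemma hom_ext_smooth: "smooth_on (UNIV \<times> (- {0})) (hom_ext P)"
 using W unfolding warped_coordinates_def by (elim conjE)

lemma warped_metric:
 assumes "y \<in> sphere 0 1" "v \<bullet> y = 0"
 shows "(norm (dir_deriv (a, v) (hom_ext P) (s, y)))\<^sup>2 = a\<^sup>2 + (g s)\<^sup>2 * (norm v)\<^sup>2"
proof -
 have "\<forall>s. \<forall>y\<in>sphere 0 1. \<forall>a v. v \<bullet> y = 0 -->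
   (norm (dir_deriv (a, v) (%(s, y). P s (sgn y)) (s, y)))\<^sup>2 = a\<^sup>2 + (g s)\<^sup>2 * (norm v)\<^sup>2"
  using W unfolding warped_coordinates_def by (elim conjE)
 then show ?thesis using assms by simp
qed

text \<open>The identification of (s, y) with (-s, -y) cannot occur with the same y, since y
  \<noteq> -y on the sphere; what remains is a shift by a period.\<close>

lemma warped_unique:
 assumes "y \<in> sphere 0 1" "P s y = P s' y" "g s \<noteq> 0"
 shows "\<exists>T. coord_period P T \<and> s' = s + T"
proof -
 have "\<forall>s s'. \<forall>y\<in>sphere 0 1. \<forall>y'\<in>sphere 0 1. P s y = P s' y' \<and> g s \<noteq> 0 -->
   (\<exists>T. coord_period P T \<and> (s' = s + T \<and> y' = y \<or> s' = T - s \<and> y' = - y))"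
  using W unfolding warped_coordinates_def by (elim conjE)
 then obtain T where T: "coord_period P T" "s' = s + T \<and> y = y \<or> s' = T - s \<and> y = - y"
  using assms by blast
 have "y \<noteq> - y"
 proof
  assume "y = - y"
  then have "2 *\<^sub>R y = 0" by (metis add.right_inverse scaleR_2)
  then show False using assms(1) by simp
 qed
 then show ?thesis using T by auto
qed

lemma hom_ext_has_derivative:
 assumes "y \<noteq> 0"
 shows "(hom_ext P has_derivative (%v. dir_deriv v (hom_ext P) (s, y))) (at (s, y))"
 by (rule smooth_on_has_derivative[OF hom_ext_smooth]) (use assms in auto)

text \<open>The metric with a = 1 and v = 0 says that the coordinate lines s \<mapsto> P s y have
  unit speed. This links sizes of differences and derivatives of \<phi> with those of the map
  u.\<close>

lemma curve_derivative:
 assumes "y \<in> sphere 0 1"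
 shows "((%s. P s y) has_vector_derivative dir_deriv (1, 0) (hom_ext P) (s, y)) (at s)"
  and "norm (dir_deriv (1, 0) (hom_ext P) (s, y)) = 1"
proof -
 define D where "D = dir_deriv (1, 0) (hom_ext P) (s, y)"
 have "dir_deriv (h, 0) (hom_ext P) (s, y) = h *\<^sub>R D" for h
  using has_derivative_linear[OF hom_ext_has_derivative[OF sphere_nonzero[OF assms]], of s]
   linear_cmul[of "%v. dir_deriv v (hom_ext P) (s, y)" h "(1, 0)"] by (simp add: D_def)
 then have D: "(%h. dir_deriv (h, 0) (hom_ext P) (s, y)) = (%h. h *\<^sub>R D)" by (rule ext)
 have "((%s. hom_ext P (s, y)) has_derivative (%h. dir_deriv (h, 0) (hom_ext P) (s, y))) (at s)"
  by (rule has_derivative_compose[of "%s. (s, y)" "%h. (h, 0)" s UNIV "hom_ext P"])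
   (use sphere_nonzero[OF assms] in \<open>auto intro!: derivative_eq_intros hom_ext_has_derivative\<close>)
 then have "((%s. P s y) has_vector_derivative D) (at s)"
  unfolding D by (simp add: has_vector_derivative_def sgn_on_sphere[OF assms])
 then show "((%s. P s y) has_vector_derivative dir_deriv (1, 0) (hom_ext P) (s, y)) (at s)"
  unfolding D_def .
 have "(norm (dir_deriv (1, 0) (hom_ext P) (s, y)))\<^sup>2 = 1"
  using warped_metric[OF assms, of 0 1 s] by simp
 then show "norm (dir_deriv (1, 0) (hom_ext P) (s, y)) = 1"
  by (simp add: power2_eq_1_iff) (smt (verit) norm_ge_zero)
qed

lemma curve_lipschitz:
 assumes "y \<in> sphere 0 1"
 shows "norm (P s y - P s' y) \<le> \<bar>s - s'\<bar>"
proof -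
 have "norm (P s y - P s' y) \<le> 1 * norm (s - s')"
 proof (rule differentiable_bound[of UNIV "%s. P s y" "%s h. h *\<^sub>R dir_deriv (1, 0) (hom_ext P) (s, y)"])
  fix s
  show "((%s. P s y) has_derivative (%h. h *\<^sub>R dir_deriv (1, 0) (hom_ext P) (s, y))) (at s within UNIV)"
   using curve_derivative(1)[OF assms] by (simp add: has_vector_derivative_def)
  show "onorm (%h. h *\<^sub>R dir_deriv (1, 0) (hom_ext P) (s, y)) \<le> 1"
   by (rule onorm_le) (simp add: curve_derivative(2)[OF assms])
 qed auto
 then show ?thesis by simp
qed

lemma chart_continuous: "continuous_on (UNIV \<times> sphere 0 1) (%(s, y). P s y)"
proof -
 have "continuous_on (UNIV \<times> sphere 0 1) (hom_ext P)"
  using smooth_on_continuous[OF hom_ext_smooth] by (rule continuous_on_subset) auto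
 moreover have "hom_ext P p = (%(s, y). P s y) p" if "p \<in> UNIV \<times> sphere 0 1" for p
  using that by (auto simp: sgn_on_sphere)
 ultimately show ?thesis by (subst continuous_on_cong[OF refl, symmetric]) auto
qed

text \<open>A coordinate line leaves P 0 y with nonzero velocity and cannot return to it
  immediately, so nonzero periods stay away from 0.\<close>

lemma coord_period_small:
 assumes "y \<in> sphere (0::real^'m) 1"
 obtains \<delta> where "\<delta> > 0" "\<And>T. coord_period P T ==> \<bar>T\<bar> < \<delta> ==> T = 0"
proof -
 let ?D = "dir_deriv (1, 0) (hom_ext P) (0, y)"
 have "((%s. P s y) has_derivative (%h. h *\<^sub>R ?D)) (at 0)"
  using curve_derivative(1)[OF assms, of 0] by (simp add: has_vector_derivative_def)
 from has_derivative_quotient[OF this, of 1]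
 have "((%h. (P h y - P 0 y) /\<^sub>R h) \<longlongrightarrow> ?D) (at 0)" by simp
 moreover have "?D \<noteq> 0" using curve_derivative(2)[OF assms, of 0] by auto
 ultimately have "\<forall>\<^sub>F h in at 0. (P h y - P 0 y) /\<^sub>R h \<noteq> 0"
  by (rule tendsto_imp_eventually_ne)
 then obtain \<delta> where \<delta>: "\<delta> > 0" "\<And>h. h \<noteq> 0 ==> dist h 0 < \<delta> ==> (P h y - P 0 y) /\<^sub>R h \<noteq> 0"
  unfolding eventually_at by auto
 show ?thesis
 proof (rule that[OF \<delta>(1)])
  fix T assume T: "coord_period P T" "\<bar>T\<bar> < \<delta>"
  have "P (0 + T) y = P 0 y" using T(1) assms unfolding coord_period_def by blast
  then show "T = 0" using \<delta>(2)[of T] T(2) by auto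
 qed
qed

lemma coord_period_diff:
 assumes "coord_period P T" "coord_period P T'"
 shows "coord_period P (T - T')"
 unfolding coord_period_def
proof (intro allI ballI)
 fix s and y :: "real^'m" assume y: "y \<in> sphere 0 1"
 have 1: "P (s - T' + T) y = P (s - T') y" using assms(1) y unfolding coord_period_def by blast
 have 2: "P (s - T' + T') y = P (s - T') y" using assms(2) y unfolding coord_period_def by blast
 show "P (s + (T - T')) y = P s y" using 1 2 by (simp add: algebra_simps)
qed

text \<open>A shift by a period leaves the parametrization unchanged, hence also the length that the
  metric assigns to a tangent vector v \<noteq> 0. The metric sees g only through its square, so the
  conclusion is about the square.\<close>

lemma coord_period_g:
 assumes T: "coord_period P T" and y: "y \<in> sphere (0::real^'m) 1" and v: "v \<bullet> y = 0" "v \<noteq> 0"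
 shows "(g (s + T))\<^sup>2 = (g s)\<^sup>2"
proof -
 have y0: "y \<noteq> 0" using y by auto
 have "((%p. hom_ext P (p + (T, 0))) has_derivative (%v. dir_deriv v (hom_ext P) (s + T, y))) (at (s, y))"
  by (rule has_derivative_compose[of "%p. p + (T, 0)" "%h. h" _ _ "hom_ext P"])
   (use y0 in \<open>auto intro!: derivative_eq_intros hom_ext_has_derivative\<close>)
 then have "(hom_ext P has_derivative (%v. dir_deriv v (hom_ext P) (s + T, y))) (at (s, y))"
 proof (rule has_derivative_transform_within_open[of _ _ _ _ "UNIV \<times> (- {0})"])
  fix p :: "real \<times> (real^'m)" assume "p \<in> UNIV \<times> (- {0})"
  then have "snd p \<noteq> 0" by auto
  then have "P (fst p + T) (sgn (snd p)) = P (fst p) (sgn (snd p))"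
   using T sgn_sphere[of "snd p"] unfolding coord_period_def by blast
  then show "hom_ext P (p + (T, 0)) = hom_ext P p" by (simp add: case_prod_beta)
 qed (use y0 in \<open>auto intro!: open_Times\<close>)
 then have "dir_deriv (0, v) (hom_ext P) (s, y) = dir_deriv (0, v) (hom_ext P) (s + T, y)"
  by (rule dir_deriv_eq)
 then have "(g (s + T))\<^sup>2 * (norm v)\<^sup>2 = (g s)\<^sup>2 * (norm v)\<^sup>2"
  using warped_metric[OF y v(1), of 0 s] warped_metric[OF y v(1), of 0 "s + T"] by simp
 then show ?thesis using v(2) by simp
qed

end

lemma eigenmap_sphere:
 assumes "eigenmap k X" "x \<in> sphere 0 1" shows "X x \<in> sphere 0 1"
 using assms unfolding eigenmap_def by blast

lemma eigenmap_smooth: "eigenmap k X ==> smooth_on (- {0}) (%x. X (sgn x))"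
 unfolding eigenmap_def by (elim conjE)

text \<open>Differentiate |X|^2 = 1. Tangency is what allows the metric formula to be applied to
  this derivative.\<close>

lemma eigenmap_deriv_orthogonal:
 assumes X: "eigenmap k X" and x: "x \<noteq> 0"
 shows "dir_deriv v (%x. X (sgn x)) x \<bullet> X (sgn x) = 0"
proof -
 have der: "((%x. X (sgn x)) has_derivative (%v. dir_deriv v (%x. X (sgn x)) x)) (at x)"
  by (rule smooth_on_has_derivative[OF eigenmap_smooth[OF X]]) (use x in auto)
 have "((%x. X (sgn x) \<bullet> X (sgn x)) has_derivative
  (%v. X (sgn x) \<bullet> dir_deriv v (%x. X (sgn x)) x + dir_deriv v (%x. X (sgn x)) x \<bullet> X (sgn x))) (at x)"
  by (rule has_derivative_inner[OF der der])
 moreover have "((%x. X (sgn x) \<bullet> X (sgn x)) has_derivative (%_. 0)) (at x)"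
 proof (rule has_derivative_transform_within_open[of "%_. 1" _ _ _ "- {0}"])
  fix z :: "real^'a" assume "z \<in> - {0}"
  then show "1 = X (sgn z) \<bullet> X (sgn z)"
   using eigenmap_sphere[OF X sgn_sphere, of z] by (simp add: dot_square_norm)
 qed (use x in auto)
 ultimately have "(%v. X (sgn x) \<bullet> dir_deriv v (%x. X (sgn x)) x + dir_deriv v (%x. X (sgn x)) x \<bullet> X (sgn x)) = (%_. 0)"
  by (rule has_derivative_unique)
 from fun_cong[OF this, of v] show ?thesis by (simp add: inner_commute)
qed

text \<open>The energy density of X is k > 0, so some derivative is nonzero. It provides the nonzero
  tangent vector with which the square of g is read off the metric.\<close>

lemma eigenmap_tangent:
 assumes X: "eigenmap k X" and k: "k > 0" and w: "\<omega> \<in> sphere 0 1"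
 obtains i where "dir_deriv i (%x. X (sgn x)) \<omega> \<noteq> 0" "dir_deriv i (%x. X (sgn x)) \<omega> \<bullet> X \<omega> = 0"
proof -
 have "(\<Sum>i\<in>Basis. (norm (dir_deriv i (%x. X (sgn x)) \<omega>))\<^sup>2) = k"
  using X w unfolding eigenmap_def by blast
 then obtain i where "i \<in> Basis" "(norm (dir_deriv i (%x. X (sgn x)) \<omega>))\<^sup>2 \<noteq> 0"
  using k by (metis (no_types, lifting) less_irrefl sum.neutral)
 then show ?thesis
  using that[of i] eigenmap_deriv_orthogonal[OF X sphere_nonzero[OF w], of i] sgn_on_sphere[OF w] by simp
qed

text \<open>The map is homogeneous of degree 0, so its derivative is homogeneous of degree -1 and a
  bound on the compact unit sphere suffices.\<close>

lemma eigenmap_deriv_bound: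
 assumes X: "eigenmap k X"
 obtains C where "C \<ge> 0" "\<And>x v. x \<noteq> 0 ==> norm (dir_deriv v (%x. X (sgn x)) x) \<le> C * norm v / norm x"
proof -
 obtain C where C: "C \<ge> 0" "\<And>x v. x \<in> sphere 0 1 ==> norm (dir_deriv v (%x. X (sgn x)) x) \<le> C * norm v"
  by (rule smooth_on_compact_deriv_bound[OF eigenmap_smooth[OF X], of "sphere 0 1"]) auto
 show ?thesis
 proof (rule that[OF C(1)])
  fix x v :: "real^'a" assume x: "x \<noteq> 0"
  have "((%z. X (sgn ((1 / norm x) *\<^sub>R z))) has_derivative (%v. dir_deriv ((1 / norm x) *\<^sub>R v) (%x. X (sgn x)) (sgn x))) (at x)"
  proof (rule has_derivative_compose[of "%z. (1 / norm x) *\<^sub>R z" "%z. (1 / norm x) *\<^sub>R z" x UNIV "%x. X (sgn x)"])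
   show "((%x. X (sgn x)) has_derivative (%v. dir_deriv v (%x. X (sgn x)) (sgn x))) (at ((1 / norm x) *\<^sub>R x))"
    using smooth_on_has_derivative[OF eigenmap_smooth[OF X], of "sgn x"] x
    by (simp add: sgn_div_norm inverse_eq_divide sgn_zero_iff)
  qed (auto intro!: derivative_eq_intros)
  moreover have "sgn ((1 / norm x) *\<^sub>R z) = sgn z" for z :: "real^'a" using x by (simp add: sgn_div_norm inverse_eq_divide)
  ultimately have "dir_deriv v (%x. X (sgn x)) x = dir_deriv ((1 / norm x) *\<^sub>R v) (%x. X (sgn x)) (sgn x)"
   by (simp add: dir_deriv_eq)
  also have "norm \<dots> \<le> C * norm ((1 / norm x) *\<^sub>R v)"
   by (rule C(2)) (use x sgn_sphere in auto)
  finally show "norm (dir_deriv v (%x. X (sgn x)) x) \<le> C * norm v / norm x" by simp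
 qed
qed

section \<open>Maps that are homogeneous of degree zero in space\<close>

text \<open>The compact set lies in a ball times a bounded interval, on which Fubini reduces the
  claim to integrability in x.\<close>

lemma set_integrable_spacetime:
 fixes B :: "'e::euclidean_space => real"
 assumes B: "\<And>\<rho>. set_integrable lborel (cball 0 \<rho>) B" and K: "compact (K :: ('e \<times> real) set)"
 shows "set_integrable lborel K (%(x, t). B x)"
proof -
 have [measurable]: "K \<in> sets borel" using K by (simp add: borel_compact)
 obtain M where M: "\<And>p. p \<in> K ==> norm p \<le> M"
  using compact_imp_bounded[OF K] by (auto simp: bounded_iff)
 define f where "f p = (indicator (cball 0 M) (fst p) *\<^sub>R B (fst p)) * indicator {-M..M} (snd p)" for p :: "'e \<times> real"
 have Bi: "integrable lborel (%x. indicator (cball 0 M) x *\<^sub>R B x)" using B[of M] unfolding set_integrable_def .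
 have Bm[measurable]: "(%x. indicator (cball 0 M) x *\<^sub>R B x) \<in> borel_measurable borel"
  using borel_measurable_integrable[OF Bi] by simp
 have fm: "f \<in> borel_measurable (lborel \<Otimes>\<^sub>M lborel)"
 proof -
  have "(%p::'e\<times>real. (indicator (cball 0 M) (fst p) *\<^sub>R B (fst p))) \<in> borel_measurable (lborel \<Otimes>\<^sub>M lborel)"
   by (rule measurable_compose[OF measurable_fst]) (use Bm in simp)
  then show ?thesis unfolding f_def by measurable
 qed
 have ind: "integrable lborel (indicator {-M..M} :: real => real)"
  by (rule integrable_real_indicator[OF _ emeasure_bounded_finite]) auto
 have "integrable (lborel \<Otimes>\<^sub>M lborel) f"
 proof (rule lborel_pair.Fubini_integrable[OF fm])
  have "(%x. \<integral>y. norm (f (x, y)) \<partial>lborel) = (%x. norm (indicator (cball 0 M) x *\<^sub>R B x) * (LBINT y. indicator {-M..M} y))"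
   by (rule ext) (simp add: f_def abs_mult)
  then show "integrable lborel (%x. \<integral>y. norm (f (x, y)) \<partial>lborel)"
   by (simp only:) (intro integrable_mult_left integrable_norm Bi)
  show "AE x in lborel. integrable lborel (%y. f (x, y))"
   using ind by (auto simp: f_def)
 qed
 then have fi: "integrable lborel f" by (simp add: lborel_prod)
 then have "integrable lborel (%p. indicator K p *\<^sub>R f p)"
  by (rule integrable_mult_indicator[rotated]) simp
 moreover have "(%p. indicator K p *\<^sub>R f p) = (%p. indicator K p *\<^sub>R (%(x, t). B x) p)"
 proof
  fix p :: "'e \<times> real"
  obtain x t where p: "p = (x, t)" by force
  have "norm x \<le> M \<and> \<bar>t\<bar> \<le> M" if "p \<in> K"
   using M[OF that] norm_fst_le[of x t] norm_snd_le[of t x] unfolding p by auto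
  then show "indicator K p *\<^sub>R f p = indicator K p *\<^sub>R (%(x, t). B x) p"
   by (auto simp: f_def indicator_def p abs_le_iff)
 qed
 ultimately show ?thesis unfolding set_integrable_def by simp
qed

lemma loc_integrable_spacetime:
 fixes F :: "'e::euclidean_space \<times> real => 'b::euclidean_space"
 assumes [measurable]: "F \<in> borel_measurable borel"
  and B: "\<And>\<rho>. set_integrable lborel (cball 0 \<rho>) B"
  and bd: "\<And>x t. x \<noteq> 0 ==> t > 0 ==> norm (F (x, t)) \<le> B x"
 shows "loc_integrable (UNIV \<times> {0<..}) F"
 unfolding loc_integrable_def
proof (intro allI impI)
 fix K :: "('e \<times> real) set" assume K: "compact K \<and> K \<subseteq> UNIV \<times> {0<..}"
 then have [measurable]: "K \<in> sets borel" by (simp add: borel_compact)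
 show "set_integrable lborel K F"
  unfolding set_integrable_def
 proof (rule Bochner_Integration.integrable_bound)
  show "integrable lborel (%p. indicator K p *\<^sub>R (%(x, t). B x) p)"
   using set_integrable_spacetime[OF B] K unfolding set_integrable_def by blast
  show "AE p in lborel. norm (indicator K p *\<^sub>R F p) \<le> norm (indicator K p *\<^sub>R (%(x, t). B x) p)"
   using AE_off_cone
  proof eventually_elim
   fix p :: "'e \<times> real" assume p: "fst p \<noteq> 0 \<and> norm (fst p) \<noteq> snd p"
   show "norm (indicator K p *\<^sub>R F p) \<le> norm (indicator K p *\<^sub>R (%(x, t). B x) p)"
   proof (cases "p \<in> K")
    case True
    then have "snd p > 0" using K by auto
    then have "norm (F p) \<le> B (fst p)" using bd[of "fst p" "snd p"] p by simp
    then show ?thesis using True by (auto simp: case_prod_beta)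
   qed simp
  qed
 qed measurable
qed

text \<open>If y is closer to x than |x|/2, the segment stays where |z| \<ge> |x|/2 and the mean
  value inequality gives the constant 2C/|x|. Otherwise 1 \<le> 2 |y - x| / |x|, and the trivial
  bound 2M gives the 4M.\<close>

lemma lipschitz_inverse_norm:
 fixes H :: "'a::euclidean_space => 'b::real_normed_vector"
 assumes C: "C \<ge> 0" and M: "\<And>x. norm (H x) \<le> M"
  and der: "\<And>x. x \<noteq> 0 ==> (H has_derivative DH x) (at x)"
  and bd: "\<And>x v. x \<noteq> 0 ==> norm (DH x v) \<le> C * norm v / norm x"
  and x: "x \<noteq> 0"
 shows "norm (H y - H x) \<le> (4 * M + 2 * C) * norm (y - x) / norm x"
proof (cases "norm (y - x) < norm x / 2")
 case True
 have "norm (H y - H x) \<le> 2 * C / norm x * norm (y - x)"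
 proof (rule differentiable_bound[of "ball x (norm x / 2)" H DH])
  fix z assume z: "z \<in> ball x (norm x / 2)"
  have "norm x \<le> norm z + norm (x - z)" by (metis norm_triangle_sub)
  then have zn: "norm z \<ge> norm x / 2" using z by (simp add: dist_norm)
  then have z0: "z \<noteq> 0" using x by auto
  show "(H has_derivative DH z) (at z within ball x (norm x / 2))"
   using der[OF z0] has_derivative_at_withinI by blast
  show "onorm (DH z) \<le> 2 * C / norm x"
  proof (rule onorm_le)
   fix v
   have "norm (DH z v) \<le> C * norm v / norm z" by (rule bd[OF z0])
   also have "\<dots> \<le> C * norm v / (norm x / 2)"
    using zn x C by (intro divide_left_mono mult_pos_pos) auto
   finally show "norm (DH z v) \<le> 2 * C / norm x * norm v" by (simp add: mult_ac)
  qed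
 qed (use True x in \<open>auto simp: dist_norm norm_minus_commute\<close>)
 also have "\<dots> \<le> (4 * M + 2 * C) * norm (y - x) / norm x"
  using order_trans[OF norm_ge_zero M[of x]] by (simp add: divide_right_mono mult_right_mono mult_ac ring_distribs)
 finally show ?thesis .
next
 case False
 have M0: "M \<ge> 0" using order_trans[OF norm_ge_zero M[of x]] .
 have "norm (H y - H x) \<le> norm (H y) + norm (H x)" by (rule norm_triangle_ineq4)
 also have "\<dots> \<le> 2 * M" using M[of x] M[of y] by simp
 also have "\<dots> \<le> 4 * M * norm (y - x) / norm x"
 proof -
  have "2 * M * norm x \<le> 2 * M * (2 * norm (y - x))" using False M0 by (intro mult_left_mono) auto
  then show ?thesis using x by (simp add: le_divide_eq)
 qed
 also have "\<dots> \<le> (4 * M + 2 * C) * norm (y - x) / norm x"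
  using C by (intro divide_right_mono mult_right_mono) auto
 finally show ?thesis .
qed

text \<open>The origin is a null set, and the bound of order 1/|x| on the difference quotients is
  locally integrable, so the singularity there contributes nothing to the weak derivative.\<close>

lemma has_weak_deriv_homogeneous:
 fixes H :: "'e::euclidean_space => 'b::euclidean_space"
 assumes d: "DIM('e) \<ge> 3" and C: "C \<ge> 0" and M: "\<And>x. norm (H x) \<le> M"
  and der: "\<And>x. x \<noteq> 0 ==> (H has_derivative DH x) (at x)"
  and bd: "\<And>x v. x \<noteq> 0 ==> norm (DH x v) \<le> C * norm v / norm x"
  and m[measurable]: "H \<in> borel_measurable borel" "(%x. DH x i) \<in> borel_measurable borel"
 shows "has_weak_deriv UNIV i H (%x. DH x i)"
  and "has_weak_deriv (UNIV \<times> {0<..}) (i, 0) (%(x, t::real). H x) (%(x, t). DH x i)"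
  and "has_weak_deriv (UNIV \<times> {0<..}) (0, 1) (%(x::'e, t::real). H x) (%(x, t). 0)"
proof -
 \<comment> \<open>The elementary bound 1/|x| \<le> 1 + 1/|x|^2 reduces integrability to the case
   already computed.\<close>
 define B where "B x = (4 * M + 2 * C) * norm i * (1 + 1 / (norm x)\<^sup>2)" for x :: 'e
 have M0: "M \<ge> 0" using order_trans[OF norm_ge_zero M[of 0]] .
 have c: "set_integrable lborel (cball (0::'e) \<rho>) (%_. c::real)" for \<rho> c
  unfolding set_integrable_def by (intro borel_integrable_compact continuous_intros) auto
 have Bi: "set_integrable lborel (cball 0 \<rho>) B" for \<rho>
  unfolding B_def using set_integrable_inverse_norm_square[OF d] c
  by (intro set_integrable_mult_right set_integral_add) auto
 have lip: "norm (H (x + h *\<^sub>R i) - H x) \<le> \<bar>h\<bar> * B x" if "x \<noteq> 0" for x h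
 proof -
  have "norm (H (x + h *\<^sub>R i) - H x) \<le> (4 * M + 2 * C) * norm (x + h *\<^sub>R i - x) / norm x"
   by (rule lipschitz_inverse_norm[OF C M der bd that])
  also have "\<dots> = \<bar>h\<bar> * ((4 * M + 2 * C) * norm i * (1 / norm x))" by simp
  also have "\<dots> \<le> \<bar>h\<bar> * B x"
   unfolding B_def
  proof (intro mult_left_mono)
   have "2 * (1 / norm x) \<le> 1 + (1 / norm x)\<^sup>2"
    using sum_squares_bound[of 1 "1 / norm x"] by simp
   moreover have "0 \<le> 1 / norm x" by simp
   ultimately show "1 / norm x \<le> 1 + 1 / (norm x)\<^sup>2" unfolding power_divide one_power2 by linarith
  qed (use M0 C in auto)
  finally show ?thesis .
 qed
 have K0: "set_integrable lborel K B" if K: "compact K" for K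
 proof -
  obtain \<rho> where "K \<subseteq> cball 0 \<rho>" using compact_imp_bounded[OF K] by (auto simp: bounded_iff subset_iff)
  then show ?thesis using set_integrable_subset[OF Bi] K by (simp add: borel_compact)
 qed
 have n0: "AE x in lborel. x \<noteq> (0::'e)" by (rule AE_lborel_singleton)
 have Hl: "loc_integrable UNIV H"
  unfolding loc_integrable_def set_integrable_def
 proof (intro allI impI)
  fix K :: "'e set" assume K: "compact K \<and> K \<subseteq> UNIV"
  then have [measurable]: "K \<in> sets borel" by (simp add: borel_compact)
  show "integrable lborel (%x. indicator K x *\<^sub>R H x)"
  proof (rule Bochner_Integration.integrable_bound)
   show "integrable lborel (%x. indicator K x *\<^sub>R M)"
    using K by (intro borel_integrable_compact continuous_intros) auto
   show "AE x in lborel. norm (indicator K x *\<^sub>R H x) \<le> norm (indicator K x *\<^sub>R M)"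
    using M M0 by (auto simp: indicator_def)
  qed measurable
 qed
 show "has_weak_deriv UNIV i H (%x. DH x i)"
 proof (rule has_weak_derivI[OF _ m(2) _ Hl])
  show "AE x in lborel. x \<in> UNIV --> ((%h. (H (x + h *\<^sub>R i) - H x) /\<^sub>R h) \<longlongrightarrow> DH x i) (at 0)"
   using n0 by eventually_elim (use has_derivative_quotient[OF der] in auto)
  fix K :: "'e set" assume K: "compact K" "K \<subseteq> UNIV"
  then have [measurable]: "K \<in> sets borel" by (simp add: borel_compact)
  show "\<exists>e>0. \<exists>B. set_integrable lborel K B \<and> (AE x in lborel. x \<in> K -->
   (\<forall>h. \<bar>h\<bar> < e --> norm (H (x + h *\<^sub>R i) - H x) \<le> \<bar>h\<bar> * B x))"
  proof (intro exI[of _ 1] exI[of _ B] conjI)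
   show "AE x in lborel. x \<in> K --> (\<forall>h. \<bar>h\<bar> < 1 --> norm (H (x + h *\<^sub>R i) - H x) \<le> \<bar>h\<bar> * B x)"
    using n0 by eventually_elim (use lip in auto)
  qed (use K0 K in auto)
 qed auto
 have Hl2: "loc_integrable (UNIV \<times> {0<..}) (%(x::'e, t::real). H x)"
 proof (rule loc_integrable_spacetime[where B="%_. M"])
  show "(%(x::'e, t::real). H x) \<in> borel_measurable borel"
   unfolding borel_prod[symmetric] by measurable
 qed (use c M in auto)
 have m2: "(%(x::'e, t::real). DH x i) \<in> borel_measurable borel"
  unfolding borel_prod[symmetric] by measurable
 have op: "open (UNIV \<times> {0<..} :: ('e \<times> real) set)" by (intro open_Times) auto
 show "has_weak_deriv (UNIV \<times> {0<..}) (i, 0) (%(x, t::real). H x) (%(x, t). DH x i)"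
 proof (rule has_weak_derivI[OF op m2 _ Hl2])
  show "AE p in lborel. p \<in> UNIV \<times> {0<..} -->
   ((%h. ((%(x, t). H x) (p + h *\<^sub>R (i, 0)) - (%(x, t::real). H x) p) /\<^sub>R h)
    \<longlongrightarrow> (%(x, t). DH x i) p) (at 0)"
   using AE_off_cone
   by eventually_elim (use has_derivative_quotient[OF der] in \<open>auto simp: case_prod_beta\<close>)
  fix K :: "('e \<times> real) set" assume K: "compact K" "K \<subseteq> UNIV \<times> {0<..}"
  show "\<exists>e>0. \<exists>B. set_integrable lborel K B \<and> (AE p in lborel. p \<in> K -->
   (\<forall>h. \<bar>h\<bar> < e --> norm ((%(x, t). H x) (p + h *\<^sub>R (i, 0)) - (%(x, t). H x) p) \<le> \<bar>h\<bar> * B p))"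
  proof (intro exI[of _ 1] exI[of _ "%(x, t). B x"] conjI)
   show "AE p in lborel. p \<in> K -->
    (\<forall>h. \<bar>h\<bar> < 1 --> norm ((%(x, t). H x) (p + h *\<^sub>R (i, 0)) - (%(x, t). H x) p) \<le> \<bar>h\<bar> * (%(x, t). B x) p)"
    using AE_off_cone by eventually_elim (use lip in \<open>auto simp: case_prod_beta\<close>)
  qed (use set_integrable_spacetime[OF Bi] K in auto)
 qed
 show "has_weak_deriv (UNIV \<times> {0<..}) (0, 1) (%(x::'e, t::real). H x) (%(x, t). 0)"
 proof (rule has_weak_derivI[OF op _ _ Hl2])
  fix K :: "('e \<times> real) set" assume K: "compact K" "K \<subseteq> UNIV \<times> {0<..}"
  show "\<exists>e>0. \<exists>B. set_integrable lborel K B \<and> (AE p in lborel. p \<in> K -->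
   (\<forall>h. \<bar>h\<bar> < e --> norm ((%(x::'e, t). H x) (p + h *\<^sub>R (0, 1)) - (%(x, t). H x) p) \<le> \<bar>h\<bar> * B p))"
   by (intro exI[of _ 1] exI[of _ "%_. 0"]) (auto simp: case_prod_beta set_integrable_def)
 qed (auto simp: case_prod_beta)
qed

text \<open>The chain-rule differential of x \<mapsto> P s (X (sgn x)). The value 0 at the origin
  keeps it linear and measurable everywhere.\<close>

definition eq_deriv ::
 "(real => real^'m => real^'n) => (real^'d => real^'m) => real => real^'d => real^'d => real^'n"
 where "eq_deriv P X s x v = (if x = 0 then 0
  else dir_deriv (0, dir_deriv v (%x. X (sgn x)) x) (hom_ext P) (s, X (sgn x)))"

text \<open>The metric with a = 0 gives the size of the differential, because the derivative of X is
  tangent to the sphere. The scaling laws and the vanishing radial derivative express homogeneity of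
  degree 0.\<close>

lemma equivariant_const_regular:
 fixes P :: "real => real^'m => real^'n" and X :: "real^'d => real^'m" and s :: real
 assumes W: "warped_coordinates N g P" and X: "eigenmap k X"
 defines "H \<equiv> equivariant_map P X (%_. s)" and "DH \<equiv> eq_deriv P X s"
 shows "linear (DH x)"
  and "x \<noteq> 0 ==> (H has_derivative DH x) (at x)"
  and "x \<noteq> 0 ==> norm (DH x v) = \<bar>g s\<bar> * norm (dir_deriv v (%x. X (sgn x)) x)"
  and "H \<in> borel_measurable borel" and "(%x. DH x v) \<in> borel_measurable borel"
  and "c > 0 ==> H (c *\<^sub>R x) = H x" and "c > 0 ==> DH (c *\<^sub>R x) v = DH x v /\<^sub>R c"
  and "DH x x = 0"
  and "\<exists>M. \<forall>x. norm (H x) \<le> M"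
proof -
 let ?Y = "%x. X (sgn x)"
 have H: "H x = P s (?Y x)" for x by (simp add: H_def equivariant_map_def)
 have Ys: "?Y x \<in> sphere 0 1" if "x \<noteq> 0" for x using eigenmap_sphere[OF X sgn_sphere[OF that]] .
 have Y0: "?Y x \<noteq> 0" if "x \<noteq> 0" for x using Ys[OF that] sphere_nonzero by blast
 define D where "D x v = dir_deriv (0, dir_deriv v ?Y x) (hom_ext P) (s, ?Y x)" for x v
 have Yd: "(?Y has_derivative (%v. dir_deriv v ?Y x)) (at x)" if "x \<noteq> 0" for x
  by (rule smooth_on_has_derivative[OF eigenmap_smooth[OF X]]) (use that in auto)
 have Dd: "(H has_derivative D x) (at x)" if x: "x \<noteq> 0" for x
 proof -
  have "((%x. hom_ext P (s, ?Y x)) has_derivative D x) (at x)"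
   unfolding D_def
   by (rule has_derivative_compose[of "%x. (s, ?Y x)" "%v. (0, dir_deriv v ?Y x)" x UNIV "hom_ext P"])
    (use hom_ext_has_derivative[OF W Y0[OF x]] in \<open>auto intro!: has_derivative_Pair Yd x\<close>)
  then show ?thesis
  proof (rule has_derivative_transform_within_open[of _ _ _ _ "- {0}"])
   fix z :: "real^'d" assume "z \<in> - {0}"
   then have "sgn (?Y z) = ?Y z" by (intro sgn_on_sphere Ys) auto
   then show "hom_ext P (s, ?Y z) = H z" by (simp add: H)
  qed (use x in auto)
 qed
 have DH_def: "DH x v = (if x = 0 then 0 else D x v)" for x v
  by (simp add: assms(4) eq_deriv_def D_def)
 have DHd: "(H has_derivative DH x) (at x)" if "x \<noteq> 0" for x
  using Dd[OF that] that by (simp add: DH_def[abs_def])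
 have lin: "linear (DH x)" for x
 proof (cases "x = 0")
  case True
  then show ?thesis by (simp add: DH_def[abs_def] linear_iff)
 qed (use DHd has_derivative_linear in blast)
 have nD: "norm (DH x v) = \<bar>g s\<bar> * norm (dir_deriv v ?Y x)" if x: "x \<noteq> 0" for x v
 proof -
  have "(norm (D x v))\<^sup>2 = (g s)\<^sup>2 * (norm (dir_deriv v ?Y x))\<^sup>2"
   unfolding D_def using warped_metric[OF W Ys[OF x] eigenmap_deriv_orthogonal[OF X x], of 0] by simp
  then have "(norm (D x v))\<^sup>2 = (\<bar>g s\<bar> * norm (dir_deriv v ?Y x))\<^sup>2" by (simp add: power_mult_distrib)
  then have "norm (D x v) = \<bar>g s\<bar> * norm (dir_deriv v ?Y x)"
   by (rule power2_eq_imp_eq) auto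
  then show ?thesis using x by (simp add: DH_def)
 qed
 have Hc: "continuous_on (- {0}) H"
  using DHd has_derivative_continuous by (intro continuous_at_imp_continuous_on) blast
 have "compact ((%(s, y). P s y) ` ({s} \<times> sphere 0 1))"
  by (intro compact_continuous_image compact_Times continuous_on_subset[OF chart_continuous[OF W]]) auto
 then obtain M0 where M0: "\<And>y. y \<in> sphere 0 1 ==> norm (P s y) \<le> M0"
  using compact_imp_bounded by (fastforce simp: bounded_iff)
 define M where "M = max M0 (norm (H 0))"
 have M: "norm (H x) \<le> M" for x
  using M0[OF Ys, of x] by (cases "x = 0") (auto simp: M_def H)
 have Hm: "H \<in> borel_measurable borel"
 proof -
  have "(%x. if x \<in> - {0} then H x else H 0) \<in> borel_measurable borel"
   by (rule borel_measurable_continuous_on_if) (auto intro: Hc)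
  moreover have "(%x. if x \<in> - {0} then H x else H 0) = H" by auto
  ultimately show ?thesis by simp
 qed
 have DHm: "(%x. DH x v) \<in> borel_measurable borel" for v
 proof -
  have c1: "continuous_on (- {0}) (dir_deriv v ?Y)"
   by (rule smooth_on_continuous[OF smooth_on_dir_deriv[OF eigenmap_smooth[OF X]]])
  have c2: "continuous_on (- {0}) (%x. dir_deriv (0, b) (hom_ext P) (s, ?Y x))" for b
   by (rule continuous_on_compose2[OF smooth_on_continuous[OF smooth_on_dir_deriv[OF hom_ext_smooth[OF W]]]])
    (use Y0 in \<open>auto intro!: continuous_intros smooth_on_continuous[OF eigenmap_smooth[OF X]]\<close>)
  have e: "D x v = (\<Sum>b\<in>Basis. (dir_deriv v ?Y x \<bullet> b) *\<^sub>R dir_deriv (0, b) (hom_ext P) (s, ?Y x))" if "x \<noteq> 0" for x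
  proof -
   have l: "linear (%w. dir_deriv (0, w) (hom_ext P) (s, ?Y x))"
   proof -
    have "linear (%w. (0::real, w::real^'m))" by (auto simp: linear_iff)
    from linear_compose[OF this has_derivative_linear[OF hom_ext_has_derivative[OF W Y0[OF that]]]]
    show ?thesis by (simp add: comp_def)
   qed
   have "D x v = dir_deriv (0, \<Sum>b\<in>Basis. (dir_deriv v ?Y x \<bullet> b) *\<^sub>R b) (hom_ext P) (s, ?Y x)"
    by (simp add: D_def euclidean_representation)
   then show ?thesis by (simp only: linear_sum[OF l] linear_cmul[OF l])
  qed
  have "continuous_on (- {0}) (%x. D x v)"
  proof (subst continuous_on_cong[OF refl e])
   show "continuous_on (- {0}) (%x. \<Sum>b\<in>Basis. (dir_deriv v ?Y x \<bullet> b) *\<^sub>R dir_deriv (0, b) (hom_ext P) (s, ?Y x))"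
    by (intro continuous_intros c1 c2)
  qed auto
  then have "(%x. if x \<in> - {0} then D x v else 0) \<in> borel_measurable borel"
   by (intro borel_measurable_continuous_on_if) auto
  moreover have "(%x. if x \<in> - {0} then D x v else 0) = (%x. DH x v)" by (auto simp: DH_def)
  ultimately show ?thesis by simp
 qed
 have hom: "H (c *\<^sub>R x) = H x" if "c > 0" for c x
  using that by (simp add: H sgn_scaleR sgn_pos)
 have Dhom: "DH (c *\<^sub>R x) v = DH x v /\<^sub>R c" if c: "c > 0" for c x v
 proof (cases "x = 0")
  case False
  have "((%z. H (c *\<^sub>R z)) has_derivative (%v. DH (c *\<^sub>R x) (c *\<^sub>R v))) (at x)"
   by (rule has_derivative_compose[of "%z. c *\<^sub>R z" "%z. c *\<^sub>R z" x UNIV H])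
    (use False c in \<open>auto intro!: derivative_eq_intros DHd\<close>)
  moreover have "(%z. H (c *\<^sub>R z)) = H" using hom[OF c] by auto
  ultimately have "(%v. DH (c *\<^sub>R x) (c *\<^sub>R v)) = DH x"
   using has_derivative_unique DHd[OF False] by metis
  from fun_cong[OF this, of v] have "c *\<^sub>R DH (c *\<^sub>R x) v = DH x v"
   by (simp add: linear_cmul[OF lin])
  then show ?thesis using c by (metis less_irrefl real_vector_affinity_eq scaleR_left_imp_eq divideR_right)
 qed (simp add: DH_def)
 have rad: "DH x x = 0" for x
 proof (cases "x = 0")
  case False
  have "\<forall>\<^sub>F h::real in at 0. 0 = (H (x + h *\<^sub>R x) - H x) /\<^sub>R h"
   unfolding eventually_at
  proof (intro exI[of _ 1] conjI ballI impI)
   fix h :: real assume "h \<noteq> 0 \<and> dist h 0 < 1"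
   then have "1 + h > 0" by (simp add: abs_less_iff)
   then have "H ((1 + h) *\<^sub>R x) = H x" by (rule hom)
   then show "0 = (H (x + h *\<^sub>R x) - H x) /\<^sub>R h" by (simp add: scaleR_add_left)
  qed auto
  then have "((%h::real. (H (x + h *\<^sub>R x) - H x) /\<^sub>R h) \<longlongrightarrow> 0) (at 0)"
   by (rule Lim_transform_eventually[OF tendsto_const])
  from tendsto_unique[OF _ has_derivative_quotient[OF DHd[OF False], of x] this]
  show ?thesis by simp
 qed (simp add: DH_def)
 show "linear (DH x)" by (rule lin)
 show "(H has_derivative DH x) (at x)" if "x \<noteq> 0" by (rule DHd[OF that])
 show "norm (DH x v) = \<bar>g s\<bar> * norm (dir_deriv v ?Y x)" if "x \<noteq> 0" by (rule nD[OF that])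
 show "H \<in> borel_measurable borel" by (rule Hm)
 show "(%x. DH x v) \<in> borel_measurable borel" by (rule DHm)
 show "H (c *\<^sub>R x) = H x" if "c > 0" by (rule hom[OF that])
 show "DH (c *\<^sub>R x) v = DH x v /\<^sub>R c" if "c > 0" by (rule Dhom[OF that])
 show "DH x x = 0" by (rule rad)
 show "\<exists>M. \<forall>x. norm (H x) \<le> M" using M by blast
qed

lemma eq_deriv_bound:
 fixes P :: "real => real^'m => real^'n" and X :: "real^'d => real^'m"
 assumes W: "warped_coordinates N g P" and X: "eigenmap k X"
 obtains C where "C \<ge> 0" "\<And>x v. x \<noteq> 0 ==> norm (eq_deriv P X s x v) \<le> C * norm v / norm x"
proof -
 obtain C where C: "C \<ge> 0" "\<And>x v. x \<noteq> 0 ==> norm (dir_deriv v (%x. X (sgn x)) x) \<le> C * norm v / norm x"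
  using eigenmap_deriv_bound[OF X] by metis
 show ?thesis
 proof (rule that[of "\<bar>g s\<bar> * C"])
  show "\<bar>g s\<bar> * C \<ge> 0" using C(1) by simp
  fix x v :: "real^'d" assume x: "x \<noteq> 0"
  have "norm (eq_deriv P X s x v) = \<bar>g s\<bar> * norm (dir_deriv v (%x. X (sgn x)) x)"
   by (rule equivariant_const_regular(3)[OF W X x])
  also have "\<dots> \<le> \<bar>g s\<bar> * (C * norm v / norm x)" by (intro mult_left_mono C x) auto
  finally show "norm (eq_deriv P X s x v) \<le> \<bar>g s\<bar> * C * norm v / norm x" by (simp add: mult.assoc)
 qed
qed

section \<open>Energy and flux of a self-similar solution\<close>

text \<open>The profile lives on the whole line and is continued by the constant s beyond the light
  cone. Its derivative is set to 0 at \<rho> = 0 and \<rho> = 1, where the equation says nothing;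
  Lipschitz continuity replaces differentiability there.\<close>

definition selfsim_profile ::
 "nat => real => (real => real) => real => (real => real) => (real => real) => bool"
 where "selfsim_profile d k g s \<Psi> \<Psi>' \<longleftrightarrow>
  (\<exists>L. L-lipschitz_on UNIV \<Psi>) \<and> (\<forall>\<rho>\<ge>1. \<Psi> \<rho> = s) \<and> (\<forall>\<rho>. \<rho> \<notin> {0<..<1} --> \<Psi>' \<rho> = 0) \<and>
  (\<forall>\<rho>\<in>{0<..<1}. (\<Psi> has_real_derivative \<Psi>' \<rho>) (at \<rho>) \<and>
   (\<exists>\<Psi>''. (\<Psi>' has_real_derivative \<Psi>'') (at \<rho>) \<and>
    \<rho>\<^sup>2 * (1 - \<rho>\<^sup>2) * \<Psi>'' + \<rho> * ((real d - 1) - 2 * \<rho>\<^sup>2) * \<Psi>' \<rho>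
     - k * g (\<Psi> \<rho>) * deriv g (\<Psi> \<rho>) = 0))"

text \<open>The value s for t \<le> 0, and 0 for the two derivatives below, match the convention of
  \<open>weak_solution\<close> that the values at t = 0 are those of the initial data.\<close>

definition ss_fun :: "real => (real => real) => real \<times> real => real"
 where "ss_fun s \<Psi> = (%(r, t). if t > 0 then \<Psi> (r / t) else s)"

definition ss_r :: "(real => real) => real \<times> real => real"
 where "ss_r \<Psi>' = (%(r, t). if t > 0 then \<Psi>' (r / t) / t else 0)"

definition ss_t :: "(real => real) => real \<times> real => real"
 where "ss_t \<Psi>' = (%(r, t). if t > 0 then - (\<Psi>' (r / t) * r / t\<^sup>2) else 0)"

text \<open>The finite set S admits points where the primitive is continuous but not known to be
  differentiable; in the applications it is the crossing with the light cone.\<close>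

lemma nn_integral_FTC_Ioo:
 fixes F f :: "real => real"
 assumes ab: "a \<le> b" and S: "finite S" and c: "continuous_on {a..b} F"
  and d: "\<And>x. a < x ==> x < b ==> x \<notin> S ==> (F has_real_derivative f x) (at x)"
  and nn: "\<And>x. a < x ==> x < b ==> 0 \<le> f x"
  and [measurable]: "f \<in> borel_measurable borel"
 shows "(\<integral>\<^sup>+x\<in>{a<..<b}. ennreal (f x) \<partial>lborel) = ennreal (F b - F a)" "F a \<le> F b"
proof -
 have "(f has_integral (F b - F a)) {a..b}"
  by (rule fundamental_theorem_of_calculus_interior_strong[OF S ab _ c])
   (use d in \<open>auto simp: has_real_derivative_iff_has_vector_derivative\<close>)
 then have i: "(f has_integral (F b - F a)) {a<..<b}" by (simp add: has_integral_Icc_iff_Ioo)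
 then have "((%x. if x \<in> {a<..<b} then f x else 0) has_integral (F b - F a)) UNIV"
  by (simp only: has_integral_restrict_UNIV)
 from nn_integral_has_integral_lborel[OF _ _ this]
 have "(\<integral>\<^sup>+x. ennreal (if x \<in> {a<..<b} then f x else 0) \<partial>lborel) = ennreal (F b - F a)"
  using nn by auto
 moreover have "ennreal (if x \<in> {a<..<b} then f x else 0) = ennreal (f x) * indicator {a<..<b} x" for x
  by (auto simp: indicator_def)
 ultimately show "(\<integral>\<^sup>+x\<in>{a<..<b}. ennreal (f x) \<partial>lborel) = ennreal (F b - F a)" by simp
 show "F a \<le> F b" using has_integral_nonneg[OF i] nn by auto
qed

context
 fixes d :: nat and k s :: real and g \<Psi> \<Psi>' :: "real => real"
 assumes prof: "selfsim_profile d k g s \<Psi> \<Psi>'"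
  and gd: "\<And>x. (g has_real_derivative deriv g x) (at x)"
  and k0: "k \<ge> 0" and d3: "d \<ge> 3"
begin

lemma profile_facts:
 obtains L where "L-lipschitz_on UNIV \<Psi>" "\<And>\<rho>. \<bar>\<Psi>' \<rho>\<bar> \<le> L"
proof -
 obtain L where L: "L-lipschitz_on UNIV \<Psi>" using prof unfolding selfsim_profile_def by blast
 have "\<bar>\<Psi>' \<rho>\<bar> \<le> L" for \<rho>
 proof (cases "\<rho> \<in> {0<..<1}")
  case True
  then have "(\<Psi> has_derivative (%h. \<Psi>' \<rho> * h)) (at \<rho>)"
   using prof unfolding selfsim_profile_def has_field_derivative_def by blast
  from has_derivative_quotient[OF this, of 1]
  have "((%h. \<bar>(\<Psi> (\<rho> + h) - \<Psi> \<rho>) / h\<bar>) \<longlongrightarrow> \<bar>\<Psi>' \<rho>\<bar>) (at 0)"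
   by (intro tendsto_rabs) (simp add: divide_inverse mult.commute)
  moreover have "\<forall>\<^sub>F h in at 0. \<bar>(\<Psi> (\<rho> + h) - \<Psi> \<rho>) / h\<bar> \<le> L"
   unfolding eventually_at
  proof (intro exI[of _ 1] conjI ballI impI)
   fix h :: real assume h: "h \<noteq> 0 \<and> dist h 0 < 1"
   have "\<bar>\<Psi> (\<rho> + h) - \<Psi> \<rho>\<bar> \<le> L * \<bar>h\<bar>"
    using lipschitz_onD[OF L, of "\<rho> + h" \<rho>] by (simp add: dist_real_def)
   then show "\<bar>(\<Psi> (\<rho> + h) - \<Psi> \<rho>) / h\<bar> \<le> L" using h by (simp add: divide_le_eq)
  qed auto
  ultimately show ?thesis by (rule tendsto_upperbound) simp
 next
  case False
  then show ?thesis using prof lipschitz_on_nonneg[OF L] unfolding selfsim_profile_def by simp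
 qed
 then show ?thesis using L that by blast
qed

lemma profile_continuous: "continuous_on UNIV \<Psi>"
 using profile_facts lipschitz_on_continuous_on by metis

lemma profile_deriv_isCont:
 assumes "\<rho> \<in> {0<..<1}" shows "isCont \<Psi>' \<rho>"
 using prof assms DERIV_isCont unfolding selfsim_profile_def by blast

lemma profile_outer:
 assumes "\<rho> \<ge> 1" shows "\<Psi> \<rho> = s" "\<Psi>' \<rho> = 0"
 using prof assms unfolding selfsim_profile_def by auto

lemma profile_deriv_zero: "\<rho> \<notin> {0<..<1} ==> \<Psi>' \<rho> = 0"
 using prof unfolding selfsim_profile_def by blast

lemma profile_measurable [measurable]: "\<Psi> \<in> borel_measurable borel" "\<Psi>' \<in> borel_measurable borel"
proof -
 show "\<Psi> \<in> borel_measurable borel" using borel_measurable_continuous_onI[OF profile_continuous] .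
 have "(%x. if x \<in> {0<..<1} then \<Psi>' x else 0) \<in> borel_measurable borel"
  by (rule borel_measurable_continuous_on_if)
   (auto intro!: continuous_at_imp_continuous_on profile_deriv_isCont)
 moreover have "(%x. if x \<in> {0<..<1} then \<Psi>' x else 0) = \<Psi>'" using profile_deriv_zero by auto
 ultimately show "\<Psi>' \<in> borel_measurable borel" by simp
qed

lemma g_continuous: "continuous_on UNIV g"
 by (meson DERIV_isCont continuous_at_imp_continuous_on gd)

lemma g_measurable [measurable]: "g \<in> borel_measurable borel"
 by (rule borel_measurable_continuous_onI[OF g_continuous])

text \<open>The first integral \<open>J\<close> of the profile equation: \<open>t ^ (d - 2) * J (r / t) / (d - 2)\<close> is the
 energy at time \<open>t\<close> in the ball of radius \<open>r\<close>.\<close>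

definition J :: "real => real"
 where "J \<rho> = k * (g (\<Psi> \<rho>))\<^sup>2 * \<rho> ^ (d - 2) - \<rho> ^ d * (1 - \<rho>\<^sup>2) * (\<Psi>' \<rho>)\<^sup>2"

text \<open>Up to scaling this is the energy density: at radius r and time t the integrand of
  \<open>energy\<close> equals t^(d-3) times the value of \<open>edens\<close> at r/t.\<close>

definition edens :: "real => real"
 where "edens \<rho> = \<rho> ^ (d - 1) * (\<Psi>' \<rho>)\<^sup>2 * (1 + \<rho>\<^sup>2) + k * \<rho> ^ (d - 3) * (g (\<Psi> \<rho>))\<^sup>2"

lemma J_outer: "\<rho> \<ge> 1 ==> J \<rho> = k * (g s)\<^sup>2 * \<rho> ^ (d - 2)"
 by (simp add: J_def profile_outer)

text \<open>Inside the cone, multiplying the profile equation by 2 \<rho>^(d-2) \<Psi>' produces a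
  total derivative. Beyond the cone both sides are plain powers of \<rho>.\<close>

lemma J_deriv:
 assumes "\<rho> > 0" "\<rho> \<noteq> 1"
 shows "(J has_real_derivative real (d - 2) * edens \<rho>) (at \<rho>)"
proof -
 \<comment> \<open>Substituting d = n + 3 removes truncated subtraction from the exponents before
   any algebra is done.\<close>
 define n where "n = d - 3"
 have n: "d - 2 = n + 1" "d - 1 = n + 2" "d - 3 = n" "real d = real n + 3" "real (d - 2) = real n + 1"
  "\<And>x::real. x ^ d = x ^ (n + 3)"
 proof -
  have "d = n + 3" using d3 by (simp add: n_def)
  then show "d - 2 = n + 1" "d - 1 = n + 2" "d - 3 = n" "real d = real n + 3" "real (d - 2) = real n + 1"
   "\<And>x::real. x ^ d = x ^ (n + 3)" by simp_all
 qed
 show ?thesis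
 proof (cases "\<rho> < 1")
  case True
  then have \<rho>: "\<rho> \<in> {0<..<1}" using assms by auto
  obtain q where D1: "(\<Psi> has_real_derivative \<Psi>' \<rho>) (at \<rho>)" and D2: "(\<Psi>' has_real_derivative q) (at \<rho>)"
   and ode: "\<rho>\<^sup>2 * (1 - \<rho>\<^sup>2) * q + \<rho> * ((real d - 1) - 2 * \<rho>\<^sup>2) * \<Psi>' \<rho>
     - k * g (\<Psi> \<rho>) * deriv g (\<Psi> \<rho>) = 0"
   using prof \<rho> unfolding selfsim_profile_def by blast
  define p G G' where "p = \<Psi>' \<rho>" and "G = g (\<Psi> \<rho>)" and "G' = deriv g (\<Psi> \<rho>)"
  have D3: "((%x. g (\<Psi> x)) has_real_derivative G' * p) (at \<rho>)"
   unfolding G'_def p_def by (rule DERIV_chain2[OF gd D1])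
  have P1: "((%x. x ^ (n + 1)) has_real_derivative real (n + 1) * \<rho> ^ n) (at \<rho>)"
   and P3: "((%x. x ^ (n + 3)) has_real_derivative real (n + 3) * \<rho> ^ (n + 2)) (at \<rho>)"
   using DERIV_pow[of "n + 1" \<rho>] DERIV_pow[of "n + 3" \<rho>] by simp_all
  have P2: "((%x. 1 - x\<^sup>2) has_real_derivative - (2 * \<rho>)) (at \<rho>)"
   by (auto intro!: derivative_eq_intros)
  have Je: "J = (%x. k * (g (\<Psi> x))\<^sup>2 * x ^ (n + 1) - x ^ (n + 3) * (1 - x\<^sup>2) * (\<Psi>' x)\<^sup>2)"
   unfolding J_def[abs_def] n(1,6) ..
  have "(J has_real_derivative (k * (2 * G * (G' * p)) * \<rho> ^ (n + 1) + k * G\<^sup>2 * (real (n + 1) * \<rho> ^ n)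
   - ((real (n + 3) * \<rho> ^ (n + 2) * (1 - \<rho>\<^sup>2) - \<rho> ^ (n + 3) * (2 * \<rho>)) * p\<^sup>2 + \<rho> ^ (n + 3) * (1 - \<rho>\<^sup>2) * (2 * p * q)))) (at \<rho>)"
   unfolding Je
   by (rule DERIV_cong[OF DERIV_diff[OF DERIV_mult[OF DERIV_cmult[OF DERIV_power[OF D3, of 2], of k] P1]
     DERIV_mult[OF DERIV_mult[OF P3 P2] DERIV_power[OF D2, of 2]]]])
    (simp add: p_def G_def algebra_simps)
  moreover have "k * (2 * G * (G' * p)) * \<rho> ^ (n + 1) + k * G\<^sup>2 * (real (n + 1) * \<rho> ^ n)
   - ((real (n + 3) * \<rho> ^ (n + 2) * (1 - \<rho>\<^sup>2) - \<rho> ^ (n + 3) * (2 * \<rho>)) * p\<^sup>2 + \<rho> ^ (n + 3) * (1 - \<rho>\<^sup>2) * (2 * p * q))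
   = real (d - 2) * edens \<rho>"
  proof -
   have "k * (2 * G * (G' * p)) * \<rho> ^ (n + 1) + k * G\<^sup>2 * (real (n + 1) * \<rho> ^ n)
   - ((real (n + 3) * \<rho> ^ (n + 2) * (1 - \<rho>\<^sup>2) - \<rho> ^ (n + 3) * (2 * \<rho>)) * p\<^sup>2 + \<rho> ^ (n + 3) * (1 - \<rho>\<^sup>2) * (2 * p * q))
   - real (n + 1) * (\<rho> ^ (n + 2) * p\<^sup>2 * (1 + \<rho>\<^sup>2) + k * \<rho> ^ n * G\<^sup>2)
   = - 2 * \<rho> ^ (n + 1) * p * (\<rho>\<^sup>2 * (1 - \<rho>\<^sup>2) * q + \<rho> * ((real (n + 3) - 1) - 2 * \<rho>\<^sup>2) * p - k * G * G')"
    by (simp add: algebra_simps power2_eq_square power_add eval_nat_numeral)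
   also have "\<dots> = 0" using ode unfolding n(4) p_def[symmetric] G_def[symmetric] G'_def[symmetric] by simp
   finally show ?thesis unfolding edens_def n p_def[symmetric] G_def[symmetric] by simp
  qed
  ultimately show ?thesis by simp
 next
  case False
  then have \<rho>: "\<rho> > 1" using assms by auto
  have "((%x. k * (g s)\<^sup>2 * x ^ (d - 2)) has_real_derivative real (d - 2) * edens \<rho>) (at \<rho>)"
   using \<rho> DERIV_cmult[OF DERIV_pow[of "n + 1" \<rho>], of "k * (g s)\<^sup>2"]
   unfolding n edens_def by (simp add: profile_outer algebra_simps)
  then show ?thesis
   by (rule has_field_derivative_transform_within_open[of _ _ _ "{1<..}"]) (use \<rho> in \<open>auto simp: J_outer\<close>)
 qed
qed

text \<open>The derivative of the profile may have no limit at \<rho> = 0 and \<rho> = 1, but it is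
  bounded and comes with the factor \<rho>^d (1 - \<rho>^2), which vanishes there. Hence the energy
  has no jump across the light cone.\<close>

lemma J_isCont: "isCont J \<rho>"
proof -
 obtain L where L: "\<And>\<rho>. \<bar>\<Psi>' \<rho>\<bar> \<le> L" using profile_facts by metis
 have c1: "isCont (%\<rho>. \<rho> ^ d * (1 - \<rho>\<^sup>2) * (\<Psi>' \<rho>)\<^sup>2) \<rho>"
 proof (cases "\<rho> \<in> {0<..<1}")
  case True
  then show ?thesis by (intro continuous_intros profile_deriv_isCont)
 next
  case False
  have z: "\<rho> ^ d * (1 - \<rho>\<^sup>2) * (\<Psi>' \<rho>)\<^sup>2 = 0" using profile_deriv_zero[OF False] by simp
  show ?thesis
  proof (cases "\<rho> = 0 \<or> \<rho> = 1")
   case True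
   have "((%x. x ^ d * (1 - x\<^sup>2) * (\<Psi>' x)\<^sup>2) \<longlongrightarrow> 0) (at \<rho>)"
   proof (rule Lim_null_comparison)
    show "\<forall>\<^sub>F x in at \<rho>. norm (x ^ d * (1 - x\<^sup>2) * (\<Psi>' x)\<^sup>2) \<le> \<bar>x ^ d * (1 - x\<^sup>2)\<bar> * L\<^sup>2"
    proof (intro always_eventually allI)
     fix x
     have "(\<Psi>' x)\<^sup>2 \<le> L\<^sup>2" using power_mono[OF L[of x] abs_ge_zero, of 2] by simp
     then show "norm (x ^ d * (1 - x\<^sup>2) * (\<Psi>' x)\<^sup>2) \<le> \<bar>x ^ d * (1 - x\<^sup>2)\<bar> * L\<^sup>2"
      by (simp add: abs_mult mult_left_mono)
    qed
    have "((%x. \<bar>x ^ d * (1 - x\<^sup>2)\<bar> * L\<^sup>2) \<longlongrightarrow> \<bar>\<rho> ^ d * (1 - \<rho>\<^sup>2)\<bar> * L\<^sup>2) (at \<rho>)"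
     by (intro tendsto_intros)
    then show "((%x. \<bar>x ^ d * (1 - x\<^sup>2)\<bar> * L\<^sup>2) \<longlongrightarrow> 0) (at \<rho>)"
     using True d3 by (auto simp: power_0_left)
   qed
   then show ?thesis unfolding isCont_def z .
  next
   case F2: False
   have "((%x. x ^ d * (1 - x\<^sup>2) * (\<Psi>' x)\<^sup>2) has_real_derivative 0) (at \<rho>)"
    by (rule has_field_derivative_transform_within_open[of "%_. 0" _ _ "- {0..1}"])
     (use False F2 profile_deriv_zero in auto)
   then show ?thesis by (rule DERIV_isCont)
  qed
 qed
 have "isCont \<Psi> \<rho>" "isCont g x" for x
  using profile_continuous g_continuous by (auto simp: continuous_on_eq_continuous_at)
 then have "isCont (%\<rho>. k * (g (\<Psi> \<rho>))\<^sup>2 * \<rho> ^ (d - 2)) \<rho>"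
  by (intro continuous_intros isCont_o2[of _ \<Psi> g])
 from isCont_diff[OF this c1] show ?thesis unfolding J_def[abs_def] .
qed

lemma J_zero: "J 0 = 0"
 using d3 by (simp add: J_def power_0_left)

text \<open>The exceptional radius r = t is the light cone, and J 0 = 0 removes the contribution of
  the vertex. The sign statement lets extended nonnegative values be added as real numbers
  later.\<close>

lemma ss_energy:
 assumes t: "t > 0" and R: "R \<ge> 0"
 shows "energy d k g (ss_fun s \<Psi>) (ss_r \<Psi>') (ss_t \<Psi>') t R = ennreal (t ^ (d - 2) * J (R / t) / real (d - 2))"
  and "0 \<le> t ^ (d - 2) * J (R / t) / real (d - 2)"
proof -
 define n where "n = d - 3"
 have n: "d - 2 = n + 1" "d - 1 = n + 2" "d - 3 = n" "real d = real n + 3" "real (d - 2) = real n + 1"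
  "\<And>x::real. x ^ d = x ^ (n + 3)"
 proof -
  have "d = n + 3" using d3 by (simp add: n_def)
  then show "d - 2 = n + 1" "d - 1 = n + 2" "d - 3 = n" "real d = real n + 3" "real (d - 2) = real n + 1"
   "\<And>x::real. x ^ d = x ^ (n + 3)" by simp_all
 qed
 let ?F = "%r. t ^ (d - 2) * J (r / t) / real (d - 2)"
 let ?f = "%r. ((\<Psi>' (r / t) / t)\<^sup>2 + k / r\<^sup>2 * (g (\<Psi> (r / t)))\<^sup>2 + (- (\<Psi>' (r / t) * r / t\<^sup>2))\<^sup>2) * r ^ (d - 1)"
 have c: "continuous_on {0..R} ?F"
  by (intro continuous_at_imp_continuous_on ballI continuous_intros isCont_o2[OF _ J_isCont]) (use t d3 in auto)
 have dv: "(?F has_real_derivative ?f r) (at r)" if "0 < r" "r < R" "r \<notin> {t}" for r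
 proof -
  have \<rho>: "r / t > 0" "r / t \<noteq> 1" using that t by auto
  have "((%r. J (r / t)) has_real_derivative real (d - 2) * edens (r / t) * (1 / t)) (at r)"
   by (rule DERIV_chain2[where f=J and g="%r. r / t", OF J_deriv[OF \<rho>]]) (use t in \<open>auto intro!: derivative_eq_intros\<close>)
  then have "(?F has_real_derivative t ^ (d - 2) * (real (d - 2) * edens (r / t) * (1 / t)) / real (d - 2)) (at r)"
   by (auto intro!: derivative_eq_intros)
  moreover have "t ^ (d - 2) * (real (d - 2) * edens (r / t) * (1 / t)) / real (d - 2) = t ^ n * edens (r / t)"
   using t unfolding n by simp
  moreover have "t ^ n * edens (r / t) = ?f r"
  proof -
   define \<rho> where "\<rho> = r / t"
   have r: "r = \<rho> * t" using t by (simp add: \<rho>_def)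
   have "\<rho> > 0" using \<rho> by (simp add: \<rho>_def)
   show ?thesis using t \<open>\<rho> > 0\<close> unfolding \<rho>_def[symmetric] unfolding r n edens_def
    by (simp add: field_simps power_mult_distrib power_divide power_add eval_nat_numeral)
  qed
  ultimately show ?thesis by simp
 qed
 have m: "?f \<in> borel_measurable borel" by measurable
 have nn: "0 \<le> ?f r" if "0 < r" for r using that k0 by auto
 note F = nn_integral_FTC_Ioo[OF R _ c dv nn m, of "{t}", simplified]
 show "energy d k g (ss_fun s \<Psi>) (ss_r \<Psi>') (ss_t \<Psi>') t R = ennreal (?F R)"
  using F(1) t unfolding energy_def ss_fun_def ss_r_def ss_t_def by (simp add: J_zero)
 show "0 \<le> ?F R" using F(2) by (simp add: J_zero)
qed

lemma ss_energy_initial: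
 assumes "R \<ge> 0"
 shows "energy d k g (ss_fun s \<Psi>) (ss_r \<Psi>') (ss_t \<Psi>') 0 R = ennreal (k * (g s)\<^sup>2 * R ^ (d - 2) / real (d - 2))"
proof -
 define n where "n = d - 3"
 have n: "d - 2 = n + 1" "d - 1 = n + 2" "d - 3 = n" "real d = real n + 3" "real (d - 2) = real n + 1"
  "\<And>x::real. x ^ d = x ^ (n + 3)"
 proof -
  have "d = n + 3" using d3 by (simp add: n_def)
  then show "d - 2 = n + 1" "d - 1 = n + 2" "d - 3 = n" "real d = real n + 3" "real (d - 2) = real n + 1"
   "\<And>x::real. x ^ d = x ^ (n + 3)" by simp_all
 qed
 let ?F = "%r. k * (g s)\<^sup>2 * r ^ (d - 2) / real (d - 2)"
 let ?f = "%r. (k / r\<^sup>2 * (g s)\<^sup>2) * r ^ (d - 1)"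
 have "(\<integral>\<^sup>+r\<in>{0<..<R}. ennreal (?f r) \<partial>lborel) = ennreal (?F R - ?F 0)"
 proof (rule nn_integral_FTC_Ioo[of _ _ "{}"])
  show "continuous_on {0..R} ?F" using d3 by (intro continuous_intros) auto
  fix r :: real assume "0 < r"
  then show "(?F has_real_derivative ?f r) (at r)"
   using DERIV_cdivide[OF DERIV_cmult[OF DERIV_pow[of "n + 1" r], of "k * (g s)\<^sup>2"], of "real n + 1"]
   unfolding n by (simp add: power_add power2_eq_square add.commute)
 qed (use assms k0 in auto)
 then show ?thesis using d3 unfolding energy_def ss_fun_def ss_r_def ss_t_def by (simp add: power_0_left)
qed

text \<open>Along r = R - t the flux density is minus the t-derivative of the energy in the ball of
  radius R - t, so the energies at times 0 and T determine the flux.\<close>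

lemma ss_flux:
 assumes T: "0 < T" "T < R"
 shows "cone_flux d k g (ss_fun s \<Psi>) (ss_r \<Psi>') (ss_t \<Psi>') T R
   = ennreal (k * (g s)\<^sup>2 * R ^ (d - 2) / real (d - 2) - T ^ (d - 2) * J ((R - T) / T) / real (d - 2))"
  and "T ^ (d - 2) * J ((R - T) / T) / real (d - 2) \<le> k * (g s)\<^sup>2 * R ^ (d - 2) / real (d - 2)"
proof -
 define n where "n = d - 3"
 have n: "d - 2 = n + 1" "d - 1 = n + 2" "d - 3 = n" "real d = real n + 3" "real (d - 2) = real n + 1"
  "\<And>x::real. x ^ d = x ^ (n + 3)"
 proof -
  have "d = n + 3" using d3 by (simp add: n_def)
  then show "d - 2 = n + 1" "d - 1 = n + 2" "d - 3 = n" "real d = real n + 3" "real (d - 2) = real n + 1"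
   "\<And>x::real. x ^ d = x ^ (n + 3)" by simp_all
 qed
 \<comment> \<open>For 2 t < R the radius R - t lies outside the light cone, where J is a pure
   power. This branch extends Q continuously to t = 0, where the ratio (R - t)/t makes no
   sense.\<close>
 define Q where "Q t = (if 2 * t < R then k * (g s)\<^sup>2 * (R - t) ^ (d - 2) / real (d - 2)
   else t ^ (d - 2) * J ((R - t) / t) / real (d - 2))" for t
 have Q2: "Q t = t ^ (d - 2) * J ((R - t) / t) / real (d - 2)" if "t > 0" for t
 proof (cases "2 * t < R")
  case True
  then have "(R - t) / t \<ge> 1" using that by (simp add: le_divide_eq)
  then show ?thesis using True that by (simp add: Q_def J_outer power_divide)
 qed (simp add: Q_def)
 let ?f = "%t. ((- (\<Psi>' ((R - t) / t) * (R - t) / t\<^sup>2))\<^sup>2 + (\<Psi>' ((R - t) / t) / t)\<^sup>2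
   + k / (R - t)\<^sup>2 * (g (\<Psi> ((R - t) / t)))\<^sup>2
   - 2 * (- (\<Psi>' ((R - t) / t) * (R - t) / t\<^sup>2)) * (\<Psi>' ((R - t) / t) / t)) * (R - t) ^ (d - 1)"
 have sq: "?f t = ((- (\<Psi>' ((R - t) / t) * (R - t) / t\<^sup>2) - \<Psi>' ((R - t) / t) / t)\<^sup>2
   + k / (R - t)\<^sup>2 * (g (\<Psi> ((R - t) / t)))\<^sup>2) * (R - t) ^ (d - 1)" for t
  by (simp add: power2_diff)
 have c: "continuous_on {0..T} (%t. - Q t)"
 proof (intro continuous_at_imp_continuous_on ballI continuous_minus)
  fix t assume t: "t \<in> {0..T}"
  show "isCont Q t"
  proof (cases "2 * t < R")
   case True
   have "isCont (%t. k * (g s)\<^sup>2 * (R - t) ^ (d - 2) / real (d - 2)) t"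
    using d3 by (intro continuous_intros) auto
   moreover have "\<forall>\<^sub>F u in nhds t. Q u = k * (g s)\<^sup>2 * (R - u) ^ (d - 2) / real (d - 2)"
    using eventually_nhds_in_open[of "{..<R/2}" t] True
    by (auto elim!: eventually_mono simp: Q_def)
   ultimately show ?thesis using isCont_cong by fast
  next
   case False
   then have t0: "t > 0" using T by auto
   have "isCont (%t. t ^ (d - 2) * J ((R - t) / t) / real (d - 2)) t"
    using d3 t0 by (intro continuous_intros isCont_o2[OF _ J_isCont]) auto
   moreover have "\<forall>\<^sub>F u in nhds t. Q u = u ^ (d - 2) * J ((R - u) / u) / real (d - 2)"
    using eventually_nhds_in_open[of "{0<..}" t] t0
    by (auto elim!: eventually_mono simp: Q2)
   ultimately show ?thesis using isCont_cong by fast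
  qed
 qed
 have dv: "((%t. - Q t) has_real_derivative ?f t) (at t)" if t: "0 < t" "t < T" "t \<notin> {R / 2}" for t
 proof -
  define \<rho> where "\<rho> = (R - t) / t"
  have \<rho>: "\<rho> > 0" "\<rho> \<noteq> 1" using t T by (auto simp: \<rho>_def field_simps)
  have Rt: "R - t = \<rho> * t" "R = (1 + \<rho>) * t" using t by (auto simp: \<rho>_def field_simps)
  have "((%t. J ((R - t) / t)) has_real_derivative real (d - 2) * edens \<rho> * (- R / t\<^sup>2)) (at t)"
   unfolding \<rho>_def
   by (rule DERIV_chain2[where f=J and g="%t. (R - t) / t", OF J_deriv])
    (use t \<rho> in \<open>auto intro!: derivative_eq_intros simp: \<rho>_def[symmetric] field_simps power2_eq_square\<close>)
  note X = this
  have "((%t. - (t ^ (n + 1) * J ((R - t) / t) / real (d - 2))) has_real_derivative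
   - ((real (n + 1) * t ^ n * J ((R - t) / t) + real (d - 2) * edens \<rho> * (- R / t\<^sup>2) * t ^ (n + 1)) / real (d - 2))) (at t)"
   by (rule DERIV_cong[OF DERIV_minus[OF DERIV_cdivide[OF DERIV_mult[OF DERIV_pow[of "n + 1" t] X]]]]) simp
  then have "((%t. - (t ^ (d - 2) * J ((R - t) / t) / real (d - 2))) has_real_derivative
   - ((real (d - 2) * t ^ n * J \<rho> + t ^ (d - 2) * (real (d - 2) * edens \<rho> * (- R / t\<^sup>2))) / real (d - 2))) (at t)"
   unfolding n(1) \<rho>_def[symmetric] by (simp add: algebra_simps)
  moreover have "- ((real (d - 2) * t ^ n * J \<rho> + t ^ (d - 2) * (real (d - 2) * edens \<rho> * (- R / t\<^sup>2))) / real (d - 2))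
    = t ^ n * ((1 + \<rho>) * edens \<rho> - J \<rho>)"
  proof -
   have e: "real (d - 2) \<noteq> 0" using d3 by simp
   have "- ((real (d - 2) * t ^ n * J \<rho> + t ^ (d - 2) * (real (d - 2) * edens \<rho> * (- R / t\<^sup>2))) / real (d - 2))
    = - (t ^ n * J \<rho>) + t ^ (d - 2) * edens \<rho> * (R / t\<^sup>2)"
   proof -
    have gen: "- ((c * A * j + B * (c * D * (- R / t\<^sup>2))) / c) = - (A * j) + B * D * (R / t\<^sup>2)"
     if "c \<noteq> 0" for c A j B D :: real
    proof -
     have "c * A * j + B * (c * D * (- R / t\<^sup>2)) = c * (A * j - B * D * (R / t\<^sup>2))"
      by (simp add: algebra_simps)
     then show ?thesis using that by simp
    qed
    show ?thesis by (rule gen[OF e])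
   qed
   also have "\<dots> = t ^ n * ((1 + \<rho>) * edens \<rho> - J \<rho>)"
    using t(1) unfolding Rt(2) n by (simp add: field_simps power2_eq_square)
   finally show ?thesis .
  qed
  moreover have "t ^ n * ((1 + \<rho>) * edens \<rho> - J \<rho>) = ?f t"
  proof -
   define p G where "p = \<Psi>' \<rho>" and "G = (g (\<Psi> \<rho>))\<^sup>2"
   \<comment> \<open>The coefficient (1 + \<rho>) (1 + \<rho>^2) + \<rho> (1 - \<rho>^2) collapses
     to (1 + \<rho>)^2, the square hidden in the flux integrand.\<close>
   have "(1 + \<rho>) * edens \<rho> - J \<rho> = \<rho> ^ (n + 2) * p\<^sup>2 * (1 + \<rho>)\<^sup>2 + k * \<rho> ^ n * G"
    unfolding edens_def J_def n p_def[symmetric] G_def[symmetric]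
    by (simp add: algebra_simps power_add power2_eq_square eval_nat_numeral)
   also have "t ^ n * \<dots> = ?f t"
    using t(1) \<rho>(1) unfolding sq \<rho>_def[symmetric] p_def[symmetric] G_def[symmetric] unfolding Rt(1) n
    by (simp add: field_simps power_mult_distrib power_add eval_nat_numeral)
   finally show ?thesis .
  qed
  ultimately have "((%t. - (t ^ (d - 2) * J ((R - t) / t) / real (d - 2))) has_real_derivative ?f t) (at t)"
   by simp
  then show ?thesis
   by (rule has_field_derivative_transform_within_open[of _ _ _ "{0<..}"]) (use t in \<open>auto simp: Q2\<close>)
 qed
 have m: "?f \<in> borel_measurable borel" by measurable
 have nn: "0 \<le> ?f t" if "t < T" for t
  unfolding sq using that T k0 by auto
 note F = nn_integral_FTC_Ioo[OF less_imp_le[OF T(1)] _ c dv nn m, of "{R / 2}", simplified]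
 have Q0: "Q 0 = k * (g s)\<^sup>2 * R ^ (d - 2) / real (d - 2)" using T by (simp add: Q_def)
 show "T ^ (d - 2) * J ((R - T) / T) / real (d - 2) \<le> k * (g s)\<^sup>2 * R ^ (d - 2) / real (d - 2)"
  using F(2) Q2[OF T(1)] Q0 by simp
 have "cone_flux d k g (ss_fun s \<Psi>) (ss_r \<Psi>') (ss_t \<Psi>') T R = (\<integral>\<^sup>+t\<in>{0<..<T}. ennreal (?f t) \<partial>lborel)"
  unfolding cone_flux_def ss_fun_def ss_r_def ss_t_def
  by (rule nn_integral_cong) (auto simp: indicator_def)
 also have "\<dots> = ennreal (Q 0 - Q T)" using F(1) by simp
 finally show "cone_flux d k g (ss_fun s \<Psi>) (ss_r \<Psi>') (ss_t \<Psi>') T R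
   = ennreal (k * (g s)\<^sup>2 * R ^ (d - 2) / real (d - 2) - T ^ (d - 2) * J ((R - T) / T) / real (d - 2))"
  using Q2[OF T(1)] Q0 by simp
qed

text \<open>The formulas for energy and flux add up to the initial energy exactly, so (EI) holds
  with equality. At T = 0 the flux is an integral over the empty interval.\<close>

lemma ss_energy_inequality:
 "energy_inequality d k g (ss_fun s \<Psi>) (ss_r \<Psi>') (ss_t \<Psi>')"
 unfolding energy_inequality_def
proof (intro allI impI)
 fix T R :: real assume TR: "0 \<le> T \<and> T < R"
 show "energy d k g (ss_fun s \<Psi>) (ss_r \<Psi>') (ss_t \<Psi>') T (R - T) + cone_flux d k g (ss_fun s \<Psi>) (ss_r \<Psi>') (ss_t \<Psi>') T R
  \<le> energy d k g (ss_fun s \<Psi>) (ss_r \<Psi>') (ss_t \<Psi>') 0 R"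
 proof (cases "T = 0")
  case True
  then show ?thesis by (simp add: cone_flux_def)
 next
  case False
  then have T: "0 < T" "T < R" using TR by auto
  then show ?thesis
   using ss_energy[of T "R - T"] ss_energy_initial[of R] ss_flux[OF T]
   by (simp add: ennreal_plus[symmetric] del: ennreal_plus)
 qed
qed

end

section \<open>The profile equation in divergence form\<close>

text \<open>On a compact thickening of K the directional derivative is bounded; the mean value
  inequality along the segment from x to x + h v turns this into a bound on difference
  quotients.\<close>

lemma has_weak_deriv_C1:
 fixes u :: "'a::euclidean_space => 'b::euclidean_space"
 assumes \<Omega>: "open \<Omega>" and d: "\<And>x. x \<in> \<Omega> ==> (u has_derivative D x) (at x)"
  and c: "continuous_on \<Omega> (%x. D x v)"
  and w[measurable]: "w \<in> borel_measurable borel" and wD: "\<And>x. x \<in> \<Omega> ==> w x = D x v"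
 shows "has_weak_deriv \<Omega> v u w"
proof (rule has_weak_derivI[OF \<Omega> w])
 show "AE x in lborel. x \<in> \<Omega> --> ((%h::real. (u (x + h *\<^sub>R v) - u x) /\<^sub>R h) \<longlongrightarrow> w x) (at 0)"
  using has_derivative_quotient[OF d] wD by auto
 have uc: "continuous_on \<Omega> u"
  using d has_derivative_continuous by (intro continuous_at_imp_continuous_on) blast
 show "loc_integrable \<Omega> u"
  unfolding loc_integrable_def set_integrable_def
  using continuous_on_subset[OF uc] by (auto intro!: borel_integrable_compact)
 fix K :: "'a set" assume K: "compact K" "K \<subseteq> \<Omega>"
 obtain e0 where e0: "e0 > 0" "(\<Union>x\<in>K. cball x e0) \<subseteq> \<Omega>"
  using compact_subset_open_imp_cball_epsilon_subset[OF K(1) \<Omega> K(2)] by metis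
 define K' where "K' = {x + y |x y. x \<in> K \<and> y \<in> cball 0 e0}"
 have cK': "compact K'" unfolding K'_def by (intro compact_sums K compact_cball)
 have K': "K' \<subseteq> \<Omega>"
 proof
  fix z assume "z \<in> K'"
  then obtain x y where "z = x + y" "x \<in> K" "norm y \<le> e0" by (auto simp: K'_def)
  then have "z \<in> (\<Union>x\<in>K. cball x e0)" by (auto simp: dist_norm intro!: bexI[of _ x])
  then show "z \<in> \<Omega>" using e0(2) by blast
 qed
 have "bounded ((%x. D x v) ` K')"
  by (intro compact_imp_bounded compact_continuous_image continuous_on_subset[OF c K'] cK')
 then obtain M where M: "\<And>x. x \<in> K' ==> norm (D x v) \<le> M" by (auto simp: bounded_iff)
 show "\<exists>e>0. \<exists>B. set_integrable lborel K B \<and> (AE x in lborel. x \<in> K -->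
   (\<forall>h. \<bar>h\<bar> < e --> norm (u (x + h *\<^sub>R v) - u x) \<le> \<bar>h\<bar> * B x))"
 proof (intro exI[of _ "e0 / (norm v + 1)"] exI[of _ "%_. M"] conjI AE_I2 impI allI)
  show "e0 / (norm v + 1) > 0" using e0(1) by (simp add: add_nonneg_pos)
  show "set_integrable lborel K (%_. M)"
   unfolding set_integrable_def using K by (intro borel_integrable_compact continuous_intros)
  fix x h assume x: "x \<in> K" and h: "\<bar>h\<bar> < e0 / (norm v + 1)"
  have "\<bar>h\<bar> * norm v \<le> \<bar>h\<bar> * (norm v + 1)" by (intro mult_left_mono) auto
  also have "\<dots> < e0" using h by (simp add: less_divide_eq add_nonneg_pos)
  finally have hv: "\<bar>h\<bar> * norm v < e0" .
  have seg: "x + (\<tau> * h) *\<^sub>R v \<in> K'" if "\<tau> \<in> {0..1}" for \<tau>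
  proof -
   have "\<bar>\<tau>\<bar> * (\<bar>h\<bar> * norm v) \<le> 1 * (\<bar>h\<bar> * norm v)" using that by (intro mult_right_mono) auto
   then have "norm ((\<tau> * h) *\<^sub>R v) \<le> e0" using hv by (simp add: abs_mult mult.assoc)
   then show ?thesis unfolding K'_def using x
    by (intro CollectI exI[of _ x] exI[of _ "(\<tau> * h) *\<^sub>R v"]) auto
  qed
  have "norm (u (x + (1 * h) *\<^sub>R v) - u (x + (0 * h) *\<^sub>R v)) \<le> (\<bar>h\<bar> * M) * norm (1 - 0 :: real)"
  proof (rule differentiable_bound[of "{0..1::real}" "%\<tau>. u (x + (\<tau> * h) *\<^sub>R v)"
     "%\<tau> s. D (x + (\<tau> * h) *\<^sub>R v) ((s * h) *\<^sub>R v)"])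
   fix \<tau> :: real assume t: "\<tau> \<in> {0..1}"
   have D: "(u has_derivative D (x + (\<tau> * h) *\<^sub>R v)) (at (x + (\<tau> * h) *\<^sub>R v))"
    using d seg[OF t] K' by blast
   have "((%\<tau>. u (x + (\<tau> * h) *\<^sub>R v)) has_derivative (%s. D (x + (\<tau> * h) *\<^sub>R v) ((s * h) *\<^sub>R v))) (at \<tau>)"
    by (rule has_derivative_compose[of "%\<tau>. x + (\<tau> * h) *\<^sub>R v" "%s. (s * h) *\<^sub>R v" \<tau> UNIV u])
     (use D in \<open>auto intro!: derivative_eq_intros\<close>)
   then show "((%\<tau>. u (x + (\<tau> * h) *\<^sub>R v)) has_derivative (%s. D (x + (\<tau> * h) *\<^sub>R v) ((s * h) *\<^sub>R v))) (at \<tau> within {0..1})"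
    by (rule has_derivative_at_withinI)
   show "onorm (%s. D (x + (\<tau> * h) *\<^sub>R v) ((s * h) *\<^sub>R v)) \<le> \<bar>h\<bar> * M"
   proof (rule onorm_le)
    fix s :: real
    have "norm (D (x + (\<tau> * h) *\<^sub>R v) ((s * h) *\<^sub>R v)) = \<bar>s * h\<bar> * norm (D (x + (\<tau> * h) *\<^sub>R v) v)"
     using linear_cmul[OF has_derivative_linear[OF D], of "s * h" v] by simp
    also have "\<dots> \<le> \<bar>s * h\<bar> * M" by (intro mult_left_mono M seg t) auto
    finally show "norm (D (x + (\<tau> * h) *\<^sub>R v) ((s * h) *\<^sub>R v)) \<le> \<bar>h\<bar> * M * norm s"
     by (simp add: abs_mult mult_ac)
   qed
  qed auto
  then show "norm (u (x + h *\<^sub>R v) - u x) \<le> \<bar>h\<bar> * M" by simp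
 qed
qed

text \<open>A cutoff of class C^1 that rises from 0 on x \<le> 0 towards 1 at infinity. One
  classical derivative is all that integration by parts asks of it, and the rational formula gives
  explicit decay.\<close>

definition cutoff :: "real => real" where "cutoff x = (max 0 x)\<^sup>2 / (1 + (max 0 x)\<^sup>2)"

definition cutoff' :: "real => real" where "cutoff' x = 2 * max 0 x / (1 + (max 0 x)\<^sup>2)\<^sup>2"

lemma cutoff_nonpos: "x \<le> 0 ==> cutoff x = 0" "x \<le> 0 ==> cutoff' x = 0"
 by (auto simp: cutoff_def cutoff'_def)

lemma cutoff_bounds: "0 \<le> cutoff x" "cutoff x \<le> 1"
 by (auto simp: cutoff_def divide_le_eq add_pos_nonneg)

lemma max0_square_deriv: "((%x::real. (max 0 x)\<^sup>2) has_real_derivative 2 * max 0 x) (at x)"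
proof -
 consider "x > 0" | "x < 0" | "x = 0" by linarith
 then show ?thesis
 proof cases
  case 1
  have "((%x::real. x\<^sup>2) has_real_derivative 2 * max 0 x) (at x)"
   using 1 by (auto intro!: derivative_eq_intros)
  then show ?thesis
   by (rule has_field_derivative_transform_within_open[of _ _ _ "{0<..}"]) (use 1 in auto)
 next
  case 2
  have "((%x::real. 0) has_real_derivative 2 * max 0 x) (at x)"
   using 2 by (auto intro!: derivative_eq_intros)
  then show ?thesis
   by (rule has_field_derivative_transform_within_open[of _ _ _ "{..<0}"]) (use 2 in auto)
 next
  case 3
  have "((%h::real. (max 0 h)\<^sup>2 / h) \<longlongrightarrow> 0) (at 0)"
  proof (rule Lim_null_comparison)
   show "\<forall>\<^sub>F h::real in at 0. norm ((max 0 h)\<^sup>2 / h) \<le> \<bar>h\<bar>"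
    by (intro always_eventually allI) (auto simp: max_def power2_eq_square)
  qed (auto intro!: tendsto_eq_intros)
  then show ?thesis using 3 by (simp add: DERIV_def)
 qed
qed

lemma cutoff_deriv: "(cutoff has_real_derivative cutoff' x) (at x)"
proof -
 have p: "1 + (max 0 x)\<^sup>2 \<noteq> 0" by (smt (verit) zero_le_power2)
 have "((%x. (max 0 x)\<^sup>2 / (1 + (max 0 x)\<^sup>2)) has_real_derivative
  (2 * max 0 x * (1 + (max 0 x)\<^sup>2) - (max 0 x)\<^sup>2 * (0 + 2 * max 0 x)) / ((1 + (max 0 x)\<^sup>2) * (1 + (max 0 x)\<^sup>2))) (at x)"
  by (rule DERIV_divide[OF max0_square_deriv DERIV_add[OF DERIV_const max0_square_deriv] p])
 then show ?thesis unfolding cutoff_def[abs_def] cutoff'_def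
  by (simp add: algebra_simps power2_eq_square)
qed

lemma cutoff'_continuous: "continuous_on UNIV cutoff'"
 unfolding cutoff'_def[abs_def]
 by (intro continuous_intros) (smt (verit) zero_le_power2 zero_eq_power2)

text \<open>With x = n q (1 - q) - 1 the factor x + 1 is n q (1 - q), which multiplies the
  derivative of the cutoff in the divergence. The decay makes this term vanish as n grows.\<close>

lemma cutoff'_decay:
 assumes x: "x \<ge> 0" shows "\<bar>cutoff' x * (x + 1)\<bar> \<le> 2 / (1 + x)"
proof -
 have p: "1 + x\<^sup>2 > 0" by (smt (verit) zero_le_power2)
 have "\<bar>cutoff' x * (x + 1)\<bar> = (2 * x) * (x + 1) / (1 + x\<^sup>2)\<^sup>2"
  using x by (simp add: cutoff'_def abs_mult)
 also have "\<dots> \<le> (1 + x\<^sup>2) * (x + 1) / (1 + x\<^sup>2)\<^sup>2"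
  using x sum_squares_bound[of 1 x] by (intro divide_right_mono mult_right_mono) auto
 also have "\<dots> = (x + 1) / (1 + x\<^sup>2)" using p by (simp add: power2_eq_square[of "1 + x\<^sup>2"])
 also have "\<dots> \<le> 2 / (1 + x)"
 proof -
  have "(x + 1) * (1 + x) \<le> 2 * (1 + x\<^sup>2)"
   using sum_squares_bound[of 1 x] by (simp add: algebra_simps power2_eq_square)
  then show ?thesis using x p by (simp add: divide_le_eq le_divide_eq)
 qed
 finally show ?thesis .
qed

lemma cutoff_near_1:
 assumes x: "x \<ge> 0" shows "\<bar>cutoff x - 1\<bar> \<le> 2 / (1 + x)"
proof -
 have p: "1 + x\<^sup>2 > 0" by (smt (verit) zero_le_power2)
 have "cutoff x - 1 = - 1 / (1 + x\<^sup>2)" using x p by (simp add: cutoff_def divide_simps)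
 then have "\<bar>cutoff x - 1\<bar> = 1 / (1 + x\<^sup>2)" using p by simp
 also have "\<dots> \<le> 2 / (1 + x)"
 proof -
  have "1 + x \<le> 2 * (1 + x\<^sup>2)"
  proof -
   have "0 \<le> 2 * (x - 1 / 4)\<^sup>2" by simp
   then have "0 \<le> 2 * x\<^sup>2 - x + 1 / 8" by (simp add: power2_eq_square algebra_simps)
   then show ?thesis by (simp add: algebra_simps)
  qed
  then show ?thesis using x p by (simp add: divide_le_eq le_divide_eq)
 qed
 finally show ?thesis .
qed

context
 fixes d :: nat and k s :: real and g \<Psi> \<Psi>' :: "real => real"
 assumes prof: "selfsim_profile d k g s \<Psi> \<Psi>'"
  and gd: "\<And>x. (g has_real_derivative deriv g x) (at x)"
  and gc: "continuous_on UNIV (deriv g)"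
  and gs: "deriv g s = 0"
  and k0: "k \<ge> 0" and d3: "d \<ge> 3"
begin

lemmas pf = profile_continuous[OF prof gd k0 d3]
 profile_outer[OF prof gd k0 d3]

lemmas pmA9 [measurable] = profile_measurable[OF prof gd k0 d3]

text \<open>With q = |x|^2/t^2, the gradient of \<Psi>(|x|/t) is \<open>bh q\<close> times x/t^2,
  and its time derivative is minus \<open>bh q\<close> times |x|^2/t^3.\<close>

definition bh :: "real => real" where "bh q = \<Psi>' (sqrt q) / sqrt q"

definition kap :: "real => real" where "kap q = k * g (\<Psi> (sqrt q)) * deriv g (\<Psi> (sqrt q))"

text \<open>The profile equation in q, solved for the derivative of \<open>bh\<close>: 2 q (1 - q)
  bh' + (d - 3 q) bh = kap / q.\<close>

definition bh' :: "real => real"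
 where "bh' q = (kap q / q - (real d - 3 * q) * bh q) / (2 * q * (1 - q))"

lemma bh_deriv:
 assumes q: "0 < q" "q < 1" shows "(bh has_real_derivative bh' q) (at q)"
proof -
 define \<rho> where "\<rho> = sqrt q"
 have \<rho>: "\<rho> > 0" "\<rho> < 1" "q = \<rho>\<^sup>2" using q by (auto simp: \<rho>_def)
 then have "\<rho> \<in> {0<..<1}" by simp
 then obtain D where D: "(\<Psi>' has_real_derivative D) (at \<rho>)"
  and ode: "\<rho>\<^sup>2 * (1 - \<rho>\<^sup>2) * D + \<rho> * ((real d - 1) - 2 * \<rho>\<^sup>2) * \<Psi>' \<rho>
     - k * g (\<Psi> \<rho>) * deriv g (\<Psi> \<rho>) = 0"
  using prof unfolding selfsim_profile_def by blast
 define p K where "p = \<Psi>' \<rho>" and "K = k * g (\<Psi> \<rho>) * deriv g (\<Psi> \<rho>)"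
 have s: "(sqrt has_real_derivative inverse \<rho> / 2) (at q)"
  unfolding \<rho>_def by (rule DERIV_real_sqrt[OF q(1)])
 have s2: "((%q. \<Psi>' (sqrt q)) has_real_derivative D * (inverse \<rho> / 2)) (at q)"
  by (rule DERIV_chain2[where g=sqrt, OF _ s]) (use D in \<open>simp add: \<rho>_def\<close>)
 have "(bh has_real_derivative (D * (inverse \<rho> / 2) * \<rho> - p * (inverse \<rho> / 2)) / (\<rho> * \<rho>)) (at q)"
  using DERIV_divide[OF s2 s] \<rho>(1) unfolding bh_def[abs_def] p_def \<rho>_def by simp
 moreover have "(D * (inverse \<rho> / 2) * \<rho> - p * (inverse \<rho> / 2)) / (\<rho> * \<rho>) = bh' q"
 proof -
  have K: "K = \<rho>\<^sup>2 * (1 - \<rho>\<^sup>2) * D + \<rho> * ((real d - 1) - 2 * \<rho>\<^sup>2) * p"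
   using ode by (simp add: K_def p_def)
  have r1: "\<rho>\<^sup>2 \<noteq> 1" using q \<rho>(3) by auto
  have "bh' q = (K / \<rho>\<^sup>2 - (real d - 3 * \<rho>\<^sup>2) * (p / \<rho>)) / (2 * \<rho>\<^sup>2 * (1 - \<rho>\<^sup>2))"
   unfolding bh'_def kap_def bh_def \<rho>_def[symmetric] K_def p_def by (simp add: \<rho>(3))
  also have "\<dots> = (D * (inverse \<rho> / 2) * \<rho> - p * (inverse \<rho> / 2)) / (\<rho> * \<rho>)"
  proof -
   have e: "K / \<rho>\<^sup>2 - (real d - 3 * \<rho>\<^sup>2) * (p / \<rho>) = (1 - \<rho>\<^sup>2) * (D - p / \<rho>)"
    unfolding K using \<rho>(1) by (simp add: field_simps power2_eq_square)
   have "(1 - \<rho>\<^sup>2) * (D - p / \<rho>) / (2 * \<rho>\<^sup>2 * (1 - \<rho>\<^sup>2)) = (D - p / \<rho>) / (2 * \<rho>\<^sup>2)"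
    using r1 by simp
   also have "\<dots> = (D * (inverse \<rho> / 2) * \<rho> - p * (inverse \<rho> / 2)) / (\<rho> * \<rho>)"
    using \<rho>(1) by (simp add: field_simps power2_eq_square)
   finally show ?thesis unfolding e .
  qed
  finally show ?thesis by simp
 qed
 ultimately show ?thesis by simp
qed

lemma bh_outer: "q \<ge> 1 ==> bh q = 0"
 by (simp add: bh_def pf(3))

text \<open>Beyond the cone the profile equals s, where the derivative of g vanishes; the constant
  solves the equation there.\<close>

lemma kap_outer: "q \<ge> 1 ==> kap q = 0"
 by (simp add: kap_def pf(2) gs)

lemma kap_continuous: "continuous_on UNIV kap"
proof -
 have gcont: "continuous_on UNIV g" by (meson DERIV_isCont continuous_at_imp_continuous_on gd)
 have c: "continuous_on UNIV (%q. \<Psi> (sqrt q))"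
  by (rule continuous_on_compose2[OF pf(1)]) (auto intro!: continuous_intros)
 show ?thesis unfolding kap_def[abs_def]
  by (intro continuous_intros continuous_on_compose2[OF gcont c] continuous_on_compose2[OF gc c]) auto
qed

lemma kap_bound: obtains C where "C \<ge> 0" "\<And>q. q \<ge> 0 ==> \<bar>kap q\<bar> \<le> C"
proof -
 have "bounded (kap ` {0..1})"
  by (intro compact_imp_bounded compact_continuous_image continuous_on_subset[OF kap_continuous]) auto
 then obtain C where C: "C > 0" "\<And>q. q \<in> {0..1} ==> \<bar>kap q\<bar> \<le> C" by (auto simp: bounded_pos)
 have "\<bar>kap q\<bar> \<le> C" if "q \<ge> 0" for q
  using C(2)[of q] kap_outer[of q] C(1) that by (cases "q \<le> 1") auto
 then show ?thesis using C(1) by (intro that[of C]) auto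
qed

lemma bh_isCont: "0 < q ==> q < 1 ==> isCont bh q"
 using bh_deriv DERIV_isCont by blast

lemma bh'_isCont: "0 < q ==> q < 1 ==> isCont bh' q"
 unfolding bh'_def[abs_def] using kap_continuous
 by (intro continuous_intros bh_isCont) (auto simp: continuous_on_eq_continuous_at)

text \<open>Multiplication by a cutoff in \<open>q = \<bar>x\<bar>\<^sup>2 / t\<^sup>2\<close> removes the vertex line \<open>q = 0\<close> and the light
 cone \<open>q = 1\<close>; the factor \<open>q (1 - q)\<close> in the divergence absorbs the derivative of the cutoff.\<close>

definition B :: "nat => real => real" where "B n q = cutoff (real n * (q * (1 - q)) - 1) * bh q"

definition B' :: "nat => real => real"
 where "B' n q = cutoff' (real n * (q * (1 - q)) - 1) * (real n * (1 - 2 * q)) * bh q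
  + cutoff (real n * (q * (1 - q)) - 1) * bh' q"

lemma B_zero:
 assumes "real n * (q * (1 - q)) \<le> 1" shows "B n q = 0" "B' n q = 0"
 using assms by (auto simp: B_def B'_def cutoff_nonpos)

lemma B_outer:
 assumes "\<not> (0 < q \<and> q < 1)" shows "B n q = 0" "B' n q = 0"
proof -
 have "q * (1 - q) \<le> 0" using assms by (auto simp: mult_le_0_iff)
 then have "real n * (q * (1 - q)) \<le> 1"
  by (meson mult_nonneg_nonpos of_nat_0_le_iff order_trans zero_le_one)
 then show "B n q = 0" "B' n q = 0" by (rule B_zero)+
qed

text \<open>An open neighbourhood of q on which the truncated field vanishes identically, so that
  differentiability at q = 0 and q = 1 is trivial.\<close>

lemma eventually_B_zero:
 assumes "\<not> (0 < q \<and> q < 1)"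
 shows "open {q. real n * (q * (1 - q)) < 1}" "q \<in> {q. real n * (q * (1 - q)) < 1}"
proof -
 show "open {q. real n * (q * (1 - q)) < 1}"
  by (intro open_Collect_less continuous_intros)
 have "q * (1 - q) \<le> 0" using assms by (auto simp: mult_le_0_iff)
 then have "real n * (q * (1 - q)) \<le> 0" by (meson mult_nonneg_nonpos of_nat_0_le_iff)
 then show "q \<in> {q. real n * (q * (1 - q)) < 1}" by simp
qed

lemma B_deriv: "(B n has_real_derivative B' n q) (at q)"
proof (cases "0 < q \<and> q < 1")
 case True
 have 1: "((%q. real n * (q * (1 - q)) - 1) has_real_derivative real n * (1 - 2 * q)) (at q)"
  by (auto intro!: derivative_eq_intros simp: algebra_simps)
 have 2: "((%q. cutoff (real n * (q * (1 - q)) - 1)) has_real_derivative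
   cutoff' (real n * (q * (1 - q)) - 1) * (real n * (1 - 2 * q))) (at q)"
  by (rule DERIV_chain2[where f=cutoff, OF cutoff_deriv 1])
 show ?thesis unfolding B_def[abs_def] B'_def
  by (rule DERIV_cong[OF DERIV_mult[OF 2 bh_deriv]]) (use True in auto)
next
 case False
 have "((%_. 0) has_real_derivative B' n q) (at q)" using B_outer[OF False] by simp
 then show ?thesis
  by (rule has_field_derivative_transform_within_open[OF _ eventually_B_zero[OF False, of n]])
   (auto simp: B_zero)
qed

lemma B'_isCont: "isCont (B' n) q"
proof (cases "0 < q \<and> q < 1")
 case True
 have "isCont cutoff' x" "isCont cutoff x" for x
  using cutoff'_continuous DERIV_isCont[OF cutoff_deriv] by (auto simp: continuous_on_eq_continuous_at)
 note cc = this
 have a: "isCont (%q. real n * (q * (1 - q)) - 1) q" by (intro continuous_intros)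
 have 1: "isCont (%q. cutoff' (real n * (q * (1 - q)) - 1)) q" by (rule isCont_o2[OF a cc(1)])
 have 2: "isCont (%q. cutoff (real n * (q * (1 - q)) - 1)) q" by (rule isCont_o2[OF a cc(2)])
 have 3: "isCont (%q. real n * (1 - 2 * q)) q" by (intro continuous_intros)
 show ?thesis unfolding B'_def[abs_def]
  by (rule continuous_add[OF continuous_mult[OF continuous_mult[OF 1 3]] continuous_mult[OF 2]])
   (use True bh_isCont bh'_isCont in auto)
next
 case False
 have "((B' n) has_real_derivative 0) (at q)"
  by (rule has_field_derivative_transform_within_open[OF _ eventually_B_zero[OF False, of n], of "%_. 0"])
   (auto simp: B_zero)
 then show ?thesis by (rule DERIV_isCont)
qed

lemma B_continuous: "continuous_on UNIV (B n)" "continuous_on UNIV (B' n)"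
 using DERIV_isCont[OF B_deriv] B'_isCont by (auto simp: continuous_on_eq_continuous_at)

lemma B_measurable [measurable]: "B n \<in> borel_measurable borel" "B' n \<in> borel_measurable borel"
 using B_continuous borel_measurable_continuous_onI by auto

text \<open>The left side is t^2 times the space-time divergence of the field built from
  \<open>B n\<close>. On the right the factor n in front of the derivative of the cutoff appears
  only in the product n q (1 - q).\<close>

lemma B_divergence:
 assumes q: "0 < q" "q < 1"
 shows "2 * q * (1 - q) * B' n q + (real d - 3 * q) * B n q
  = 2 * (cutoff' (real n * (q * (1 - q)) - 1) * (real n * (q * (1 - q)))) * (1 - 2 * q) * bh q
   + cutoff (real n * (q * (1 - q)) - 1) * kap q / q"
proof -
 have "2 * q * (1 - q) * bh' q = kap q / q - (real d - 3 * q) * bh q"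
  using q by (simp add: bh'_def)
 then have "cutoff (real n * (q * (1 - q)) - 1) * (2 * q * (1 - q) * bh' q)
  = cutoff (real n * (q * (1 - q)) - 1) * (kap q / q - (real d - 3 * q) * bh q)" by simp
 then show ?thesis unfolding B_def B'_def by (simp add: algebra_simps)
qed

lemma cutoff_seq:
 assumes q: "0 < q" "q < 1"
 shows "(%n. cutoff (real n * (q * (1 - q)) - 1)) \<longlonglongrightarrow> 1"
  and "(%n. cutoff' (real n * (q * (1 - q)) - 1) * (real n * (q * (1 - q)))) \<longlonglongrightarrow> 0"
  and "\<bar>cutoff' (real n * (q * (1 - q)) - 1) * (real n * (q * (1 - q)))\<bar> \<le> 2"
proof -
 define c where "c = q * (1 - q)"
 have c: "c > 0" using q by (simp add: c_def)
 have lim: "filterlim (%n. real n * c) at_top sequentially"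
  by (intro filterlim_at_top_mult_tendsto_pos[OF tendsto_const c filterlim_real_sequentially] )
 then have ev: "\<forall>\<^sub>F n in sequentially. real n * c \<ge> 1" by (auto simp: filterlim_at_top)
 have lim0: "(%n. 2 / (real n * c)) \<longlonglongrightarrow> 0"
  by (intro tendsto_divide_0[OF tendsto_const] filterlim_at_top_imp_at_infinity lim)
 have "(%n. cutoff (real n * c - 1) - 1) \<longlonglongrightarrow> 0"
 proof (rule Lim_null_comparison[OF _ lim0])
  show "\<forall>\<^sub>F n in sequentially. norm (cutoff (real n * c - 1) - 1) \<le> 2 / (real n * c)"
   using ev
  proof eventually_elim
   case (elim n)
   then show ?case using cutoff_near_1[of "real n * c - 1"] by simp
  qed
 qed
 then show "(%n. cutoff (real n * (q * (1 - q)) - 1)) \<longlonglongrightarrow> 1" unfolding c_def by (simp add: LIM_zero_iff)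
 show "(%n. cutoff' (real n * (q * (1 - q)) - 1) * (real n * (q * (1 - q)))) \<longlonglongrightarrow> 0"
  unfolding c_def[symmetric]
 proof (rule Lim_null_comparison[OF _ lim0])
  show "\<forall>\<^sub>F n in sequentially. norm (cutoff' (real n * c - 1) * (real n * c)) \<le> 2 / (real n * c)"
   using ev
  proof eventually_elim
   case (elim n)
   then show ?case using cutoff'_decay[of "real n * c - 1"] by simp
  qed
 qed
 show "\<bar>cutoff' (real n * (q * (1 - q)) - 1) * (real n * (q * (1 - q)))\<bar> \<le> 2"
 proof (cases "real n * (q * (1 - q)) \<ge> 1")
  case True
  then have "\<bar>cutoff' (real n * (q * (1 - q)) - 1) * (real n * (q * (1 - q)))\<bar> \<le> 2 / (real n * (q * (1 - q)))"
   using cutoff'_decay[of "real n * (q * (1 - q)) - 1"] by simp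
  also have "\<dots> \<le> 2" using True by (simp add: divide_le_eq)
  finally show ?thesis .
 qed (simp add: cutoff_nonpos)
qed

text \<open>Off the vertex and the cone, the field with components bh x_i/t^2 and bh |x|^2/t^3 has
  divergence kap/|x|^2; this is the profile equation. The identity is proved for the truncated
  fields, which are of class C^1, and then n tends to infinity under a common integrable
  bound.\<close>

lemma core_identity:
 fixes \<eta> :: "'e::euclidean_space \<times> real => real"
 assumes d: "DIM('e) = d" and t: "test_fun (UNIV \<times> {0<..}) \<eta>"
 defines "Q \<equiv> (%p::'e \<times> real. (fst p \<bullet> fst p) / (snd p)\<^sup>2)"
 shows "(LBINT p. (\<Sum>i\<in>Basis. dir_deriv (i, 0) \<eta> p * (bh (Q p) * (fst p \<bullet> i) / (snd p)\<^sup>2))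
  + dir_deriv (0, 1) \<eta> p * (bh (Q p) * (fst p \<bullet> fst p) / (snd p) ^ 3)
  + \<eta> p * (kap (Q p) / (fst p \<bullet> fst p))) = 0"
proof -
 let ?\<Omega> = "UNIV \<times> {0<..} :: ('e \<times> real) set"
 have op: "open ?\<Omega>" by (intro open_Times) auto
 define U where "U n i p = B n (Q p) * ((fst p \<bullet> i) / (snd p)\<^sup>2)" for n and i :: 'e and p
 define V where "V n p = B n (Q p) * ((fst p \<bullet> fst p) / (snd p) ^ 3)" for n and p :: "'e \<times> real"
 define DQ where "DQ p v = 2 * (fst p \<bullet> fst v) / (snd p)\<^sup>2 - 2 * snd v * (fst p \<bullet> fst p) / (snd p) ^ 3" for p v :: "'e \<times> real"
 define U' where "U' n i p = B' n (Q p) * (2 * (fst p \<bullet> i) / (snd p)\<^sup>2) * ((fst p \<bullet> i) / (snd p)\<^sup>2) + B n (Q p) / (snd p)\<^sup>2" for n and i :: 'e and p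
 define V' where "V' n p = B' n (Q p) * (- 2 * (fst p \<bullet> fst p) / (snd p) ^ 3) * ((fst p \<bullet> fst p) / (snd p) ^ 3)
  - 3 * B n (Q p) * (fst p \<bullet> fst p) / (snd p) ^ 4" for n and p :: "'e \<times> real"
 have Qd: "(Q has_derivative DQ p) (at p)" if "p \<in> ?\<Omega>" for p
  unfolding Q_def DQ_def[abs_def] using that
  by (auto intro!: derivative_eq_intros ext simp: inner_commute field_simps power2_eq_square power3_eq_cube)
 have Bd: "((%p. B n (Q p)) has_derivative (%v. B' n (Q p) * DQ p v)) (at p)" if "p \<in> ?\<Omega>" for p n
  by (rule has_derivative_compose[OF Qd[OF that], of "B n" "%h. B' n (Q p) * h"])
   (use B_deriv in \<open>simp add: has_field_derivative_def\<close>)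
 have Ud: "(U n i has_derivative (%v. B n (Q p) * ((fst v \<bullet> i) / (snd p)\<^sup>2 - 2 * snd v * (fst p \<bullet> i) / (snd p) ^ 3)
   + B' n (Q p) * DQ p v * ((fst p \<bullet> i) / (snd p)\<^sup>2))) (at p)" if p: "p \<in> ?\<Omega>" for n i p
 proof -
  have "((%p. (fst p \<bullet> i) / (snd p)\<^sup>2) has_derivative (%v. (fst v \<bullet> i) / (snd p)\<^sup>2 - 2 * snd v * (fst p \<bullet> i) / (snd p) ^ 3)) (at p)"
   using p by (auto intro!: derivative_eq_intros ext simp: field_simps power2_eq_square power3_eq_cube)
  from has_derivative_mult[OF Bd[OF p] this] show ?thesis unfolding U_def[abs_def] .
 qed
 have Vd: "(V n has_derivative (%v. B n (Q p) * (2 * (fst p \<bullet> fst v) / (snd p) ^ 3 - 3 * snd v * (fst p \<bullet> fst p) / (snd p) ^ 4)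
   + B' n (Q p) * DQ p v * ((fst p \<bullet> fst p) / (snd p) ^ 3))) (at p)" if p: "p \<in> ?\<Omega>" for n p
 proof -
  have "((%p. (fst p \<bullet> fst p) / (snd p) ^ 3) has_derivative (%v. 2 * (fst p \<bullet> fst v) / (snd p) ^ 3 - 3 * snd v * (fst p \<bullet> fst p) / (snd p) ^ 4)) (at p)"
   using p by (auto intro!: derivative_eq_intros ext simp: inner_commute field_simps eval_nat_numeral)
  from has_derivative_mult[OF Bd[OF p] this] show ?thesis unfolding V_def[abs_def] .
 qed
 have Qc: "continuous_on ?\<Omega> Q" unfolding Q_def by (intro continuous_intros) auto
 have BQ: "continuous_on ?\<Omega> (%p. B n (Q p))" "continuous_on ?\<Omega> (%p. B' n (Q p))" for n
  by (rule continuous_on_compose2[OF B_continuous(1) Qc] continuous_on_compose2[OF B_continuous(2) Qc]; simp)+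
 have Qm[measurable]: "Q \<in> borel_measurable borel" unfolding Q_def borel_prod[symmetric] by measurable
 have Um: "U' n i \<in> borel_measurable borel" for n i
  unfolding U'_def[abs_def] by (intro borel_measurable_add borel_measurable_times borel_measurable_divide
    measurable_compose[OF Qm B_measurable(1)] measurable_compose[OF Qm B_measurable(2)])
   (unfold borel_prod[symmetric], measurable)
 have Vm: "V' n \<in> borel_measurable borel" for n
  unfolding V'_def[abs_def] by (intro borel_measurable_diff borel_measurable_times borel_measurable_divide
    measurable_compose[OF Qm B_measurable(1)] measurable_compose[OF Qm B_measurable(2)])
   (unfold borel_prod[symmetric], measurable)
 have wU: "has_weak_deriv ?\<Omega> (i, 0) (U n i) (U' n i)" if i: "i \<in> Basis" for n i
 proof (rule has_weak_deriv_C1[OF op Ud _ Um])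
  show "U' n i p = B n (Q p) * ((fst (i, 0::real) \<bullet> i) / (snd p)\<^sup>2 - 2 * snd (i, 0::real) * (fst p \<bullet> i) / (snd p) ^ 3)
   + B' n (Q p) * DQ p (i, 0) * ((fst p \<bullet> i) / (snd p)\<^sup>2)" for p
   using i by (simp add: U'_def DQ_def)
  show "continuous_on ?\<Omega> (%p. B n (Q p) * ((fst (i, 0::real) \<bullet> i) / (snd p)\<^sup>2 - 2 * snd (i, 0::real) * (fst p \<bullet> i) / (snd p) ^ 3)
   + B' n (Q p) * DQ p (i, 0) * ((fst p \<bullet> i) / (snd p)\<^sup>2))"
   unfolding DQ_def by (intro continuous_intros BQ) auto
 qed
 have wV: "has_weak_deriv ?\<Omega> (0, 1) (V n) (V' n)" for n
 proof (rule has_weak_deriv_C1[OF op Vd _ Vm])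
  show "V' n p = B n (Q p) * (2 * (fst p \<bullet> fst (0::'e, 1::real)) / (snd p) ^ 3 - 3 * snd (0::'e, 1::real) * (fst p \<bullet> fst p) / (snd p) ^ 4)
   + B' n (Q p) * DQ p (0, 1) * ((fst p \<bullet> fst p) / (snd p) ^ 3)" for p
   by (simp add: V'_def DQ_def)
  show "continuous_on ?\<Omega> (%p. B n (Q p) * (2 * (fst p \<bullet> fst (0::'e, 1::real)) / (snd p) ^ 3 - 3 * snd (0::'e, 1::real) * (fst p \<bullet> fst p) / (snd p) ^ 4)
   + B' n (Q p) * DQ p (0, 1) * ((fst p \<bullet> fst p) / (snd p) ^ 3))"
   unfolding DQ_def by (intro continuous_intros BQ) auto
 qed
 \<comment> \<open>Integrand of the divergence identity for the n-th truncation: the derivative of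
   \<eta> along the field plus \<eta> times the divergence. Its integral is 0.\<close>
 define T where "T n p = (\<Sum>i\<in>Basis. dir_deriv (i, 0) \<eta> p * U n i p) + dir_deriv (0, 1) \<eta> p * V n p
  + \<eta> p * ((\<Sum>i\<in>Basis. U' n i p) + V' n p)" for n p
 have I1: "integrable lborel (%p. dir_deriv (i, 0) \<eta> p * U n i p)"
  "integrable lborel (%p. \<eta> p * U' n i p)"
  "(LBINT p. dir_deriv (i, 0) \<eta> p * U n i p) = - (LBINT p. \<eta> p * U' n i p)" if "i \<in> Basis" for n i
  using wU[OF that, of n] integrable_test_scaleR[OF t, of "U' n i"]
   integrable_test_scaleR[OF test_fun_dir_deriv[OF t, of "(i, 0)"], of "U n i"] t
  unfolding has_weak_deriv_def by auto
 have I2: "integrable lborel (%p. dir_deriv (0, 1) \<eta> p * V n p)"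
  "integrable lborel (%p. \<eta> p * V' n p)"
  "(LBINT p. dir_deriv (0, 1) \<eta> p * V n p) = - (LBINT p. \<eta> p * V' n p)" for n
  using wV[of n] integrable_test_scaleR[OF t, of "V' n"]
   integrable_test_scaleR[OF test_fun_dir_deriv[OF t, of "(0, 1)"], of "V n"] t
  unfolding has_weak_deriv_def by auto
 have Te: "T n p = (\<Sum>i\<in>Basis. dir_deriv (i, 0) \<eta> p * U n i p + \<eta> p * U' n i p)
   + (dir_deriv (0, 1) \<eta> p * V n p + \<eta> p * V' n p)" for n p
  by (simp add: T_def sum.distrib sum_distrib_left algebra_simps)
 have T0: "integral\<^sup>L lborel (T n) = 0" "integrable lborel (T n)" for n
 proof -
  have "integrable lborel (%p. \<Sum>i\<in>Basis. dir_deriv (i, 0) \<eta> p * U n i p + \<eta> p * U' n i p)"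
   using I1 by (intro Bochner_Integration.integrable_sum Bochner_Integration.integrable_add) auto
  moreover have "integrable lborel (%p. dir_deriv (0, 1) \<eta> p * V n p + \<eta> p * V' n p)"
   using I2 by (intro Bochner_Integration.integrable_add) auto
  ultimately show "integrable lborel (T n)" "integral\<^sup>L lborel (T n) = 0"
   unfolding Te[abs_def] using I1 I2 by simp_all
 qed
 obtain K where K: "compact K" "K \<subseteq> ?\<Omega>" "\<And>x. x \<notin> K ==> \<eta> x = 0" "\<And>x v. x \<notin> K ==> dir_deriv v \<eta> x = 0"
  using test_funE[OF t] by metis
 have [measurable]: "K \<in> sets borel" using K(1) by (simp add: borel_compact)
 obtain M0 where M0: "\<And>x. \<bar>\<eta> x\<bar> \<le> M0" "M0 \<ge> 0" using test_fun_bounded[OF t] by metis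
 obtain C where C: "C \<ge> 0" "\<And>x v. x \<in> K ==> norm (dir_deriv v \<eta> x) \<le> C * norm v"
  by (rule smooth_on_compact_deriv_bound[OF test_fun_smooth[OF t] K(1) subset_UNIV]) blast
 define M where "M = max M0 C"
 have M: "\<bar>\<eta> p\<bar> \<le> M" "\<bar>dir_deriv v \<eta> p\<bar> \<le> M * norm v" "M \<ge> 0" for p v
 proof -
  show "\<bar>\<eta> p\<bar> \<le> M" using M0(1)[of p] by (simp add: M_def)
  show M0': "M \<ge> 0" using M0(2) by (simp add: M_def)
  show "\<bar>dir_deriv v \<eta> p\<bar> \<le> M * norm v"
  proof (cases "p \<in> K")
   case True
   have "\<bar>dir_deriv v \<eta> p\<bar> \<le> C * norm v" using C(2)[OF True] by simp
   also have "\<dots> \<le> M * norm v" by (intro mult_right_mono) (auto simp: M_def)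
   finally show ?thesis .
  qed (use K(4) M0' in auto)
 qed
 obtain \<delta> where \<delta>: "\<delta> > 0" "\<And>p. p \<in> K ==> snd p \<ge> \<delta>"
 proof (cases "K = {}")
  case False
  obtain z where "z \<in> K" "\<And>p. p \<in> K ==> snd z \<le> snd p"
   using continuous_attains_inf[OF K(1) False, of snd] continuous_on_snd[OF continuous_on_id] by metis
  then show ?thesis using K(2) by (intro that[of "snd z"]) auto
 qed (auto intro: that[of 1])
 obtain L where L: "\<And>\<rho>. \<bar>\<Psi>' \<rho>\<bar> \<le> L" using profile_facts[OF prof gd k0 d3] by metis
 have L0: "L \<ge> 0" using order_trans[OF abs_ge_zero L[of 0]] .
 obtain C2 where C2: "C2 \<ge> 0" "\<And>q. q \<ge> 0 ==> \<bar>kap q\<bar> \<le> C2" using kap_bound by metis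
 \<comment> \<open>Here b1 collects the DIM('e) + 1 first-order terms, each at most M L/\<delta>,
   and b2/|x|^2 bounds the divergence term: 4 L comes from the derivative of the cutoff, C2 from the
   nonlinearity.\<close>
 define b1 b2 where "b1 = M * L / \<delta> * (real DIM('e) + 1)" and "b2 = M * (4 * L + C2)"
 define Bd where "Bd x = b1 + b2 / (norm x)\<^sup>2" for x :: 'e
 have Bdi: "set_integrable lborel (cball 0 \<rho>) Bd" for \<rho>
 proof -
  have "set_integrable lborel (cball (0::'e) \<rho>) (%_. b1)"
   unfolding set_integrable_def by (intro borel_integrable_compact continuous_intros) auto
  then show ?thesis unfolding Bd_def using set_integrable_inverse_norm_square[where 'a='e, of \<rho> b2] d d3
   by (intro set_integral_add) auto
 qed
 define T\<^sub>0 where "T\<^sub>0 p = (\<Sum>i\<in>Basis. dir_deriv (i, 0) \<eta> p * (bh (Q p) * (fst p \<bullet> i) / (snd p)\<^sup>2))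
  + dir_deriv (0, 1) \<eta> p * (bh (Q p) * (fst p \<bullet> fst p) / (snd p) ^ 3)
  + \<eta> p * (kap (Q p) / (fst p \<bullet> fst p))" for p
 have sumU: "(\<Sum>i\<in>Basis. U' n i p) + V' n p = (2 * Q p * (1 - Q p) * B' n (Q p) + (real d - 3 * Q p) * B n (Q p)) / (snd p)\<^sup>2"
  if p: "snd p > 0" for n p
 proof -
  have "(\<Sum>i\<in>Basis. U' n i p) = (\<Sum>i\<in>Basis. B' n (Q p) * 2 / (snd p) ^ 4 * ((fst p \<bullet> i) * (fst p \<bullet> i)) + B n (Q p) / (snd p)\<^sup>2)"
   by (intro sum.cong refl) (simp add: U'_def field_simps eval_nat_numeral)
  also have "\<dots> = B' n (Q p) * 2 / (snd p) ^ 4 * (fst p \<bullet> fst p) + real d * (B n (Q p) / (snd p)\<^sup>2)"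
  proof -
   have "(\<Sum>i\<in>Basis. c * ((x \<bullet> i) * (x \<bullet> i)) + D) = c * (x \<bullet> x) + real d * D" for c D and x :: 'e
    by (simp add: sum.distrib d[symmetric] euclidean_inner[of x x] sum_distrib_left)
   then show ?thesis .
  qed
  also have "\<dots> + V' n p = (2 * Q p * (1 - Q p) * B' n (Q p) + (real d - 3 * Q p) * B n (Q p)) / (snd p)\<^sup>2"
  proof -
   have x: "fst p \<bullet> fst p = Q p * (snd p)\<^sup>2" using p by (simp add: Q_def)
   show ?thesis unfolding V'_def x using p by (simp add: field_simps eval_nat_numeral)
  qed
  finally show ?thesis .
 qed
 have facts: "Q p = (norm (fst p) / snd p)\<^sup>2" "sqrt (Q p) = norm (fst p) / snd p" "Q p > 0"
  if "fst p \<noteq> 0" "snd p > 0" for p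
  using that by (auto simp: Q_def power_divide dot_square_norm real_sqrt_divide)
 have outer: "T n p = 0" "T\<^sub>0 p = 0" if p: "fst p \<noteq> 0" "snd p > 0" and q: "Q p \<ge> 1" for n p
 proof -
  show "T n p = 0" using B_outer[of "Q p" n] q by (simp add: T_def U_def V_def U'_def V'_def)
  show "T\<^sub>0 p = 0" using bh_outer[OF q] kap_outer[OF q] by (simp add: T\<^sub>0_def)
 qed
 have Tn: "T n p = (\<Sum>i\<in>Basis. dir_deriv (i, 0) \<eta> p * (cutoff (real n * (Q p * (1 - Q p)) - 1) * bh (Q p) * ((fst p \<bullet> i) / (snd p)\<^sup>2)))
  + dir_deriv (0, 1) \<eta> p * (cutoff (real n * (Q p * (1 - Q p)) - 1) * bh (Q p) * ((fst p \<bullet> fst p) / (snd p) ^ 3))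
  + \<eta> p * ((2 * (cutoff' (real n * (Q p * (1 - Q p)) - 1) * (real n * (Q p * (1 - Q p)))) * (1 - 2 * Q p) * bh (Q p)
   + cutoff (real n * (Q p * (1 - Q p)) - 1) * kap (Q p) / Q p) / (snd p)\<^sup>2)"
  if p: "fst p \<noteq> 0" "snd p > 0" and q: "Q p < 1" for n p
  unfolding T_def sumU[OF p(2)] B_divergence[OF facts(3)[OF p] q] unfolding U_def V_def B_def by simp
 have lim: "(%n. T n p) \<longlonglongrightarrow> T\<^sub>0 p" if p: "fst p \<noteq> 0" for p
 proof (cases "snd p > 0")
  case t: True
  show ?thesis
  proof (cases "Q p < 1")
   case True
   note cs = cutoff_seq[OF facts(3)[OF p t] True]
   have "(%n. T n p) \<longlonglongrightarrow> (\<Sum>i\<in>Basis. dir_deriv (i, 0) \<eta> p * (1 * bh (Q p) * ((fst p \<bullet> i) / (snd p)\<^sup>2)))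
  + dir_deriv (0, 1) \<eta> p * (1 * bh (Q p) * ((fst p \<bullet> fst p) / (snd p) ^ 3))
  + \<eta> p * ((2 * 0 * (1 - 2 * Q p) * bh (Q p) + 1 * kap (Q p) / Q p) / (snd p)\<^sup>2)"
    unfolding Tn[OF p t True] using t facts(3)[OF p t] by (intro tendsto_intros cs) auto
   moreover have "Q p * (snd p)\<^sup>2 = fst p \<bullet> fst p"
    using t by (simp add: Q_def)
   ultimately show ?thesis by (simp add: T\<^sub>0_def)
  qed (use outer[OF p t] in auto)
 next
  case False
  then have "p \<notin> K" using K(2) by auto
  then have "T n p = 0" "T\<^sub>0 p = 0" for n using K(3,4) by (auto simp: T_def T\<^sub>0_def)
  then show ?thesis by simp
 qed
 have bound: "norm (T n p) \<le> indicator K p *\<^sub>R (%(x, t). Bd x) p" if p: "fst p \<noteq> 0" for n p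
 proof (cases "p \<in> K")
  case pK: True
  then have t: "snd p > 0" using K(2) by auto
  \<comment> \<open>From here x is the norm of the spatial point and r is the time
    coordinate.\<close>
  define x r where "x = norm (fst p)" and "r = snd p"
  have xr: "x > 0" "r > 0" "r \<ge> \<delta>" using p t \<delta>(2)[OF pK] by (auto simp: x_def r_def)
  have Bd0: "Bd (fst p) \<ge> 0" using M(3) L0 C2(1) \<delta>(1) by (simp add: Bd_def b1_def b2_def)
  show ?thesis
  proof (cases "Q p < 1")
   case True
   have Q: "Q p = (x / r)\<^sup>2" "sqrt (Q p) = x / r" using facts[OF p t] by (auto simp: x_def r_def)
   have xlr: "x < r"
   proof -
    have "(x / r)\<^sup>2 < 1\<^sup>2" using True Q by simp
    then have "x / r < 1" by (rule power2_less_imp_less) simp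
    then show ?thesis using xr by simp
   qed
   define c where "c = cutoff (real n * (Q p * (1 - Q p)) - 1)"
   define c' where "c' = cutoff' (real n * (Q p * (1 - Q p)) - 1) * (real n * (Q p * (1 - Q p)))"
   have c: "\<bar>c\<bar> \<le> 1" using cutoff_bounds by (simp add: c_def)
   have c': "\<bar>c'\<bar> \<le> 2" unfolding c'_def using cutoff_seq(3)[OF facts(3)[OF p t] True] .
   have bb: "\<bar>bh (Q p)\<bar> \<le> L * r / x"
   proof -
    have "\<bar>bh (Q p)\<bar> = \<bar>\<Psi>' (x / r)\<bar> * r / x" using xr by (simp add: bh_def Q abs_mult)
    also have "\<dots> \<le> L * r / x" using L xr by (intro divide_right_mono mult_right_mono) auto
    finally show ?thesis .
   qed
   have cb: "\<bar>c * bh (Q p)\<bar> \<le> L * r / x"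
    using mult_mono[OF c bb] by (simp add: abs_mult)
   have 1: "\<bar>dir_deriv (i, 0) \<eta> p * (c * bh (Q p) * ((fst p \<bullet> i) / r\<^sup>2))\<bar> \<le> M * L / \<delta>" if i: "i \<in> Basis" for i
   proof -
    have a: "\<bar>(fst p \<bullet> i) / r\<^sup>2\<bar> \<le> x / r\<^sup>2" using Basis_le_norm[OF i, of "fst p"] by (simp add: x_def divide_right_mono)
    have "\<bar>dir_deriv (i, 0) \<eta> p\<bar> \<le> M" using M(2)[of "(i, 0)" p] i by simp
    then have "\<bar>dir_deriv (i, 0) \<eta> p\<bar> * (\<bar>c * bh (Q p)\<bar> * \<bar>(fst p \<bullet> i) / r\<^sup>2\<bar>) \<le> M * (L * r / x * (x / r\<^sup>2))"
     using M(3) L0 xr by (intro mult_mono cb a) auto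
    also have "\<dots> = M * L / r" using xr by (simp add: power2_eq_square)
    also have "\<dots> \<le> M * L / \<delta>" using xr \<delta>(1) M(3) L0 by (intro divide_left_mono) auto
    finally show ?thesis by (simp only: abs_mult)
   qed
   have 2: "\<bar>dir_deriv (0, 1) \<eta> p * (c * bh (Q p) * ((fst p \<bullet> fst p) / r ^ 3))\<bar> \<le> M * L / \<delta>"
   proof -
    have "\<bar>dir_deriv (0, 1) \<eta> p\<bar> \<le> M" using M(2)[of "(0, 1)" p] by simp
    then have "\<bar>dir_deriv (0, 1) \<eta> p\<bar> * (\<bar>c * bh (Q p)\<bar> * \<bar>(fst p \<bullet> fst p) / r ^ 3\<bar>) \<le> M * (L * r / x * (x\<^sup>2 / r ^ 3))"
     using M(3) L0 xr by (intro mult_mono cb) (auto simp: x_def dot_square_norm)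
    also have "\<dots> = M * L / r * (x / r)" using xr by (simp add: power2_eq_square power3_eq_cube)
    also have "\<dots> \<le> M * L / r * 1" using xr xlr M(3) L0 by (intro mult_left_mono) auto
    also have "\<dots> \<le> M * L / \<delta>" using xr \<delta>(1) M(3) L0 by (simp add: divide_left_mono)
    finally show ?thesis by (simp only: abs_mult)
   qed
   have 3: "\<bar>\<eta> p * ((2 * c' * (1 - 2 * Q p) * bh (Q p) + c * kap (Q p) / Q p) / r\<^sup>2)\<bar> \<le> b2 / x\<^sup>2"
   proof -
    have Q01: "0 \<le> Q p" "Q p \<le> 1" using True facts(3)[OF p t] by auto
    have "\<bar>2 * c' * (1 - 2 * Q p) * bh (Q p)\<bar> = (2 * \<bar>c'\<bar>) * \<bar>1 - 2 * Q p\<bar> * \<bar>bh (Q p)\<bar>" by (simp add: abs_mult)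
    also have "\<dots> \<le> (2 * 2) * 1 * (L * r / x)" using Q01 c' bb by (intro mult_mono) auto
    finally have a: "\<bar>2 * c' * (1 - 2 * Q p) * bh (Q p)\<bar> \<le> 4 * (L * r / x)" by simp
    have "\<bar>c * kap (Q p) / Q p\<bar> = \<bar>c\<bar> * \<bar>kap (Q p)\<bar> / Q p" using Q01 by (simp add: abs_mult)
    also have "\<dots> \<le> 1 * C2 / Q p" using c C2(2)[OF Q01(1)] Q01 by (intro divide_right_mono mult_mono) auto
    finally have b: "\<bar>c * kap (Q p) / Q p\<bar> \<le> C2 / Q p" by simp
    have "\<bar>2 * c' * (1 - 2 * Q p) * bh (Q p) + c * kap (Q p) / Q p\<bar> \<le> 4 * (L * r / x) + C2 / Q p"
     using a b abs_triangle_ineq[of "2 * c' * (1 - 2 * Q p) * bh (Q p)" "c * kap (Q p) / Q p"] by linarith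
    then have "\<bar>\<eta> p\<bar> * (\<bar>2 * c' * (1 - 2 * Q p) * bh (Q p) + c * kap (Q p) / Q p\<bar> / r\<^sup>2) \<le> M * ((4 * (L * r / x) + C2 / Q p) / r\<^sup>2)"
     using M by (intro mult_mono divide_right_mono) auto
    also have "\<dots> = M * (4 * L / (x * r) + C2 / x\<^sup>2)"
     unfolding Q(1) using xr by (simp add: field_simps power2_eq_square)
    also have "\<dots> \<le> M * (4 * L / (x * x) + C2 / x\<^sup>2)"
     using xr xlr L0 M(3) by (intro mult_left_mono add_right_mono divide_left_mono) auto
    also have "\<dots> = b2 / x\<^sup>2" by (simp add: b2_def power2_eq_square add_divide_distrib ring_distribs)
    finally show ?thesis by (simp add: abs_mult)
   qed
   have "\<bar>T n p\<bar> \<le> (\<Sum>i\<in>(Basis::'e set). M * L / \<delta>) + M * L / \<delta> + b2 / x\<^sup>2"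
    unfolding Tn[OF p t True] c_def[symmetric] c'_def[symmetric] r_def[symmetric]
    by (intro order_trans[OF abs_triangle_ineq] add_mono order_trans[OF sum_abs] sum_mono 1 2 3)
   also have "\<dots> = Bd (fst p)" by (simp add: Bd_def b1_def x_def algebra_simps add_divide_distrib)
   finally show ?thesis using pK by (simp add: case_prod_beta)
  next
   case False
   then show ?thesis using outer(1)[OF p t] Bd0 pK by (simp add: case_prod_beta)
  qed
 next
  case False
  then have "T n p = 0" using K(3,4) by (simp add: T_def)
  then show ?thesis using False by simp
 qed
 have ae0: "AE p :: 'e \<times> real in lborel. fst p \<noteq> 0" using AE_off_cone by eventually_elim auto
 have Tm: "T n \<in> borel_measurable lborel" for n using T0(2) borel_measurable_integrable by blast
 have limAE: "AE p in lborel. (%n. T n p) \<longlonglongrightarrow> T\<^sub>0 p" using ae0 by eventually_elim (rule lim)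
 have T0m: "T\<^sub>0 \<in> borel_measurable lborel"
 proof -
  have dm[measurable]: "dir_deriv v \<eta> \<in> borel_measurable borel" "\<eta> \<in> borel_measurable borel" for v
   using test_fun_measurable[OF test_fun_dir_deriv[OF t]] test_fun_measurable[OF t] by auto
  have [measurable]: "bh \<in> borel_measurable borel" unfolding bh_def[abs_def] by measurable
  have [measurable]: "kap \<in> borel_measurable borel" by (rule borel_measurable_continuous_onI[OF kap_continuous])
  have f[measurable]: "(fst :: 'e \<times> real => 'e) \<in> borel_measurable borel" "(snd :: 'e \<times> real => real) \<in> borel_measurable borel"
   unfolding borel_prod[symmetric] by measurable
  show ?thesis unfolding T\<^sub>0_def[abs_def] by measurable
 qed
 have "(%n. integral\<^sup>L lborel (T n)) \<longlonglongrightarrow> integral\<^sup>L lborel T\<^sub>0"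
 proof (rule integral_dominated_convergence[OF T0m Tm _ limAE])
  show "integrable lborel (%p. indicator K p *\<^sub>R (%(x, t). Bd x) p)"
   using set_integrable_spacetime[OF Bdi K(1)] unfolding set_integrable_def .
  show "AE p in lborel. norm (T n p) \<le> indicator K p *\<^sub>R (%(x, t). Bd x) p" for n
   using ae0 by eventually_elim (rule bound)
 qed
 then have "integral\<^sup>L lborel T\<^sub>0 = 0" by (simp add: T0 LIMSEQ_const_iff)
 then show ?thesis unfolding T\<^sub>0_def .
qed

end

lemma has_weak_deriv_const: "has_weak_deriv \<Omega> v (%x::'a::euclidean_space. c::'b::euclidean_space) (%x. 0)"
proof -
 have "has_weak_deriv UNIV v (%x::'a. c) (%x. 0)"
 proof (rule has_weak_derivI)
  show "loc_integrable UNIV (%x::'a. c)"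
   unfolding loc_integrable_def set_integrable_def
   by (auto intro!: borel_integrable_compact continuous_intros)
 qed (auto simp: set_integrable_def intro!: exI[of _ 1] exI[of _ "%_. 0"])
 then show ?thesis using has_weak_deriv_mono by blast
qed

section \<open>Self-similar weak solutions\<close>

lemma continuous_AE_eq:
 fixes f h :: "'a::euclidean_space => 'b::euclidean_space"
 assumes "open S" "continuous_on S f" "continuous_on S h"
  and ae: "AE x in lborel. x \<in> S --> f x = h x" and x: "x \<in> S"
 shows "f x = h x"
proof -
 define V where "V = S \<inter> (%x. f x - h x) -` (- {0})"
 have V: "open V" unfolding V_def
  by (rule continuous_open_preimage[OF _ assms(1)]) (auto intro!: continuous_intros assms(2,3))
 have "{x \<in> space lborel. \<not> (x \<in> S --> f x = h x)} = V" by (auto simp: V_def)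
 then have "V \<in> null_sets lborel"
  using ae V by (subst (asm) AE_iff_null) auto
 then have "negligible V" by (simp add: negligible_iff_null_sets null_sets_completionI)
 then have "V = {}" using open_not_negligible[OF V] by auto
 then show ?thesis using x by (auto simp: V_def)
qed

lemma pair_measurable [measurable]:
 "(fst :: 'a::euclidean_space \<times> 'b::euclidean_space => 'a) \<in> borel_measurable borel"
 "(snd :: 'a::euclidean_space \<times> 'b::euclidean_space => 'b) \<in> borel_measurable borel"
 unfolding borel_prod[symmetric] by measurable

context
 fixes d :: nat and k s :: real and g \<Psi> \<Psi>' :: "real => real"
 assumes prof: "selfsim_profile d k g s \<Psi> \<Psi>'"
  and gd: "\<And>x. (g has_real_derivative deriv g x) (at x)"
  and gc: "continuous_on UNIV (deriv g)"
  and gs: "deriv g s = 0"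
  and k0: "k \<ge> 0" and d3: "d \<ge> 3"
begin

lemmas pmA10 [measurable] = profile_measurable[OF prof gd k0 d3]

text \<open>At y = 0 the quotient is 0, so the family is linear at every point, including those
  where the radial profile has no derivative.\<close>

definition Frad' :: "'e::euclidean_space => 'e => real"
 where "Frad' y v = \<Psi>' (norm y) * (y \<bullet> v) / norm y"

lemma radial_profile:
 obtains L where "L-lipschitz_on UNIV (%y::'e::euclidean_space. \<Psi> (norm y))"
  "\<And>y::'e. y \<noteq> 0 ==> norm y \<noteq> 1 ==> ((%y. \<Psi> (norm y)) has_derivative Frad' y) (at y)"
  "\<And>y::'e. linear (Frad' y)"
  "\<And>b::'e. (%y. Frad' y b) \<in> borel_measurable borel"
proof -
 obtain L where L: "L-lipschitz_on UNIV \<Psi>" using profile_facts[OF prof gd k0 d3] by metis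
 have L0: "L \<ge> 0" using lipschitz_on_nonneg[OF L] .
 show ?thesis
 proof (rule that[of L])
  show "L-lipschitz_on UNIV (%y::'e. \<Psi> (norm y))"
  proof (rule lipschitz_onI[OF _ L0])
   fix x y :: 'e
   have "dist (\<Psi> (norm x)) (\<Psi> (norm y)) \<le> L * dist (norm x) (norm y)"
    using lipschitz_onD[OF L] by simp
   also have "\<dots> \<le> L * dist x y"
    by (intro mult_left_mono L0) (simp add: dist_norm norm_triangle_ineq3)
   finally show "dist (\<Psi> (norm x)) (\<Psi> (norm y)) \<le> L * dist x y" .
  qed
  show "linear (Frad' y)" for y :: 'e
   by (auto simp: linear_iff Frad'_def inner_add_right ring_distribs add_divide_distrib)
  show "(%y. Frad' y b) \<in> borel_measurable borel" for b :: 'e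
   unfolding Frad'_def by measurable
  fix y :: 'e assume y: "y \<noteq> 0" "norm y \<noteq> 1"
  show "((%y. \<Psi> (norm y)) has_derivative Frad' y) (at y)"
  proof (cases "norm y < 1")
   case True
   then have "(\<Psi> has_real_derivative \<Psi>' (norm y)) (at (norm y))"
    using prof y unfolding selfsim_profile_def by auto
   then have 1: "(\<Psi> has_derivative (%h. \<Psi>' (norm y) * h)) (at (norm y))"
    by (simp add: has_field_derivative_def)
   have 2: "(norm has_derivative (%h. h \<bullet> sgn y)) (at y)" using has_derivative_norm[OF y(1)] .
   have "((%y. \<Psi> (norm y)) has_derivative (%h. \<Psi>' (norm y) * (h \<bullet> sgn y))) (at y)"
    by (rule has_derivative_compose[OF 2 1])
   moreover have "(%h. \<Psi>' (norm y) * (h \<bullet> sgn y)) = Frad' y"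
    by (auto simp: Frad'_def sgn_div_norm inner_commute divide_inverse)
   ultimately show ?thesis by simp
  next
   case False
   then have "norm y > 1" using y by simp
   have "((%_. s) has_derivative Frad' y) (at y)"
    using profile_outer[OF prof gd k0 d3, of "norm y"] \<open>norm y > 1\<close> by (simp add: Frad'_def[abs_def])
   then show ?thesis
    by (rule has_derivative_transform_within_open[of _ _ _ _ "- cball 0 1"])
     (use \<open>norm y > 1\<close> profile_outer[OF prof gd k0 d3] in auto)
  qed
 qed
qed

lemma ss_measurable:
 "ss_fun s \<Psi> \<in> borel_measurable borel" "ss_r \<Psi>' \<in> borel_measurable borel" "ss_t \<Psi>' \<in> borel_measurable borel"
proof -
 have "(%p::real\<times>real. if snd p > 0 then \<Psi> (fst p / snd p) else s) \<in> borel_measurable borel"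
  "(%p::real\<times>real. if snd p > 0 then \<Psi>' (fst p / snd p) / snd p else 0) \<in> borel_measurable borel"
  "(%p::real\<times>real. if snd p > 0 then - (\<Psi>' (fst p / snd p) * fst p / (snd p)\<^sup>2) else 0) \<in> borel_measurable borel"
  by measurable
 then show "ss_fun s \<Psi> \<in> borel_measurable borel" "ss_r \<Psi>' \<in> borel_measurable borel" "ss_t \<Psi>' \<in> borel_measurable borel"
  unfolding ss_fun_def ss_r_def ss_t_def by (simp_all add: case_prod_beta')
qed

text \<open>The one-dimensional instance of the radial case, restricted to the quadrant r, t >
  0.\<close>

lemma ss_weak_deriv:
 "has_weak_deriv ({0<..} \<times> {0<..}) (1, 0) (ss_fun s \<Psi>) (ss_r \<Psi>')"
 "has_weak_deriv ({0<..} \<times> {0<..}) (0, 1) (ss_fun s \<Psi>) (ss_t \<Psi>')"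
proof -
 obtain L where L: "L-lipschitz_on UNIV (%y::real. \<Psi> (norm y))"
  "\<And>y::real. y \<noteq> 0 ==> norm y \<noteq> 1 ==> ((%y. \<Psi> (norm y)) has_derivative Frad' y) (at y)"
  "\<And>y::real. linear (Frad' y)"
  "\<And>b::real. (%y. Frad' y b) \<in> borel_measurable borel"
  using radial_profile[where 'e=real] by metis
 have w1: "has_weak_deriv ({0<..} \<times> {0<..}) (1, 0) (%(x, t). \<Psi> (norm (x /\<^sub>R t))) (%(x::real, t). Frad' (x /\<^sub>R t) (1 /\<^sub>R t))"
  by (rule has_weak_deriv_mono[OF has_weak_deriv_selfsimilar(1)[OF L]]) auto
 have w2: "has_weak_deriv ({0<..} \<times> {0<..}) (0, 1) (%(x, t). \<Psi> (norm (x /\<^sub>R t))) (%(x::real, t). Frad' (x /\<^sub>R t) (- (x /\<^sub>R t\<^sup>2)))"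
  by (rule has_weak_deriv_mono[OF has_weak_deriv_selfsimilar(2)[OF L]]) auto
 show "has_weak_deriv ({0<..} \<times> {0<..}) (1, 0) (ss_fun s \<Psi>) (ss_r \<Psi>')"
  by (rule has_weak_deriv_cong_AE[OF w1 ss_measurable(1,2)])
   (rule AE_I2, auto simp: ss_fun_def ss_r_def Frad'_def divide_simps)+
 show "has_weak_deriv ({0<..} \<times> {0<..}) (0, 1) (ss_fun s \<Psi>) (ss_t \<Psi>')"
  by (rule has_weak_deriv_cong_AE[OF w2 ss_measurable(1,3)])
   (rule AE_I2, auto simp: ss_fun_def ss_t_def Frad'_def divide_simps power2_eq_square)+
qed

end

text \<open>From each second derivative of the test function one derivative is moved onto
  \<Psi>(|x|/t) by means of its weak first derivatives; what remains is
  \<open>core_identity\<close>.\<close>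

lemma ss_ewm:
 fixes D :: "'d::finite itself"
 assumes prof: "selfsim_profile CARD('d) k g s \<Psi> \<Psi>'"
  and gd: "\<And>x. (g has_real_derivative deriv g x) (at x)"
  and gc: "continuous_on UNIV (deriv g)"
  and gs: "deriv g s = 0"
  and k0: "k \<ge> 0" and d3: "CARD('d) \<ge> 3"
 shows "ewm_distributional D k g (ss_fun s \<Psi>)"
proof -
 let ?\<Omega> = "UNIV \<times> {0<..} :: ((real^'d) \<times> real) set"
 let ?A = "%(x::real^'d, t). ss_fun s \<Psi> (norm x, t)"
 let ?N = "%(x::real^'d, t). k / (norm x)\<^sup>2 * g (ss_fun s \<Psi> (norm x, t)) * deriv g (ss_fun s \<Psi> (norm x, t))"
 have DIM: "DIM(real^'d) = CARD('d)" by simp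
 note kap = kap_def[OF prof gd gc gs k0 d3] and bh = bh_def[OF prof gd gc gs k0 d3]
  and Frad' = Frad'_def[OF prof gd gc gs k0 d3]
 let ?bh = "Submission.bh \<Psi>'" and ?kap = "Submission.kap k g \<Psi>" and ?F' = "Submission.Frad' \<Psi>' :: real^'d => _"
 obtain L where L: "L-lipschitz_on UNIV (%y::real^'d. \<Psi> (norm y))"
  "\<And>y::real^'d. y \<noteq> 0 ==> norm y \<noteq> 1 ==> ((%y. \<Psi> (norm y)) has_derivative ?F' y) (at y)"
  "\<And>y::real^'d. linear (?F' y)"
  "\<And>b::real^'d. (%y. ?F' y b) \<in> borel_measurable borel"
  using radial_profile[OF prof gd gc gs k0 d3, where 'e="real^'d"] by metis
 have ssm: "ss_fun s \<Psi> \<in> borel_measurable borel" using ss_measurable[OF prof gd gc gs k0 d3] by simp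
 have gcont: "continuous_on UNIV g" by (meson DERIV_isCont continuous_at_imp_continuous_on gd)
 have [measurable]: "g \<in> borel_measurable borel" "deriv g \<in> borel_measurable borel"
  using borel_measurable_continuous_onI gcont gc by auto
 have nm: "(%p::(real^'d) \<times> real. (norm (fst p), snd p)) \<in> borel_measurable borel"
  unfolding borel_prod[symmetric] by measurable
 have Am': "(%p::(real^'d) \<times> real. ss_fun s \<Psi> (norm (fst p), snd p)) \<in> borel_measurable borel"
  by (rule measurable_compose[OF nm ssm])
 have Am: "?A \<in> borel_measurable borel" using Am' by (simp add: case_prod_beta')
 have Nm: "?N \<in> borel_measurable borel"
 proof -
  have "(%p::(real^'d) \<times> real. k / (norm (fst p))\<^sup>2 * g (ss_fun s \<Psi> (norm (fst p), snd p)) * deriv g (ss_fun s \<Psi> (norm (fst p), snd p))) \<in> borel_measurable borel"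
   using Am' by measurable
  then show ?thesis by (simp add: case_prod_beta')
 qed
 have wd1: "has_weak_deriv ?\<Omega> (i, 0) (%(x, t). \<Psi> (norm (x /\<^sub>R t))) (%(x, t). ?F' (x /\<^sub>R t) (i /\<^sub>R t))" for i
  by (rule has_weak_deriv_selfsimilar(1)[OF L])
 have wd2: "has_weak_deriv ?\<Omega> (0, 1) (%(x, t). \<Psi> (norm (x /\<^sub>R t))) (%(x, t). ?F' (x /\<^sub>R t) (- (x /\<^sub>R t\<^sup>2)))"
  by (rule has_weak_deriv_selfsimilar(2)[OF L])
 have Ali: "loc_integrable ?\<Omega> ?A"
 proof (rule loc_integrable_cong_AE[OF _ Am])
  show "loc_integrable ?\<Omega> (%(x::real^'d, t). \<Psi> (norm (x /\<^sub>R t)))"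
   using wd2 unfolding has_weak_deriv_def by blast
 qed (auto simp: ss_fun_def divide_inverse mult.commute)
 obtain C2 where C2: "C2 \<ge> 0" "\<And>q. q \<ge> 0 ==> \<bar>?kap q\<bar> \<le> C2" using kap_bound[OF prof gd gc gs k0 d3] by metis
 have kapN: "?N (x, t) = ?kap ((x \<bullet> x) / t\<^sup>2) / (x \<bullet> x)" if "t > 0" for x :: "real^'d" and t
  using that by (simp add: kap ss_fun_def real_sqrt_divide norm_eq_sqrt_inner[symmetric] dot_square_norm)
 have Nli: "loc_integrable ?\<Omega> ?N"
 proof (rule loc_integrable_spacetime[OF Nm, where B="%x. C2 / (norm x)\<^sup>2"])
  show "set_integrable lborel (cball (0::real^'d) \<rho>) (%x. C2 / (norm x)\<^sup>2)" for \<rho>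
   by (rule set_integrable_inverse_norm_square) (use d3 in simp)
  fix x :: "real^'d" and t :: real assume "x \<noteq> 0" "t > 0"
  then show "norm (?N (x, t)) \<le> C2 / (norm x)\<^sup>2"
   unfolding kapN[OF \<open>t > 0\<close>] using C2(2)[of "(x \<bullet> x) / t\<^sup>2"] by (simp add: dot_square_norm divide_right_mono)
 qed
 show ?thesis unfolding ewm_distributional_def
 proof (intro conjI Ali Nli allI impI)
  fix \<eta> :: "(real^'d) \<times> real => real" assume t: "test_fun ?\<Omega> \<eta>"
  obtain K where K: "K \<subseteq> ?\<Omega>" "\<And>x. x \<notin> K ==> \<eta> x = 0" "\<And>x v. x \<notin> K ==> dir_deriv v \<eta> x = 0"
   using test_funE[OF t] by metis
  \<comment> \<open>The formulas for the weak derivatives are meaningful only for t > 0; for t \<le>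
    0 the test function kills every term.\<close>
  have z: "\<eta> p = 0" "dir_deriv v \<eta> p = 0" "dir_deriv v (dir_deriv w \<eta>) p = 0" if "\<not> snd p > 0" for p v w
  proof -
   have "p \<notin> K" using that K(1) by auto
   then show "\<eta> p = 0" "dir_deriv v \<eta> p = 0" using K by auto
   obtain K' where "K' \<subseteq> ?\<Omega>" "\<And>x v. x \<notin> K' ==> dir_deriv v (dir_deriv w \<eta>) x = 0"
    using test_funE[OF test_fun_dir_deriv[OF t, of w]] by metis
   moreover have "p \<notin> K'" using that calculation(1) by auto
   ultimately show "dir_deriv v (dir_deriv w \<eta>) p = 0" by metis
  qed
  define Q where "Q p = (fst p \<bullet> fst p) / (snd p)\<^sup>2" for p :: "(real^'d) \<times> real"
  define a where "a i p = dir_deriv (i, 0) \<eta> p * (?bh (Q p) * (fst p \<bullet> i) / (snd p)\<^sup>2)" for i p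
  define b where "b p = dir_deriv (0, 1) \<eta> p * (?bh (Q p) * (fst p \<bullet> fst p) / (snd p) ^ 3)" for p
  define c where "c p = \<eta> p * (?kap (Q p) / (fst p \<bullet> fst p))" for p
  have core: "(LBINT p. (\<Sum>i\<in>Basis. a i p) + b p + c p) = 0"
   unfolding a_def b_def c_def Q_def
   by (rule core_identity[OF prof gd gc gs k0 d3 DIM t])
  have bhQ: "?bh (Q p) = \<Psi>' (norm (fst p) / snd p) * snd p / norm (fst p)" if "snd p > 0" for p
   using that by (simp add: bh Q_def real_sqrt_divide norm_eq_sqrt_inner[symmetric])
  have e1: "dir_deriv (i, 0) \<eta> p *\<^sub>R (%(x, t). ?F' (x /\<^sub>R t) (i /\<^sub>R t)) p = a i p" for i p
  proof (cases "snd p > 0")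
   case True
   then show ?thesis
    by (simp add: a_def bhQ case_prod_beta Frad' field_simps power2_eq_square)
  qed (simp add: a_def z)
  have e2: "dir_deriv (0, 1) \<eta> p *\<^sub>R (%(x, t). ?F' (x /\<^sub>R t) (- (x /\<^sub>R t\<^sup>2))) p = - b p" for p
  proof (cases "snd p > 0")
   case True
   then show ?thesis
    by (simp add: b_def bhQ case_prod_beta Frad' field_simps power2_eq_square power3_eq_cube)
  qed (simp add: b_def z)
  have e3: "dir_deriv v (dir_deriv w \<eta>) p *\<^sub>R (%(x, t). \<Psi> (norm (x /\<^sub>R t))) p = ?A p * dir_deriv v (dir_deriv w \<eta>) p" for v w p
   by (cases "snd p > 0") (auto simp: z case_prod_beta ss_fun_def divide_inverse mult.commute)
  have e4: "\<eta> p *\<^sub>R ?N p = c p" for p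
   using kapN[of "snd p" "fst p"] by (cases "snd p > 0") (auto simp: z c_def Q_def case_prod_beta)
  have i3: "integrable lborel (%p. ?A p * dir_deriv v (dir_deriv v \<eta>) p)" for v
   using integrable_test_scaleR[OF test_fun_dir_deriv[OF test_fun_dir_deriv[OF t]] Ali, of v v]
   by (simp add: mult.commute)
  have i4: "integrable lborel c" using integrable_test_scaleR[OF t Nli] unfolding e4 .
  have i1: "integrable lborel (a i)" for i
   using integrable_test_scaleR[OF test_fun_dir_deriv[OF t], of "%(x, t). ?F' (x /\<^sub>R t) (i /\<^sub>R t)" "(i, 0)"] wd1[of i]
   unfolding has_weak_deriv_def e1 by simp
  have i2: "integrable lborel b"
   using integrable_test_scaleR[OF test_fun_dir_deriv[OF t], of "%(x, t). ?F' (x /\<^sub>R t) (- (x /\<^sub>R t\<^sup>2))" "(0, 1)"] wd2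
   unfolding has_weak_deriv_def e2 by simp
  have w1: "(LBINT p. ?A p * dir_deriv (i, 0) (dir_deriv (i, 0) \<eta>) p) = - integral\<^sup>L lborel (a i)" for i
   using wd1[of i] test_fun_dir_deriv[OF t, of "(i, 0)"] unfolding has_weak_deriv_def e1[symmetric] e3[symmetric] by blast
  have w2: "(LBINT p. ?A p * dir_deriv (0, 1) (dir_deriv (0, 1) \<eta>) p) = integral\<^sup>L lborel b"
  proof -
   have "(LBINT p. ?A p * dir_deriv (0, 1) (dir_deriv (0, 1) \<eta>) p) = - (LBINT p. - b p)"
    using wd2 test_fun_dir_deriv[OF t, of "(0, 1)"] unfolding has_weak_deriv_def e2[symmetric] e3[symmetric] by blast
   then show ?thesis by simp
  qed
  have "(LBINT p. ?A p * (dir_deriv (0, 1) (dir_deriv (0, 1) \<eta>) p - (\<Sum>i\<in>Basis. dir_deriv (i, 0) (dir_deriv (i, 0) \<eta>) p)) + ?N p * \<eta> p)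
   = (LBINT p. ?A p * dir_deriv (0, 1) (dir_deriv (0, 1) \<eta>) p - (\<Sum>i\<in>Basis. ?A p * dir_deriv (i, 0) (dir_deriv (i, 0) \<eta>) p) + c p)"
   unfolding e4[symmetric] by (intro Bochner_Integration.integral_cong refl) (simp add: algebra_simps sum_distrib_left)
  also have "\<dots> = integral\<^sup>L lborel b - (\<Sum>i\<in>Basis. - integral\<^sup>L lborel (a i)) + integral\<^sup>L lborel c"
   using i3 i4 by (simp add: w1 w2 Bochner_Integration.integral_sum)
  also have "\<dots> = (LBINT p. (\<Sum>i\<in>Basis. a i p) + b p + c p)"
   using i1 i2 i4 by (simp add: Bochner_Integration.integral_sum sum_negf)
  also have "\<dots> = 0" by (rule core)
  finally show "(LBINT (x, t). ss_fun s \<Psi> (norm x, t) * (dir_deriv (0, 1) (dir_deriv (0, 1) \<eta>) (x, t)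
          - (\<Sum>i\<in>Basis. dir_deriv (i, 0) (dir_deriv (i, 0) \<eta>) (x, t)))
       + k / (norm x)\<^sup>2 * g (ss_fun s \<Psi> (norm x, t)) * deriv g (ss_fun s \<Psi> (norm x, t)) * \<eta> (x, t)) = 0"
   by (simp add: case_prod_beta')
 qed
qed

lemma smooth_real_derivs:
 fixes g :: "real => real"
 assumes "smooth_on UNIV g"
 shows "(g has_real_derivative deriv g x) (at x)" "continuous_on UNIV (deriv g)"
proof -
 have d: "(g has_real_derivative dir_deriv 1 g x) (at x)" for x
 proof -
  have h: "(g has_derivative (%v. dir_deriv v g x)) (at x)"
   by (rule smooth_on_has_derivative[OF assms]) simp
  have e1: "dir_deriv v g x = dir_deriv 1 g x * v" for v
   using linear_cmul[OF has_derivative_linear[OF h], of v 1] by (simp add: mult.commute)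
  have "(%v. dir_deriv v g x) = (*) (dir_deriv 1 g x)" by (rule ext, rule e1)
  then show ?thesis using h by (simp add: has_field_derivative_def)
 qed
 then have e: "deriv g = dir_deriv 1 g" using DERIV_imp_deriv by blast
 show "(g has_real_derivative deriv g x) (at x)" unfolding e by (rule d)
 show "continuous_on UNIV (deriv g)"
  unfolding e by (rule smooth_on_continuous[OF smooth_on_dir_deriv[OF assms]])
qed

lemma ss_weak_solution:
 fixes P :: "real => real^'m => real^'n" and X :: "real^'d => real^'m"
 assumes prof: "selfsim_profile CARD('d) k g s \<Psi> \<Psi>'"
  and gd: "\<And>x. (g has_real_derivative deriv g x) (at x)"
  and gc: "continuous_on UNIV (deriv g)"
  and gs: "deriv g s = 0"
  and k0: "k \<ge> 0" and d3: "CARD('d) \<ge> 3"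
  and reg: "has_energy_regularity (%(x, t). equivariant_map P X (%r. ss_fun s \<Psi> (r, t)) x) Du ut"
   "attains_data (%(x, t). equivariant_map P X (%r. ss_fun s \<Psi> (r, t)) x) Du ut
    (equivariant_map P X (%r. s)) (%x. 0)"
 shows "weak_solution P X k g (%r. s) (%r. 0) (ss_fun s \<Psi>) (ss_r \<Psi>') (ss_t \<Psi>')"
proof -
 have "ss_r \<Psi>' (r, 0) = 0" "ss_t \<Psi>' (r, 0) = 0" "ss_fun s \<Psi> (r, 0) = s" for r
  by (auto simp: ss_r_def ss_t_def ss_fun_def)
 then show ?thesis
  unfolding weak_solution_def
  using ss_measurable[OF prof gd gc gs k0 d3] ss_weak_deriv[OF prof gd gc gs k0 d3]
   ss_ewm[OF prof gd gc gs k0 d3] has_weak_deriv_const[of "{0<..}" 1 s] reg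
  by (intro conjI exI[of _ Du] exI[of _ ut]) auto
qed

text \<open>The equator is the self-similar solution with constant profile. Its regularity still
  needs an argument, since X (sgn x) may be singular at the origin.\<close>

lemma equator_weak_solution:
 fixes P :: "real => real^'m => real^'n" and X :: "real^'d => real^'m"
 assumes W: "warped_coordinates N g P" and X: "eigenmap k X"
  and gd: "\<And>x. (g has_real_derivative deriv g x) (at x)"
  and gc: "continuous_on UNIV (deriv g)"
  and gs: "deriv g s = 0"
  and k0: "k \<ge> 0" and d3: "CARD('d) \<ge> 3"
 shows "weak_solution P X k g (%r. s) (%r. 0) (%p. s) (%p. 0) (%p. 0)"
  and "energy_inequality CARD('d) k g (%p. s) (%p. 0) (%p. 0)"
proof -
 have prof: "selfsim_profile CARD('d) k g s (%_. s) (%_. 0)"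
  unfolding selfsim_profile_def
  by (auto simp: gs lipschitz_on_def intro!: exI[of _ 0] derivative_eq_intros)
 have e: "ss_fun s (%_. s) = (%p. s)" "ss_r (%_. 0) = (%p. 0)" "ss_t (%_. 0) = (%p. 0)"
  by (auto simp: ss_fun_def ss_r_def ss_t_def)
 show "energy_inequality CARD('d) k g (%p. s) (%p. 0) (%p. 0)"
  using ss_energy_inequality[OF prof gd k0 d3] unfolding e .
 let ?DH = "eq_deriv P X s"
 note R = equivariant_const_regular[OF W X, where s=s]
 obtain C where C: "C \<ge> 0" "\<And>x v. x \<noteq> 0 ==> norm (?DH x v) \<le> C * norm v / norm x"
  using eq_deriv_bound[OF W X, of s] by metis
 obtain M where M: "\<And>x. norm (equivariant_map P X (%_. s) x) \<le> M" using R(9) by blast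
 define DH where "DH = ?DH"
 have H: "C \<ge> 0" "\<And>x. norm (equivariant_map P X (%_. s) x) \<le> M" "\<And>x. linear (DH x)"
  "\<And>x. x \<noteq> 0 ==> (equivariant_map P X (%_. s) has_derivative DH x) (at x)"
  "\<And>x v. x \<noteq> 0 ==> norm (DH x v) \<le> C * norm v / norm x"
  "equivariant_map P X (%_. s) \<in> borel_measurable borel" "\<And>v. (%x. DH x v) \<in> borel_measurable borel"
  unfolding DH_def using C M R by auto
 have d3': "DIM(real^'d) \<ge> 3" using d3 by simp
 have wd: "has_weak_deriv UNIV i (equivariant_map P X (%_. s)) (%x. DH x i)"
  "has_weak_deriv (UNIV \<times> {0<..}) (i, 0) (%(x, t::real). equivariant_map P X (%_. s) x) (%(x, t). DH x i)"
  "has_weak_deriv (UNIV \<times> {0<..}) (0, 1) (%(x, t::real). equivariant_map P X (%_. s) x) (%(x, t). 0)" for i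
  by (rule has_weak_deriv_homogeneous[OF d3' H(1,2,4,5,6,7)]; assumption)+
 have MC: "norm (DH x i) \<le> (C + M) / norm x" if "x \<noteq> 0" "i \<in> Basis" for x i
 proof -
  have "norm (DH x i) \<le> C / norm x" using H(5)[OF that(1), of i] that(2) by simp
  also have "\<dots> \<le> (C + M) / norm x"
   using order_trans[OF norm_ge_zero H(2)[of 0]] by (intro divide_right_mono) auto
  finally show ?thesis .
 qed
 have MC0: "0 \<le> (C + M) / norm x" for x :: "real^'d"
  using order_trans[OF norm_ge_zero H(2)[of 0]] H(1) by simp
 have fm: "(%(x::real^'d, t::real). f x) \<in> borel_measurable borel" if "f \<in> borel_measurable borel" for f :: "real^'d => real^'n"
  using that unfolding borel_prod[symmetric] by measurable
 define u :: "(real^'d) \<times> real => real^'n" where "u = (%(x, t). equivariant_map P X (%_. s) x)"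
 define Du :: "real^'d => (real^'d) \<times> real => real^'n" where "Du = (%i (x, t). DH x i)"
 define ut :: "(real^'d) \<times> real => real^'n" where "ut = (%(x, t). 0)"
 define w where "w = (%i x. DH x i)"
 have m: "u \<in> borel_measurable borel" "\<And>i. Du i \<in> borel_measurable borel" "ut \<in> borel_measurable borel"
   "equivariant_map P X (%_. s) \<in> borel_measurable borel" "\<And>i. w i \<in> borel_measurable borel"
   "(%x::real^'d. 0 :: real^'n) \<in> borel_measurable borel"
  unfolding u_def Du_def ut_def w_def using fm H(6,7) by simp_all
 have wd': "\<And>i. i \<in> Basis ==> has_weak_deriv (UNIV \<times> {0<..}) (i, 0) u (Du i)"
   "has_weak_deriv (UNIV \<times> {0<..}) (0, 1) u ut"
   "\<And>i. i \<in> Basis ==> has_weak_deriv UNIV i (equivariant_map P X (%_. s)) (w i)"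
  unfolding u_def Du_def ut_def w_def using wd by simp_all
 have bd: "\<And>x t. x \<noteq> 0 ==> t > 0 ==> norm (u (x, t)) \<le> C + M"
   "\<And>i x t. i \<in> Basis ==> x \<noteq> 0 ==> t > 0 ==> norm (Du i (x, t)) \<le> (C + M) / norm x"
   "\<And>x t. x \<noteq> 0 ==> t > 0 ==> norm (ut (x, t)) \<le> (C + M) / norm x"
  unfolding u_def Du_def ut_def using H(1) order_trans[OF H(2), of "C + M"] MC MC0 by simp_all
 have ev: "\<And>x. x \<noteq> 0 ==> \<forall>\<^sub>F t in at_right 0. u (x, t) = equivariant_map P X (%_. s) x"
   "\<And>i x. i \<in> Basis ==> x \<noteq> 0 ==> \<forall>\<^sub>F t in at_right 0. Du i (x, t) = w i x"
   "\<And>x. x \<noteq> 0 ==> \<forall>\<^sub>F t in at_right 0. ut (x, t) = 0"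
  unfolding u_def Du_def ut_def w_def by simp_all
 have reg: "has_energy_regularity u Du ut" "attains_data u Du ut (equivariant_map P X (%_. s)) (%x. 0)"
  by (rule energy_regularity_attains_data[OF d3 wd' m bd ev]; assumption)+
 have "weak_solution P X k g (%r. s) (%r. 0) (ss_fun s (%_. s)) (ss_r (%_. 0)) (ss_t (%_. 0))"
 proof (rule ss_weak_solution[OF prof gd gc gs k0 d3])
  show "has_energy_regularity (%(x, t). equivariant_map P X (%r. ss_fun s (%_. s) (r, t)) x) Du ut"
   using reg(1) unfolding u_def e .
  show "attains_data (%(x, t). equivariant_map P X (%r. ss_fun s (%_. s) (r, t)) x) Du ut
    (equivariant_map P X (%r. s)) (%x. 0)"
   using reg(2) unfolding u_def e .
 qed
 then show "weak_solution P X k g (%r. s) (%r. 0) (%p. s) (%p. 0) (%p. 0)"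
  unfolding e .
qed

section \<open>Normal form of a smooth profile\<close>

text \<open>Smoothness is assumed of the composed map only: \<psi> solves the equation on (0, 1) and
  its value at 1 is prescribed separately, so it may jump by a period there. Subtracting that period
  gives a Lipschitz profile with boundary value s, and continuity of U at the origin forces g to
  vanish at the vertex.\<close>

lemma blowup_profile_normal_form:
 fixes P :: "real => real^'m => real^'n" and X :: "real^'d => real^'m"
 assumes W: "warped_coordinates N g P" and X: "eigenmap k X"
  and gd: "\<And>x. (g has_real_derivative deriv g x) (at x)"
  and g0: "g s \<noteq> 0" and k0: "k > 0"
  and bp: "blowup_profile d k g \<psi>" and \<psi>1: "\<psi> 1 = s"
  and U: "open W'" "cball 0 1 \<subseteq> W'" "smooth_on W' U"
   "\<And>x. x \<in> cball 0 1 - {0} ==> U x = equivariant_map P X \<psi> x"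
 obtains \<Psi> \<Psi>' where "selfsim_profile d k g s \<Psi> \<Psi>'" "g (\<Psi> 0) = 0"
  "\<And>x. x \<noteq> 0 ==> norm x \<le> 1 ==> U x = P (\<Psi> (norm x)) (X (sgn x))"
proof -
 obtain \<psi>' \<psi>'' where \<psi>: "\<And>\<rho>. 0 < \<rho> ==> \<rho> < 1 ==> (\<psi> has_real_derivative \<psi>' \<rho>) (at \<rho>)"
   "\<And>\<rho>. 0 < \<rho> ==> \<rho> < 1 ==> (\<psi>' has_real_derivative \<psi>'' \<rho>) (at \<rho>)"
   "\<And>\<rho>. 0 < \<rho> ==> \<rho> < 1 ==> \<rho>\<^sup>2 * (1 - \<rho>\<^sup>2) * \<psi>'' \<rho> + \<rho> * ((real d - 1) - 2 * \<rho>\<^sup>2) * \<psi>' \<rho>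
    - k * g (\<psi> \<rho>) * deriv g (\<psi> \<rho>) = 0"
  using bp unfolding blowup_profile_def greaterThanLessThan_iff Ball_def by metis
 obtain \<omega> :: "real^'d" where \<omega>b: "\<omega> \<in> Basis" using nonempty_Basis by blast
 then have \<omega>: "\<omega> \<in> sphere 0 1" "norm \<omega> = 1" by auto
 define y where "y = X \<omega>"
 have y: "y \<in> sphere 0 1" using eigenmap_sphere[OF X \<omega>(1)] by (simp add: y_def)
 obtain i where v: "dir_deriv i (%x. X (sgn x)) \<omega> \<noteq> 0" "dir_deriv i (%x. X (sgn x)) \<omega> \<bullet> y = 0"
  using eigenmap_tangent[OF X k0 \<omega>(1)] unfolding y_def by metis
 obtain LU where LU: "LU-lipschitz_on (cball 0 1) U" "\<And>x v. x \<in> cball 0 1 ==> norm (dir_deriv v U x) \<le> LU * norm v"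
  using smooth_on_lipschitz[OF U(3) compact_cball convex_cball U(2)] by blast
 have LU0: "LU \<ge> 0" using lipschitz_on_nonneg[OF LU(1)] .
 have sgnr: "sgn (\<rho> *\<^sub>R \<omega>) = \<omega>" if "\<rho> > 0" for \<rho>
  using that \<omega>(2) by (simp add: sgn_scaleR sgn_div_norm)
 have Uray: "U (\<rho> *\<^sub>R z) = P (\<psi> \<rho>) (X z)" if "0 < \<rho>" "\<rho> \<le> 1" "z \<in> sphere 0 1" for \<rho> z
 proof -
  have n: "norm (\<rho> *\<^sub>R z) = \<rho>" "sgn (\<rho> *\<^sub>R z) = z" using that by (auto simp: sgn_scaleR sgn_div_norm)
  have "\<rho> *\<^sub>R z \<in> cball 0 1 - {0}" using that n(1) by auto
  from U(4)[OF this] show ?thesis unfolding equivariant_map_def n .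
 qed
 \<comment> \<open>Coordinate lines have unit speed, so |\<psi>'| is the length of the radial
   derivative of U, which is bounded on the ball.\<close>
 have \<psi>b: "\<bar>\<psi>' \<rho>\<bar> \<le> LU" if \<rho>: "0 < \<rho>" "\<rho> < 1" for \<rho>
 proof -
  have in1: "\<rho> *\<^sub>R \<omega> \<in> cball 0 1" using \<rho> \<omega>(2) by simp
  have inW: "\<rho> *\<^sub>R \<omega> \<in> W'" using in1 U(2) by blast
  have "((%\<rho>. U (\<rho> *\<^sub>R \<omega>)) has_derivative (%h. dir_deriv (h *\<^sub>R \<omega>) U (\<rho> *\<^sub>R \<omega>))) (at \<rho>)"
   by (rule has_derivative_compose[of "%\<rho>. \<rho> *\<^sub>R \<omega>" "%h. h *\<^sub>R \<omega>" \<rho> UNIV U])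
    (use smooth_on_has_derivative[OF U(3) inW] in \<open>auto intro!: derivative_eq_intros\<close>)
  then have 1: "((%\<rho>. P (\<psi> \<rho>) y) has_derivative (%h. dir_deriv (h *\<^sub>R \<omega>) U (\<rho> *\<^sub>R \<omega>))) (at \<rho>)"
   by (rule has_derivative_transform_within_open[of _ _ _ _ "{0<..<1}"])
    (use \<rho> Uray[OF _ _ \<omega>(1)] in \<open>auto simp: y_def\<close>)
  let ?D = "dir_deriv (1, 0) (hom_ext P) (\<psi> \<rho>, y)"
  have 2: "((%\<rho>. P (\<psi> \<rho>) y) has_derivative (%h. (\<psi>' \<rho> * h) *\<^sub>R ?D)) (at \<rho>)"
   by (rule has_derivative_compose[of \<psi> "%h. \<psi>' \<rho> * h" \<rho> UNIV "%s. P s y"])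
    (use \<psi>(1)[OF \<rho>] curve_derivative(1)[OF W y, of "\<psi> \<rho>"] in
     \<open>simp_all add: has_field_derivative_def has_vector_derivative_def\<close>)
  have "dir_deriv (1 *\<^sub>R \<omega>) U (\<rho> *\<^sub>R \<omega>) = (\<psi>' \<rho> * 1) *\<^sub>R ?D"
   using fun_cong[OF has_derivative_unique[OF 1 2], of 1] .
  then have "norm (dir_deriv \<omega> U (\<rho> *\<^sub>R \<omega>)) = \<bar>\<psi>' \<rho>\<bar>"
   using curve_derivative(2)[OF W y, of "\<psi> \<rho>"] by simp
  then show ?thesis using LU(2)[OF in1, of \<omega>] \<omega>(2) by simp
 qed
 have "LU-lipschitz_on {0<..<1} \<psi>"
 proof (rule lipschitz_onI[OF _ LU0])
  fix a b :: real assume ab: "a \<in> {0<..<1}" "b \<in> {0<..<1}"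
  have "norm (\<psi> a - \<psi> b) \<le> LU * norm (a - b)"
  proof (rule field_differentiable_bound[of "{0<..<1}" \<psi> \<psi>'])
   show "(\<psi> has_field_derivative \<psi>' z) (at z within {0<..<1})" if "z \<in> {0<..<1}" for z
    using \<psi>(1)[of z] that has_field_derivative_at_within by auto
  qed (use \<psi>b ab in auto)
  then show "dist (\<psi> a) (\<psi> b) \<le> LU * dist a b" by (simp add: dist_norm)
 qed
 then obtain \<psi>e where \<psi>e: "LU-lipschitz_on {0..1} \<psi>e" "\<And>x. x \<in> {0<..<1} ==> \<psi>e x = \<psi> x"
  using lipschitz_extend_closure[of LU "{0<..<1}" \<psi>] closure_greaterThanLessThan[of "0::real" 1] by auto
 have \<psi>ec: "continuous_on {0..1} \<psi>e" using lipschitz_on_continuous_on[OF \<psi>e(1)] .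
 have Uc: "continuous_on (cball 0 1) U"
  using smooth_on_continuous[OF U(3)] U(2) continuous_on_subset by blast
 have ext: "U (\<rho> *\<^sub>R z) = P (\<psi>e \<rho>) (X z)" if z: "z \<in> sphere 0 1" and \<rho>: "\<rho> \<in> {0..1}" for \<rho> z
 proof -
  have Xz: "X z \<in> sphere 0 1" by (rule eigenmap_sphere[OF X z])
  have c1: "continuous_on {0..1} (%\<rho>. U (\<rho> *\<^sub>R z))"
   by (rule continuous_on_compose2[OF Uc]) (use z in \<open>auto intro!: continuous_intros\<close>)
  have "continuous_on UNIV (%s. (%(s, y). P s y) (s, X z))"
   by (rule continuous_on_compose2[OF chart_continuous[OF W]]) (use Xz in \<open>auto intro!: continuous_intros\<close>)
  then have "continuous_on UNIV (%s. P s (X z))" by simp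
  then have c2: "continuous_on {0..1} (%\<rho>. P (\<psi>e \<rho>) (X z))"
   by (rule continuous_on_compose2[OF _ \<psi>ec]) auto
  have cl: "closure {0<..<1::real} = {0..1}" by (rule closure_greaterThanLessThan) simp
  have "continuous_on (closure {0<..<1}) (%\<rho>. U (\<rho> *\<^sub>R z) - P (\<psi>e \<rho>) (X z))"
   unfolding cl by (intro continuous_intros c1 c2)
  from continuous_constant_on_closure[OF this, of 0 \<rho>] show ?thesis
   using \<rho> Uray[OF _ _ z] \<psi>e(2) unfolding cl by auto
 qed
 \<comment> \<open>The limit of \<psi> at 1 and the prescribed value s describe the same point of N;
   as g does not vanish at s, they differ by a period T.\<close>
 have "P (\<psi>e 1) y = P s y"
  using ext[OF \<omega>(1), of 1] Uray[of 1 \<omega>] \<omega>(1) \<psi>1 by (simp add: y_def)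
 from warped_unique[OF W y this[symmetric] g0] obtain T where T: "coord_period P T" "\<psi>e 1 = s + T" by blast
 have gT: "(g (x + T))\<^sup>2 = (g x)\<^sup>2" for x
  by (rule coord_period_g[OF W T(1) y v(2,1)])
 \<comment> \<open>Periodicity of g^2 differentiates to periodicity of g g', the combination in the
   profile equation; so the shifted profile solves it too.\<close>
 have ggT: "g (x + T) * deriv g (x + T) = g x * deriv g x" for x
 proof -
  have "((%x. (g (x + T))\<^sup>2) has_real_derivative 2 * g (x + T) * deriv g (x + T)) (at x)"
   using DERIV_power[OF DERIV_shift[THEN iffD1, OF gd[of "x + T"]], of 2] by (simp add: mult_ac)
  moreover have "((%x. (g x)\<^sup>2) has_real_derivative 2 * g x * deriv g x) (at x)"
   using DERIV_power[OF gd[of x], of 2] by (simp add: mult_ac)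
  ultimately show ?thesis using DERIV_unique gT by fastforce
 qed
 \<comment> \<open>Clamping the argument to [0, 1] extends the profile to the line without
   increasing its Lipschitz constant.\<close>
 define \<Psi> where "\<Psi> \<rho> = \<psi>e (max 0 (min 1 \<rho>)) - T" for \<rho>
 define \<Psi>' where "\<Psi>' \<rho> = (if 0 < \<rho> \<and> \<rho> < 1 then \<psi>' \<rho> else 0)" for \<rho>
 have prof: "selfsim_profile d k g s \<Psi> \<Psi>'"
  unfolding selfsim_profile_def
 proof (intro conjI allI impI ballI)
  have "LU-lipschitz_on UNIV \<Psi>"
  proof (rule lipschitz_onI[OF _ LU0])
   fix a b :: real
   have "dist (\<psi>e (max 0 (min 1 a))) (\<psi>e (max 0 (min 1 b))) \<le> LU * dist (max 0 (min 1 a)) (max 0 (min 1 b))"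
    by (rule lipschitz_onD[OF \<psi>e(1)]) auto
   also have "\<dots> \<le> LU * dist a b"
    by (intro mult_left_mono LU0) (auto simp: dist_real_def max_def min_def)
   finally show "dist (\<Psi> a) (\<Psi> b) \<le> LU * dist a b" by (simp add: \<Psi>_def dist_real_def)
  qed
  then show "\<exists>L. L-lipschitz_on UNIV \<Psi>" ..
  show "\<Psi> \<rho> = s" if "\<rho> \<ge> 1" for \<rho> using that T(2) by (simp add: \<Psi>_def)
  show "\<Psi>' \<rho> = 0" if "\<rho> \<notin> {0<..<1}" for \<rho> using that by (auto simp: \<Psi>'_def)
  fix \<rho> :: real assume "\<rho> \<in> {0<..<1}"
  then have \<rho>: "0 < \<rho>" "\<rho> < 1" by auto
  have e: "\<Psi> x = \<psi> x - T" if "x \<in> {0<..<1}" for x using that \<psi>e(2)[of x] by (simp add: \<Psi>_def)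
  have "((%x. \<psi> x - T) has_real_derivative \<psi>' \<rho>) (at \<rho>)"
   using \<psi>(1)[OF \<rho>] by (auto intro!: derivative_eq_intros)
  then show "(\<Psi> has_real_derivative \<Psi>' \<rho>) (at \<rho>)"
   unfolding \<Psi>'_def using \<rho>
   by (auto intro: has_field_derivative_transform_within_open[of _ _ _ "{0<..<1}"] simp: e)
  have "(\<Psi>' has_real_derivative \<psi>'' \<rho>) (at \<rho>)"
   by (rule has_field_derivative_transform_within_open[OF \<psi>(2)[OF \<rho>], of "{0<..<1}"]) (use \<rho> in \<open>auto simp: \<Psi>'_def\<close>)
  moreover have ke: "k * g (\<Psi> \<rho>) * deriv g (\<Psi> \<rho>) = k * g (\<psi> \<rho>) * deriv g (\<psi> \<rho>)"
   using ggT[of "\<Psi> \<rho>"] e[of \<rho>] \<rho> by (simp add: mult.assoc)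
  ultimately show "\<exists>D. (\<Psi>' has_real_derivative D) (at \<rho>) \<and>
    \<rho>\<^sup>2 * (1 - \<rho>\<^sup>2) * D + \<rho> * (real d - 1 - 2 * \<rho>\<^sup>2) * \<Psi>' \<rho> - k * g (\<Psi> \<rho>) * deriv g (\<Psi> \<rho>) = 0"
   unfolding ke using \<psi>(3)[OF \<rho>] \<rho> by (intro exI[of _ "\<psi>'' \<rho>"]) (simp add: \<Psi>'_def)
 qed
 \<comment> \<open>At the vertex value the map x \<mapsto> P (\<psi>e 0) (X (sgn x)) is the constant
   U 0 off the origin. Its differential has length |g| |dX|, and dX is nonzero in the direction
   i.\<close>
 have g\<psi>0: "g (\<psi>e 0) = 0"
 proof -
  have const: "equivariant_map P X (%_. \<psi>e 0) x = U 0" if "x \<noteq> 0" for x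
   using ext[OF sgn_sphere[OF that], of 0] by (simp add: equivariant_map_def)
  note DH = equivariant_const_regular(2,3)[OF W X sphere_nonzero[OF \<omega>(1)], where s="\<psi>e 0"]
  have "(equivariant_map P X (%_. \<psi>e 0) has_derivative (%_. 0)) (at \<omega>)"
   by (rule has_derivative_transform_within_open[of "%_. U 0" _ _ _ "- {0}"])
    (use const sphere_nonzero[OF \<omega>(1)] in auto)
  from fun_cong[OF has_derivative_unique[OF DH(1) this], of i]
  show ?thesis using DH(2)[of i] v(1) by simp
 qed
 show ?thesis
 proof (rule that[OF prof])
  show "g (\<Psi> 0) = 0" using gT[of "\<Psi> 0"] g\<psi>0 by (simp add: \<Psi>_def)
  fix x :: "real^'d" assume x: "x \<noteq> 0" "norm x \<le> 1"
  have "U (norm x *\<^sub>R sgn x) = P (\<psi>e (norm x)) (X (sgn x))"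
   by (rule ext[OF sgn_sphere]) (use x in auto)
  moreover have "norm x *\<^sub>R sgn x = x" using x by (simp add: sgn_div_norm)
  moreover have "P (\<Psi> (norm x) + T) (X (sgn x)) = P (\<Psi> (norm x)) (X (sgn x))"
   using T(1) eigenmap_sphere[OF X sgn_sphere[OF x(1)]] unfolding coord_period_def by blast
  ultimately show "U x = P (\<Psi> (norm x)) (X (sgn x))" using x by (simp add: \<Psi>_def)
 qed
qed

lemma measurable_linear_family:
 fixes F' :: "'e::euclidean_space => 'e => 'b::euclidean_space"
 assumes lin: "\<And>y. linear (F' y)" and m: "\<And>b. (%y. F' y b) \<in> borel_measurable borel"
  and f: "f \<in> borel_measurable M" and h: "h \<in> borel_measurable M"
 shows "(%p. F' (f p) (h p)) \<in> borel_measurable M"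
proof -
 have e: "F' y z = (\<Sum>b\<in>Basis. (z \<bullet> b) *\<^sub>R F' y b)" for y z
 proof -
  have "F' y z = F' y (\<Sum>b\<in>Basis. (z \<bullet> b) *\<^sub>R b)" by (simp add: euclidean_representation)
  then show ?thesis using lin[of y] by (simp add: linear_sum linear_cmul)
 qed
 have "(%p. F' (f p) (h p)) = (%p. \<Sum>b\<in>Basis. (h p \<bullet> b) *\<^sub>R F' (f p) b)" by (rule ext, rule e)
 also have "\<dots> \<in> borel_measurable M"
  by (intro borel_measurable_sum borel_measurable_scaleR borel_measurable_inner h
    measurable_compose[OF f m]) auto
 finally show ?thesis .
qed

text \<open>The nearest-point projection is 1-Lipschitz; composing U with it will give a Lipschitz
  extension outside the ball.\<close>

lemma closest_point_unit_cball:
 fixes y :: "'a::euclidean_space"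
 shows "norm y \<le> 1 ==> closest_point (cball 0 1) y = y"
  and "norm y > 1 ==> closest_point (cball 0 1) y = sgn y"
proof -
 show "closest_point (cball 0 1) y = y" if "norm y \<le> 1"
  by (rule closest_point_self) (use that in simp)
 show "closest_point (cball 0 1) y = sgn y" if y: "norm y > 1"
 proof (rule closest_point_unique[symmetric])
  have y0: "y \<noteq> 0" using y by auto
  show "sgn y \<in> cball 0 1" by (simp add: norm_sgn)
  have "y - sgn y = (1 - inverse (norm y)) *\<^sub>R y" by (simp add: sgn_div_norm scaleR_diff_left)
  then have "dist y (sgn y) = \<bar>1 - inverse (norm y)\<bar> * norm y" by (simp add: dist_norm)
  also have "\<dots> = norm y - 1"
  proof -
   have "inverse (norm y) \<le> 1" using y by (simp add: inverse_le_1_iff)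
   then show ?thesis using y0 by (simp add: left_diff_distrib)
  qed
  finally have d: "dist y (sgn y) = norm y - 1" .
  show "\<forall>z\<in>cball 0 1. dist y (sgn y) \<le> dist y z"
  proof
   fix z :: 'a assume "z \<in> cball 0 1"
   then have "norm z \<le> 1" by simp
   moreover have "norm y - norm z \<le> dist y z" by (simp add: dist_norm norm_triangle_ineq2)
   ultimately show "dist y (sgn y) \<le> dist y z" unfolding d by linarith
  qed
 qed auto
qed

section \<open>Uniqueness excludes smooth profiles\<close>

text \<open>Most of the work is regularity: off the axis u is G (x/t) with G Lipschitz, so the weak
  derivatives come from the self-similar case, and the bounds of order 1/|x| follow separately
  inside and outside the cone.\<close>

lemma profile_contradicts_uniqueness:
 fixes P :: "real => real^'m => real^'n" and X :: "real^'d => real^'m"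
 assumes W: "warped_coordinates N g P" and X: "eigenmap k X"
  and gd: "\<And>x. (g has_real_derivative deriv g x) (at x)"
  and gc: "continuous_on UNIV (deriv g)"
  and gs: "deriv g s = 0" and g0: "g s \<noteq> 0" and k0: "k > 0" and d3: "CARD('d) \<ge> 3"
  and uniq: "equator_unique_weak_solution P X k g s"
 shows "no_smooth_profile P X k g s"
 unfolding no_smooth_profile_def
proof
 assume "\<exists>\<psi>. blowup_profile CARD('d) k g \<psi> \<and> \<psi> 1 = s \<and> smooth_on_closed_unit_ball (equivariant_map P X \<psi>)"
 then obtain \<psi> where bp: "blowup_profile CARD('d) k g \<psi>" and \<psi>1: "\<psi> 1 = s"
  and "smooth_on_closed_unit_ball (equivariant_map P X \<psi>)" by blast
 then obtain W' U where U: "open W'" "cball 0 1 \<subseteq> W'" "smooth_on W' U"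
   "\<And>x. x \<in> cball 0 1 - {0} ==> U x = equivariant_map P X \<psi> x"
  unfolding smooth_on_closed_unit_ball_def by blast
 obtain \<Psi> \<Psi>' where prof: "selfsim_profile CARD('d) k g s \<Psi> \<Psi>'" and \<Psi>0: "g (\<Psi> 0) = 0"
  and U\<Psi>: "\<And>x. x \<noteq> 0 ==> norm x \<le> 1 ==> U x = P (\<Psi> (norm x)) (X (sgn x))"
  using blowup_profile_normal_form[OF W X gd g0 k0 bp \<psi>1 U] by metis
 have k0': "k \<ge> 0" using k0 by simp
 note outer = profile_outer[OF prof gd k0' d3]
 have \<Psi>c: "continuous_on UNIV \<Psi>" by (rule profile_continuous[OF prof gd k0' d3])
 define H where "H = equivariant_map P X (%_. s)"
 define DH where "DH = eq_deriv P X s"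
 note R = equivariant_const_regular[OF W X, where s=s, folded H_def DH_def]
 obtain C where C: "C \<ge> 0" "\<And>x v. x \<noteq> 0 ==> norm (DH x v) \<le> C * norm v / norm x"
  using eq_deriv_bound[OF W X, of s] unfolding DH_def by metis
 obtain M1 where M1: "\<And>x. norm (H x) \<le> M1" using R(9) by blast
 obtain LU where LU: "LU-lipschitz_on (cball 0 1) U" "\<And>x v. x \<in> cball 0 1 ==> norm (dir_deriv v U x) \<le> LU * norm v"
  using smooth_on_lipschitz[OF U(3) compact_cball convex_cball U(2)] by blast
 have LU0: "LU \<ge> 0" using lipschitz_on_nonneg[OF LU(1)] .
 have Uc: "continuous_on (cball 0 1) U"
  using smooth_on_continuous[OF U(3)] U(2) continuous_on_subset by blast
 obtain M2 where "\<forall>z\<in>U ` cball 0 1. norm z \<le> M2"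
  using compact_imp_bounded[OF compact_continuous_image[OF Uc compact_cball]] unfolding bounded_iff by blast
 then have M2: "norm (U x) \<le> M2" if "x \<in> cball 0 1" for x using that by blast
 have Hs: "H x = P s (X (sgn x))" for x by (simp add: H_def equivariant_map_def)
 \<comment> \<open>U inside the ball, the equator map outside; on the unit sphere both coincide
   because \<Psi> 1 = s.\<close>
 define G where "G y = (if norm y \<le> 1 then U y else H y)" for y
 have Gpr: "G y = U (closest_point (cball 0 1) y)" for y
 proof (cases "norm y \<le> 1")
  case False
  then have y: "norm y > 1" "y \<noteq> 0" by auto
  have "U (sgn y) = P (\<Psi> (norm (sgn y))) (X (sgn (sgn y)))"
   by (rule U\<Psi>) (use y in \<open>auto simp: norm_sgn sgn_zero_iff\<close>)
  also have "\<dots> = H y"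
  proof -
   have 1: "sgn (sgn y) = sgn y" by (rule sgn_on_sphere[OF sgn_sphere[OF y(2)]])
   have 2: "norm (sgn y) = 1" using y by (simp add: norm_sgn)
   have 3: "\<Psi> 1 = s" by (rule outer(1)) simp
   show ?thesis unfolding 1 2 3 Hs ..
  qed
  finally show ?thesis using False closest_point_unit_cball(2)[OF y(1)] by (simp add: G_def)
 qed (simp add: G_def closest_point_unit_cball)
 have GL: "LU-lipschitz_on UNIV G"
 proof (rule lipschitz_onI[OF _ LU0])
  fix x y :: "real^'d"
  have ne: "cball (0::real^'d) 1 \<noteq> {}" by simp
  have "dist (G x) (G y) \<le> LU * dist (closest_point (cball 0 1) x) (closest_point (cball 0 1) y)"
   unfolding Gpr by (intro lipschitz_onD[OF LU(1)] closest_point_in_set ne closed_cball)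
  also have "\<dots> \<le> LU * dist x y"
   by (intro mult_left_mono LU0 closest_point_lipschitz[OF convex_cball closed_cball ne])
  finally show "dist (G x) (G y) \<le> LU * dist x y" .
 qed
 have Gm: "G \<in> borel_measurable borel"
  by (rule borel_measurable_continuous_onI[OF lipschitz_on_continuous_on[OF GL]])
 \<comment> \<open>The value 0 at the origin and on the unit sphere is a default on the set where G
   need not be differentiable.\<close>
 define DG where "DG y v = (if y = 0 \<or> norm y = 1 then 0 else if norm y < 1 then dir_deriv v U y else DH y v)" for y v
 have DGlin: "linear (DG y)" for y
 proof -
  consider "y = 0 \<or> norm y = 1" | "y \<noteq> 0" "norm y < 1" | "norm y > 1" "y \<noteq> 0" by fastforce
  then show ?thesis
  proof cases
   case 1 then show ?thesis by (simp add: DG_def[abs_def] linear_iff)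
  next
   case 2
   then have "y \<in> W'" using U(2) by auto
   then show ?thesis using dir_deriv_linear[OF U(3)] 2 by (simp add: DG_def[abs_def])
  next
   case 3
   then have "DG y = DH y" by (auto simp: DG_def)
   then show ?thesis using R(1) by simp
  qed
 qed
 have DGd: "(G has_derivative DG y) (at y)" if y: "y \<noteq> 0" "norm y \<noteq> 1" for y
 proof (cases "norm y < 1")
  case True
  then have yW: "y \<in> W'" using U(2) by auto
  have "(U has_derivative DG y) (at y)"
   using smooth_on_has_derivative[OF U(3) yW] y True by (simp add: DG_def[abs_def])
  then show ?thesis
   by (rule has_derivative_transform_within_open[of _ _ _ _ "ball 0 1"]) (use True in \<open>auto simp: G_def\<close>)
 next
  case False
  have "DG y = DH y" using y False by (auto simp: DG_def)
  then have "(H has_derivative DG y) (at y)" using R(2)[OF y(1)] by simp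
  then show ?thesis
   by (rule has_derivative_transform_within_open[of _ _ _ _ "- cball 0 1"]) (use y False in \<open>auto simp: G_def\<close>)
 qed
 have DGm: "(%y. DG y v) \<in> borel_measurable borel" for v
 proof -
  have m1: "(%y. if y \<in> ball 0 1 then dir_deriv v U y else 0) \<in> borel_measurable borel"
   by (rule borel_measurable_continuous_on_if)
    (use U(2) in \<open>auto intro!: continuous_on_subset[OF smooth_on_continuous[OF smooth_on_dir_deriv[OF U(3)]]]\<close>)
  have "(%y. DG y v) = (%y. if y = 0 \<or> norm y = 1 then 0 else if norm y < 1 then
    (if y \<in> ball 0 1 then dir_deriv v U y else 0) else DH y v)" by (auto simp: DG_def)
  also have "\<dots> \<in> borel_measurable borel" using m1 R(5)[of v] by measurable
  finally show ?thesis .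
 qed
 define u :: "(real^'d) \<times> real => real^'n" where "u = (%(x, t). equivariant_map P X (%r. ss_fun s \<Psi> (r, t)) x)"
 define Du :: "real^'d => (real^'d) \<times> real => real^'n" where "Du = (%i (x, t). DG (x /\<^sub>R t) (i /\<^sub>R t))"
 define ut :: "(real^'d) \<times> real => real^'n" where "ut = (%(x, t). DG (x /\<^sub>R t) (- (x /\<^sub>R t\<^sup>2)))"
 have uG: "u (x, t) = G (x /\<^sub>R t)" if "x \<noteq> 0" "t > 0" for x t
 proof -
  have sg: "sgn (x /\<^sub>R t) = sgn x" using that by (simp add: sgn_scaleR)
  have nx: "norm (x /\<^sub>R t) = norm x / t" using that by (simp add: divide_inverse mult.commute)
  have uv: "u (x, t) = P (\<Psi> (norm x / t)) (X (sgn x))"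
   using that by (simp add: u_def equivariant_map_def ss_fun_def)
  show ?thesis
  proof (cases "norm (x /\<^sub>R t) \<le> 1")
   case True
   have "U (x /\<^sub>R t) = P (\<Psi> (norm (x /\<^sub>R t))) (X (sgn (x /\<^sub>R t)))"
    by (rule U\<Psi>) (use that True in auto)
   then have "U (x /\<^sub>R t) = P (\<Psi> (norm x / t)) (X (sgn x))" unfolding sg nx .
   then show ?thesis using uv True by (simp only: G_def if_True)
  next
   case False
   then have "norm x / t \<ge> 1" unfolding nx by simp
   then show ?thesis using uv False outer(1) by (simp add: G_def Hs sg)
  qed
 qed
 have u0: "u (0, t) = P (\<Psi> 0) (X 0)" if "t > 0" for t
  using that by (simp add: u_def equivariant_map_def ss_fun_def)
 have un: "u (x, t) = H x" if "\<not> t > 0" for x t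
  using that by (simp add: u_def equivariant_map_def ss_fun_def Hs)
 have um: "u \<in> borel_measurable borel"
 proof -
  have "(%p. G (fst p /\<^sub>R snd p)) \<in> borel_measurable (borel :: ((real^'d) \<times> real) measure)"
   by (rule measurable_compose[OF _ Gm]) measurable
  moreover have "(%p. H (fst p)) \<in> borel_measurable (borel :: ((real^'d) \<times> real) measure)"
   by (rule measurable_compose[OF _ R(4)]) measurable
  ultimately have "(%p. if snd p > 0 then (if fst p = 0 then P (\<Psi> 0) (X 0) else G (fst p /\<^sub>R snd p)) else H (fst p))
   \<in> borel_measurable (borel :: ((real^'d) \<times> real) measure)" by measurable
  moreover have "u = (%p. if snd p > 0 then (if fst p = 0 then P (\<Psi> 0) (X 0) else G (fst p /\<^sub>R snd p)) else H (fst p))"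
  proof
   fix p :: "(real^'d) \<times> real"
   show "u p = (if snd p > 0 then (if fst p = 0 then P (\<Psi> 0) (X 0) else G (fst p /\<^sub>R snd p)) else H (fst p))"
    using uG[of "fst p" "snd p"] u0[of "snd p"] un[of "snd p" "fst p"] by (cases p) auto
  qed
  ultimately show ?thesis by simp
 qed
 have Dum: "Du i \<in> borel_measurable borel" for i
 proof -
  have "(%p. DG (fst p /\<^sub>R snd p) (i /\<^sub>R snd p)) \<in> borel_measurable (borel :: ((real^'d) \<times> real) measure)"
   by (rule measurable_linear_family[OF DGlin DGm]) measurable
  then show ?thesis by (simp add: Du_def case_prod_beta')
 qed
 have utm: "ut \<in> borel_measurable borel"
 proof -
  have "(%p. DG (fst p /\<^sub>R snd p) (- (fst p /\<^sub>R (snd p)\<^sup>2))) \<in> borel_measurable (borel :: ((real^'d) \<times> real) measure)"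
   by (rule measurable_linear_family[OF DGlin DGm]) measurable
  then show ?thesis by (simp add: ut_def case_prod_beta')
 qed
 have aeu: "AE p in lborel. p \<in> UNIV \<times> {0<..} --> (%(x, t). G (x /\<^sub>R t)) p = u p"
  using AE_off_cone
 proof eventually_elim
  fix p :: "(real^'d) \<times> real" assume "fst p \<noteq> 0 \<and> norm (fst p) \<noteq> snd p"
  then show "p \<in> UNIV \<times> {0<..} --> (%(x, t). G (x /\<^sub>R t)) p = u p"
   using uG[of "fst p" "snd p"] by (cases p) auto
 qed
 have d3': "DIM(real^'d) \<ge> 3" using d3 by simp
 have M: "M1 \<ge> 0" "M2 \<ge> 0" using order_trans[OF norm_ge_zero M1[of 0]] order_trans[OF norm_ge_zero M2[of 0]] by auto
 \<comment> \<open>A single constant above all the others, so that B and B/|x| serve for u and for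
   each of its derivatives.\<close>
 define B where "B = C + LU + M1 + M2"
 have wd: "\<And>i. i \<in> Basis ==> has_weak_deriv (UNIV \<times> {0<..}) (i, 0) u (Du i)"
  "has_weak_deriv (UNIV \<times> {0<..}) (0, 1) u ut"
  "\<And>i. i \<in> Basis ==> has_weak_deriv UNIV i H (DH' i)" if "DH' = (%i x. DH x i)" for DH'
 proof -
  fix i :: "real^'d"
  have "has_weak_deriv (UNIV \<times> {0<..}) (i, 0) (%(x, t). G (x /\<^sub>R t)) (Du i)"
   unfolding Du_def by (rule has_weak_deriv_selfsimilar(1)[OF GL DGd DGlin DGm])
  then show "has_weak_deriv (UNIV \<times> {0<..}) (i, 0) u (Du i)"
   by (rule has_weak_deriv_cong_AE[OF _ um Dum aeu]) simp
 next
  have "has_weak_deriv (UNIV \<times> {0<..}) (0, 1) (%(x, t). G (x /\<^sub>R t)) ut"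
   unfolding ut_def by (rule has_weak_deriv_selfsimilar(2)[OF GL DGd DGlin DGm])
  then show "has_weak_deriv (UNIV \<times> {0<..}) (0, 1) u ut"
   by (rule has_weak_deriv_cong_AE[OF _ um utm aeu]) simp
 next
  fix i :: "real^'d"
  show "has_weak_deriv UNIV i H (DH' i)"
   unfolding that by (rule has_weak_deriv_homogeneous(1)[OF d3' C(1) M1 R(2) C(2) R(4) R(5)])
 qed
 define w where "w = (%i x. DH x i)"
 note wd' = wd[OF w_def]
 have wm: "w i \<in> borel_measurable borel" for i unfolding w_def by (rule R(5))
 have bd1: "norm (u (x, t)) \<le> B" if "x \<noteq> 0" "t > 0" for x t
  unfolding uG[OF that] G_def B_def using M M1[of "x /\<^sub>R t"] M2[of "x /\<^sub>R t"] LU0 C(1) by auto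
 have bdG: "norm (DG (x /\<^sub>R t) v) \<le> (if norm x < t then LU * norm v else C * norm v * t / norm x)"
  if "x \<noteq> 0" "t > 0" for x t v
 proof -
  have nx: "norm (x /\<^sub>R t) = norm x / t" using that by (simp add: divide_inverse mult.commute)
  consider "norm x < t" | "norm x = t" | "norm x > t" by linarith
  then show ?thesis
  proof cases
   case 1
   then have n1: "norm (x /\<^sub>R t) < 1" unfolding nx using that by simp
   then have "DG (x /\<^sub>R t) v = dir_deriv v U (x /\<^sub>R t)" using that by (auto simp: DG_def)
   then show ?thesis using LU(2)[of "x /\<^sub>R t" v] n1 1 by simp
  next
   case 2
   then have "norm (x /\<^sub>R t) = 1" unfolding nx using that by simp
   then have "DG (x /\<^sub>R t) v = 0" by (simp only: DG_def) simp
   then show ?thesis using 2 C(1) that by simp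
  next
   case 3
   then have n1: "norm (x /\<^sub>R t) > 1" unfolding nx using that by simp
   then have "DG (x /\<^sub>R t) v = DH (x /\<^sub>R t) v" using that by (auto simp: DG_def)
   then have "norm (DG (x /\<^sub>R t) v) \<le> C * norm v / norm (x /\<^sub>R t)" using C(2)[of "x /\<^sub>R t" v] that by simp
   then show ?thesis unfolding nx using 3 that by simp
  qed
 qed
 have bd2: "norm (Du i (x, t)) \<le> B / norm x" if i: "i \<in> Basis" and x: "x \<noteq> 0" "t > 0" for i x t
 proof -
  have "norm (Du i (x, t)) \<le> (if norm x < t then LU * norm (i /\<^sub>R t) else C * norm (i /\<^sub>R t) * t / norm x)"
   unfolding Du_def prod.case by (rule bdG[OF x])
  also have "\<dots> \<le> B / norm x"
  proof (cases "norm x < t")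
   case True
   have "LU / t \<le> LU / norm x" using True x LU0 by (intro divide_left_mono) auto
   also have "\<dots> \<le> B / norm x" using M C(1) by (intro divide_right_mono) (auto simp: B_def)
   finally show ?thesis using True i x by (simp add: divide_inverse)
  next
   case False
   have "C / norm x \<le> B / norm x" using M LU0 by (intro divide_right_mono) (auto simp: B_def)
   moreover have "C * norm (i /\<^sub>R t) * t / norm x = C / norm x" using i x by (simp add: field_simps)
   ultimately show ?thesis using False by (simp only: if_False)
  qed
  finally show ?thesis .
 qed
 \<comment> \<open>Beyond the cone the time derivative is a multiple of the radial derivative of a
   map homogeneous of degree 0, hence zero.\<close>
 have ut0: "ut (x, t) = 0" if "t > 0" "norm x > t" for x t
 proof -
  have x: "x \<noteq> 0" using that by auto
  have nx: "norm (x /\<^sub>R t) = norm x / t" using that by (simp add: divide_inverse mult.commute)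
  have n1: "norm (x /\<^sub>R t) > 1" unfolding nx using that by simp
  have "- (x /\<^sub>R t\<^sup>2) = (- inverse t) *\<^sub>R (x /\<^sub>R t)" by (simp add: power2_eq_square)
  then have "ut (x, t) = (- inverse t) *\<^sub>R DG (x /\<^sub>R t) (x /\<^sub>R t)"
   unfolding ut_def prod.case by (metis linear_cmul[OF DGlin])
  moreover have "DG (x /\<^sub>R t) (x /\<^sub>R t) = DH (x /\<^sub>R t) (x /\<^sub>R t)" using n1 by (auto simp: DG_def)
  ultimately show ?thesis using R(8) by simp
 qed
 have bd3: "norm (ut (x, t)) \<le> B / norm x" if x: "x \<noteq> 0" "t > 0" for x t
 proof (cases "norm x > t")
  case True
  then show ?thesis using ut0[OF x(2)] M C(1) LU0 by (simp add: B_def)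
 next
  case False
  have "norm (ut (x, t)) \<le> (if norm x < t then LU * norm (- (x /\<^sub>R t\<^sup>2)) else C * norm (- (x /\<^sub>R t\<^sup>2)) * t / norm x)"
   unfolding ut_def prod.case by (rule bdG[OF x])
  also have "\<dots> \<le> (LU + C) / norm x"
  proof (cases "norm x < t")
   case True
   have "LU * (norm x / t\<^sup>2) \<le> LU / norm x"
   proof -
    have "norm x * norm x \<le> t\<^sup>2" unfolding power2_eq_square using True x by (intro mult_mono) auto
    then have "norm x / t\<^sup>2 \<le> 1 / norm x" using x by (simp add: divide_le_eq le_divide_eq)
    from mult_left_mono[OF this LU0] show ?thesis by simp
   qed
   also have "\<dots> \<le> (LU + C) / norm x" using C(1) by (intro divide_right_mono) auto
   finally show ?thesis using True by (simp add: divide_inverse mult_ac)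
  next
   case F: False
   then have "norm x = t" using False by simp
   then have "C * norm (- (x /\<^sub>R t\<^sup>2)) * t / norm x = C / norm x"
    using x by (simp add: field_simps power2_eq_square)
   also have "\<dots> \<le> (LU + C) / norm x" using LU0 by (intro divide_right_mono) auto
   finally show ?thesis using F by (simp only: if_False)
  qed
  also have "\<dots> \<le> B / norm x" using M by (intro divide_right_mono) (auto simp: B_def)
  finally show ?thesis .
 qed
 have ev0: "\<forall>\<^sub>F t in at_right (0::real). 0 < t \<and> t < norm x" if "x \<noteq> 0" for x :: "real^'d"
  using that by (auto simp: eventually_at_right_field intro!: exI[of _ "norm x"])
 \<comment> \<open>For t < |x| the point x/t lies outside the unit ball, where G is the equator map;
   this is the eventual equality with the data.\<close>
 have far: "u (x, t) = H x" "Du i (x, t) = w i x" "ut (x, t) = 0" if t: "0 < t \<and> t < norm x" for x i t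
 proof -
  have x: "x \<noteq> 0" using t by auto
  have nx: "norm (x /\<^sub>R t) = norm x / t" using t by (simp add: divide_inverse mult.commute)
  have n1: "norm (x /\<^sub>R t) > 1" unfolding nx using t by simp
  have it: "inverse t > 0" using t by simp
  show "u (x, t) = H x" using uG[OF x] t n1 R(6)[OF it, of x] by (simp add: G_def)
  have "DG (x /\<^sub>R t) (i /\<^sub>R t) = DH (x /\<^sub>R t) (i /\<^sub>R t)" using n1 by (auto simp: DG_def)
  also have "\<dots> = inverse t *\<^sub>R DH (x /\<^sub>R t) i" using linear_cmul[OF R(1)] by blast
  also have "\<dots> = DH x i" unfolding R(7)[OF it, of x i] using t by simp
  finally show "Du i (x, t) = w i x" by (simp add: Du_def w_def)
  show "ut (x, t) = 0" by (rule ut0) (use t in auto)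
 qed
 have ev: "\<And>x. x \<noteq> 0 ==> \<forall>\<^sub>F t in at_right 0. u (x, t) = H x"
   "\<And>i x. i \<in> Basis ==> x \<noteq> 0 ==> \<forall>\<^sub>F t in at_right 0. Du i (x, t) = w i x"
   "\<And>x. x \<noteq> 0 ==> \<forall>\<^sub>F t in at_right 0. ut (x, t) = 0"
  using eventually_mono[OF ev0 far(1)] eventually_mono[OF ev0 far(2)] eventually_mono[OF ev0 far(3)] by auto
 have zm: "(%x::real^'d. 0 :: real^'n) \<in> borel_measurable borel" by simp
 have reg: "has_energy_regularity u Du ut" "attains_data u Du ut H (%x. 0)"
  by (rule energy_regularity_attains_data[OF d3 wd' um Dum utm R(4) wm zm bd1 bd2 bd3 ev]; assumption)+
 have sol: "weak_solution P X k g (%r. s) (%r. 0) (ss_fun s \<Psi>) (ss_r \<Psi>') (ss_t \<Psi>')"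
  by (rule ss_weak_solution[OF prof gd gc gs k0' d3 reg(1)[unfolded u_def] reg(2)[unfolded u_def H_def]])
 have "energy_inequality CARD('d) k g (ss_fun s \<Psi>) (ss_r \<Psi>') (ss_t \<Psi>')"
  by (rule ss_energy_inequality[OF prof gd k0' d3])
 with sol uniq obtain T where
  ae: "AE p in lborel. p \<in> {0<..} \<times> {0<..} --> ss_fun s \<Psi> p = s + T"
  unfolding equator_unique_weak_solution_def by blast
 have eq: "\<Psi> (r / t) = s + T" if "r > 0" "t > 0" for r t
 proof -
  have o: "open ({0<..} \<times> {0<..} :: (real \<times> real) set)" by (intro open_Times) auto
  have c: "continuous_on ({0<..} \<times> {0<..}) (%p::real\<times>real. \<Psi> (fst p / snd p))"
   by (rule continuous_on_compose2[OF \<Psi>c]) (auto intro!: continuous_intros)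
  have ae': "AE p in lborel. p \<in> {0<..} \<times> {0<..} --> \<Psi> (fst p / snd p) = s + T"
   using ae by eventually_elim (auto simp: ss_fun_def)
  show ?thesis
   using continuous_AE_eq[OF o c continuous_on_const ae', of "(r, t)"] that by simp
 qed
 \<comment> \<open>At r/t = 2, beyond the light cone, the profile is s; so the period is 0.\<close>
 have T0: "T = 0" using eq[of 2 1] outer(1)[of 2] by simp
 have "closure {0<..} = {0::real..}" by simp
 then have "\<Psi> 0 = s"
  using continuous_constant_on_closure[of "{0<..}" \<Psi> s 0] continuous_on_subset[OF \<Psi>c] eq[of _ 1] T0 by auto
 then show False using \<Psi>0 g0 by simp
qed

section \<open>Smooth bump functions\<close>

lemma differentiable_dir_deriv: "f differentiable (at x) ==> (f has_derivative (%v. dir_deriv v f x)) (at x)"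
 unfolding dir_deriv_def by (simp add: frechet_derivative_works eta_contract_eq)

lemma Ck_on_add:
 fixes f h :: "'a::real_normed_vector => 'b::real_normed_vector"
 shows "Ck_on n UNIV f ==> Ck_on n UNIV h ==> Ck_on n UNIV (%x. f x + h x)"
proof (induction n arbitrary: f h)
 case 0
 then show ?case by (auto intro: continuous_on_add)
next
 case (Suc n)
 have d: "((%x. f x + h x) has_derivative (%v. dir_deriv v f x + dir_deriv v h x)) (at x)" for x
  by (rule has_derivative_add) (use Suc.prems in \<open>auto intro: differentiable_dir_deriv\<close>)
 have "dir_deriv v (%x. f x + h x) = (%x. dir_deriv v f x + dir_deriv v h x)" for v
  using dir_deriv_eq[OF d] by blast
 then show ?case using Suc differentiableI[OF d] by simp
qed

lemma Ck_on_cmult: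
 fixes f :: "'a::real_normed_vector => real"
 shows "Ck_on n UNIV f ==> Ck_on n UNIV (%x. c * f x)"
proof (induction n arbitrary: f)
 case 0
 then show ?case by (auto intro: continuous_on_mult_left)
next
 case (Suc n)
 have d: "((%x. c * f x) has_derivative (%v. c * dir_deriv v f x)) (at x)" for x
  by (rule has_derivative_mult_right) (use Suc.prems in \<open>auto intro: differentiable_dir_deriv\<close>)
 have "dir_deriv v (%x. c * f x) = (%x. c * dir_deriv v f x)" for v
  using dir_deriv_eq[OF d] by blast
 then show ?case using Suc differentiableI[OF d] by simp
qed

lemma Ck_on_mult:
 fixes f h :: "'a::real_normed_vector => real"
 shows "Ck_on n UNIV f ==> Ck_on n UNIV h ==> Ck_on n UNIV (%x. f x * h x)"
proof (induction n arbitrary: f h)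
 case 0
 then show ?case by (auto intro: continuous_on_mult)
next
 case (Suc n)
 have d: "((%x. f x * h x) has_derivative (%v. f x * dir_deriv v h x + dir_deriv v f x * h x)) (at x)" for x
  by (rule has_derivative_mult) (use Suc.prems in \<open>auto intro: differentiable_dir_deriv\<close>)
 have e: "dir_deriv v (%x. f x * h x) = (%x. f x * dir_deriv v h x + dir_deriv v f x * h x)" for v
  using dir_deriv_eq[OF d] by blast
 have "Ck_on n UNIV (dir_deriv v (%x. f x * h x))" for v
  unfolding e using Suc.prems Ck_on_SucD[OF Suc.prems(1)] Ck_on_SucD[OF Suc.prems(2)]
  by (intro Ck_on_add Suc.IH) auto
 then show ?case using differentiableI[OF d] by simp
qed

lemma Ck_on_affine:
 fixes f :: "'b::real_normed_vector => real" and L :: "'a::real_normed_vector => 'b"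
 assumes L: "bounded_linear L"
 shows "Ck_on n UNIV f ==> Ck_on n UNIV (%x. f (L x + c))"
proof (induction n arbitrary: f)
 case 0
 have "continuous_on UNIV (%x. L x + c)"
  by (intro continuous_intros linear_continuous_on[OF L])
 then show ?case using 0 continuous_on_compose2[of UNIV f UNIV "%x. L x + c"] by auto
next
 case (Suc n)
 have d: "((%x. f (L x + c)) has_derivative (%v. dir_deriv (L v) f (L x + c))) (at x)" for x
 proof (rule has_derivative_compose[of "%x. L x + c" L x UNIV f])
  show "((%x. L x + c) has_derivative L) (at x)"
   using bounded_linear_imp_has_derivative[OF L] by (auto intro!: derivative_eq_intros)
  show "(f has_derivative (%v. dir_deriv v f (L x + c))) (at (L x + c))"
   using Suc.prems by (auto intro: differentiable_dir_deriv)
 qed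
 have "dir_deriv v (%x. f (L x + c)) = (%x. dir_deriv (L v) f (L x + c))" for v
  using dir_deriv_eq[OF d] by blast
 then show ?case using Suc differentiableI[OF d] by simp
qed

text \<open>The powers of 1/x make the family closed under differentiation up to linear
  combinations, so smoothness of exp (-1/x) extended by 0 follows by induction on the order, for all
  m at once.\<close>

definition flat :: "nat => real => real"
 where "flat m x = (if x > 0 then (1 / x) ^ m * exp (- (1 / x)) else 0)"

text \<open>As h decreases to 0, 1/h tends to infinity and the exponential beats every power. This
  is differentiability at 0, the one delicate point.\<close>

lemma flat_quotient_lim: "((%h. flat m h / h) \<longlongrightarrow> 0) (at 0)"
proof -
 have "((%h. flat m h / h) \<longlongrightarrow> 0) (at_right 0)"
 proof -
  have "((%y::real. y ^ (m + 1) / exp y) \<longlongrightarrow> 0) at_top" by (rule tendsto_power_div_exp_0)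
  then have "((%h::real. inverse h ^ (m + 1) / exp (inverse h)) \<longlongrightarrow> 0) (at_right 0)"
   by (rule filterlim_compose[OF _ filterlim_inverse_at_top_right])
  then show ?thesis
  proof (rule Lim_transform_eventually)
   have "\<forall>\<^sub>F h::real in at_right 0. h > 0" by (simp add: eventually_at_right_less)
   then show "\<forall>\<^sub>F h in at_right 0. inverse h ^ (m + 1) / exp (inverse h) = flat m h / h"
    by eventually_elim (simp add: flat_def divide_inverse exp_minus mult_ac)
  qed
 qed
 moreover have "((%h. flat m h / h) \<longlongrightarrow> 0) (at_left 0)"
 proof (rule Lim_transform_eventually[OF tendsto_const])
  have "\<forall>\<^sub>F h::real in at_left 0. h < 0" by (simp add: eventually_at_filter)
  then show "\<forall>\<^sub>F h in at_left 0. 0 = flat m h / h" by eventually_elim (simp add: flat_def)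
 qed
 ultimately show ?thesis by (simp add: filterlim_at_split)
qed

lemma flat_deriv: "(flat m has_real_derivative flat (m + 2) x + (- real m) * flat (m + 1) x) (at x)"
proof -
 consider "x > 0" | "x < 0" | "x = 0" by linarith
 then show ?thesis
 proof cases
  case 1
  have i: "((%x. 1 / x) has_real_derivative - ((1 / x) ^ 2)) (at x)"
   using 1 by (auto intro!: derivative_eq_intros simp: power2_eq_square)
  have p: "((%x. (1 / x) ^ m) has_real_derivative real m * (1 / x) ^ (m - 1) * (- ((1 / x) ^ 2))) (at x)"
   using DERIV_power[OF i, of m] by (simp add: mult_ac)
  have e: "((%x. exp (- (1 / x))) has_real_derivative exp (- (1 / x)) * (1 / x) ^ 2) (at x)"
   using DERIV_chain2[OF DERIV_exp DERIV_minus[OF i]] by simp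
  have "((%x. (1 / x) ^ m * exp (- (1 / x))) has_real_derivative flat (m + 2) x + (- real m) * flat (m + 1) x) (at x)"
  proof (rule DERIV_cong[OF DERIV_mult[OF p e]])
   have "real m * (1 / x) ^ (m - 1) * (- ((1 / x) ^ 2)) = - real m * (1 / x) ^ (m + 1)"
    using 1 by (cases m) (auto simp: power2_eq_square field_simps)
   then have "real m * (1 / x) ^ (m - 1) * (- ((1 / x) ^ 2)) * exp (- (1 / x)) + exp (- (1 / x)) * (1 / x) ^ 2 * (1 / x) ^ m
    = - real m * (1 / x) ^ (m + 1) * exp (- (1 / x)) + exp (- (1 / x)) * (1 / x) ^ 2 * (1 / x) ^ m" by (simp only:)
   also have "\<dots> = flat (m + 2) x + (- real m) * flat (m + 1) x"
    using 1 by (simp add: flat_def power2_eq_square mult_ac)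
   finally show "real m * (1 / x) ^ (m - 1) * (- ((1 / x) ^ 2)) * exp (- (1 / x)) + exp (- (1 / x)) * (1 / x) ^ 2 * (1 / x) ^ m
    = flat (m + 2) x + (- real m) * flat (m + 1) x" .
  qed
  then show ?thesis
   by (rule has_field_derivative_transform_within_open[of _ _ _ "{0<..}"]) (use 1 in \<open>auto simp: flat_def\<close>)
 next
  case 2
  have "((%x. 0) has_real_derivative flat (m + 2) x + (- real m) * flat (m + 1) x) (at x)"
   using 2 by (simp add: flat_def)
  then show ?thesis
   by (rule has_field_derivative_transform_within_open[of _ _ _ "{..<0}"]) (use 2 in \<open>auto simp: flat_def\<close>)
 next
  case 3
  then show ?thesis using flat_quotient_lim[of m] by (simp add: DERIV_def flat_def)
 qed
qed

lemma flat_Ck: "Ck_on n UNIV (flat m)"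
proof (induction n arbitrary: m)
 case 0
 then show ?case
  using DERIV_isCont[OF flat_deriv] by (auto simp: continuous_on_eq_continuous_at)
next
 case (Suc n)
 have d: "(flat m has_derivative (%v. v * (flat (m + 2) x + (- real m) * flat (m + 1) x))) (at x)" for x
  using flat_deriv[of m x] by (simp add: has_field_derivative_def mult_commute_abs)
 have "dir_deriv v (flat m) = (%x. v * (flat (m + 2) x + (- real m) * flat (m + 1) x))" for v
  using dir_deriv_eq[OF d] by blast
 moreover have "Ck_on n UNIV (%x. v * (flat (m + 2) x + (- real m) * flat (m + 1) x))" for v
  by (intro Ck_on_cmult Ck_on_add Suc.IH)
 ultimately show ?case using d by (auto simp: differentiable_def)
qed

text \<open>Smooth approximations of the indicator of (a, b) with values in [0, 1]: for c > 0 the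
  value of \<open>flat 0\<close> at n c tends to 1. They transfer identities for test functions to
  intervals.\<close>

definition bump :: "real => real => nat => real => real"
 where "bump a b n x = flat 0 (real (Suc n) * (x - a)) * flat 0 (real (Suc n) * (b - x))"

lemma bump_Ck: "Ck_on m UNIV (bump a b n)"
proof -
 have "Ck_on m UNIV (%x. flat 0 (real (Suc n) * x + (- real (Suc n) * a)) * flat 0 ((- real (Suc n)) * x + real (Suc n) * b))"
  by (intro Ck_on_mult Ck_on_affine flat_Ck bounded_linear_mult_right)
 moreover have "(%x. flat 0 (real (Suc n) * x + (- real (Suc n) * a)) * flat 0 ((- real (Suc n)) * x + real (Suc n) * b)) = bump a b n"
  by (auto simp: bump_def[abs_def] algebra_simps)
 ultimately show ?thesis by simp
qed

lemma flat_0_bounds: "0 \<le> flat 0 x" "flat 0 x \<le> 1"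
 by (auto simp: flat_def)

lemma bump_bounds: "0 \<le> bump a b n x" "bump a b n x \<le> 1" "x \<notin> {a<..<b} ==> bump a b n x = 0"
proof -
 show "0 \<le> bump a b n x" unfolding bump_def using flat_0_bounds by simp
 show "bump a b n x \<le> 1" unfolding bump_def by (intro mult_le_one flat_0_bounds)
 show "bump a b n x = 0" if "x \<notin> {a<..<b}"
  using that by (auto simp: bump_def flat_def zero_less_mult_iff)
qed

lemma bump_lim: "(%n. bump a b n x) \<longlonglongrightarrow> indicator {a<..<b} x"
proof (cases "x \<in> {a<..<b}")
 case True
 have l: "(%n. flat 0 (real (Suc n) * c)) \<longlonglongrightarrow> 1" if c: "c > 0" for c
 proof -
  have "(%n. exp (- (inverse (real (Suc n)) * inverse c))) \<longlonglongrightarrow> exp (- (0 * inverse c))"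
   by (intro tendsto_intros LIMSEQ_inverse_real_of_nat)
  moreover have "flat 0 (real (Suc n) * c) = exp (- (inverse (real (Suc n)) * inverse c))" for n
   using c by (simp add: flat_def divide_inverse)
  ultimately show ?thesis by simp
 qed
 have "(%n. bump a b n x) \<longlonglongrightarrow> 1 * 1"
  unfolding bump_def by (intro tendsto_mult l) (use True in auto)
 then show ?thesis using True by simp
next
 case False
 then show ?thesis using bump_bounds(3)[OF False] by simp
qed

lemma bump_continuous: "continuous_on UNIV (bump a b n)"
 using bump_Ck[of 0] by simp

lemma bump_measurable [measurable]: "bump a b n \<in> borel_measurable borel"
 by (rule borel_measurable_continuous_onI[OF bump_continuous])

lemma bump_integrable: "integrable lborel (bump a b n)"
proof -
 have "integrable lborel (%x. indicator {a..b} x *\<^sub>R bump a b n x)"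
  by (rule borel_integrable_compact[OF _ continuous_on_subset[OF bump_continuous]]) auto
 moreover have "(%x. indicator {a..b} x *\<^sub>R bump a b n x) = bump a b n"
 proof
  fix x show "indicator {a..b} x *\<^sub>R bump a b n x = bump a b n x"
   using bump_bounds(3)[where a=a and b=b and n=n and x=x] by (cases "x \<in> {a<..<b}") auto
 qed
 ultimately show ?thesis by simp
qed

lemma bump_integral_lim: "a \<le> b ==> (%n. integral\<^sup>L lborel (bump a b n)) \<longlonglongrightarrow> b - a"
proof -
 assume ab: "a \<le> b"
 have "(%n. integral\<^sup>L lborel (bump a b n)) \<longlonglongrightarrow> integral\<^sup>L lborel (indicator {a<..<b} :: real => real)"
 proof (rule integral_dominated_convergence[where w="indicator {a<..<b}"])
  show "integrable lborel (indicator {a<..<b} :: real => real)"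
   by (rule integrable_real_indicator[OF _ emeasure_bounded_finite]) auto
  show "AE x in lborel. norm (bump a b n x) \<le> indicator {a<..<b} x" for n
  proof (rule AE_I2)
   fix x show "norm (bump a b n x) \<le> indicator {a<..<b} x"
    using bump_bounds[where a=a and b=b and n=n and x=x] by (cases "x \<in> {a<..<b}") auto
  qed
 qed (use bump_lim in auto)
 then show ?thesis using ab by simp
qed

text \<open>A compactly supported function with mean zero has a primitive that vanishes on both
  sides of its support, hence one that may serve as a test function.\<close>

lemma smooth_antiderivative:
 fixes \<zeta> :: "real => real"
 assumes sm: "\<And>n. Ck_on n UNIV \<zeta>" and i: "integrable lborel \<zeta>" and z: "integral\<^sup>L lborel \<zeta> = 0"
  and supp: "\<And>x. x \<notin> {a<..<b} ==> \<zeta> x = 0"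
 obtains B where "smooth_on UNIV B" "\<And>x. x \<notin> {a..b} ==> B x = 0"
  "\<And>x. (B has_real_derivative \<zeta> x) (at x)"
proof -
 \<comment> \<open>Integration starts left of the support, so that every x \<ge> a is interior to
   the interval [c, x + 1].\<close>
 define c where "c = a - 1"
 define B where "B x = integral {c..x} \<zeta>" for x
 have cont: "continuous_on UNIV \<zeta>" using sm[of 0] by simp
 have low: "B x = 0" if "x \<le> a" for x
 proof -
  have "B x = integral {c..x} (%_. 0::real)"
   unfolding B_def by (rule Henstock_Kurzweil_Integration.integral_cong) (use supp that in auto)
  then show ?thesis by simp
 qed
 have high: "B x = 0" if "x \<ge> b" for x
 proof -
  have "(\<zeta> has_integral 0) UNIV" using has_integral_integral_lborel[OF i] z by simp
  then have "((%y. if y \<in> {c..x} then \<zeta> y else 0) has_integral 0) UNIV"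
  proof (rule has_integral_eq[rotated])
   fix y show "\<zeta> y = (if y \<in> {c..x} then \<zeta> y else 0)"
    using supp[of y] that by (auto simp: c_def)
  qed
  then have "(\<zeta> has_integral 0) {c..x}" by (simp only: has_integral_restrict_UNIV)
  then show ?thesis unfolding B_def by (rule integral_unique)
 qed
 have d: "(B has_real_derivative \<zeta> x) (at x)" for x
 proof (cases "x < a")
  case True
  then have "((%_. 0) has_real_derivative \<zeta> x) (at x)" using supp[of x] by simp
  then show ?thesis
   by (rule has_field_derivative_transform_within_open[of _ _ _ "{..<a}"]) (use True low in auto)
 next
  case False
  have "((%u. integral {c..u} \<zeta>) has_vector_derivative \<zeta> x) (at x within {c..x+1})"
   by (rule integral_has_vector_derivative[OF continuous_on_subset[OF cont]]) (use False in \<open>auto simp: c_def\<close>)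
  moreover have "at x within {c..x+1} = at x"
   by (rule at_within_interior) (use False in \<open>auto simp: c_def\<close>)
  ultimately show ?thesis unfolding B_def[abs_def] by (simp add: has_real_derivative_iff_has_vector_derivative)
 qed
 have dd: "(B has_derivative (%v. v * \<zeta> x)) (at x)" for x
  using d[of x] by (simp add: has_field_derivative_def mult_commute_abs)
 have e: "dir_deriv v B = (%x. v * \<zeta> x)" for v using dir_deriv_eq[OF dd] by blast
 have "Ck_on (Suc n) UNIV B" for n
  using dd Ck_on_cmult[OF sm] by (auto simp: e differentiable_def)
 then have "smooth_on UNIV B" unfolding smooth_on_def using Ck_on_SucD by blast
 then show ?thesis using that low high d by (metis atLeastAtMost_iff linear)
qed

declare profile_measurable [measurable del] g_measurable [measurable del] pmA9 [measurable del] pmA10 [measurable del] B_measurable [measurable del]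

section \<open>Primitives on almost every line\<close>

lemma box_real_prod: "box (a, a') (b, b') = {a<..<b::real} \<times> {a'<..<b'::real}"
 by (auto simp: mem_box Basis_prod_def)

text \<open>The positive and negative parts of f define measures that agree on boxes. Boxes are
  stable under intersection and generate the Borel sets, so the measures agree, and then their
  densities.\<close>

lemma AE_zero_if_box_integrals_zero:
 fixes f :: "'a::euclidean_space => real"
 assumes f: "integrable lborel f"
  and z: "\<And>a b. (LBINT p. indicator (box a b) p * f p) = 0"
 shows "AE p in lborel. f p = 0"
proof -
 have fm[measurable]: "f \<in> borel_measurable borel" using borel_measurable_integrable[OF f] by simp
 define \<mu> where "\<mu> = density lborel (%p. ennreal (max 0 (f p)))"
 define \<nu> where "\<nu> = density lborel (%p. ennreal (max 0 (- f p)))"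
 have box: "emeasure \<mu> (box a b) = emeasure \<nu> (box a b)" "emeasure \<mu> (box a b) \<noteq> \<infinity>" for a b
 proof -
  have ip: "integrable lborel (%p. indicator (box a b) p *\<^sub>R max 0 (f p))"
   "integrable lborel (%p. indicator (box a b) p *\<^sub>R max 0 (- f p))"
   by (rule integrable_mult_indicator[OF _ Bochner_Integration.integrable_max]; use f in simp)+
  have gen: "emeasure (density lborel (%p. ennreal (h p))) S = ennreal (LBINT p. indicator S p *\<^sub>R h p)"
   if "integrable lborel (%p. indicator S p *\<^sub>R h p)" "h \<in> borel_measurable borel" "\<And>p. 0 \<le> h p" "S \<in> sets borel"
   for h :: "'a => real" and S
  proof -
   have "emeasure (density lborel (%p. ennreal (h p))) S = (\<integral>\<^sup>+p. ennreal (h p) * indicator S p \<partial>lborel)"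
    by (rule emeasure_density) (use that(2,4) in auto)
   also have "\<dots> = (\<integral>\<^sup>+p. ennreal (indicator S p *\<^sub>R h p) \<partial>lborel)"
   proof (rule nn_integral_cong)
    fix p show "ennreal (h p) * indicator S p = ennreal (indicator S p *\<^sub>R h p)"
     by (cases "p \<in> S") auto
   qed
   also have "\<dots> = ennreal (LBINT p. indicator S p *\<^sub>R h p)"
    by (rule nn_integral_eq_integral[OF that(1)]) (use that(3) in auto)
   finally show ?thesis .
  qed
  have e: "emeasure \<mu> (box a b) = ennreal (LBINT p. indicator (box a b) p *\<^sub>R max 0 (f p))"
   "emeasure \<nu> (box a b) = ennreal (LBINT p. indicator (box a b) p *\<^sub>R max 0 (- f p))"
   unfolding \<mu>_def \<nu>_def by (rule gen[OF ip(1)] gen[OF ip(2)]; simp)+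
  have "(LBINT p. indicator (box a b) p *\<^sub>R max 0 (f p)) - (LBINT p. indicator (box a b) p *\<^sub>R max 0 (- f p))
   = (LBINT p. indicator (box a b) p *\<^sub>R max 0 (f p) - indicator (box a b) p *\<^sub>R max 0 (- f p))"
   using ip by simp
  also have "\<dots> = (LBINT p. indicator (box a b) p * f p)"
   by (intro Bochner_Integration.integral_cong refl) (auto simp: indicator_def max_def)
  also have "\<dots> = 0" by (rule z)
  finally show "emeasure \<mu> (box a b) = emeasure \<nu> (box a b)" unfolding e by simp
  show "emeasure \<mu> (box a b) \<noteq> \<infinity>" unfolding e by simp
 qed
 have "\<mu> = \<nu>"
 proof (rule measure_eqI_generator_eq)
  let ?E = "range (%(a, b). box a b :: 'a set)"
  show "Int_stable ?E" by (auto simp: Int_stable_def Int_interval[symmetric] box_Int_box)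
  show "?E \<subseteq> Pow UNIV" by simp
  show "sets \<mu> = sigma_sets UNIV ?E" "sets \<nu> = sigma_sets UNIV ?E"
   by (simp_all add: \<mu>_def \<nu>_def borel_eq_box)
  let ?A = "%n::nat. box (- (real n *\<^sub>R One)) (real n *\<^sub>R One) :: 'a set"
  show "range ?A \<subseteq> ?E" "(\<Union>i. ?A i) = UNIV" unfolding UN_box_eq_UNIV by auto
  show "emeasure \<mu> S = emeasure \<nu> S" if "S \<in> ?E" for S using that box(1) by auto
  show "emeasure \<mu> (?A i) \<noteq> \<infinity>" for i by (rule box(2))
 qed
 then have "AE p in lborel. ennreal (max 0 (f p)) = ennreal (max 0 (- f p))"
  unfolding \<mu>_def \<nu>_def by (subst (asm) sigma_finite_measure.density_unique_iff[OF lborel.sigma_finite_measure_axioms]) auto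
 then show ?thesis
 proof eventually_elim
  case (elim p)
  then have "max 0 (f p) = max 0 (- f p)" by (subst (asm) ennreal_inj) auto
  then show ?case by (auto simp: max_def split: if_splits)
 qed
qed

lemma integrable_pair_mult:
 fixes f h :: "real => real"
 assumes f: "integrable lborel f" and h: "integrable lborel h"
 shows "integrable lborel (%p. f (fst p) * h (snd p))"
proof -
 have [measurable]: "f \<in> borel_measurable borel" "h \<in> borel_measurable borel"
  using borel_measurable_integrable f h by auto
 have "integrable (lborel \<Otimes>\<^sub>M lborel) (%p. f (fst p) * h (snd p))"
 proof (rule lborel_pair.Fubini_integrable)
  have "(%x. \<integral>y. norm (f (fst (x, y)) * h (snd (x, y))) \<partial>lborel) = (%x. norm (f x) * (LBINT y. norm (h y)))"
   by (simp add: abs_mult)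
  then show "integrable lborel (%x. \<integral>y. norm (f (fst (x, y)) * h (snd (x, y))) \<partial>lborel)"
   using f by simp
  show "AE x in lborel. integrable lborel (%y. f (fst (x, y)) * h (snd (x, y)))" using h by simp
 qed measurable
 then show ?thesis by (simp add: lborel_prod)
qed

lemma continuous_compact_support_integrable:
 fixes f :: "real => real"
 assumes "continuous_on UNIV f" "\<And>x. x \<notin> {a..b} ==> f x = 0"
 shows "integrable lborel f"
proof -
 have "integrable lborel (%x. indicator {a..b} x *\<^sub>R f x)"
  by (rule borel_integrable_compact[OF _ continuous_on_subset[OF assms(1)]]) auto
 moreover have "(%x. indicator {a..b} x *\<^sub>R f x) = f"
 proof
  fix x show "indicator {a..b} x *\<^sub>R f x = f x" using assms(2)[of x] by (cases "x \<in> {a..b}") auto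
 qed
 ultimately show ?thesis by simp
qed

text \<open>The function w is only integrable, so its primitive need not be differentiable
  everywhere. Fubini on the region s \<le> r replaces the product rule.\<close>

lemma integration_by_parts_primitive:
 fixes \<alpha> \<alpha>' w :: "real => real"
 assumes d: "\<And>x. (\<alpha> has_real_derivative \<alpha>' x) (at x)" and c: "continuous_on UNIV \<alpha>'"
  and supp: "\<And>x. x \<notin> {a..b} ==> \<alpha> x = 0" "\<And>x. x \<notin> {a..b} ==> \<alpha>' x = 0"
  and w: "integrable lborel w"
 shows "(LBINT r. \<alpha> r * w r) = - (LBINT r. \<alpha>' r * (LBINT s. indicator {..r} s * w s))"
proof -
 have [measurable]: "w \<in> borel_measurable borel" "\<alpha>' \<in> borel_measurable borel"
  using borel_measurable_integrable[OF w] borel_measurable_continuous_onI[OF c] by auto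
 have i\<alpha>': "integrable lborel \<alpha>'" by (rule continuous_compact_support_integrable[OF c supp(2)])
 define F where "F = (%(r, s). \<alpha>' r * (indicator {..r} s * w s))"
 have Fi: "integrable (lborel \<Otimes>\<^sub>M lborel) F"
 proof (rule Bochner_Integration.integrable_bound)
  show "integrable (lborel \<Otimes>\<^sub>M lborel) (%p. \<alpha>' (fst p) * w (snd p))"
   using integrable_pair_mult[OF i\<alpha>' w] by (simp add: lborel_prod)
  have "F = (%p. \<alpha>' (fst p) * ((if snd p \<le> fst p then 1 else 0) * w (snd p)))"
   by (auto simp: F_def indicator_def)
  also have "\<dots> \<in> borel_measurable (lborel \<Otimes>\<^sub>M lborel)" by measurable
  finally show "F \<in> borel_measurable (lborel \<Otimes>\<^sub>M lborel)" .
  show "AE p in lborel \<Otimes>\<^sub>M lborel. norm (F p) \<le> norm (\<alpha>' (fst p) * w (snd p))"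
   by (intro AE_I2) (auto simp: F_def indicator_def abs_mult split: prod.split)
 qed
 have inner: "(LBINT r. F (r, s)) = - (\<alpha> s * w s)" for s
 proof -
  \<comment> \<open>The upper end is at least s and not left of the support, so the integral of
    \<alpha>' from s is \<alpha> m - \<alpha> s with \<alpha> m = 0.\<close>
  define m where "m = max s b"
  have "(LBINT r. F (r, s)) = (LBINT r. (\<alpha>' r * indicator {s..m} r) * w s)"
  proof (intro Bochner_Integration.integral_cong refl)
   fix r
   show "F (r, s) = (\<alpha>' r * indicator {s..m} r) * w s"
   proof (cases "r > m")
    case True
    then have "\<alpha>' r = 0" using supp(2)[of r] by (simp add: m_def)
    then show ?thesis by (simp add: F_def)
   qed (auto simp: F_def indicator_def)
  qed
  also have "\<dots> = (LBINT r. \<alpha>' r * indicator {s..m} r) * w s" by simp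
  also have "(LBINT r. \<alpha>' r * indicator {s..m} r) = \<alpha> m - \<alpha> s"
   by (rule integral_FTC_Icc_real) (use d c in \<open>auto simp: m_def continuous_on_eq_continuous_at\<close>)
  also have "\<alpha> m = 0"
  proof (cases "m > b")
   case True then show ?thesis using supp(1)[of m] by simp
  next
   case False
   then have mb: "m = b" by (simp add: m_def)
   \<comment> \<open>At b itself the support condition is silent; \<alpha> b = 0 follows from
     continuity and the zero values to the right.\<close>
   have "isCont \<alpha> b" using d DERIV_isCont by blast
   then have "(\<alpha> \<longlongrightarrow> \<alpha> b) (at_right b)" by (simp add: isCont_def filterlim_at_split)
   moreover have "(\<alpha> \<longlongrightarrow> 0) (at_right b)"
   proof (rule Lim_transform_eventually[OF tendsto_const])
    show "\<forall>\<^sub>F x in at_right b. 0 = \<alpha> x"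
     unfolding eventually_at_filter using supp(1) by (intro always_eventually) auto
   qed
   ultimately show ?thesis unfolding mb by (rule tendsto_unique[rotated]) simp
  qed
  finally show ?thesis by simp
 qed
 have "(LBINT r. (LBINT s. F (r, s))) = (LBINT s. (LBINT r. F (r, s)))"
  using lborel_pair.Fubini_integral[of "%x y. F (x, y)"] Fi by simp
 also have "\<dots> = - (LBINT s. \<alpha> s * w s)" by (simp add: inner)
 finally show ?thesis by (simp add: F_def)
qed

text \<open>The lemma of du Bois-Reymond with a parameter: v minus the primitive of w in the first
  variable is orthogonal to all mean-zero functions of that variable, hence depends on the second
  variable only.\<close>

lemma AE_slice_primitive:
 fixes v w :: "real \<times> real => real" and a b A B :: real
 assumes ab: "a < b"
  and iv: "integrable lborel v" and iw: "integrable lborel w"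
  and v0: "\<And>p. p \<notin> {a..b} \<times> {A..B} ==> v p = 0" and w0: "\<And>p. p \<notin> {a..b} \<times> {A..B} ==> w p = 0"
  and wk: "\<And>\<alpha> \<alpha>' \<beta>. smooth_on UNIV \<alpha> ==> (\<And>x. (\<alpha> has_real_derivative \<alpha>' x) (at x)) ==> smooth_on UNIV \<beta> ==>
    (\<And>x. x \<notin> {a..b} ==> \<alpha> x = 0) ==> (\<And>x. x \<notin> {A..B} ==> \<beta> x = 0) ==>
    (LBINT p. \<alpha>' (fst p) * \<beta> (snd p) * v p) = - (LBINT p. \<alpha> (fst p) * \<beta> (snd p) * w p)"
 obtains zz where "AE p in lborel. fst p \<in> {a<..<b} \<and> snd p \<in> {A<..<B} -->
  v p = zz (snd p) + (LBINT s. indicator {..fst p} s * w (s, snd p))"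
proof -
 have vm[measurable]: "v \<in> borel_measurable borel" and wm[measurable]: "w \<in> borel_measurable borel"
  using borel_measurable_integrable iv iw by auto
 have wm2: "(%q::(real \<times> real) \<times> real. w (snd q, snd (fst q))) \<in> borel_measurable (borel \<Otimes>\<^sub>M lborel)"
 proof -
  have "(%q::(real \<times> real) \<times> real. (snd q, snd (fst q))) \<in> (borel \<Otimes>\<^sub>M lborel) \<rightarrow>\<^sub>M borel"
   unfolding borel_prod[symmetric] by measurable
  then show ?thesis by (rule measurable_compose[OF _ wm])
 qed
 define W where "W p = (LBINT s. indicator {..fst p} s * w (s, snd p))" for p
 have Wm[measurable]: "W \<in> borel_measurable borel"
 proof -
  have "(%q::(real \<times> real) \<times> real. (if snd q \<le> fst (fst q) then 1 else 0) * w (snd q, snd (fst q))) \<in> borel_measurable (borel \<Otimes>\<^sub>M lborel)"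
  proof (rule borel_measurable_times[OF _ wm2])
   have "{q::(real \<times> real) \<times> real. snd q \<le> fst (fst q)} \<in> sets (borel \<Otimes>\<^sub>M borel)"
    unfolding borel_prod by (intro borel_closed closed_Collect_le continuous_intros)
   then show "(%q::(real \<times> real) \<times> real. if snd q \<le> fst (fst q) then 1 else 0 :: real) \<in> borel_measurable (borel \<Otimes>\<^sub>M lborel)"
    by (intro measurable_If) (auto simp: space_pair_measure)
  qed
  moreover have "(if snd q \<le> fst (fst q) then 1 else 0) * w (snd q, snd (fst q)) = (%(p, s). indicator {..fst p} s * w (s, snd p)) q" for q
   by (auto simp: indicator_def split: prod.split)
  ultimately have "(%(p, s). indicator {..fst p} s * w (s, snd p)) \<in> borel_measurable (borel \<Otimes>\<^sub>M lborel)"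
   by simp
  from lborel.borel_measurable_lebesgue_integral[OF this] show ?thesis by (simp add: W_def[abs_def])
 qed
 define m where "m R = (LBINT s. norm (w (s, R)))" for R
 have iw': "integrable (lborel \<Otimes>\<^sub>M lborel) (%(x, y). w (y, x))"
  by (rule lborel_pair.integrable_product_swap) (use iw in \<open>simp add: lborel_prod\<close>)
 have mi: "integrable lborel m"
 proof -
  have "integrable (lborel \<Otimes>\<^sub>M lborel) (%(x, y). norm (w (y, x)))"
   using integrable_norm[OF iw'] by (simp add: case_prod_beta')
  from lborel_pair.integrable_fst[OF this] show ?thesis unfolding m_def[abs_def] .
 qed
 have wR: "AE R in lborel. integrable lborel (%s. w (s, R))"
  using lborel_pair.AE_integrable_fst[OF iw'] by simp
 have Wb: "AE R in lborel. \<forall>r. \<bar>W (r, R)\<bar> \<le> m R"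
  using wR
 proof eventually_elim
  case (elim R)
  show ?case
  proof
   fix r
   have "norm (W (r, R)) \<le> (LBINT s. norm (indicator {..r} s * w (s, R)))"
    unfolding W_def fst_conv snd_conv by (rule integral_norm_bound)
   also have "\<dots> \<le> m R"
    unfolding m_def
   proof (rule integral_mono)
    have "integrable lborel (%s. indicator {..r} s *\<^sub>R w (s, R))"
     by (rule integrable_mult_indicator[OF _ elim]) simp
    then show "integrable lborel (%s. norm (indicator {..r} s * w (s, R)))" by (auto intro: integrable_norm)
   qed (use elim in \<open>auto simp: indicator_def\<close>)
   finally show "\<bar>W (r, R)\<bar> \<le> m R" by simp
  qed
 qed
 have iab: "integrable lborel (indicator {a..b} :: real => real)"
  by (rule integrable_real_indicator[OF _ emeasure_bounded_finite]) auto
 \<comment> \<open>The difference that has to be shown independent of the first variable on (a,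
   b).\<close>
 define z where "z p = indicator {a..b} (fst p) * (v p - W p)" for p
 have AE_snd: "AE p::real \<times> real in lborel. Q (snd p)" if q: "AE R in lborel. Q R" for Q :: "real => bool"
 proof -
  obtain N0 where N0: "{R. \<not> Q R} \<subseteq> N0" "N0 \<in> sets lborel" "emeasure lborel N0 = 0" by (rule AE_E[OF q]) auto
  have "AE R in lborel. R \<notin> N0" by (rule AE_not_in) (use N0 in auto)
  moreover have "{p::real \<times> real. snd p \<notin> N0} \<in> sets borel"
  proof -
   have [measurable]: "N0 \<in> sets borel" using N0 by simp
   have "{p::real \<times> real \<in> space borel. snd p \<notin> N0} \<in> sets borel" by measurable
   then show ?thesis by simp
  qed
  ultimately have "AE p::real \<times> real in lborel. snd p \<notin> N0" by (intro AE_lborel_pairI) auto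
  then show ?thesis by eventually_elim (use N0 in auto)
 qed
 have zi: "integrable lborel z"
 proof -
  have 1: "integrable lborel (%p. indicator {a..b} (fst p) * W p)"
  proof (rule Bochner_Integration.integrable_bound[OF integrable_pair_mult[OF iab mi]])
   show "AE p in lborel. norm (indicator {a..b} (fst p) * W p) \<le> norm (indicator {a..b} (fst p) * m (snd p))"
    using AE_snd[OF Wb]
   proof eventually_elim
    case (elim p)
    then have "\<bar>W p\<bar> \<le> m (snd p)" by (metis prod.collapse)
    then show ?case by (auto simp: indicator_def)
   qed
  qed measurable
  have 2: "integrable lborel (%p. indicator {a..b} (fst p) * v p)"
  proof (rule Bochner_Integration.integrable_bound[OF iv])
   show "AE p in lborel. norm (indicator {a..b} (fst p) * v p) \<le> norm (v p)"
    by (auto simp: indicator_def)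
  qed measurable
  show ?thesis unfolding z_def[abs_def] right_diff_distrib by (rule Bochner_Integration.integrable_diff[OF 2 1])
 qed
 have zm[measurable]: "z \<in> borel_measurable borel" using borel_measurable_integrable[OF zi] by simp
 \<comment> \<open>A mean-zero \<zeta> is the derivative of an admissible \<alpha>; the weak
   identity for v and integration by parts on each line for W then cancel.\<close>
 have key: "(LBINT p. \<zeta> (fst p) * \<beta> (snd p) * z p) = 0"
  if \<zeta>: "\<And>n. Ck_on n UNIV \<zeta>" "integrable lborel \<zeta>" "integral\<^sup>L lborel \<zeta> = 0" "\<And>x. x \<notin> {a<..<b} ==> \<zeta> x = 0"
   and \<beta>: "smooth_on UNIV \<beta>" "\<And>x. x \<notin> {A..B} ==> \<beta> x = 0" for \<zeta> \<beta>
 proof -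
  obtain \<alpha> where \<alpha>: "smooth_on UNIV \<alpha>" "\<And>x. x \<notin> {a..b} ==> \<alpha> x = 0" "\<And>x. (\<alpha> has_real_derivative \<zeta> x) (at x)"
   using smooth_antiderivative[OF \<zeta>] by metis
  have \<zeta>c: "continuous_on UNIV \<zeta>" using \<zeta>(1)[of 0] by simp
  have \<beta>c: "continuous_on UNIV \<beta>" using smooth_on_continuous[OF \<beta>(1)] .
  have \<alpha>c: "continuous_on UNIV \<alpha>" using smooth_on_continuous[OF \<alpha>(1)] .
  have bdd: "\<exists>C. \<forall>x. \<bar>f x\<bar> \<le> C" if f: "continuous_on UNIV f" "\<And>x. x \<notin> {c..d} ==> f x = 0" for f :: "real => real" and c d
  proof -
   have "bounded (f ` {c..d})"
    by (rule compact_imp_bounded[OF compact_continuous_image[OF continuous_on_subset[OF f(1)]]]) auto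
   then obtain C where C: "C > 0" "\<And>x. x \<in> {c..d} ==> \<bar>f x\<bar> \<le> C" by (auto simp: bounded_pos)
   have "\<bar>f x\<bar> \<le> C" for x using C f(2)[of x] by (cases "x \<in> {c..d}") auto
   then show ?thesis by blast
  qed
  obtain C1 where C1: "\<And>x. \<bar>\<zeta> x\<bar> \<le> C1" using bdd[OF \<zeta>c, of a b] \<zeta>(4) by force
  obtain C2 where C2: "\<And>x. \<bar>\<beta> x\<bar> \<le> C2" using bdd[OF \<beta>c \<beta>(2)] by blast
  obtain C3 where C3: "\<And>x. \<bar>\<alpha> x\<bar> \<le> C3" using bdd[OF \<alpha>c \<alpha>(2)] by blast
  have [measurable]: "\<zeta> \<in> borel_measurable borel" "\<beta> \<in> borel_measurable borel" "\<alpha> \<in> borel_measurable borel"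
   using borel_measurable_continuous_onI \<zeta>c \<beta>c \<alpha>c by auto
  have mult_i: "integrable lborel (%p. f (fst p) * \<beta> (snd p) * h p)"
   if h: "integrable lborel h" and f: "\<And>x. \<bar>f x\<bar> \<le> C" and fm[measurable]: "f \<in> borel_measurable borel" for f C and h :: "real \<times> real => real"
  proof (rule Bochner_Integration.integrable_bound)
   show "integrable lborel (%p. (C * C2) * h p)" using h by simp
   have [measurable]: "h \<in> borel_measurable borel" using borel_measurable_integrable[OF h] by simp
   show "(%p. f (fst p) * \<beta> (snd p) * h p) \<in> borel_measurable lborel" by measurable
   show "AE p in lborel. norm (f (fst p) * \<beta> (snd p) * h p) \<le> norm ((C * C2) * h p)"
   proof (rule AE_I2)
    fix p :: "real \<times> real"
    have "\<bar>f (fst p)\<bar> * \<bar>\<beta> (snd p)\<bar> * \<bar>h p\<bar> \<le> C * C2 * \<bar>h p\<bar>"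
     by (intro mult_right_mono mult_mono f C2) (auto intro: order_trans[OF abs_ge_zero f[of 0]])
    also have "\<dots> \<le> \<bar>C * C2\<bar> * \<bar>h p\<bar>" by (intro mult_right_mono) auto
    finally show "norm (f (fst p) * \<beta> (snd p) * h p) \<le> norm ((C * C2) * h p)" by (simp add: abs_mult)
   qed
  qed
  have i1: "integrable lborel (%p. \<alpha> (fst p) * \<beta> (snd p) * w p)" by (rule mult_i[OF iw C3]) measurable
  have i2: "integrable lborel (%p. \<zeta> (fst p) * \<beta> (snd p) * v p)" by (rule mult_i[OF iv C1]) measurable
  have i3: "integrable lborel (%p. \<zeta> (fst p) * \<beta> (snd p) * z p)" by (rule mult_i[OF zi C1]) measurable
  have zeq: "\<zeta> (fst p) * \<beta> (snd p) * z p = \<zeta> (fst p) * \<beta> (snd p) * v p - \<zeta> (fst p) * \<beta> (snd p) * W p" for p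
   using \<zeta>(4)[of "fst p"] by (cases "fst p \<in> {a<..<b}") (auto simp: z_def algebra_simps)
  have i4: "integrable lborel (%p. \<zeta> (fst p) * \<beta> (snd p) * W p)"
   using Bochner_Integration.integrable_diff[OF i2 i3] unfolding zeq by simp
  have fub: "(LBINT p. h p) = (LBINT R. (LBINT r. h (r, R)))" if "integrable lborel h" for h :: "real \<times> real => real"
   using lborel_pair.integral_snd[of "%x y. h (x, y)"] that by (simp add: lborel_prod)
  have "(LBINT p. \<alpha> (fst p) * \<beta> (snd p) * w p) = (LBINT R. (LBINT r. \<alpha> r * \<beta> R * w (r, R)))"
   using fub[OF i1] by simp
  also have "\<dots> = (LBINT R. - (LBINT r. \<zeta> r * \<beta> R * W (r, R)))"
  proof (rule integral_cong_AE)
   have 1: "(%p. \<alpha> (snd p) * \<beta> (fst p) * w (snd p, fst p)) \<in> borel_measurable (borel \<Otimes>\<^sub>M lborel)"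
    "(%p. \<zeta> (snd p) * \<beta> (fst p) * W (snd p, fst p)) \<in> borel_measurable (borel \<Otimes>\<^sub>M lborel)"
   proof -
    have sw: "(%p::real \<times> real. (snd p, fst p)) \<in> (borel \<Otimes>\<^sub>M lborel) \<rightarrow>\<^sub>M borel"
     unfolding borel_prod[symmetric] by measurable
    show "(%p. \<alpha> (snd p) * \<beta> (fst p) * w (snd p, fst p)) \<in> borel_measurable (borel \<Otimes>\<^sub>M lborel)"
     by (rule borel_measurable_times[OF _ measurable_compose[OF sw wm]]) measurable
    show "(%p. \<zeta> (snd p) * \<beta> (fst p) * W (snd p, fst p)) \<in> borel_measurable (borel \<Otimes>\<^sub>M lborel)"
     by (rule borel_measurable_times[OF _ measurable_compose[OF sw Wm]]) measurable
   qed
   show "(%R. \<integral>r. \<alpha> r * \<beta> R * w (r, R) \<partial>lborel) \<in> borel_measurable lborel"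
    using lborel.borel_measurable_lebesgue_integral[of "%R r. \<alpha> r * \<beta> R * w (r, R)" borel] 1(1) by (simp add: case_prod_beta')
   show "(%R. - (LBINT r. \<zeta> r * \<beta> R * W (r, R))) \<in> borel_measurable lborel"
    using lborel.borel_measurable_lebesgue_integral[of "%R r. \<zeta> r * \<beta> R * W (r, R)" borel] 1(2) by (simp add: case_prod_beta')
   show "AE R in lborel. (LBINT r. \<alpha> r * \<beta> R * w (r, R)) = - (LBINT r. \<zeta> r * \<beta> R * W (r, R))"
    using wR
   proof eventually_elim
    case (elim R)
    have z0: "\<zeta> x = 0" if "x \<notin> {a..b}" for x using \<zeta>(4)[of x] that by auto
    have "(LBINT r. \<alpha> r * w (r, R)) = - (LBINT r. \<zeta> r * W (r, R))"
     using integration_by_parts_primitive[OF \<alpha>(3) \<zeta>c \<alpha>(2) z0 elim] by (simp add: W_def)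
    then have "\<beta> R * (LBINT r. \<alpha> r * w (r, R)) = - (\<beta> R * (LBINT r. \<zeta> r * W (r, R)))" by simp
    then have "(LBINT r. \<beta> R * (\<alpha> r * w (r, R))) = - (LBINT r. \<beta> R * (\<zeta> r * W (r, R)))"
     by (simp only: integral_mult_right_zero)
    then show ?case by (simp add: mult_ac)
   qed
  qed
  also have "\<dots> = - (LBINT p. \<zeta> (fst p) * \<beta> (snd p) * W p)"
   using fub[OF i4] by simp
  finally have "(LBINT p. \<alpha> (fst p) * \<beta> (snd p) * w p) = - (LBINT p. \<zeta> (fst p) * \<beta> (snd p) * W p)" .
  moreover have "(LBINT p. \<zeta> (fst p) * \<beta> (snd p) * v p) = - (LBINT p. \<alpha> (fst p) * \<beta> (snd p) * w p)"
   by (rule wk[OF \<alpha>(1) \<alpha>(3) \<beta>(1) \<alpha>(2) \<beta>(2)])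
  ultimately show ?thesis unfolding zeq using i2 i4 by simp
 qed
 have lim: "(LBINT p. ((b - a) * indicator {p1<..<q1} (fst p) - (q1 - p1) * indicator {a<..<b} (fst p)) * indicator {A'<..<B'} (snd p) * z p) = 0"
  if pq: "a \<le> p1" "p1 \<le> q1" "q1 \<le> b" and AB: "A \<le> A'" "B' \<le> B" for p1 q1 A' B'
 proof -
  define c1 where "c1 n = integral\<^sup>L lborel (bump p1 q1 n)" for n
  define c2 where "c2 n = integral\<^sup>L lborel (bump a b n)" for n
  \<comment> \<open>Weighting each bump with the integral of the other, with opposite signs,
    produces a mean-zero combination whose limit involves indicators of intervals.\<close>
  define \<zeta> where "\<zeta> n x = c2 n * bump p1 q1 n x + (- c1 n) * bump a b n x" for n x
  define T where "T n p = \<zeta> n (fst p) * bump A' B' n (snd p) * z p" for n p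
  have 0: "integral\<^sup>L lborel (T n) = 0" for n
   unfolding T_def
  proof (rule key)
   show "Ck_on m UNIV (\<zeta> n)" for m unfolding \<zeta>_def[abs_def] by (intro Ck_on_add Ck_on_cmult bump_Ck)
   show "integrable lborel (\<zeta> n)" unfolding \<zeta>_def[abs_def] using bump_integrable by simp
   show "integral\<^sup>L lborel (\<zeta> n) = 0" unfolding \<zeta>_def[abs_def] using bump_integrable by (simp add: c1_def c2_def)
   show "\<zeta> n x = 0" if "x \<notin> {a<..<b}" for x
    using bump_bounds(3)[of x a b n] bump_bounds(3)[of x p1 q1 n] that pq by (auto simp: \<zeta>_def)
   show "smooth_on UNIV (bump A' B' n)" using bump_Ck by (simp add: smooth_on_def)
   show "bump A' B' n x = 0" if "x \<notin> {A..B}" for x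
    using bump_bounds(3)[of x A' B' n] that AB by auto
  qed
  have c1l: "c1 \<longlonglongrightarrow> q1 - p1" unfolding c1_def by (rule bump_integral_lim[OF pq(2)])
  have c2l: "c2 \<longlonglongrightarrow> b - a" unfolding c2_def by (rule bump_integral_lim) (use ab in simp)
  obtain D1 where D1: "\<And>n. \<bar>c1 n\<bar> \<le> D1" using convergent_imp_Bseq[of c1] c1l by (auto simp: convergent_def Bseq_def)
  obtain D2 where D2: "\<And>n. \<bar>c2 n\<bar> \<le> D2" using convergent_imp_Bseq[of c2] c2l by (auto simp: convergent_def Bseq_def)
  have "(%n. integral\<^sup>L lborel (T n)) \<longlonglongrightarrow> (LBINT p. ((b - a) * indicator {p1<..<q1} (fst p) + (- (q1 - p1)) * indicator {a<..<b} (fst p)) * indicator {A'<..<B'} (snd p) * z p)"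
  proof (rule integral_dominated_convergence)
   show "integrable lborel (%p. (D1 + D2) * norm (z p))" using zi by simp
   show "(%p. ((b - a) * indicator {p1<..<q1} (fst p) + (- (q1 - p1)) * indicator {a<..<b} (fst p)) * indicator {A'<..<B'} (snd p) * z p) \<in> borel_measurable lborel"
    by measurable
   show "T n \<in> borel_measurable lborel" for n unfolding T_def[abs_def] \<zeta>_def by measurable
   show "AE p in lborel. (%n. T n p) \<longlonglongrightarrow> ((b - a) * indicator {p1<..<q1} (fst p) + (- (q1 - p1)) * indicator {a<..<b} (fst p)) * indicator {A'<..<B'} (snd p) * z p"
    unfolding T_def \<zeta>_def by (intro AE_I2 tendsto_intros c1l c2l bump_lim)
   show "AE p in lborel. norm (T n p) \<le> (D1 + D2) * norm (z p)" for n
   proof (rule AE_I2)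
    fix p :: "real \<times> real"
    have "\<bar>\<zeta> n (fst p)\<bar> \<le> \<bar>c2 n\<bar> * \<bar>bump p1 q1 n (fst p)\<bar> + \<bar>c1 n\<bar> * \<bar>bump a b n (fst p)\<bar>"
     unfolding \<zeta>_def by (rule order_trans[OF abs_triangle_ineq]) (simp add: abs_mult)
    also have "\<dots> \<le> D2 * 1 + D1 * 1"
     using bump_bounds(1,2) D1[of n] D2[of n] by (intro add_mono mult_mono) (auto intro: order_trans[OF abs_ge_zero])
    finally have "\<bar>\<zeta> n (fst p)\<bar> \<le> D1 + D2" by simp
    then have "\<bar>\<zeta> n (fst p)\<bar> * \<bar>bump A' B' n (snd p)\<bar> * \<bar>z p\<bar> \<le> (D1 + D2) * 1 * \<bar>z p\<bar>"
     using bump_bounds(1,2) by (intro mult_right_mono mult_mono) (auto intro: order_trans[OF abs_ge_zero])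
    then show "norm (T n p) \<le> (D1 + D2) * norm (z p)" by (simp add: T_def abs_mult)
   qed
  qed
  then show ?thesis unfolding 0 LIMSEQ_const_iff mult_minus_left add_uminus_conv_diff by (rule sym)
 qed
 \<comment> \<open>The only candidate for a function of R alone: the average of z over (a,
   b).\<close>
 define zz where "zz R = (LBINT r. z (r, R)) / (b - a)" for R
 have zsw: "integrable (lborel \<Otimes>\<^sub>M lborel) (%(x, y). z (y, x))"
  by (rule lborel_pair.integrable_product_swap) (use zi in \<open>simp add: lborel_prod\<close>)
 have zzi: "integrable lborel zz"
  unfolding zz_def[abs_def] using lborel_pair.integrable_fst[OF zsw] by simp
 define f where "f p = indicator {a<..<b} (fst p) * indicator {A<..<B} (snd p) * (z p - zz (snd p))" for p
 have ioo: "integrable lborel (indicator {c<..<d} :: real => real)" "integral\<^sup>L lborel (indicator {c<..<d} :: real => real) = max 0 (d - c)" for c d :: real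
 proof -
  show "integrable lborel (indicator {c<..<d} :: real => real)"
   by (rule integrable_real_indicator[OF _ emeasure_bounded_finite]) auto
  show "integral\<^sup>L lborel (indicator {c<..<d} :: real => real) = max 0 (d - c)" by (cases "c \<le> d") auto
 qed
 have indz: "integrable lborel (%p. indicator {c<..<d} (fst p) * indicator {c'<..<d'} (snd p) * z p)" for c d c' d'
 proof (rule Bochner_Integration.integrable_bound[OF zi])
  show "AE p in lborel. norm (indicator {c<..<d} (fst p) * indicator {c'<..<d'} (snd p) * z p) \<le> norm (z p)"
   by (auto simp: indicator_def)
 qed measurable
 have zzm[measurable]: "zz \<in> borel_measurable borel" using borel_measurable_integrable[OF zzi] by simp
 have izz: "integrable lborel (%R. indicator {c'<..<d'} R * zz R)" for c' d' :: real
 proof (rule Bochner_Integration.integrable_bound[OF zzi])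
  show "AE R in lborel. norm (indicator {c'<..<d'} R * zz R) \<le> norm (zz R)" by (auto simp: indicator_def)
 qed (rule borel_measurable_times; use zzm in simp)
 have indzz: "integrable lborel (%p. indicator {c<..<d} (fst p) * (indicator {c'<..<d'} (snd p) * zz (snd p)))" for c d c' d' :: real
  by (rule integrable_pair_mult[OF ioo(1) izz])
 have fub: "(LBINT p. h p) = (LBINT R. (LBINT r. h (r, R)))" if "integrable lborel h" for h :: "real \<times> real => real"
  using lborel_pair.integral_snd[of "%x y. h (x, y)"] that by (simp add: lborel_prod)
 have fi: "integrable lborel f"
  using Bochner_Integration.integrable_diff[OF indz[of a b A B] indzz[of a b A B]]
  by (simp add: f_def[abs_def] algebra_simps)
 have zab: "AE p in lborel. indicator {a<..<b} (fst p) * z p = z p"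
 proof (rule AE_lborel_pairI)
  have "{p \<in> space borel. indicator {a<..<b} (fst p) * z p = z p} \<in> sets borel" by measurable
  then show "{p. indicator {a<..<b} (fst p) * z p = z p} \<in> sets borel" by simp
  show "AE x in lborel. AE y in lborel. indicator {a<..<b} (fst (x, y)) * z (x, y) = z (x, y)"
   using AE_lborel_singleton[of a] AE_lborel_singleton[of b]
   by eventually_elim (auto simp: z_def indicator_def)
 qed
 have "AE p in lborel. f p = 0"
 proof (rule AE_zero_if_box_integrals_zero[OF fi])
  fix lo hi :: "real \<times> real"
  obtain c c' d d' where lohi: "lo = (c, c')" "hi = (d, d')" by force
  \<comment> \<open>The box is clipped to the rectangle; the maximum with p1 turns an empty
    intersection into an interval of length 0.\<close>
  define p1 q1 A' B' where "p1 = max a c" and "q1 = max p1 (min b d)" and "A' = max A c'" and "B' = min B d'"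
  have "(LBINT p. indicator ({c<..<d} \<times> {c'<..<d'}) p * f p) = 0"
  proof (cases "p1 \<le> b")
   case False
   then have "indicator ({c<..<d} \<times> {c'<..<d'}) p * f p = 0" for p
    using ab by (auto simp: f_def indicator_def p1_def)
   then have "(%p. indicator ({c<..<d} \<times> {c'<..<d'}) p * f p) = (%p. 0)" by (rule ext)
   then show ?thesis by (simp only: integral_zero)
  next
   case True
   have pq: "a \<le> p1" "p1 \<le> q1" "q1 \<le> b" "A \<le> A'" "B' \<le> B" using True ab by (auto simp: p1_def q1_def A'_def B'_def)
   have e1: "indicator ({c<..<d} \<times> {c'<..<d'}) p * f p = indicator {p1<..<q1} (fst p) * indicator {A'<..<B'} (snd p) * z p
    - indicator {p1<..<q1} (fst p) * (indicator {A'<..<B'} (snd p) * zz (snd p))" for p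
   proof -
    have "indicator ({c<..<d} \<times> {c'<..<d'}) p * (indicator {a<..<b} (fst p) * indicator {A<..<B} (snd p))
     = (indicator {p1<..<q1} (fst p) * indicator {A'<..<B'} (snd p) :: real)"
     by (cases p) (auto simp: indicator_def p1_def q1_def A'_def B'_def split: if_splits)
    then show ?thesis unfolding f_def by (simp add: mult.assoc[symmetric] right_diff_distrib)
   qed
   have "(LBINT p. indicator {p1<..<q1} (fst p) * (indicator {A'<..<B'} (snd p) * zz (snd p)))
    = (LBINT R. (q1 - p1) * (indicator {A'<..<B'} R * zz R))"
    using fub[OF indzz[of p1 q1 A' B']] ioo(2)[of p1 q1] pq(2) by simp
   also have "\<dots> = (LBINT R. (q1 - p1) / (b - a) * (LBINT r. indicator {A'<..<B'} R * z (r, R)))"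
    by (intro Bochner_Integration.integral_cong refl) (simp add: zz_def)
   also have "\<dots> = (q1 - p1) / (b - a) * (LBINT R. (LBINT r. indicator {A'<..<B'} R * z (r, R)))" by simp
   also have "(LBINT R. (LBINT r. indicator {A'<..<B'} R * z (r, R))) = (LBINT p. indicator {A'<..<B'} (snd p) * z p)"
   proof -
    have "integrable lborel (%p. indicator {A'<..<B'} (snd p) * z p)"
    proof (rule Bochner_Integration.integrable_bound[OF zi])
     show "AE p in lborel. norm (indicator {A'<..<B'} (snd p) * z p) \<le> norm (z p)" by (auto simp: indicator_def)
    qed measurable
    from fub[OF this] show ?thesis by simp
   qed
   also have "\<dots> = (LBINT p. indicator {a<..<b} (fst p) * indicator {A'<..<B'} (snd p) * z p)"
   proof (rule integral_cong_AE)
    show "AE p in lborel. indicator {A'<..<B'} (snd p) * z p = indicator {a<..<b} (fst p) * indicator {A'<..<B'} (snd p) * z p"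
     using zab by eventually_elim (auto simp: indicator_def)
   qed measurable
   finally have e2: "(b - a) * (LBINT p. indicator {p1<..<q1} (fst p) * (indicator {A'<..<B'} (snd p) * zz (snd p)))
    = (q1 - p1) * (LBINT p. indicator {a<..<b} (fst p) * indicator {A'<..<B'} (snd p) * z p)"
    using ab by simp
   have "(LBINT p. (b - a) * (indicator {p1<..<q1} (fst p) * indicator {A'<..<B'} (snd p) * z p)
    - (q1 - p1) * (indicator {a<..<b} (fst p) * indicator {A'<..<B'} (snd p) * z p)) = 0"
    using lim[OF pq] by (simp add: algebra_simps)
   then have e3: "(b - a) * (LBINT p. indicator {p1<..<q1} (fst p) * indicator {A'<..<B'} (snd p) * z p)
    = (q1 - p1) * (LBINT p. indicator {a<..<b} (fst p) * indicator {A'<..<B'} (snd p) * z p)"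
    using indz by simp
   have "(b - a) * (LBINT p. indicator ({c<..<d} \<times> {c'<..<d'}) p * f p) = 0"
    unfolding e1 using indz indzz e2 e3 by (simp add: right_diff_distrib)
   then show ?thesis using ab by simp
  qed
  then show "(LBINT p. indicator (box lo hi) p * f p) = 0" unfolding lohi box_real_prod .
 qed
 then have "AE p in lborel. fst p \<in> {a<..<b} \<and> snd p \<in> {A<..<B} --> v p = zz (snd p) + (LBINT s. indicator {..fst p} s * w (s, snd p))"
  by eventually_elim (auto simp: f_def z_def W_def indicator_def split: if_splits)
 then show ?thesis by (rule that)
qed

section \<open>Shears of the plane and null sets on lines\<close>

text \<open>On each vertical line the shear is a translation, so Tonelli gives invariance of the
  measure.\<close>

lemma emeasure_shear:
 fixes S :: "(real \<times> real) set"
 assumes S: "S \<in> sets borel"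
 shows "emeasure lborel ((%p. (fst p, snd p + c * fst p)) -` S) = emeasure lborel S"
proof -
 have Sm[measurable]: "(indicator S :: real \<times> real => ennreal) \<in> borel_measurable borel" using S by simp
 have shm: "(%p::real \<times> real. (fst p, snd p + c * fst p)) \<in> borel \<rightarrow>\<^sub>M borel"
  by (intro borel_measurable_continuous_onI continuous_intros)
 have vS: "(%p::real \<times> real. (fst p, snd p + c * fst p)) -` S \<in> sets borel"
  using measurable_sets[OF shm S] by simp
 have fub: "emeasure lborel A = (\<integral>\<^sup>+x. \<integral>\<^sup>+y. indicator A (x, y) \<partial>lborel \<partial>lborel)" if A: "A \<in> sets borel" for A :: "(real \<times> real) set"
 proof -
  have "emeasure lborel A = (\<integral>\<^sup>+p. indicator A p \<partial>(lborel \<Otimes>\<^sub>M lborel))"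
   using A by (simp add: lborel_prod)
  also have "\<dots> = (\<integral>\<^sup>+x. \<integral>\<^sup>+y. indicator A (x, y) \<partial>lborel \<partial>lborel)"
   by (rule lborel.nn_integral_fst[symmetric]) (use A in \<open>simp add: lborel_prod\<close>)
  finally show ?thesis .
 qed
 have "(\<integral>\<^sup>+y. indicator S (x, y + c * x) \<partial>lborel) = (\<integral>\<^sup>+y. indicator S (x, y) \<partial>lborel)" for x
 proof -
  have m: "(%y. indicator S (x, y) :: ennreal) \<in> borel_measurable borel"
   by (rule measurable_compose[OF _ Sm]) (intro borel_measurable_continuous_onI continuous_intros)
  show ?thesis using nn_integral_real_affine[OF m, of 1 "c * x"] by (simp add: add.commute)
 qed
 then show ?thesis unfolding fub[OF vS] fub[OF S] by (simp add: indicator_vimage[symmetric] indicator_def)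
qed

lemma distr_shear: "distr lborel borel (%p. (fst p, snd p + c * fst p)) = (lborel :: (real \<times> real) measure)"
proof (rule measure_eqI)
 fix S :: "(real \<times> real) set" assume "S \<in> sets (distr lborel borel (%p. (fst p, snd p + c * fst p)))"
 then have S: "S \<in> sets borel" by simp
 have "(%p::real \<times> real. (fst p, snd p + c * fst p)) \<in> borel \<rightarrow>\<^sub>M borel"
  by (intro borel_measurable_continuous_onI continuous_intros)
 then show "emeasure (distr lborel borel (%p. (fst p, snd p + c * fst p))) S = emeasure lborel S"
  using emeasure_shear[OF S, of c] S by (subst emeasure_distr) auto
qed simp

lemma shear_measurable: "(%p::real \<times> real. (fst p, snd p + c * fst p)) \<in> lborel \<rightarrow>\<^sub>M borel"
proof -
 have "(%p::real \<times> real. (fst p, snd p + c * fst p)) \<in> borel \<rightarrow>\<^sub>M borel"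
  by (intro borel_measurable_continuous_onI continuous_intros)
 then show ?thesis by simp
qed

lemma integral_shear:
 fixes f :: "real \<times> real => real"
 assumes f: "f \<in> borel_measurable borel"
 shows "integrable lborel (%p. f (fst p, snd p + c * fst p)) \<longleftrightarrow> integrable lborel f"
  and "(LBINT p. f (fst p, snd p + c * fst p)) = (LBINT p. f p)"
 using integrable_distr_eq[OF shear_measurable f, of c] integral_distr[OF shear_measurable f, of c]
 unfolding distr_shear by simp_all

lemma AE_shear:
 fixes Q :: "real \<times> real => bool"
 assumes Q: "{p. Q p} \<in> sets borel"
 shows "(AE p in lborel. Q (fst p, snd p + c * fst p)) \<longleftrightarrow> (AE p in lborel. Q p)"
 using AE_distr_iff[OF shear_measurable, of Q c] Q unfolding distr_shear by simp

lemma AE_swap: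
 fixes Q :: "real \<times> real => bool"
 assumes Q: "{p. Q p} \<in> sets borel"
 shows "(AE p in lborel. Q (snd p, fst p)) \<longleftrightarrow> (AE p in lborel. Q p)"
proof -
 have sw: "(%p::real \<times> real. (snd p, fst p)) \<in> borel \<rightarrow>\<^sub>M borel"
  by (intro borel_measurable_continuous_onI continuous_intros)
 have "distr (lborel \<Otimes>\<^sub>M lborel) (lborel \<Otimes>\<^sub>M lborel) (%(x, y). (y, x)) = (lborel \<Otimes>\<^sub>M lborel :: (real \<times> real) measure)"
  by (rule lborel_pair.distr_pair_swap[symmetric])
 then have sw': "distr lborel lborel (%(x, y). (y, x)) = (lborel :: (real \<times> real) measure)"
  unfolding lborel_prod .
 have "distr lborel borel (%p::real \<times> real. (snd p, fst p)) = distr lborel lborel (%(x, y). (y, x))"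
  by (rule distr_cong) auto
 with sw' have e: "distr lborel borel (%p. (snd p, fst p)) = (lborel :: (real \<times> real) measure)" by (rule trans[rotated])
 have "almost_everywhere (distr lborel borel (%p. (snd p, fst p))) Q \<longleftrightarrow> (AE p in lborel. Q (snd p, fst p))"
  by (rule AE_distr_iff) (use sw Q in auto)
 then show ?thesis unfolding e by blast
qed

text \<open>The predicate Q may define a set that is not Borel; a Borel null set containing the
  exceptional points is swapped in its place.\<close>

lemma AE_swapD:
 fixes Q :: "real \<times> real => bool"
 assumes q: "AE p in lborel. Q p"
 shows "AE p in lborel. Q (snd p, fst p)"
proof -
 obtain M where M: "{p \<in> space lborel. \<not> Q p} \<subseteq> M" "emeasure lborel M = 0" "M \<in> sets lborel" by (rule AE_E[OF q])
 have "AE p in lborel. p \<notin> M" by (rule AE_not_in) (use M in auto)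
 moreover have "{p. p \<notin> M} \<in> sets borel" using M(3) by (simp add: Compl_eq[symmetric])
 ultimately have "AE p in lborel. (snd p, fst p) \<notin> M" using AE_swap[of "%p. p \<notin> M"] by simp
 then show ?thesis by eventually_elim (use M(1) in auto)
qed

text \<open>Almost everywhere along almost every characteristic \<open>r + t = const\<close> is almost everywhere.\<close>

lemma AE_characteristics:
 fixes Q :: "real \<times> real => bool"
 assumes Q: "{p. Q p} \<in> sets borel" and *: "AE R in lborel. AE r in lborel. Q (r, R - r)"
 shows "AE p in lborel. Q p" "AE t in lborel. AE r in lborel. Q (r, t)"
proof -
 have m: "(%p::real \<times> real. (fst p, snd p + c * fst p)) \<in> borel \<rightarrow>\<^sub>M borel"
  "(%p::real \<times> real. (snd p, fst p)) \<in> borel \<rightarrow>\<^sub>M borel" for c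
  by (intro borel_measurable_continuous_onI continuous_intros)+
 have 1: "{p. Q (fst p, snd p + (-1) * fst p)} \<in> sets borel"
  using measurable_sets[OF m(1)[of "-1"] Q] by (simp add: vimage_def)
 \<comment> \<open>In coordinates (r, R) the point (r, R - r) is the image under the shear with
   slope -1. The swap comes in because the hypothesis quantifies over R first.\<close>
 have 2: "{p. Q (fst (snd p, fst p), snd (snd p, fst p) + (-1) * fst (snd p, fst p))} \<in> sets borel"
  using measurable_sets[OF m(2) 1] by (simp add: vimage_def)
 have "AE p in lborel. Q (fst (snd p, fst p), snd (snd p, fst p) + (-1) * fst (snd p, fst p))"
  by (rule AE_lborel_pairI[OF 2]) (use * in simp)
 then have "AE p in lborel. Q (fst p, snd p + (-1) * fst p)" using AE_swap[OF 1] by simp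
 then show "AE p in lborel. Q p" using AE_shear[OF Q, of "-1"] by blast
 then have "AE p in lborel. Q (snd p, fst p)" using AE_swap[OF Q] by blast
 from AE_lborel_pairD[OF this] show "AE t in lborel. AE r in lborel. Q (r, t)" by simp
qed

text \<open>Pointwise \<open>2 |w| \<le> \<lambda> + w\<^sup>2 / \<lambda>\<close> with \<open>\<lambda> = (y - x)\<^sup>-\<^sup>1\<^sup>/\<^sup>2\<close>
 replaces the Cauchy-Schwarz inequality.\<close>

lemma primitive_holder:
 fixes w :: "real => real"
 assumes w[measurable]: "w \<in> borel_measurable borel"
  and C: "(\<integral>\<^sup>+s\<in>{a<..<b}. ennreal ((w s)\<^sup>2) \<partial>lborel) \<le> ennreal C" and C0: "C \<ge> 0"
  and xy: "a \<le> x" "x \<le> y" "y \<le> b"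
 shows "integrable lborel (%s. indicator {x<..<y} s * w s)"
  and "\<bar>\<integral>s. indicator {x<..<y} s * w s \<partial>lborel\<bar> \<le> (1 + C) / 2 * sqrt (y - x)"
proof -
 have *: "integrable lborel (%s. indicator {x<..<y} s * w s) \<and>
  \<bar>\<integral>s. indicator {x<..<y} s * w s \<partial>lborel\<bar> \<le> (1 + C) / 2 * sqrt (y - x)"
 proof (cases "x = y")
  case True then show ?thesis by simp
 next
  case False
  define q where "q = sqrt (y - x)"
  have q: "q > 0" "q * q = y - x" using False xy by (auto simp: q_def)
  define h where "h s = indicator {x<..<y} s * (1 / q + q * (w s)\<^sup>2) / 2" for s
  have hm[measurable]: "h \<in> borel_measurable borel" unfolding h_def[abs_def] by measurable
  have h0: "0 \<le> h s" for s using q(1) by (auto simp: h_def indicator_def)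
  have hw: "\<bar>indicator {x<..<y} s * w s\<bar> \<le> h s" for s
  proof -
   have "0 \<le> (1 - q * \<bar>w s\<bar>)\<^sup>2" by simp
   then have "2 * q * \<bar>w s\<bar> \<le> 1 + q * q * (w s)\<^sup>2" by (simp add: power2_eq_square algebra_simps)
   then have "\<bar>w s\<bar> \<le> (1 / q + q * (w s)\<^sup>2) / 2" using q(1) by (simp add: field_simps)
   then show ?thesis by (auto simp: h_def indicator_def)
  qed
  have "(\<integral>\<^sup>+s. ennreal (h s) \<partial>lborel) =
   (\<integral>\<^sup>+s. ennreal (1 / (2 * q)) * indicator {x<..<y} s + ennreal (q / 2) * (ennreal ((w s)\<^sup>2) * indicator {x<..<y} s) \<partial>lborel)"
  proof (rule nn_integral_cong)
   fix s
   show "ennreal (h s) = ennreal (1 / (2 * q)) * indicator {x<..<y} s + ennreal (q / 2) * (ennreal ((w s)\<^sup>2) * indicator {x<..<y} s)"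
    using q(1) by (cases "s \<in> {x<..<y}") (auto simp: h_def ennreal_plus[symmetric] ennreal_mult[symmetric] field_simps simp del: ennreal_plus)
  qed
  also have "\<dots> = ennreal (1 / (2 * q)) * ennreal (y - x) + ennreal (q / 2) * (\<integral>\<^sup>+s\<in>{x<..<y}. ennreal ((w s)\<^sup>2) \<partial>lborel)"
   using xy by (simp add: nn_integral_add nn_integral_cmult)
  also have "(\<integral>\<^sup>+s\<in>{x<..<y}. ennreal ((w s)\<^sup>2) \<partial>lborel) \<le> (\<integral>\<^sup>+s\<in>{a<..<b}. ennreal ((w s)\<^sup>2) \<partial>lborel)"
   using xy by (intro nn_integral_mono) (auto simp: indicator_def)
  also have "\<dots> \<le> ennreal C" by (rule C)
  also have "ennreal (1 / (2 * q)) * ennreal (y - x) + ennreal (q / 2) * ennreal C = ennreal ((1 + C) / 2 * q)"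
   using q C0 xy by (simp add: ennreal_plus[symmetric] ennreal_mult[symmetric] q(2)[symmetric] field_simps del: ennreal_plus)
  finally have le: "(\<integral>\<^sup>+s. ennreal (h s) \<partial>lborel) \<le> ennreal ((1 + C) / 2 * q)"
   by (simp add: add_left_mono mult_left_mono)
  have hi: "integrable lborel h"
   by (rule integrableI_nonneg) (use h0 le in \<open>auto intro: le_less_trans\<close>)
  have "(LBINT s. h s) = enn2real (\<integral>\<^sup>+s. ennreal (h s) \<partial>lborel)"
   by (rule integral_eq_nn_integral) (use h0 in auto)
  also have "\<dots> \<le> (1 + C) / 2 * q"
   by (rule enn2real_leI) (use le q(1) C0 in auto)
  finally have "(LBINT s. h s) \<le> (1 + C) / 2 * q" .
  moreover have i: "integrable lborel (%s. indicator {x<..<y} s * w s)"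
   by (rule Bochner_Integration.integrable_bound[OF hi]) (use hw h0 in auto)
  moreover have "\<bar>\<integral>s. indicator {x<..<y} s * w s \<partial>lborel\<bar> \<le> (LBINT s. h s)"
  proof -
   have "\<bar>\<integral>s. indicator {x<..<y} s * w s \<partial>lborel\<bar> \<le> (LBINT s. \<bar>indicator {x<..<y} s * w s\<bar>)"
    by (rule integral_abs_bound)
   also have "\<dots> \<le> (LBINT s. h s)"
    by (rule integral_mono[OF integrable_abs[OF i] hi hw])
   finally show ?thesis .
  qed
  ultimately show ?thesis by (simp add: q_def)
 qed
 then show "integrable lborel (%s. indicator {x<..<y} s * w s)"
  "\<bar>\<integral>s. indicator {x<..<y} s * w s \<partial>lborel\<bar> \<le> (1 + C) / 2 * sqrt (y - x)" by auto
qed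

text \<open>Testing against bumps shows that w has integral 0 over every compact subinterval.
  Applied to the initial data it says that \<phi>r (r, 0) is 0 for almost every r, so the initial
  energy is that of the equator.\<close>

lemma weak_deriv_const_unique:
 fixes w :: "real => real"
 assumes wd: "has_weak_deriv {0<..} 1 (%r. s) w" and wm[measurable]: "w \<in> borel_measurable borel"
 shows "AE r in lborel. 0 < r --> w r = 0"
proof -
 have loc: "AE r in lborel. indicator {a<..<b} r * w r = 0" if ab: "0 < a" "a < b" for a b :: real
 proof (rule AE_zero_if_box_integrals_zero)
  have I: "integrable lborel (%r. indicator {a..b} r *\<^sub>R w r)"
  proof -
   have "compact {a..b} \<and> {a..b} \<subseteq> {0<..} --> set_integrable lborel {a..b} w"
    using wd unfolding has_weak_deriv_def loc_integrable_def by blast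
   then show ?thesis using ab by (auto simp: set_integrable_def)
  qed
  show "integrable lborel (%r. indicator {a<..<b} r * w r)"
   by (rule Bochner_Integration.integrable_bound[OF I]) (auto simp: indicator_def)
  fix c d :: real
  define p q where "p = max a c" and "q = min b d"
  have "(%n. \<integral>r. bump p q n r *\<^sub>R w r \<partial>lborel) \<longlonglongrightarrow> (LBINT r. indicator {p<..<q} r *\<^sub>R w r)"
  proof (rule integral_dominated_convergence)
   show "integrable lborel (%r. norm (indicator {a..b} r *\<^sub>R w r))" using I by (rule integrable_norm)
   show "AE r in lborel. (%n. bump p q n r *\<^sub>R w r) \<longlonglongrightarrow> indicator {p<..<q} r *\<^sub>R w r"
    by (intro AE_I2 tendsto_intros bump_lim)
   show "AE r in lborel. norm (bump p q n r *\<^sub>R w r) \<le> norm (indicator {a..b} r *\<^sub>R w r)" for n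
   proof (rule AE_I2)
    fix r
    show "norm (bump p q n r *\<^sub>R w r) \<le> norm (indicator {a..b} r *\<^sub>R w r)"
    proof (cases "r \<in> {p<..<q}")
     case True
     then have "indicator {a..b} r = (1::real)" by (auto simp: p_def q_def)
     then show ?thesis using bump_bounds(1,2)[of p q n r] by (simp add: abs_mult mult_left_le_one_le)
    next
     case False
     then show ?thesis using bump_bounds(3) by simp
    qed
   qed
  qed measurable
  moreover have "(LBINT r. bump p q n r *\<^sub>R w r) = 0" for n
  proof -
   have T: "test_fun {0<..} (bump p q n)"
    unfolding test_fun_def
   proof (intro conjI exI)
    show "smooth_on UNIV (bump p q n)" using bump_Ck by (simp add: smooth_on_def)
    show "compact {a..b}" "{a..b} \<subseteq> {0<..}" using ab by auto
    show "\<forall>x. x \<notin> {a..b} --> bump p q n x = 0" using bump_bounds(3)[of _ p q n] by (auto simp: p_def q_def)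
   qed
   have 1: "(LBINT r. dir_deriv 1 (bump p q n) r *\<^sub>R s) = - (LBINT r. bump p q n r *\<^sub>R w r)"
    using wd T unfolding has_weak_deriv_def by blast
   have 2: "(LBINT r. dir_deriv 1 (bump p q n) r *\<^sub>R s) = - (LBINT r. bump p q n r *\<^sub>R 0)"
    using has_weak_deriv_const[of "{0<..}" "1::real" s] T unfolding has_weak_deriv_def by blast
   show ?thesis using 1 2 by simp
  qed
  ultimately have "(LBINT r. indicator {p<..<q} r *\<^sub>R w r) = 0" by (simp add: LIMSEQ_const_iff)
  moreover have "indicator (box c d) r * (indicator {a<..<b} r * w r) = indicator {p<..<q} r *\<^sub>R w r" for r
   by (auto simp: indicator_def p_def q_def)
  ultimately show "(LBINT r. indicator (box c d) r * (indicator {a<..<b} r * w r)) = 0" by (simp only:)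
 qed
 \<comment> \<open>The intervals (1/(n+2), n+2) exhaust the half-line; with n + 2 they are nonempty
   already for n = 0.\<close>
 have "AE r in lborel. \<forall>n::nat. indicator {1 / real (n + 2)<..<real (n + 2)} r * w r = 0"
 proof (subst AE_all_countable, intro allI loc)
  fix n show "0 < 1 / real (n + 2)" "1 / real (n + 2) < real (n + 2)"
   by (auto simp: divide_less_eq) (smt (verit, best) mult_less_cancel_left2 of_nat_0_le_iff mult_nonneg_nonneg)
 qed
 then show ?thesis
 proof eventually_elim
  case (elim r)
  show ?case
  proof
   assume r: "0 < r"
   obtain n :: nat where "real n > r + 1 / r" using reals_Archimedean2 by blast
   then have n: "r + 1 / r < real (n + 2)" by simp
   have "1 / r < real (n + 2)" using n r by linarith
   then have "1 / real (n + 2) < r" using r by (simp add: field_simps)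
   moreover have "r < real (n + 2)" using n r by (smt (verit) divide_pos_pos)
   ultimately show "w r = 0" using spec[OF elim, of n] by (simp add: indicator_def)
  qed
 qed
qed

section \<open>Solutions along characteristics and at fixed times\<close>

text \<open>The initial data are represented here by a bound on the initial energy that has the
  scaling R^(d-2) of the equator map.\<close>

locale equator_energy_solution =
 fixes d :: nat and k E0 :: real and g :: "real => real" and \<phi> \<phi>r \<phi>t :: "real \<times> real => real"
 assumes \<phi>m [measurable]: "\<phi> \<in> borel_measurable borel" and \<phi>rm [measurable]: "\<phi>r \<in> borel_measurable borel"
  and \<phi>tm [measurable]: "\<phi>t \<in> borel_measurable borel" and gm [measurable]: "g \<in> borel_measurable borel"
  and wr: "has_weak_deriv ({0<..} \<times> {0<..}) (1, 0) \<phi> \<phi>r"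
  and wt: "has_weak_deriv ({0<..} \<times> {0<..}) (0, 1) \<phi> \<phi>t"
  and EI: "energy_inequality d k g \<phi> \<phi>r \<phi>t"
  and e0: "\<And>R. R > 0 ==> energy d k g \<phi> \<phi>r \<phi>t 0 R \<le> ennreal (E0 * R ^ (d - 2))"
  and E0: "E0 \<ge> 0" and k0: "k \<ge> 0"
begin

text \<open>Formally the derivative of r \<mapsto> \<phi> (r, R - c r). Slope c = 1 gives the
  characteristic r + t = R and c = 0 the fixed time t = R, so both kinds of lines share one
  development.\<close>

definition slice_deriv :: "real => real => real => real"
 where "slice_deriv c r R = \<phi>r (r, R - c * r) - c * \<phi>t (r, R - c * r)"

lemma slice_measurable:
 "(%r. slice_deriv c r R) \<in> borel_measurable borel" "(%r. \<phi> (r, R - c * r)) \<in> borel_measurable borel"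
proof -
 have m: "(%r::real. (r, R - c * r)) \<in> borel \<rightarrow>\<^sub>M borel"
  by (intro borel_measurable_continuous_onI continuous_intros)
 show "(%r. \<phi> (r, R - c * r)) \<in> borel_measurable borel" by (rule measurable_compose[OF m \<phi>m])
 show "(%r. slice_deriv c r R) \<in> borel_measurable borel"
  unfolding slice_deriv_def
  by (intro borel_measurable_diff borel_measurable_times measurable_compose[OF m \<phi>rm] measurable_compose[OF m \<phi>tm] borel_measurable_const)
qed

lemma slice_measurable2:
 "(%p. slice_deriv c (fst p) (snd p)) \<in> borel_measurable borel" "(%p. \<phi> (fst p, snd p - c * fst p)) \<in> borel_measurable borel"
proof -
 have m: "(%p::real \<times> real. (fst p, snd p - c * fst p)) \<in> borel \<rightarrow>\<^sub>M borel"
  by (intro borel_measurable_continuous_onI continuous_intros)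
 show "(%p. \<phi> (fst p, snd p - c * fst p)) \<in> borel_measurable borel" by (rule measurable_compose[OF m \<phi>m])
 show "(%p. slice_deriv c (fst p) (snd p)) \<in> borel_measurable borel"
  unfolding slice_deriv_def
  by (intro borel_measurable_diff borel_measurable_times measurable_compose[OF m \<phi>rm] measurable_compose[OF m \<phi>tm] borel_measurable_const)
qed

text \<open>(EI) concerns truncated cones of height T < R. Dropping the energy on top, substituting
  r = R - s and letting T increase to R gives the full cone by monotone convergence.\<close>

lemma flux_bound:
 assumes R: "R > 0"
 shows "(\<integral>\<^sup>+r\<in>{0<..<R}. ennreal (((slice_deriv 1 r R)\<^sup>2 + k / r\<^sup>2 * (g (\<phi> (r, R - r)))\<^sup>2) * r ^ (d - 1)) \<partial>lborel)
  \<le> ennreal (E0 * R ^ (d - 2))"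
proof -
 define h where "h r = ennreal (((slice_deriv 1 r R)\<^sup>2 + k / r\<^sup>2 * (g (\<phi> (r, R - r)))\<^sup>2) * r ^ (d - 1))" for r
 have [measurable]: "(%r. slice_deriv 1 r R) \<in> borel_measurable borel" "(%r. \<phi> (r, R - r)) \<in> borel_measurable borel"
  using slice_measurable[of 1 R] by auto
 have hm[measurable]: "h \<in> borel_measurable borel" unfolding h_def[abs_def] by measurable
 define T where "T n = R - R / real (n + 1)" for n
 have T: "0 \<le> T n" "T n < R" for n using R by (auto simp: T_def field_simps)
 have flux: "cone_flux d k g \<phi> \<phi>r \<phi>t (T n) R = (\<integral>\<^sup>+s. h (R - s) * indicator {0<..<T n} s \<partial>lborel)" for n
  unfolding cone_flux_def h_def slice_deriv_def
  by (intro nn_integral_cong) (simp add: power2_eq_square algebra_simps)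
 have shift: "(\<integral>\<^sup>+s. h (R - s) * indicator {0<..<T n} s \<partial>lborel) = (\<integral>\<^sup>+r. h r * indicator {R / real (n + 1)<..<R} r \<partial>lborel)" for n
 proof -
  have "(\<integral>\<^sup>+r. h r * indicator {R / real (n + 1)<..<R} r \<partial>lborel)
   = (\<integral>\<^sup>+s. h (R + (-1) * s) * indicator {R / real (n + 1)<..<R} (R + (-1) * s) \<partial>lborel)"
   using nn_integral_real_affine[of "%r. h r * indicator {R / real (n + 1)<..<R} r" "-1" R] by simp
  also have "\<dots> = (\<integral>\<^sup>+s. h (R - s) * indicator {0<..<T n} s \<partial>lborel)"
   by (intro nn_integral_cong) (auto simp: indicator_def T_def)
  finally show ?thesis by simp
 qed
 have le: "(\<integral>\<^sup>+r. h r * indicator {R / real (n + 1)<..<R} r \<partial>lborel) \<le> ennreal (E0 * R ^ (d - 2))" for n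
 proof -
  have "cone_flux d k g \<phi> \<phi>r \<phi>t (T n) R \<le> energy d k g \<phi> \<phi>r \<phi>t (T n) (R - T n) + cone_flux d k g \<phi> \<phi>r \<phi>t (T n) R" by simp
  also have "\<dots> \<le> energy d k g \<phi> \<phi>r \<phi>t 0 R" using EI T[of n] unfolding energy_inequality_def by blast
  also have "\<dots> \<le> ennreal (E0 * R ^ (d - 2))" by (rule e0[OF R])
  finally show ?thesis unfolding flux shift .
 qed
 have "(\<integral>\<^sup>+r. (SUP n. h r * indicator {R / real (n + 1)<..<R} r) \<partial>lborel) = (SUP n. \<integral>\<^sup>+r. h r * indicator {R / real (n + 1)<..<R} r \<partial>lborel)"
 proof (rule nn_integral_monotone_convergence_SUP)
  show "incseq (%n r. h r * indicator {R / real (n + 1)<..<R} r)"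
  proof (rule incseq_SucI, rule le_funI)
   fix n r
   have "R / real (Suc n + 1) \<le> R / real (n + 1)" using R by (simp add: frac_le)
   then show "h r * indicator {R / real (n + 1)<..<R} r \<le> h r * indicator {R / real (Suc n + 1)<..<R} r"
    by (auto simp: indicator_def)
  qed
 qed measurable
 also have "\<dots> \<le> ennreal (E0 * R ^ (d - 2))" by (rule SUP_least) (rule le)
 finally have 1: "(\<integral>\<^sup>+r. (SUP n. h r * indicator {R / real (n + 1)<..<R} r) \<partial>lborel) \<le> ennreal (E0 * R ^ (d - 2))" .
 have "(\<integral>\<^sup>+r\<in>{0<..<R}. h r \<partial>lborel) \<le> (\<integral>\<^sup>+r. (SUP n. h r * indicator {R / real (n + 1)<..<R} r) \<partial>lborel)"
 proof (rule nn_integral_mono)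
  fix r
  show "h r * indicator {0<..<R} r \<le> (SUP n. h r * indicator {R / real (n + 1)<..<R} r)"
  proof (cases "r \<in> {0<..<R}")
   case True
   obtain n :: nat where "real n > R / r" using reals_Archimedean2 by blast
   then have "R < real (n + 1) * r" using True by (simp add: field_simps)
   then have "R / real (n + 1) < r" by (simp add: divide_less_eq mult.commute)
   then have "h r * indicator {0<..<R} r = h r * indicator {R / real (n + 1)<..<R} r" using True by simp
   also have "\<dots> \<le> (SUP n. h r * indicator {R / real (n + 1)<..<R} r)" by (rule SUP_upper) simp
   finally show ?thesis .
  qed simp
 qed
 with 1 show ?thesis unfolding h_def[symmetric] by simp
qed

text \<open>On r > a the weight r^(d-1) is at least a^(d-1), so away from the axis weighted bounds
  become plain square integrability.\<close>

lemma slice_deriv_L2_of_weighted: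
 assumes a: "0 < a" and C: "C \<ge> 0"
  and le: "\<And>r. r \<in> {a<..<b} ==> ennreal ((w r)\<^sup>2 * r ^ (d - 1)) \<le> f r"
  and f: "f \<in> borel_measurable borel" "(\<integral>\<^sup>+r\<in>{0<..<b}. f r \<partial>lborel) \<le> ennreal C"
 shows "(\<integral>\<^sup>+r\<in>{a<..<b}. ennreal ((w r)\<^sup>2) \<partial>lborel) \<le> ennreal (C / a ^ (d - 1))"
proof -
 have [measurable]: "f \<in> borel_measurable borel" by (rule f(1))
 have "(\<integral>\<^sup>+r\<in>{a<..<b}. ennreal ((w r)\<^sup>2) \<partial>lborel) \<le> (\<integral>\<^sup>+r. ennreal (1 / a ^ (d - 1)) * (f r * indicator {0<..<b} r) \<partial>lborel)"
 proof (rule nn_integral_mono)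
  fix r
  show "ennreal ((w r)\<^sup>2) * indicator {a<..<b} r \<le> ennreal (1 / a ^ (d - 1)) * (f r * indicator {0<..<b} r)"
  proof (cases "r \<in> {a<..<b}")
   case True
   have "a ^ (d - 1) \<le> r ^ (d - 1)" using True a by (intro power_mono) auto
   then have "(w r)\<^sup>2 * a ^ (d - 1) \<le> (w r)\<^sup>2 * r ^ (d - 1)" by (intro mult_left_mono) auto
   then have "(w r)\<^sup>2 \<le> 1 / a ^ (d - 1) * ((w r)\<^sup>2 * r ^ (d - 1))" using a by (simp add: field_simps)
   then have "ennreal ((w r)\<^sup>2) \<le> ennreal (1 / a ^ (d - 1)) * ennreal ((w r)\<^sup>2 * r ^ (d - 1))"
    using a True by (subst ennreal_mult[symmetric]) (auto intro!: ennreal_leI)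
   also have "\<dots> \<le> ennreal (1 / a ^ (d - 1)) * f r" by (rule mult_left_mono[OF le[OF True]]) simp
   finally show ?thesis using True a by simp
  qed simp
 qed
 also have "\<dots> = ennreal (1 / a ^ (d - 1)) * (\<integral>\<^sup>+r\<in>{0<..<b}. f r \<partial>lborel)" by (rule nn_integral_cmult) measurable
 also have "\<dots> \<le> ennreal (1 / a ^ (d - 1)) * ennreal C" by (rule mult_left_mono[OF f(2)]) simp
 also have "\<dots> = ennreal (C / a ^ (d - 1))" using C a by (simp add: ennreal_mult[symmetric])
 finally show ?thesis .
qed

lemma slice_deriv_L2_char:
 assumes a: "0 < a" and R: "a < R"
 shows "(\<integral>\<^sup>+r\<in>{a<..<R}. ennreal ((slice_deriv 1 r R)\<^sup>2) \<partial>lborel) \<le> ennreal (E0 * R ^ (d - 2) / a ^ (d - 1))"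
proof (rule slice_deriv_L2_of_weighted[OF a _ _ _ flux_bound])
 show "0 \<le> E0 * R ^ (d - 2)" using E0 a R by simp
 show "(%r. ennreal (((slice_deriv 1 r R)\<^sup>2 + k / r\<^sup>2 * (g (\<phi> (r, R - r)))\<^sup>2) * r ^ (d - 1))) \<in> borel_measurable borel"
 proof -
  have [measurable]: "(%r. slice_deriv 1 r R) \<in> borel_measurable borel" "(%r. \<phi> (r, R - r)) \<in> borel_measurable borel"
   using slice_measurable[of 1 R] by auto
  show ?thesis by measurable
 qed
 show "R > 0" using a R by simp
 fix r assume r: "r \<in> {a<..<R}"
 show "ennreal ((slice_deriv 1 r R)\<^sup>2 * r ^ (d - 1)) \<le> ennreal (((slice_deriv 1 r R)\<^sup>2 + k / r\<^sup>2 * (g (\<phi> (r, R - r)))\<^sup>2) * r ^ (d - 1))"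
  using k0 a r by (intro ennreal_leI mult_right_mono) auto
qed

text \<open>(EI) with T = t and R = b + t: the top of this truncated cone is the ball of radius b at
  time t.\<close>

lemma slice_deriv_L2_time:
 assumes a: "0 < a" and b: "a < b" and t: "0 \<le> t"
 shows "(\<integral>\<^sup>+r\<in>{a<..<b}. ennreal ((slice_deriv 0 r t)\<^sup>2) \<partial>lborel) \<le> ennreal (E0 * (b + t) ^ (d - 2) / a ^ (d - 1))"
proof (rule slice_deriv_L2_of_weighted[OF a])
 show "0 \<le> E0 * (b + t) ^ (d - 2)" using E0 a b t by simp
 show "(\<integral>\<^sup>+r\<in>{0<..<b}. ennreal (((\<phi>r (r, t))\<^sup>2 + k / r\<^sup>2 * (g (\<phi> (r, t)))\<^sup>2 + (\<phi>t (r, t))\<^sup>2) * r ^ (d - 1)) \<partial>lborel) \<le> ennreal (E0 * (b + t) ^ (d - 2))"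
 proof -
  have "energy d k g \<phi> \<phi>r \<phi>t t (b + t - t) \<le> energy d k g \<phi> \<phi>r \<phi>t t (b + t - t) + cone_flux d k g \<phi> \<phi>r \<phi>t t (b + t)" by simp
  also have "\<dots> \<le> energy d k g \<phi> \<phi>r \<phi>t 0 (b + t)" 
  proof -
   have "0 \<le> t \<and> t < b + t" using a b t by simp
   then show ?thesis using EI unfolding energy_inequality_def by blast
  qed
  also have "\<dots> \<le> ennreal (E0 * (b + t) ^ (d - 2))" by (rule e0) (use a b t in simp)
  finally show ?thesis by (simp add: energy_def)
 qed
 show "(%r. ennreal (((\<phi>r (r, t))\<^sup>2 + k / r\<^sup>2 * (g (\<phi> (r, t)))\<^sup>2 + (\<phi>t (r, t))\<^sup>2) * r ^ (d - 1))) \<in> borel_measurable borel"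
 proof -
  have m: "(%r::real. (r, t)) \<in> borel \<rightarrow>\<^sub>M borel"
   by (intro borel_measurable_continuous_onI continuous_intros)
  have [measurable]: "(%r. \<phi> (r, t)) \<in> borel_measurable borel" "(%r. \<phi>r (r, t)) \<in> borel_measurable borel" "(%r. \<phi>t (r, t)) \<in> borel_measurable borel"
   by (rule measurable_compose[OF m \<phi>m] measurable_compose[OF m \<phi>rm] measurable_compose[OF m \<phi>tm])+
  show ?thesis by measurable
 qed
 fix r assume r: "r \<in> {a<..<b}"
 show "ennreal ((slice_deriv 0 r t)\<^sup>2 * r ^ (d - 1)) \<le> ennreal (((\<phi>r (r, t))\<^sup>2 + k / r\<^sup>2 * (g (\<phi> (r, t)))\<^sup>2 + (\<phi>t (r, t))\<^sup>2) * r ^ (d - 1))"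
  unfolding slice_deriv_def using k0 a r by (intro ennreal_leI mult_right_mono) auto
qed

text \<open>In the test function \<alpha>(r) \<beta>(t + c r) the second factor is constant along
  the lines t + c r = R, so differentiation in the direction (1, -c) falls on \<alpha> alone. The
  condition c b < A keeps the support in t > 0.\<close>

lemma slice_weak_deriv:
 fixes c B :: real
 assumes a: "0 < a" and c: "0 \<le> c" and A: "0 < A" "c * b < A"
  and \<alpha>: "smooth_on UNIV \<alpha>" "\<And>x. (\<alpha> has_real_derivative \<alpha>' x) (at x)" "\<And>x. x \<notin> {a..b} ==> \<alpha> x = 0"
  and \<beta>: "smooth_on UNIV \<beta>" "\<And>x. x \<notin> {A..B} ==> \<beta> x = 0"
 shows "(LBINT q. \<alpha>' (fst q) * \<beta> (snd q + c * fst q) * \<phi> q)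
  = - (LBINT q. \<alpha> (fst q) * \<beta> (snd q + c * fst q) * (\<phi>r q - c * \<phi>t q))"
proof -
 define \<eta> where "\<eta> q = \<alpha> (fst q) * \<beta> (snd q + c * fst q)" for q :: "real \<times> real"
 define K where "K = (%p::real \<times> real. (fst p, snd p - c * fst p)) ` ({a..b} \<times> {A..B})"
 have T: "test_fun ({0<..} \<times> {0<..}) \<eta>"
  unfolding test_fun_def
 proof (intro conjI exI)
  have L1: "bounded_linear (%q::real \<times> real. fst q)" and L2: "bounded_linear (%q::real \<times> real. snd q + c * fst q)"
   by (auto intro!: bounded_linear_fst bounded_linear_add bounded_linear_snd bounded_linear_const_mult)
  have 1: "Ck_on n UNIV (%q::real \<times> real. \<alpha> (fst q + 0))" for n
   by (rule Ck_on_affine[OF L1]) (use \<alpha>(1) in \<open>simp add: smooth_on_def\<close>)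
  have 2: "Ck_on n UNIV (%q::real \<times> real. \<beta> ((snd q + c * fst q) + 0))" for n
   by (rule Ck_on_affine[OF L2]) (use \<beta>(1) in \<open>simp add: smooth_on_def\<close>)
  show "smooth_on UNIV \<eta>" unfolding smooth_on_def \<eta>_def[abs_def]
  proof (intro allI Ck_on_mult)
   fix n show "Ck_on n UNIV (%q::real \<times> real. \<alpha> (fst q))" "Ck_on n UNIV (%q::real \<times> real. \<beta> (snd q + c * fst q))"
    using 1[of n] 2[of n] by simp_all
  qed
  show "compact K" unfolding K_def
   by (intro compact_continuous_image continuous_intros compact_Times) auto
  show "K \<subseteq> {0<..} \<times> {0<..}"
  proof
   fix q assume "q \<in> K"
   then obtain r R where q: "q = (r, R - c * r)" "a \<le> r" "r \<le> b" "A \<le> R" by (auto simp: K_def)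
   have "c * r \<le> c * b" using q(3) c by (rule mult_left_mono)
   then show "q \<in> {0<..} \<times> {0<..}" using q a A by auto
  qed
  show "\<forall>q. q \<notin> K --> \<eta> q = 0"
  proof (intro allI impI)
   fix q assume q: "q \<notin> K"
   have "q = (fst (fst q, snd q + c * fst q), snd (fst q, snd q + c * fst q) - c * fst (fst q, snd q + c * fst q))" by (cases q) simp
   then have "(fst q, snd q + c * fst q) \<notin> {a..b} \<times> {A..B}" using q unfolding K_def by blast
   then show "\<eta> q = 0" using \<alpha>(3) \<beta>(2) by (auto simp: \<eta>_def)
  qed
 qed
 define \<beta>' where "\<beta>' x = dir_deriv 1 \<beta> x" for x
 have \<beta>d: "(\<beta> has_derivative (%h. \<beta>' x * h)) (at x)" for x
 proof -
  have D: "(\<beta> has_derivative (%v. dir_deriv v \<beta> x)) (at x)" by (rule smooth_on_has_derivative[OF \<beta>(1)]) simp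
  have "dir_deriv h \<beta> x = \<beta>' x * h" for h
   using linear_scale[OF has_derivative_linear[OF D], of h 1] by (simp add: \<beta>'_def)
  then show ?thesis using D by simp
 qed
 have \<eta>d: "(\<eta> has_derivative (%v. \<alpha> (fst q) * (\<beta>' (snd q + c * fst q) * (snd v + c * fst v)) + (\<alpha>' (fst q) * fst v) * \<beta> (snd q + c * fst q))) (at q)" for q
 proof -
  have 1: "((%q::real \<times> real. \<alpha> (fst q)) has_derivative (%v. \<alpha>' (fst q) * fst v)) (at q)"
   by (rule has_derivative_compose[of fst _ _ _ \<alpha>, OF _ \<alpha>(2)[unfolded has_field_derivative_def]]) (auto intro!: derivative_eq_intros)
  have 2: "((%q::real \<times> real. \<beta> (snd q + c * fst q)) has_derivative (%v. \<beta>' (snd q + c * fst q) * (snd v + c * fst v))) (at q)"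
   by (rule has_derivative_compose[of "%q. snd q + c * fst q" _ _ _ \<beta>, OF _ \<beta>d]) (auto intro!: derivative_eq_intros)
  show ?thesis unfolding \<eta>_def[abs_def] by (rule has_derivative_mult[OF 1 2])
 qed
 have id: "\<alpha>' (fst q) * \<beta> (snd q + c * fst q) = dir_deriv (1, 0) \<eta> q - c * dir_deriv (0, 1) \<eta> q" for q
  unfolding dir_deriv_eq[OF \<eta>d] by (simp add: algebra_simps)
 have li: "loc_integrable ({0<..} \<times> {0<..}) \<phi>" "loc_integrable ({0<..} \<times> {0<..}) \<phi>r" "loc_integrable ({0<..} \<times> {0<..}) \<phi>t"
  using wr wt unfolding has_weak_deriv_def by auto
 note I = integrable_test_scaleR[OF test_fun_dir_deriv[OF T] li(1)] integrable_test_scaleR[OF T li(2)] integrable_test_scaleR[OF T li(3)]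
 have "(LBINT q. \<alpha>' (fst q) * \<beta> (snd q + c * fst q) * \<phi> q)
  = (LBINT q. dir_deriv (1, 0) \<eta> q *\<^sub>R \<phi> q - c * (dir_deriv (0, 1) \<eta> q *\<^sub>R \<phi> q))"
  unfolding id by (simp add: algebra_simps)
 also have "\<dots> = (LBINT q. dir_deriv (1, 0) \<eta> q *\<^sub>R \<phi> q) - c * (LBINT q. dir_deriv (0, 1) \<eta> q *\<^sub>R \<phi> q)"
  using I(1) by (subst Bochner_Integration.integral_diff) auto
 also have "(LBINT q. dir_deriv (1, 0) \<eta> q *\<^sub>R \<phi> q) = - (LBINT q. \<eta> q *\<^sub>R \<phi>r q)"
  using wr T unfolding has_weak_deriv_def by blast
 also have "(LBINT q. dir_deriv (0, 1) \<eta> q *\<^sub>R \<phi> q) = - (LBINT q. \<eta> q *\<^sub>R \<phi>t q)"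
  using wt T unfolding has_weak_deriv_def by blast
 also have "- (LBINT q. \<eta> q *\<^sub>R \<phi>r q) - c * - (LBINT q. \<eta> q *\<^sub>R \<phi>t q)
  = - ((LBINT q. \<eta> q *\<^sub>R \<phi>r q) - (LBINT q. c * (\<eta> q *\<^sub>R \<phi>t q)))" by simp
 also have "(LBINT q. \<eta> q *\<^sub>R \<phi>r q) - (LBINT q. c * (\<eta> q *\<^sub>R \<phi>t q)) = (LBINT q. \<eta> q *\<^sub>R \<phi>r q - c * (\<eta> q *\<^sub>R \<phi>t q))"
  by (rule Bochner_Integration.integral_diff[symmetric]) (use I(2,3) in auto)
 also have "\<dots> = (LBINT q. \<alpha> (fst q) * \<beta> (snd q + c * fst q) * (\<phi>r q - c * \<phi>t q))"
  by (simp add: \<eta>_def algebra_simps)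
 finally show ?thesis .
qed

end

lemma AE_interval_ex:
 assumes "AE t in lborel. Q t" "a < (b::real)"
 shows "\<exists>t\<in>{a<..<b}. Q t"
proof (rule ccontr)
 assume n: "\<not> (\<exists>t\<in>{a<..<b}. Q t)"
 obtain M where M: "{t \<in> space lborel. \<not> Q t} \<subseteq> M" "emeasure lborel M = 0" "M \<in> sets lborel" by (rule AE_E[OF assms(1)])
 have "emeasure lborel {a<..<b} \<le> emeasure lborel M" by (rule emeasure_mono) (use n M in auto)
 then show False using M(2) assms(2) by simp
qed

lemma AE_translate:
 assumes "AE x in lborel. Q (x::real)"
 shows "AE x in lborel. Q (x + t)"
proof -
 obtain M where M: "{x \<in> space lborel. \<not> Q x} \<subseteq> M" "emeasure lborel M = 0" "M \<in> sets lborel" by (rule AE_E[OF assms])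
 have "AE x in lborel. x \<notin> M" by (rule AE_not_in) (use M in auto)
 moreover have "Measurable.pred borel (%x. x \<notin> M)" using M(3) by simp
 ultimately have "AE x in lborel. t + 1 * x \<notin> M" by (intro AE_borel_affine) auto
 then show ?thesis by eventually_elim (use M(1) in \<open>auto simp: add.commute\<close>)
qed

context equator_energy_solution
begin

text \<open>In the sheared coordinates (r, R) with t = R - c r the lines are those with R constant,
  and \<open>AE_slice_primitive\<close> applies to \<phi> and its slice derivative, both cut off
  outside a rectangle.\<close>

lemma slice_primitive_rect:
 fixes c B :: real
 assumes a: "0 < a" and ab: "a < b" and c: "0 \<le> c" and A: "0 < A" "c * b < A"
 shows "AE R in lborel. R \<in> {A<..<B} --> (\<exists>z. AE r in lborel. r \<in> {a<..<b} -->
  \<phi> (r, R - c * r) = z + (LBINT s. indicator {a<..<r} s * slice_deriv c s R))"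
proof -
 define K where "K = {q::real \<times> real. fst q \<in> {a..b} \<and> snd q + c * fst q \<in> {A..B}}"
 define v where "v p = indicator ({a..b} \<times> {A..B}) p * \<phi> (fst p, snd p - c * fst p)" for p
 define w where "w p = indicator ({a..b} \<times> {A..B}) p * slice_deriv c (fst p) (snd p)" for p
 have cK: "compact K"
 proof -
  have "K = (%p::real \<times> real. (fst p, snd p - c * fst p)) ` ({a..b} \<times> {A..B})"
  proof (intro equalityI subsetI)
   fix q assume q: "q \<in> K"
   have "q = (fst (fst q, snd q + c * fst q), snd (fst q, snd q + c * fst q) - c * fst (fst q, snd q + c * fst q))" by (cases q) simp
   moreover have "(fst q, snd q + c * fst q) \<in> {a..b} \<times> {A..B}" using q by (simp add: K_def)
   ultimately show "q \<in> (%p::real \<times> real. (fst p, snd p - c * fst p)) ` ({a..b} \<times> {A..B})" by (rule image_eqI)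
  qed (auto simp: K_def)
  then show ?thesis by (simp only:) (intro compact_continuous_image continuous_intros compact_Times compact_Icc)
 qed
 have sK: "K \<subseteq> {0<..} \<times> {0<..}"
 proof
  fix q assume q: "q \<in> K"
  have "c * fst q \<le> c * b" using q c by (intro mult_left_mono) (auto simp: K_def)
  then show "q \<in> {0<..} \<times> {0<..}" using q a A by (cases q) (auto simp: K_def)
 qed
 have [measurable]: "K \<in> sets borel" using cK by (simp add: borel_compact)
 have ind: "indicator K (fst p, snd p + (- c) * fst p) = (indicator ({a..b} \<times> {A..B}) p :: real)" for p
  by (cases p) (auto simp: K_def indicator_def)
 have li0: "integrable lborel (%q. indicator K q * u q)" if "loc_integrable ({0<..} \<times> {0<..}) u" for u :: "real \<times> real => real"
  using loc_integrableD[OF that cK sK] by (simp add: set_integrable_def)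
 have li: "integrable lborel (%q. indicator K q * \<phi> q)" "integrable lborel (%q. indicator K q * \<phi>r q)" "integrable lborel (%q. indicator K q * \<phi>t q)"
  by (rule li0; use wr wt in \<open>simp add: has_weak_deriv_def\<close>)+
 have iv: "integrable lborel v"
 proof -
  have "integrable lborel (%p. (%q. indicator K q * \<phi> q) (fst p, snd p + (- c) * fst p))"
   using li(1) by (subst integral_shear(1)) measurable
  then show ?thesis unfolding ind v_def[abs_def] by simp
 qed
 have iw: "integrable lborel w"
 proof -
  have "integrable lborel (%q. indicator K q * \<phi>r q - c * (indicator K q * \<phi>t q))" using li by simp
  then have "integrable lborel (%p. (%q. indicator K q * \<phi>r q - c * (indicator K q * \<phi>t q)) (fst p, snd p + (- c) * fst p))"
   by (subst integral_shear(1)) measurable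
  then show ?thesis unfolding ind w_def[abs_def] slice_deriv_def by (simp add: algebra_simps)
 qed
 have wk: "(LBINT p. \<alpha>' (fst p) * \<beta> (snd p) * v p) = - (LBINT p. \<alpha> (fst p) * \<beta> (snd p) * w p)"
  if \<alpha>: "smooth_on UNIV \<alpha>" "\<And>x. (\<alpha> has_real_derivative \<alpha>' x) (at x)" and \<beta>: "smooth_on UNIV \<beta>"
   and \<alpha>0: "\<And>x. x \<notin> {a..b} ==> \<alpha> x = 0" and \<beta>0: "\<And>x. x \<notin> {A..B} ==> \<beta> x = 0" for \<alpha> \<alpha>' \<beta>
 proof -
  have \<alpha>'0: "\<alpha>' x = 0" if x: "x \<notin> {a..b}" for x
  proof (rule DERIV_unique[OF \<alpha>(2)])
   show "(\<alpha> has_real_derivative 0) (at x)"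
    by (rule has_field_derivative_transform_within_open[of "%_. 0" 0 x "- {a..b}"]) (use x \<alpha>0 in auto)
  qed
  have "\<alpha>' = dir_deriv 1 \<alpha>"
   using dir_deriv_eq[OF \<alpha>(2)[unfolded has_field_derivative_def]] by (intro ext) simp
  then have ca': "continuous_on UNIV \<alpha>'" using smooth_on_continuous[OF smooth_on_dir_deriv[OF \<alpha>(1)]] by simp
  have [measurable]: "\<alpha> \<in> borel_measurable borel" "\<alpha>' \<in> borel_measurable borel" "\<beta> \<in> borel_measurable borel"
   using ca' smooth_on_continuous[OF \<alpha>(1)] smooth_on_continuous[OF \<beta>] by (auto intro: borel_measurable_continuous_onI)
  define G where "G q = \<alpha>' (fst q) * \<beta> (snd q + c * fst q) * \<phi> q" for q
  define H where "H q = \<alpha> (fst q) * \<beta> (snd q + c * fst q) * (\<phi>r q - c * \<phi>t q)" for q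
  have Gm: "G \<in> borel_measurable borel" "H \<in> borel_measurable borel" unfolding G_def[abs_def] H_def[abs_def] by measurable
  have "\<alpha>' (fst p) * \<beta> (snd p) * v p = G (fst p, snd p + (- c) * fst p)" for p
   using \<alpha>'0[of "fst p"] \<beta>0[of "snd p"] by (cases p) (auto simp: G_def v_def indicator_def)
  moreover have "\<alpha> (fst p) * \<beta> (snd p) * w p = H (fst p, snd p + (- c) * fst p)" for p
   using \<alpha>0[of "fst p"] \<beta>0[of "snd p"] by (cases p) (auto simp: H_def w_def slice_deriv_def indicator_def)
  moreover have "(LBINT q. G q) = - (LBINT q. H q)"
   unfolding G_def H_def by (rule slice_weak_deriv[OF a c A \<alpha>(1,2) \<alpha>0 \<beta> \<beta>0])
  ultimately show ?thesis using integral_shear(2)[OF Gm(1), of "- c"] integral_shear(2)[OF Gm(2), of "- c"] by simp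
 qed
 obtain zz where zz: "AE p in lborel. fst p \<in> {a<..<b} \<and> snd p \<in> {A<..<B} -->
  v p = zz (snd p) + (LBINT s. indicator {..fst p} s * w (s, snd p))"
  by (rule AE_slice_primitive[OF ab iv iw, of A B]) (use wk in \<open>auto simp: v_def w_def\<close>)
 from AE_lborel_pairD[OF AE_swapD[OF zz]]
 have "AE R in lborel. AE r in lborel. r \<in> {a<..<b} \<and> R \<in> {A<..<B} -->
  v (r, R) = zz R + (LBINT s. indicator {..r} s * w (s, R))" by simp
 then show ?thesis
 proof eventually_elim
  case (elim R)
  show ?case
  proof (intro impI exI)
   assume R: "R \<in> {A<..<B}"
   show "AE r in lborel. r \<in> {a<..<b} -->
    \<phi> (r, R - c * r) = zz R + (LBINT s. indicator {a<..<r} s * slice_deriv c s R)"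
    using elim
   proof eventually_elim
    case (elim r)
    have "(LBINT s. indicator {..r} s * w (s, R)) = (LBINT s. indicator {a<..<r} s * slice_deriv c s R)" if r: "r \<in> {a<..<b}"
    proof (rule integral_cong_AE)
     have [measurable]: "(%s. slice_deriv c s R) \<in> borel_measurable borel" by (rule slice_measurable(1))
     have "(%s. indicator {..r} s * w (s, R)) = (%s. indicator {..r} s * (indicator {a..b} s * slice_deriv c s R))"
      using R by (auto simp: w_def indicator_def)
     also have "\<dots> \<in> borel_measurable lborel" by measurable
     finally show "(%s. indicator {..r} s * w (s, R)) \<in> borel_measurable lborel" .
     show "(%s. indicator {a<..<r} s * slice_deriv c s R) \<in> borel_measurable lborel" by measurable
     show "AE s in lborel. indicator {..r} s * w (s, R) = indicator {a<..<r} s * slice_deriv c s R"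
      using AE_lborel_singleton[of a] AE_lborel_singleton[of r]
      by eventually_elim (use R r in \<open>auto simp: w_def indicator_def\<close>)
    qed
    then show ?case using elim R by (auto simp: v_def)
   qed
  qed
 qed
qed

text \<open>Countably many rectangles, with R - c b between 1/(n+1) and n+1, exhaust all R > c
  b.\<close>

lemma slice_primitive:
 fixes c :: real
 assumes a: "0 < a" and ab: "a < b" and c: "0 \<le> c"
 shows "AE R in lborel. 0 < R \<and> c * b < R --> (\<exists>z. AE r in lborel. r \<in> {a<..<b} -->
  \<phi> (r, R - c * r) = z + (LBINT s. indicator {a<..<r} s * slice_deriv c s R))"
proof -
 have cb: "0 \<le> c * b" using a ab c by simp
 have "AE R in lborel. \<forall>n::nat. R \<in> {c * b + 1 / real (n + 1)<..<c * b + real (n + 1)} --> (\<exists>z. AE r in lborel. r \<in> {a<..<b} -->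
  \<phi> (r, R - c * r) = z + (LBINT s. indicator {a<..<r} s * slice_deriv c s R))"
  unfolding AE_all_countable
 proof (intro allI slice_primitive_rect[OF a ab c])
  fix n :: nat
  have "0 < 1 / real (n + 1)" by simp
  then show "0 < c * b + 1 / real (n + 1)" "c * b < c * b + 1 / real (n + 1)" using cb by linarith+
 qed
 then show ?thesis
 proof eventually_elim
  case (elim R)
  show ?case
  proof (intro impI)
   assume R: "0 < R \<and> c * b < R"
   define y where "y = R - c * b"
   have y: "y > 0" using R by (simp add: y_def)
   obtain n :: nat where n: "real n > y + 1 / y" using reals_Archimedean2 by blast
   have yy: "0 < 1 / y" using y by simp
   have "y < real (n + 1)" "1 / y < real (n + 1)" using n y yy by linarith+
   moreover from this(2) have "1 / real (n + 1) < y" using y by (simp add: field_simps)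
   ultimately have "R \<in> {c * b + 1 / real (n + 1)<..<c * b + real (n + 1)}" by (auto simp: y_def)
   then show "\<exists>z. AE r in lborel. r \<in> {a<..<b} -->
    \<phi> (r, R - c * r) = z + (LBINT s. indicator {a<..<r} s * slice_deriv c s R)" using elim by blast
  qed
 qed
qed

text \<open>Formally \<phi> (R, 0) - \<phi> (r, R - r): the integral of the derivative along the
  characteristic from r to its foot on t = 0.\<close>

definition tail :: "real => real => real"
 where "tail r R = (LBINT s. indicator {r<..<R} s * slice_deriv 1 s R)"

lemma tail_measurable: "(%p. tail (fst p) (snd p)) \<in> borel_measurable borel"
proof -
 have m: "(%q::(real \<times> real) \<times> real. (snd q, snd (fst q))) \<in> (borel \<Otimes>\<^sub>M lborel) \<rightarrow>\<^sub>M borel"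
  unfolding borel_prod[symmetric] by measurable
 have "{q::(real \<times> real) \<times> real. fst (fst q) < snd q \<and> snd q < snd (fst q)} \<in> sets (borel \<Otimes>\<^sub>M borel)"
  unfolding borel_prod by (intro borel_open open_Collect_conj open_Collect_less continuous_intros)
 then have "(%q::(real \<times> real) \<times> real. if fst (fst q) < snd q \<and> snd q < snd (fst q) then slice_deriv 1 (snd q) (snd (fst q)) else 0) \<in> borel_measurable (borel \<Otimes>\<^sub>M lborel)"
  using measurable_compose[OF m slice_measurable2(1)[of 1]] by (intro measurable_If) (auto simp: space_pair_measure)
 moreover have "(if fst (fst q) < snd q \<and> snd q < snd (fst q) then slice_deriv 1 (snd q) (snd (fst q)) else 0)
  = (%(p, s). indicator {fst p<..<snd p} s * slice_deriv 1 s (snd p)) q" for q :: "(real \<times> real) \<times> real"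
  by (auto simp: indicator_def split: prod.split)
 ultimately have "(%(p::real \<times> real, s). indicator {fst p<..<snd p} s * slice_deriv 1 s (snd p)) \<in> borel_measurable (borel \<Otimes>\<^sub>M lborel)"
  by simp
 from lborel.borel_measurable_lebesgue_integral[OF this] show ?thesis by (simp add: tail_def)
qed

text \<open>The exceptional set of R depends on the interval, so endpoints are taken rational.
  Measuring from the foot r = R makes the constants of different intervals comparable, and they
  agree because every interval is enlarged to contain a fixed one.\<close>

lemma char_primitive:
 "AE R in lborel. 0 < R --> (\<exists>z. AE r in lborel. r \<in> {0<..<R} --> \<phi> (r, R - r) = z - tail r R)"
proof -
 define S where "S = {(a, b). a \<in> \<rat> \<and> b \<in> \<rat> \<and> 0 < a \<and> a < (b::real)}"
 have cS: "countable S" by (rule countable_subset[of _ "\<rat> \<times> \<rat>"]) (auto simp: S_def countable_rat)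
 have "AE R in lborel. \<forall>q\<in>S. 0 < R \<and> 1 * snd q < R --> (\<exists>z. AE r in lborel. r \<in> {fst q<..<snd q} -->
  \<phi> (r, R - 1 * r) = z + (LBINT s. indicator {fst q<..<r} s * slice_deriv 1 s R))"
  unfolding AE_ball_countable[OF cS] by (intro ballI slice_primitive) (auto simp: S_def)
 then show ?thesis
 proof eventually_elim
  case (elim R)
  show ?case
  proof
   assume R: "0 < R"
   have tl: "\<exists>z. AE r in lborel. r \<in> {a<..<b} --> \<phi> (r, R - r) = z - tail r R"
    if ab: "(a, b) \<in> S" "b < R" for a b
   proof -
    have a: "0 < a" "a < b" "a < R" using ab by (auto simp: S_def)
    obtain z where z: "AE r in lborel. r \<in> {a<..<b} -->
     \<phi> (r, R - r) = z + (LBINT s. indicator {a<..<r} s * slice_deriv 1 s R)"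
     using bspec[OF elim ab(1)] ab(2) R by auto
    note ph = primitive_holder(1)[OF slice_measurable(1) slice_deriv_L2_char[OF a(1) a(3)]]
    have C: "0 \<le> E0 * R ^ (d - 2) / a ^ (d - 1)" using E0 R a by simp
    have "AE r in lborel. r \<in> {a<..<b} --> \<phi> (r, R - r) = (z + (LBINT s. indicator {a<..<R} s * slice_deriv 1 s R)) - tail r R"
     using z
    proof eventually_elim
     case (elim r)
     have "(LBINT s. indicator {a<..<R} s * slice_deriv 1 s R)
      = (LBINT s. indicator {a<..<r} s * slice_deriv 1 s R) + tail r R" if r: "r \<in> {a<..<b}"
     proof -
      have i: "integrable lborel (%s. indicator {a<..<r} s * slice_deriv 1 s R)" "integrable lborel (%s. indicator {r<..<R} s * slice_deriv 1 s R)"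
       by (rule ph[OF C]; use r a ab(2) in auto)+
      have "(LBINT s. indicator {a<..<R} s * slice_deriv 1 s R)
       = (LBINT s. indicator {a<..<r} s * slice_deriv 1 s R + indicator {r<..<R} s * slice_deriv 1 s R)"
      proof (rule integral_cong_AE)
       have [measurable]: "(%s. slice_deriv 1 s R) \<in> borel_measurable borel" by (rule slice_measurable(1))
       show "(%s. indicator {a<..<R} s * slice_deriv 1 s R) \<in> borel_measurable lborel" by measurable
       show "(%s. indicator {a<..<r} s * slice_deriv 1 s R + indicator {r<..<R} s * slice_deriv 1 s R) \<in> borel_measurable lborel" by measurable
       show "AE s in lborel. indicator {a<..<R} s * slice_deriv 1 s R = indicator {a<..<r} s * slice_deriv 1 s R + indicator {r<..<R} s * slice_deriv 1 s R"
        using AE_lborel_singleton[of r] by eventually_elim (use r ab(2) in \<open>auto simp: indicator_def\<close>)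
      qed
      also have "\<dots> = (LBINT s. indicator {a<..<r} s * slice_deriv 1 s R) + tail r R"
       unfolding tail_def by (rule Bochner_Integration.integral_add[OF i])
      finally show ?thesis .
     qed
     then show ?case using elim by auto
    qed
    then show ?thesis by blast
   qed
   \<comment> \<open>The fixed rational interval (a0, b0) around R/2, on which all constants are
     compared.\<close>
   obtain b0 where b0: "b0 \<in> \<rat>" "R / 2 < b0" "b0 < R" using Rats_dense_in_real[of "R / 2" R] R by auto
   obtain a0 where a0: "a0 \<in> \<rat>" "0 < a0" "a0 < R / 2" using Rats_dense_in_real[of 0 "R / 2"] R by auto
   have "(a0, b0) \<in> S" using a0 b0 by (auto simp: S_def)
   then obtain z where z: "AE r in lborel. r \<in> {a0<..<b0} --> \<phi> (r, R - r) = z - tail r R" using tl[of a0 b0] b0 by blast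
   have all: "AE r in lborel. r \<in> {a<..<b} --> \<phi> (r, R - r) = z - tail r R" if ab: "(a, b) \<in> S" "b < R" for a b
   proof -
    have "(min a a0, max b b0) \<in> S" using ab(1) a0 b0 by (auto simp: S_def min_def max_def)
    moreover have "max b b0 < R" using ab b0 by simp
    ultimately obtain z' where z': "AE r in lborel. r \<in> {min a a0<..<max b b0} --> \<phi> (r, R - r) = z' - tail r R" using tl by blast
    have "AE r in lborel. r \<in> {a0<..<b0} --> z = z'" using z z' by eventually_elim auto
    then have "z = z'" using AE_interval_ex[of "%r. r \<in> {a0<..<b0} --> z = z'" a0 b0] a0 b0 by auto
    then show ?thesis using z' by (auto elim!: eventually_mono)
   qed
   have "AE r in lborel. \<forall>q\<in>{q\<in>S. snd q < R}. r \<in> {fst q<..<snd q} --> \<phi> (r, R - r) = z - tail r R"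
    by (subst AE_ball_countable) (use all cS in \<open>auto intro: countable_subset\<close>)
   then have "AE r in lborel. r \<in> {0<..<R} --> \<phi> (r, R - r) = z - tail r R"
   proof eventually_elim
    case (elim r)
    show ?case
    proof
     assume r: "r \<in> {0<..<R}"
     obtain a where a: "a \<in> \<rat>" "0 < a" "a < r" using Rats_dense_in_real[of 0 r] r by auto
     obtain b where b: "b \<in> \<rat>" "r < b" "b < R" using Rats_dense_in_real[of r R] r by auto
     have "(a, b) \<in> {q\<in>S. snd q < R}" using a b by (auto simp: S_def)
     from bspec[OF elim this] show "\<phi> (r, R - r) = z - tail r R" using a b by simp
    qed
   qed
   then show "\<exists>z. AE r in lborel. r \<in> {0<..<R} --> \<phi> (r, R - r) = z - tail r R" by blast
  qed
 qed
qed

text \<open>The constant of integration, obtained as an average over (R/2, R) rather than by choice,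
  so that it depends measurably on R. It plays the role of \<phi> (R, 0).\<close>

definition trace :: "real => real"
 where "trace R = 2 / R * (LBINT r. indicator {R / 2<..<R} r * (\<phi> (r, R - 1 * r) + tail r R))"

lemma trace_measurable [measurable]: "trace \<in> borel_measurable borel"
proof -
 have m: "(%q::real \<times> real. (snd q, fst q)) \<in> (borel \<Otimes>\<^sub>M lborel) \<rightarrow>\<^sub>M borel"
  unfolding borel_prod[symmetric] by measurable
 have 1: "(%q. \<phi> (snd q, fst q - 1 * snd q) + tail (snd q) (fst q)) \<in> borel_measurable (borel \<Otimes>\<^sub>M lborel)"
  using measurable_compose[OF m slice_measurable2(2)[of 1]] measurable_compose[OF m tail_measurable] by simp
 have "{q::real \<times> real. fst q / 2 < snd q \<and> snd q < fst q} \<in> sets (borel \<Otimes>\<^sub>M borel)"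
  unfolding borel_prod by (intro borel_open open_Collect_conj open_Collect_less continuous_intros) auto
 then have "(%q::real \<times> real. if fst q / 2 < snd q \<and> snd q < fst q then \<phi> (snd q, fst q - 1 * snd q) + tail (snd q) (fst q) else 0) \<in> borel_measurable (borel \<Otimes>\<^sub>M lborel)"
  using 1 by (intro measurable_If) (auto simp: space_pair_measure)
 moreover have "(if fst q / 2 < snd q \<and> snd q < fst q then \<phi> (snd q, fst q - 1 * snd q) + tail (snd q) (fst q) else 0)
  = (%(R, r). indicator {R / 2<..<R} r * (\<phi> (r, R - 1 * r) + tail r R)) q" for q :: "real \<times> real"
  by (auto simp: indicator_def split: prod.split)
 ultimately have "(%(R, r). indicator {R / 2<..<R} r * (\<phi> (r, R - 1 * r) + tail r R)) \<in> borel_measurable (borel \<Otimes>\<^sub>M lborel)"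
  by simp
 note 2 = lborel.borel_measurable_lebesgue_integral[OF this]
 show ?thesis unfolding trace_def[abs_def] by (intro borel_measurable_times 2 borel_measurable_divide borel_measurable_const measurable_ident) auto
qed

lemma char_formula:
 "AE R in lborel. 0 < R --> (AE r in lborel. r \<in> {0<..<R} --> \<phi> (r, R - r) = trace R - tail r R)"
 using char_primitive
proof eventually_elim
 case (elim R)
 show ?case
 proof
  assume R: "0 < R"
  then obtain z where z: "AE r in lborel. r \<in> {0<..<R} --> \<phi> (r, R - r) = z - tail r R" using elim by blast
  have "(LBINT r. indicator {R / 2<..<R} r * (\<phi> (r, R - 1 * r) + tail r R)) = (LBINT r. indicator {R / 2<..<R} r * z)"
  proof (rule integral_cong_AE)
   have [measurable]: "(%r. \<phi> (r, R - 1 * r)) \<in> borel_measurable borel" by (rule slice_measurable(2))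
   have "(%r::real. (r, R)) \<in> borel \<rightarrow>\<^sub>M borel" by (intro borel_measurable_continuous_onI continuous_intros)
   from measurable_compose[OF this tail_measurable] have [measurable]: "(%r. tail r R) \<in> borel_measurable borel" by simp
   show "(%r. indicator {R / 2<..<R} r * (\<phi> (r, R - 1 * r) + tail r R)) \<in> borel_measurable lborel" by measurable
   show "(%r. indicator {R / 2<..<R} r * z) \<in> borel_measurable lborel" by measurable
   show "AE r in lborel. indicator {R / 2<..<R} r * (\<phi> (r, R - 1 * r) + tail r R) = indicator {R / 2<..<R} r * z"
    using z by eventually_elim (use R in \<open>auto simp: indicator_def\<close>)
  qed
  also have "\<dots> = R / 2 * z" using R by simp
  finally have "trace R = z" using R by (simp add: trace_def field_simps)
  then show "AE r in lborel. r \<in> {0<..<R} --> \<phi> (r, R - r) = trace R - tail r R" using z by simp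
 qed
qed

text \<open>Here b + 1 bounds R = r + t for r < b and t < 1. The shape (1 + C)/2 comes from
  \<open>primitive_holder\<close>, with C the bound on the integral of the square.\<close>

definition holder_const :: "real => real => real"
 where "holder_const a b = (1 + E0 * (b + 1) ^ (d - 2) / a ^ (d - 1)) / 2"

text \<open>On a characteristic the distance from r to the foot is R - r = t, so the tail is of
  order sqrt t. \<open>AE_characteristics\<close> then converts almost every characteristic into
  almost every time.\<close>

lemma trace_approx:
 assumes a: "0 < a" and ab: "a < b"
 shows "AE t in lborel. AE r in lborel. 0 < t \<and> t < 1 \<and> r \<in> {a<..<b} --> \<bar>\<phi> (r, t) - trace (r + t)\<bar> \<le> holder_const a b * sqrt t"
proof -
 define Q where "Q p \<longleftrightarrow> (0 < snd p \<and> snd p < 1 \<and> a < fst p \<and> fst p < b --> \<bar>\<phi> p - trace (fst p + snd p)\<bar> \<le> holder_const a b * sqrt (snd p))" for p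
 have "{p \<in> space borel. Q p} \<in> sets borel" unfolding Q_def by measurable
 then have Qm: "{p. Q p} \<in> sets borel" by simp
 have "AE R in lborel. AE r in lborel. Q (r, R - r)"
  using char_formula
 proof eventually_elim
  case (elim R)
  show ?case
  proof (cases "0 < R")
   case False
   then have "Q (r, R - r)" for r using a by (auto simp: Q_def)
   then show ?thesis by simp
  next
   case True
   then have "AE r in lborel. r \<in> {0<..<R} --> \<phi> (r, R - r) = trace R - tail r R" using elim by blast
   then show ?thesis
   proof eventually_elim
    case (elim r)
    show ?case
     unfolding Q_def fst_conv snd_conv
    proof (intro impI)
     assume r: "0 < R - r \<and> R - r < 1 \<and> a < r \<and> r < b"
     have C: "0 \<le> E0 * R ^ (d - 2) / a ^ (d - 1)" using E0 True a by simp
     have "\<bar>tail r R\<bar> \<le> (1 + E0 * R ^ (d - 2) / a ^ (d - 1)) / 2 * sqrt (R - r)"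
      unfolding tail_def
      by (rule primitive_holder(2)[OF slice_measurable(1) slice_deriv_L2_char[OF a] C]) (use r in auto)
     also have "\<dots> \<le> holder_const a b * sqrt (R - r)"
      unfolding holder_const_def using E0 True a r
      by (intro mult_right_mono divide_right_mono add_left_mono mult_left_mono power_mono) auto
     finally show "\<bar>\<phi> (r, R - r) - trace (r + (R - r))\<bar> \<le> holder_const a b * sqrt (R - r)" using elim r a by simp
    qed
   qed
  qed
 qed
 from AE_characteristics(2)[OF Qm this] show ?thesis by (simp add: Q_def)
qed

lemma time_slice_holder:
 assumes a: "0 < a" and ab: "a < b"
 shows "AE t in lborel. 0 < t \<and> t < 1 --> (\<exists>f. (AE r in lborel. r \<in> {a<..<b} --> \<phi> (r, t) = f r) \<and>
  (\<forall>x\<in>{a<..<b}. \<forall>y\<in>{a<..<b}. \<bar>f x - f y\<bar> \<le> holder_const a b * sqrt \<bar>x - y\<bar>))"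
 using slice_primitive[OF a ab order_refl]
proof eventually_elim
 case (elim t)
 show ?case
 proof
  assume t: "0 < t \<and> t < 1"
  then obtain z where z: "AE r in lborel. r \<in> {a<..<b} --> \<phi> (r, t) = z + (LBINT s. indicator {a<..<r} s * slice_deriv 0 s t)"
   using elim by auto
  define f where "f r = z + (LBINT s. indicator {a<..<r} s * slice_deriv 0 s t)" for r
  have C: "0 \<le> E0 * (b + t) ^ (d - 2) / a ^ (d - 1)" using E0 a ab t by simp
  note ph = primitive_holder[OF slice_measurable(1) slice_deriv_L2_time[OF a ab, of t] C]
  have le: "\<bar>f x - f y\<bar> \<le> holder_const a b * sqrt \<bar>x - y\<bar>" if xy: "a < x" "x \<le> y" "y < b" for x y
  proof -
   have i: "integrable lborel (%s. indicator {a<..<x} s * slice_deriv 0 s t)" "integrable lborel (%s. indicator {x<..<y} s * slice_deriv 0 s t)"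
    by (rule ph(1); use t xy in auto)+
   have "(LBINT s. indicator {a<..<y} s * slice_deriv 0 s t)
    = (LBINT s. indicator {a<..<x} s * slice_deriv 0 s t + indicator {x<..<y} s * slice_deriv 0 s t)"
   proof (rule integral_cong_AE)
    have [measurable]: "(%s. slice_deriv 0 s t) \<in> borel_measurable borel" by (rule slice_measurable(1))
    show "(%s. indicator {a<..<y} s * slice_deriv 0 s t) \<in> borel_measurable lborel" by measurable
    show "(%s. indicator {a<..<x} s * slice_deriv 0 s t + indicator {x<..<y} s * slice_deriv 0 s t) \<in> borel_measurable lborel" by measurable
    show "AE s in lborel. indicator {a<..<y} s * slice_deriv 0 s t = indicator {a<..<x} s * slice_deriv 0 s t + indicator {x<..<y} s * slice_deriv 0 s t"
     using AE_lborel_singleton[of x] by eventually_elim (use xy in \<open>auto simp: indicator_def\<close>)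
   qed
   also have "\<dots> = (LBINT s. indicator {a<..<x} s * slice_deriv 0 s t) + (LBINT s. indicator {x<..<y} s * slice_deriv 0 s t)"
    by (rule Bochner_Integration.integral_add[OF i])
   finally have "\<bar>f x - f y\<bar> = \<bar>\<integral>s. indicator {x<..<y} s * slice_deriv 0 s t \<partial>lborel\<bar>" by (simp add: f_def)
   also have "\<dots> \<le> (1 + E0 * (b + t) ^ (d - 2) / a ^ (d - 1)) / 2 * sqrt (y - x)"
    by (rule ph(2)) (use t xy in auto)
   also have "\<dots> \<le> holder_const a b * sqrt (y - x)"
    unfolding holder_const_def using E0 a ab t xy
    by (intro mult_right_mono divide_right_mono add_left_mono mult_left_mono power_mono) auto
   finally show ?thesis using xy(2) by (simp add: abs_minus_commute[of x y])
  qed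
  show "\<exists>f. (AE r in lborel. r \<in> {a<..<b} --> \<phi> (r, t) = f r) \<and>
   (\<forall>x\<in>{a<..<b}. \<forall>y\<in>{a<..<b}. \<bar>f x - f y\<bar> \<le> holder_const a b * sqrt \<bar>x - y\<bar>)"
  proof (intro exI[of _ f] conjI ballI)
   show "AE r in lborel. r \<in> {a<..<b} --> \<phi> (r, t) = f r" using z by (simp add: f_def)
   fix x y assume "x \<in> {a<..<b}" "y \<in> {a<..<b}"
   then show "\<bar>f x - f y\<bar> \<le> holder_const a b * sqrt \<bar>x - y\<bar>"
    using le[of x y] le[of y x] by (cases "x \<le> y") (auto simp: abs_minus_commute)
  qed
 qed
qed

text \<open>At suitable times t_n tending to 0 the slices are 1/2-Hoelder with one constant, and the
  trace at x differs from the slice at x - t_n by O(sqrt t_n). The limit inherits the modulus off a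
  countable union of null sets.\<close>

lemma trace_holder:
 assumes a: "0 < a" and ab: "a < b"
 shows "\<exists>G. (AE x in lborel. x \<in> G) \<and>
  (\<forall>x\<in>G \<inter> {a<..<b}. \<forall>y\<in>G \<inter> {a<..<b}. \<bar>trace x - trace y\<bar> \<le> holder_const a b * sqrt \<bar>x - y\<bar>)"
proof -
 let ?K = "holder_const a b"
 \<comment> \<open>The time slice is replaced by its continuous version f. The shift x - t appears
   because \<open>trace_approx\<close> compares \<phi> (r, t) with the trace at r + t.\<close>
 define good where "good t \<longleftrightarrow> (\<exists>f. (AE x in lborel. x \<in> {a + t<..<b + t} --> \<bar>f (x - t) - trace x\<bar> \<le> ?K * sqrt t) \<and>
  (\<forall>x\<in>{a<..<b}. \<forall>y\<in>{a<..<b}. \<bar>f x - f y\<bar> \<le> ?K * sqrt \<bar>x - y\<bar>))" for t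
 have gd: "AE t in lborel. 0 < t \<and> t < 1 --> good t"
  using trace_approx[OF a ab] time_slice_holder[OF a ab]
 proof eventually_elim
  case (elim t)
  show ?case
  proof
   assume t: "0 < t \<and> t < 1"
   from elim(2) t obtain f where f: "AE r in lborel. r \<in> {a<..<b} --> \<phi> (r, t) = f r"
    "\<forall>x\<in>{a<..<b}. \<forall>y\<in>{a<..<b}. \<bar>f x - f y\<bar> \<le> ?K * sqrt \<bar>x - y\<bar>" by blast
   have "AE r in lborel. r \<in> {a<..<b} --> \<bar>f r - trace (r + t)\<bar> \<le> ?K * sqrt t"
    using elim(1) f(1) by eventually_elim (use t in auto)
   from AE_translate[OF this, of "- t"]
   have "AE x in lborel. x \<in> {a + t<..<b + t} --> \<bar>f (x - t) - trace x\<bar> \<le> ?K * sqrt t"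
    by eventually_elim auto
   then show "good t" unfolding good_def using f(2) by blast
  qed
 qed
 have "\<exists>t. 0 < t \<and> t < 1 / real (n + 1) \<and> good t" for n :: nat
 proof -
  have "0 < 1 / real (n + 1)" by simp
  from AE_interval_ex[OF gd this] obtain t where t: "t \<in> {0<..<1 / real (n + 1)}" "0 < t \<and> t < 1 --> good t" by blast
  have "t < 1 / real (n + 1)" using t(1) unfolding greaterThanLessThan_iff by blast
  also have "\<dots> \<le> 1" by simp
  finally have "t < 1" .
  then show ?thesis using t by auto
 qed
 then obtain tt where tt: "\<And>n. 0 < tt n" "\<And>n::nat. tt n < 1 / real (n + 1)" "\<And>n. good (tt n)" by metis
 from tt(3) have "\<exists>f. \<forall>n. (AE x in lborel. x \<in> {a + tt n<..<b + tt n} --> \<bar>f n (x - tt n) - trace x\<bar> \<le> ?K * sqrt (tt n)) \<and>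
  (\<forall>x\<in>{a<..<b}. \<forall>y\<in>{a<..<b}. \<bar>f n x - f n y\<bar> \<le> ?K * sqrt \<bar>x - y\<bar>)"
  unfolding good_def by (intro choice) blast
 then obtain f where f1: "\<And>n. AE x in lborel. x \<in> {a + tt n<..<b + tt n} --> \<bar>f n (x - tt n) - trace x\<bar> \<le> ?K * sqrt (tt n)"
  and f2: "\<And>n x y. x \<in> {a<..<b} ==> y \<in> {a<..<b} ==> \<bar>f n x - f n y\<bar> \<le> ?K * sqrt \<bar>x - y\<bar>" by blast
 have tt0: "tt \<longlonglongrightarrow> 0"
 proof (rule tendsto_sandwich[OF always_eventually always_eventually tendsto_const])
  show "(%n. 1 / real (n + 1)) \<longlonglongrightarrow> 0" using LIMSEQ_inverse_real_of_nat by (simp add: inverse_eq_divide)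
  show "\<forall>n. 0 \<le> tt n" using tt(1) less_imp_le by blast
  show "\<forall>n. tt n \<le> 1 / real (n + 1)" using tt(2) less_imp_le by blast
 qed
 define G where "G = {x. \<forall>n. x \<in> {a + tt n<..<b + tt n} --> \<bar>f n (x - tt n) - trace x\<bar> \<le> ?K * sqrt (tt n)}"
 have "AE x in lborel. \<forall>n. x \<in> {a + tt n<..<b + tt n} --> \<bar>f n (x - tt n) - trace x\<bar> \<le> ?K * sqrt (tt n)"
  unfolding AE_all_countable using f1 by blast
 then have "AE x in lborel. x \<in> G" unfolding G_def by simp
 moreover have "\<bar>trace x - trace y\<bar> \<le> ?K * sqrt \<bar>x - y\<bar>" if x: "x \<in> G \<inter> {a<..<b}" and y: "y \<in> G \<inter> {a<..<b}" for x y
 proof (rule tendsto_lowerbound)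
  have "(%n. 2 * (?K * sqrt (tt n)) + ?K * sqrt \<bar>x - y\<bar>) \<longlonglongrightarrow> 2 * (?K * sqrt 0) + ?K * sqrt \<bar>x - y\<bar>"
   by (intro tendsto_intros tt0)
  then show "(%n. 2 * (?K * sqrt (tt n)) + ?K * sqrt \<bar>x - y\<bar>) \<longlonglongrightarrow> ?K * sqrt \<bar>x - y\<bar>" by simp
  have "\<forall>\<^sub>F n in sequentially. tt n < min (x - a) (y - a)"
   by (rule order_tendstoD(2)[OF tt0]) (use x y in auto)
  then show "\<forall>\<^sub>F n in sequentially. \<bar>trace x - trace y\<bar> \<le> 2 * (?K * sqrt (tt n)) + ?K * sqrt \<bar>x - y\<bar>"
  proof eventually_elim
   case (elim n)
   have "x \<in> {a + tt n<..<b + tt n}" "y \<in> {a + tt n<..<b + tt n}" using elim x y tt(1)[of n] by auto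
   then have "\<bar>f n (x - tt n) - trace x\<bar> \<le> ?K * sqrt (tt n)" "\<bar>f n (y - tt n) - trace y\<bar> \<le> ?K * sqrt (tt n)"
    using x y by (auto simp: G_def)
   moreover have "\<bar>f n (x - tt n) - f n (y - tt n)\<bar> \<le> ?K * sqrt \<bar>(x - tt n) - (y - tt n)\<bar>"
    by (rule f2) (use elim x y tt(1)[of n] in auto)
   ultimately show ?case by simp
  qed
 qed simp
 ultimately show ?thesis by blast
qed

text \<open>Moves the argument of the trace from r + t to r at the price of a second sqrt t; the
  enlarged endpoint b + 1 leaves room for r + t.\<close>

lemma initial_trace:
 assumes a: "0 < a" and ab: "a < b"
 shows "AE t in lborel. 0 < t \<and> t < 1 --> (AE r in lborel. r \<in> {a<..<b} --> \<bar>\<phi> (r, t) - trace r\<bar> \<le> 2 * holder_const a (b + 1) * sqrt t)"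
proof -
 let ?K = "holder_const a (b + 1)"
 have ab1: "a < b + 1" using ab by simp
 obtain G where G: "AE x in lborel. x \<in> G"
  "\<And>x y. x \<in> G \<inter> {a<..<b + 1} ==> y \<in> G \<inter> {a<..<b + 1} ==> \<bar>trace x - trace y\<bar> \<le> ?K * sqrt \<bar>x - y\<bar>"
  using trace_holder[OF a ab1] by blast
 show ?thesis
  using trace_approx[OF a ab1]
 proof eventually_elim
  case (elim t)
  show ?case
  proof
   assume t: "0 < t \<and> t < 1"
   show "AE r in lborel. r \<in> {a<..<b} --> \<bar>\<phi> (r, t) - trace r\<bar> \<le> 2 * ?K * sqrt t"
    using elim G(1) AE_translate[OF G(1), of t]
   proof eventually_elim
    case (elim r)
    show ?case
    proof
     assume r: "r \<in> {a<..<b}"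
     have "\<bar>\<phi> (r, t) - trace (r + t)\<bar> \<le> ?K * sqrt t" using elim(1) r t by auto
     moreover have "\<bar>trace (r + t) - trace r\<bar> \<le> ?K * sqrt \<bar>r + t - r\<bar>" by (rule G(2)) (use elim r t in auto)
     ultimately show "\<bar>\<phi> (r, t) - trace r\<bar> \<le> 2 * ?K * sqrt t" using t by simp
    qed
   qed
  qed
 qed
qed

end

section \<open>Identification of the initial trace\<close>

text \<open>P and X are controlled on spheres only and may be arbitrary elsewhere, so auxiliary
  extensions by 0 are used and the origin is masked by an indicator.\<close>

lemma chart_measurable:
 fixes P :: "real => real^'m => real^'n" and X :: "real^'d => real^'m"
 assumes W: "warped_coordinates N g P" and X: "eigenmap k X" and h[measurable]: "h \<in> borel_measurable borel"
 shows "(%x. indicator (- {0}) x *\<^sub>R P (h x) (X (sgn x))) \<in> borel_measurable borel"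
proof -
 define Pb where "Pb p = (if p \<in> UNIV \<times> (- {0}) then P (fst p) (sgn (snd p)) else 0)" for p :: "real \<times> (real^'m)"
 define Xb where "Xb x = (if x \<in> - {0} then X (sgn x) else 0)" for x
 have "continuous_on (UNIV \<times> (- {0})) (%(s, y). P s (sgn y))"
  using W smooth_on_continuous unfolding warped_coordinates_def by blast
 then have c: "continuous_on (UNIV \<times> (- {0})) (%p. P (fst p) (sgn (snd p)))" by (simp add: case_prod_beta')
 have Pm: "Pb \<in> borel_measurable borel" unfolding Pb_def[abs_def]
  by (rule borel_measurable_continuous_on_if[OF _ c]) (auto intro!: borel_open open_Times)
 have Xm[measurable]: "Xb \<in> borel_measurable borel" unfolding Xb_def[abs_def]
  by (rule borel_measurable_continuous_on_if[OF _ smooth_on_continuous[OF eigenmap_smooth[OF X]]]) (auto intro!: borel_open)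
 have "(%x. (h x, Xb x)) \<in> borel \<rightarrow>\<^sub>M borel" unfolding borel_prod[symmetric] by measurable
 from measurable_compose[OF this Pm] have "(%x. indicator (- {0}) x *\<^sub>R Pb (h x, Xb x)) \<in> borel_measurable borel" by measurable
 moreover have "(%x. indicator (- {0}) x *\<^sub>R Pb (h x, Xb x)) = (%x. indicator (- {0}) x *\<^sub>R P (h x) (X (sgn x)))"
 proof
  fix x
  show "indicator (- {0}) x *\<^sub>R Pb (h x, Xb x) = indicator (- {0}) x *\<^sub>R P (h x) (X (sgn x))"
  proof (cases "x = 0")
   case False
   then have "norm (X (sgn x)) = 1" using eigenmap_sphere[OF X sgn_sphere[OF False]] by simp
   then have "X (sgn x) \<noteq> 0" "sgn (X (sgn x)) = X (sgn x)" by (auto simp: sgn_div_norm)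
   then show ?thesis using False by (simp add: Pb_def Xb_def)
  qed simp
 qed
 ultimately show ?thesis by simp
qed

lemma L2_inner_integrable:
 fixes f h :: "'a::euclidean_space => 'b::euclidean_space"
 assumes f: "L2_on A f" and h: "L2_on A h"
 shows "set_integrable lborel A (%x. f x \<bullet> h x)"
 unfolding set_integrable_def
proof (rule Bochner_Integration.integrable_bound[OF L2_on_mult_integrable[OF f h]])
 have [measurable]: "(%x. indicator A x *\<^sub>R f x) \<in> borel_measurable lborel" "(%x. indicator A x *\<^sub>R h x) \<in> borel_measurable lborel"
  using f h by (auto simp: L2_on_def set_borel_measurable_def)
 have "(%x. indicator A x *\<^sub>R (f x \<bullet> h x)) = (%x. (indicator A x *\<^sub>R f x) \<bullet> (indicator A x *\<^sub>R h x))"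
  by (auto simp: indicator_def)
 also have "\<dots> \<in> borel_measurable lborel" by measurable
 finally show "(%x. indicator A x *\<^sub>R (f x \<bullet> h x)) \<in> borel_measurable lborel" .
 show "AE x in lborel. norm (indicator A x *\<^sub>R (f x \<bullet> h x)) \<le> norm (indicator A x *\<^sub>R (norm (f x) * norm (h x)))"
  by (intro AE_I2) (auto simp: indicator_def Cauchy_Schwarz_ineq2)
qed

text \<open>The Jacobian in the polar formula is positive for r > 0, so a Borel set of positive
  radii whose spheres fill a null set is itself null.\<close>

lemma AE_radial_converse:
 fixes Q :: "real => bool"
 assumes Q: "{r. Q r} \<in> sets borel" and *: "AE x::'a::euclidean_space in lborel. x \<in> cball 0 M --> Q (norm x)" and M: "M > 0"
 shows "AE r in lborel. 0 < r \<and> r \<le> M --> Q r"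
proof -
 define f :: "real => ennreal" where "f = indicator (- {r. Q r})"
 have fm[measurable]: "f \<in> borel_measurable borel" using Q by (simp add: f_def)
 have "(\<integral>\<^sup>+x\<in>cball (0::'a) M. f (norm x) \<partial>lborel) = 0"
 proof -
  have m: "(%x::'a. f (norm x) * indicator (cball 0 M) x) \<in> borel_measurable lborel" by measurable
  show ?thesis unfolding nn_integral_0_iff_AE[OF m]
   using * by eventually_elim (auto simp: f_def indicator_def)
 qed
 then have "(\<integral>\<^sup>+r\<in>{0..M}. f r * ennreal (unit_ball_vol (real DIM('a)) * (real DIM('a) * r ^ (DIM('a) - 1))) \<partial>lborel) = 0"
  using nn_integral_radial[OF fm M, where 'a = 'a] by simp
 then have "AE r in lborel. f r * ennreal (unit_ball_vol (real DIM('a)) * (real DIM('a) * r ^ (DIM('a) - 1))) * indicator {0..M} r = 0"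
  by (subst (asm) nn_integral_0_iff_AE) auto
 then show ?thesis
 proof eventually_elim
  case (elim r)
  show ?case
  proof
   assume r: "0 < r \<and> r \<le> M"
   define c where "c = unit_ball_vol (real DIM('a)) * (real DIM('a) * r ^ (DIM('a) - 1))"
   have c: "0 < c" using r by (simp add: c_def)
   from elim have "f r * ennreal c * indicator {0..M} r = 0" unfolding c_def .
   then have "f r * ennreal c = 0" using r by (simp only: indicator_def) simp
   then have "f r = 0" using c by auto
   then show "Q r" by (auto simp: f_def indicator_def split: if_splits)
  qed
 qed
qed

text \<open>Closedness makes the set of radii at which L r - s is a period a Borel set, as the
  passage from x to r requires.\<close>

lemma closed_coord_periods:
 fixes P :: "real => real^'m => real^'n"
 assumes W: "warped_coordinates N g P"
 shows "closed {T. coord_period P T}"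
proof -
 have "{T. coord_period P T} = (\<Inter>s. \<Inter>y\<in>sphere 0 1. {T. P (s + T) y = P s y})" by (auto simp: coord_period_def)
 moreover have "closed {T. P (s + T) y = P s y}" if y: "y \<in> sphere 0 1" for s y
 proof (rule closed_Collect_eq)
  show "continuous_on UNIV (%T. P (s + T) y)"
  proof (rule continuous_on_subset[OF _ subset_UNIV] , unfold continuous_on_iff, intro ballI allI impI)
   fix x e :: real assume e: "0 < e"
   show "\<exists>d>0. \<forall>x'\<in>UNIV. dist x' x < d --> dist (P (s + x') y) (P (s + x) y) < e"
   proof (intro exI[of _ e] conjI ballI impI e)
    fix x' assume "dist x' x < e"
    then show "dist (P (s + x') y) (P (s + x) y) < e"
     using curve_lipschitz[OF W y, of "s + x'" "s + x"] by (simp add: dist_norm)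
   qed
  qed
 qed (intro continuous_intros)
 ultimately show ?thesis by (simp add: closed_INT)
qed

text \<open>Since coordinate lines have unit speed, the maps at good times converge to the map with
  coordinate L uniformly, up to null sets, on the annulus; weakly they converge to the equator map.
  Testing weak convergence with the truncated difference of the two limits shows that the integral
  of its square is 0, and uniqueness of coordinates turns this into a statement about L.\<close>

lemma weak_initial_trace:
 fixes P :: "real => real^'m => real^'n" and X :: "real^'d => real^'m" and L :: "real => real"
 assumes W: "warped_coordinates N g P" and X: "eigenmap k X" and gs: "g s \<noteq> 0"
  and Lm[measurable]: "L \<in> borel_measurable borel"
  and a: "0 < a" and ab: "a < b" and K: "K \<ge> 0"
  and att: "weakly_tendsto_initially (%(x, t). equivariant_map P X (%r. \<phi> (r, t)) x) (equivariant_map P X (%r. s))"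
  and near: "AE t in lborel. 0 < t \<and> t < 1 --> (AE r in lborel. r \<in> {a<..<b} --> \<bar>\<phi> (r, t) - L r\<bar> \<le> K * sqrt t)"
 shows "AE r in lborel. r \<in> {a<..<b} --> coord_period P (L r - s)"
proof -
 have b: "b > 0" using a ab by simp
 define F where "F t x = P (\<phi> (norm x, t)) (X (sgn x))" for t and x :: "real^'d"
 define u0 where "u0 x = P s (X (sgn x))" for x :: "real^'d"
 define uL where "uL x = P (L (norm x)) (X (sgn x))" for x :: "real^'d"
 have conv: "L2_on (cball 0 b) u0 \<and> (\<exists>Z\<in>null_sets lborel.
    (\<forall>t\<in>{0<..} - Z. L2_on (cball 0 b) (F t)) \<and>
    (\<forall>\<zeta>. L2_on (cball 0 b) \<zeta> -->
     ((%t. LINT x:cball 0 b|lborel. F t x \<bullet> \<zeta> x)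
      \<longlongrightarrow> (LINT x:cball 0 b|lborel. u0 x \<bullet> \<zeta> x)) (at 0 within ({0<..} - Z))))"
  using mp[OF spec[OF att[unfolded weakly_tendsto_initially_def], of b] b]
  unfolding F_def[abs_def] u0_def[abs_def] equivariant_map_def[abs_def] case_prod_conv .
 from conjunct2[OF conv] obtain Z where Z: "Z \<in> null_sets lborel" and ZZ: "(\<forall>t\<in>{0<..} - Z. L2_on (cball 0 b) (F t)) \<and>
    (\<forall>\<zeta>. L2_on (cball 0 b) \<zeta> -->
     ((%t. LINT x:cball 0 b|lborel. F t x \<bullet> \<zeta> x)
      \<longlongrightarrow> (LINT x:cball 0 b|lborel. u0 x \<bullet> \<zeta> x)) (at 0 within ({0<..} - Z)))" by (elim bexE)
 note L2u0 = conjunct1[OF conv] and L2F = bspec[OF conjunct1[OF ZZ]] and lim = mp[OF spec[OF conjunct2[OF ZZ]]]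
 have Zae: "AE t in lborel. t \<notin> Z" using Z by (rule AE_not_in)
 have gd: "AE t in lborel. t \<notin> Z \<and> (0 < t \<and> t < 1 --> (AE r in lborel. r \<in> {a<..<b} --> \<bar>\<phi> (r, t) - L r\<bar> \<le> K * sqrt t))"
  using Zae near by eventually_elim blast
 \<comment> \<open>Weak convergence and closeness to L both hold off null sets of times, so a
   sequence of good times tending to 0 is selected.\<close>
 have "\<exists>t. 0 < t \<and> t < 1 / real (n + 1) \<and> t \<notin> Z \<and> (AE r in lborel. r \<in> {a<..<b} --> \<bar>\<phi> (r, t) - L r\<bar> \<le> K * sqrt t)" for n :: nat
 proof -
  have "0 < 1 / real (n + 1)" by simp
  from AE_interval_ex[OF gd this] obtain t where t: "t \<in> {0<..<1 / real (n + 1)}" and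
   q: "t \<notin> Z \<and> (0 < t \<and> t < 1 --> (AE r in lborel. r \<in> {a<..<b} --> \<bar>\<phi> (r, t) - L r\<bar> \<le> K * sqrt t))" by (elim bexE)
  have t0: "0 < t" and tn: "t < 1 / real (n + 1)" using t unfolding greaterThanLessThan_iff by blast+
  note tn
  also have "1 / real (n + 1) \<le> 1" by simp
  finally have t1: "t < 1" .
  show ?thesis
   by (rule exI[of _ t], intro conjI) (rule t0 tn conjunct1[OF q] mp[OF conjunct2[OF q] conjI[OF t0 t1]])+
 qed
 then have "\<forall>n::nat. \<exists>t. 0 < t \<and> t < 1 / real (n + 1) \<and> t \<notin> Z \<and> (AE r in lborel. r \<in> {a<..<b} --> \<bar>\<phi> (r, t) - L r\<bar> \<le> K * sqrt t)"
  by (rule allI)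
 from choice[OF this] obtain tt where tt': "\<forall>n::nat. 0 < tt n \<and> tt n < 1 / real (n + 1) \<and> tt n \<notin> Z \<and>
  (AE r in lborel. r \<in> {a<..<b} --> \<bar>\<phi> (r, tt n) - L r\<bar> \<le> K * sqrt (tt n))" by (elim exE)
 note tt = conjunct1[OF spec[OF tt']] conjunct1[OF conjunct2[OF spec[OF tt']]]
  conjunct1[OF conjunct2[OF conjunct2[OF spec[OF tt']]]] conjunct2[OF conjunct2[OF conjunct2[OF spec[OF tt']]]]
 have tt1: "tt n < 1" for n
 proof -
  have "1 / real (n + 1) \<le> 1" by simp
  then show ?thesis using tt(2)[of n] by linarith
 qed
 have tt0: "tt \<longlonglongrightarrow> 0"
 proof (rule tendsto_sandwich[OF always_eventually always_eventually tendsto_const])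
  show "(%n. 1 / real (n + 1)) \<longlonglongrightarrow> 0" using LIMSEQ_inverse_real_of_nat by (simp add: inverse_eq_divide)
  show "\<forall>n. 0 \<le> tt n" using tt(1) less_imp_le by blast
  show "\<forall>n. tt n \<le> 1 / real (n + 1)" using tt(2) less_imp_le by blast
 qed
 have ttf: "filterlim tt (at 0 within ({0<..} - Z)) sequentially"
 proof -
  have h: "tt n \<in> {0<..} - Z \<and> tt n \<noteq> 0" for n using tt(1)[of n] tt(3)[of n] by auto
  show ?thesis unfolding filterlim_at by (rule conjI[OF always_eventually tt0]) (rule allI, rule h)
 qed
 have nx: "AE x in lborel. \<forall>n. norm x \<in> {a<..<b} --> \<bar>\<phi> (norm (x::real^'d), tt n) - L (norm x)\<bar> \<le> K * sqrt (tt n)"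
  unfolding AE_all_countable
 proof
  fix n show "AE x in lborel. norm x \<in> {a<..<b} --> \<bar>\<phi> (norm (x::real^'d), tt n) - L (norm x)\<bar> \<le> K * sqrt (tt n)"
   using AE_radial[OF tt(4)[of n], where 'a = "real^'d"] .
 qed
 \<comment> \<open>No bound on L is available. Restricting to |L| \<le> M makes the test function
   bounded, and M runs through the naturals afterwards.\<close>
 have main: "AE x in lborel. norm (x::real^'d) \<in> {a<..<b} \<and> \<bar>L (norm x)\<bar> \<le> real M --> uL x = u0 x" for M :: nat
 proof -
  define S where "S = {x::real^'d. a < norm x \<and> norm x < b \<and> \<bar>L (norm x)\<bar> \<le> real M}"
  have Sm: "S \<in> sets borel"
  proof -
   have "{x::real^'d \<in> space borel. a < norm x \<and> norm x < b \<and> \<bar>L (norm x)\<bar> \<le> real M} \<in> sets borel" by measurable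
   then show ?thesis by (simp add: S_def)
  qed
  define \<zeta> where "\<zeta> x = indicator S x *\<^sub>R (uL x - u0 x)" for x
  define M' where "M' = real M + \<bar>s\<bar>"
  have M': "M' \<ge> 0" by (simp add: M'_def)
  have Xs: "X (sgn x) \<in> sphere 0 1" if "x \<in> S" for x
   using that a by (intro eigenmap_sphere[OF X] sgn_sphere) (auto simp: S_def)
  have \<zeta>b: "norm (\<zeta> x) \<le> M'" for x
  proof (cases "x \<in> S")
   case True
   have "norm (uL x - u0 x) \<le> \<bar>L (norm x) - s\<bar>" unfolding uL_def u0_def by (rule curve_lipschitz[OF W Xs[OF True]])
   also have "\<dots> \<le> M'" using True by (auto simp: S_def M'_def)
   finally show ?thesis using True by (simp add: \<zeta>_def)
  qed (use M' in \<open>simp add: \<zeta>_def\<close>)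
  have \<zeta>m[measurable]: "\<zeta> \<in> borel_measurable borel"
  proof -
   have [measurable]: "S \<in> sets borel" by (rule Sm)
   have Ln: "(%x::real^'d. L (norm x)) \<in> borel_measurable borel" by measurable
   have [measurable]: "(%x. indicator (- {0}) x *\<^sub>R uL x) \<in> borel_measurable borel" "(%x. indicator (- {0}) x *\<^sub>R u0 x) \<in> borel_measurable borel"
    unfolding uL_def u0_def using chart_measurable[OF W X Ln] chart_measurable[OF W X, of "%x. s"] by auto
   have "\<zeta> = (%x. indicator S x *\<^sub>R (indicator (- {0}) x *\<^sub>R uL x - indicator (- {0}) x *\<^sub>R u0 x))"
    using a by (auto simp: \<zeta>_def S_def indicator_def)
   also have "\<dots> \<in> borel_measurable borel" by measurable
   finally show ?thesis .
  qed
  have L2\<zeta>: "L2_on (cball 0 b) \<zeta>"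
  proof (rule L2_on_dominated[OF L2_on_const[of b M']])
   show "set_borel_measurable lborel (cball 0 b) \<zeta>" unfolding set_borel_measurable_def by measurable
   show "AE x in lborel. x \<in> cball 0 b --> norm (\<zeta> x) \<le> norm M'" using \<zeta>b M' by simp
  qed
  define D where "D n = (LINT x:cball 0 b|lborel. (F (tt n) x - u0 x) \<bullet> \<zeta> x)" for n
  have iF: "set_integrable lborel (cball 0 b) (%x. F (tt n) x \<bullet> \<zeta> x)" for n
   by (rule L2_inner_integrable[OF L2F L2\<zeta>]) (use tt in auto)
  have iu: "set_integrable lborel (cball 0 b) (%x. u0 x \<bullet> \<zeta> x)" by (rule L2_inner_integrable[OF L2u0 L2\<zeta>])
  have D: "D n = (LINT x:cball 0 b|lborel. F (tt n) x \<bullet> \<zeta> x) - (LINT x:cball 0 b|lborel. u0 x \<bullet> \<zeta> x)" for n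
   unfolding D_def inner_diff_left by (rule set_integral_diff(2)[OF iF iu])
  have "(%n. LINT x:cball 0 b|lborel. F (tt n) x \<bullet> \<zeta> x) \<longlonglongrightarrow> (LINT x:cball 0 b|lborel. u0 x \<bullet> \<zeta> x)"
   by (rule filterlim_compose[OF lim[OF L2\<zeta>] ttf])
  then have D0: "D \<longlonglongrightarrow> 0" unfolding D[abs_def] by (intro LIM_zero)
  have "D \<longlonglongrightarrow> (LBINT x. indicator (cball 0 b) x *\<^sub>R (\<zeta> x \<bullet> \<zeta> x))"
   unfolding D_def[abs_def] set_lebesgue_integral_def
  proof (rule integral_dominated_convergence)
   show "(%x. indicator (cball 0 b) x *\<^sub>R (\<zeta> x \<bullet> \<zeta> x)) \<in> borel_measurable lborel" by measurable
   show "(%x. indicator (cball 0 b) x *\<^sub>R ((F (tt n) x - u0 x) \<bullet> \<zeta> x)) \<in> borel_measurable lborel" for n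
    using borel_measurable_integrable[OF set_integral_diff(1)[OF iF[of n] iu, unfolded set_integrable_def]]
    by (simp add: inner_diff_left)
   show "integrable lborel (%x::real^'d. (indicator (cball 0 b) x * ((M' + K) * M')))"
    by (rule integrable_mult_left, rule integrable_real_indicator[OF _ emeasure_bounded_finite]) auto
   have nr: "norm (F (tt n) x - uL x) \<le> K * sqrt (tt n)"
    if "x \<in> S" "\<forall>n. norm x \<in> {a<..<b} --> \<bar>\<phi> (norm x, tt n) - L (norm x)\<bar> \<le> K * sqrt (tt n)" for x n
   proof -
    have "norm (F (tt n) x - uL x) \<le> \<bar>\<phi> (norm x, tt n) - L (norm x)\<bar>"
     unfolding F_def uL_def by (rule curve_lipschitz[OF W Xs[OF that(1)]])
    also have "\<dots> \<le> K * sqrt (tt n)" using that(1) spec[OF that(2), of n] by (simp add: S_def)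
    finally show ?thesis .
   qed
   show "AE x in lborel. (%n. indicator (cball 0 b) x *\<^sub>R ((F (tt n) x - u0 x) \<bullet> \<zeta> x)) \<longlonglongrightarrow> indicator (cball 0 b) x *\<^sub>R (\<zeta> x \<bullet> \<zeta> x)"
    using nx
   proof eventually_elim
    case (elim x)
    show ?case
    proof (cases "x \<in> S")
     case True
     have "(%n. F (tt n) x) \<longlonglongrightarrow> uL x"
     proof (rule Lim_transform_bound[of _ "%n. K * sqrt (tt n)", THEN LIM_zero_cancel])
      show "\<forall>\<^sub>F n in sequentially. norm (F (tt n) x - uL x) \<le> norm (K * sqrt (tt n))"
       by (rule always_eventually, rule allI, unfold real_norm_def, rule order_trans[OF nr[OF True elim] abs_ge_self])
      have "(%n. K * sqrt (tt n)) \<longlonglongrightarrow> K * sqrt 0" by (intro tendsto_intros tt0)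
      then show "(%n. K * sqrt (tt n)) \<longlonglongrightarrow> 0" by simp
     qed
     then have "(%n. indicator (cball 0 b) x *\<^sub>R ((F (tt n) x - u0 x) \<bullet> \<zeta> x)) \<longlonglongrightarrow> indicator (cball 0 b) x *\<^sub>R ((uL x - u0 x) \<bullet> \<zeta> x)"
      by (intro tendsto_intros)
     then show ?thesis using True by (simp add: \<zeta>_def)
    qed (simp add: \<zeta>_def)
   qed
   show "AE x in lborel. norm (indicator (cball 0 b) x *\<^sub>R ((F (tt n) x - u0 x) \<bullet> \<zeta> x)) \<le> indicator (cball 0 b) x * ((M' + K) * M')" for n
    using nx
   proof eventually_elim
    case (elim x)
    have "\<bar>(F (tt n) x - u0 x) \<bullet> \<zeta> x\<bar> \<le> (M' + K) * M'"
    proof (cases "x \<in> S")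
     case True
     have "sqrt (tt n) \<le> 1" using tt1[of n] by (simp add: less_imp_le)
     then have "K * sqrt (tt n) \<le> K" using K by (simp add: mult_left_le)
     then have 1: "norm (F (tt n) x - uL x) \<le> K" using nr[OF True elim, of n] by simp
     have 2: "norm (uL x - u0 x) \<le> M'" using \<zeta>b[of x] True by (simp add: \<zeta>_def)
     have "norm (F (tt n) x - u0 x) \<le> norm (F (tt n) x - uL x) + norm (uL x - u0 x)"
      using norm_triangle_ineq[of "F (tt n) x - uL x" "uL x - u0 x"] by simp
     then have "norm (F (tt n) x - u0 x) \<le> M' + K" using 1 2 by simp
     then have "norm (F (tt n) x - u0 x) * norm (\<zeta> x) \<le> (M' + K) * M'" using \<zeta>b[of x] M' K by (intro mult_mono) auto
     then show ?thesis using Cauchy_Schwarz_ineq2[of "F (tt n) x - u0 x" "\<zeta> x"] by linarith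
    qed (use M' K in \<open>simp add: \<zeta>_def\<close>)
    then show ?case by (auto simp: indicator_def)
   qed
  qed
  then have z: "(LBINT x. indicator (cball 0 b) x *\<^sub>R (\<zeta> x \<bullet> \<zeta> x)) = 0" using D0 LIMSEQ_unique by blast
  have I: "integrable lborel (%x. indicator (cball 0 b) x *\<^sub>R (\<zeta> x \<bullet> \<zeta> x))"
   using L2_inner_integrable[OF L2\<zeta> L2\<zeta>] by (simp add: set_integrable_def)
  have nn: "AE x in lborel. 0 \<le> indicator (cball 0 b) x *\<^sub>R (\<zeta> x \<bullet> \<zeta> x)" by (rule AE_I2) (simp add: indicator_def)
  have "AE x in lborel. indicator (cball 0 b) x *\<^sub>R (\<zeta> x \<bullet> \<zeta> x) = 0"
   by (rule iffD1[OF integral_nonneg_eq_0_iff_AE[OF I nn] z])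
  then show ?thesis
  proof eventually_elim
   case (elim x)
   show ?case
   proof
    assume "norm x \<in> {a<..<b} \<and> \<bar>L (norm x)\<bar> \<le> real M"
    then have "x \<in> S" "x \<in> cball 0 b" by (auto simp: S_def)
    then show "uL x = u0 x" using elim by (simp add: \<zeta>_def)
   qed
  qed
 qed
 have "AE x in lborel. \<forall>M::nat. norm (x::real^'d) \<in> {a<..<b} \<and> \<bar>L (norm x)\<bar> \<le> real M --> uL x = u0 x"
  unfolding AE_all_countable using main by blast
 then have "AE x in lborel. x \<in> cball 0 b --> (norm (x::real^'d) \<in> {a<..<b} --> coord_period P (L (norm x) - s))"
 proof eventually_elim
  case (elim x)
  show ?case
  proof (intro impI)
   assume x: "norm x \<in> {a<..<b}"
   obtain M :: nat where "\<bar>L (norm x)\<bar> \<le> real M" using real_arch_simple by blast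
   then have e: "P s (X (sgn x)) = P (L (norm x)) (X (sgn x))" using elim x by (auto simp: uL_def u0_def)
   have "x \<noteq> 0" using x a by auto
   from warped_unique[OF W eigenmap_sphere[OF X sgn_sphere[OF this]] e gs]
   show "coord_period P (L (norm x) - s)" by auto
  qed
 qed
 moreover have "{r. r \<in> {a<..<b} --> coord_period P (L r - s)} \<in> sets borel"
 proof -
  have c: "{T. coord_period P T} \<in> sets borel" using closed_coord_periods[OF W] by (rule borel_closed)
  have "(%r. L r - s) -` {T. coord_period P T} \<inter> space borel \<in> sets borel" by (rule measurable_sets[OF _ c]) measurable
  moreover have "{r. r \<in> {a<..<b} --> coord_period P (L r - s)} = - {a<..<b} \<union> ((%r. L r - s) -` {T. coord_period P T} \<inter> space borel)" by auto
  ultimately show ?thesis by auto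
 qed
 ultimately have "AE r in lborel. 0 < r \<and> r \<le> b --> (r \<in> {a<..<b} --> coord_period P (L r - s))"
  by (intro AE_radial_converse[where 'a = "real^'d"] b)
 then show ?thesis by eventually_elim (use a in auto)
qed

text \<open>Locally, an oscillation below the gap \<delta> between periods forces a single period;
  connectedness of the half-line makes it the same everywhere.\<close>

lemma period_valued_const:
 fixes P :: "real => real^'m => real^'n" and L :: "real => real"
 assumes W: "warped_coordinates N g P"
  and per: "\<And>a b. 0 < a ==> a < b ==> AE r in lborel. r \<in> {a<..<b} --> coord_period P (L r - s)"
  and hol: "\<And>a b. 0 < a ==> a < b ==> \<exists>K G. (AE x in lborel. x \<in> G) \<and>
   (\<forall>x\<in>G \<inter> {a<..<b}. \<forall>y\<in>G \<inter> {a<..<b}. \<bar>L x - L y\<bar> \<le> K * sqrt \<bar>x - y\<bar>)"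
 shows "\<exists>T. coord_period P T \<and> (AE r in lborel. 0 < r --> L r = s + T)"
proof -
 obtain i :: "real^'m" where "i \<in> Basis" using nonempty_Basis by blast
 then have i: "i \<in> sphere 0 1" by simp
 obtain \<delta> where \<delta>: "\<delta> > 0" "\<And>T. coord_period P T ==> \<bar>T\<bar> < \<delta> ==> T = 0" by (rule coord_period_small[OF W i]) blast
 have loc: "\<exists>p q T. 0 < p \<and> p < c \<and> c < q \<and> coord_period P T \<and> (AE r in lborel. r \<in> {p<..<q} --> L r = s + T)" if c: "0 < c" for c
 proof -
  have "0 < c / 2" "c / 2 < 2 * c" using c by auto
  from hol[OF this] obtain K G where G: "AE x in lborel. x \<in> G"
   "\<And>x y. x \<in> G \<inter> {c / 2<..<2 * c} ==> y \<in> G \<inter> {c / 2<..<2 * c} ==> \<bar>L x - L y\<bar> \<le> K * sqrt \<bar>x - y\<bar>" by blast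
  \<comment> \<open>Points of (c - e, c + e) differ by at most 2 e, so the oscillation of L is at
    most |K| \<delta>/(|K| + 1) < \<delta>. The added 1 covers K = 0.\<close>
  define e where "e = min (c / 2) ((\<delta> / (\<bar>K\<bar> + 1))\<^sup>2 / 2)"
  have e: "0 < e" "e \<le> c / 2" "2 * e \<le> (\<delta> / (\<bar>K\<bar> + 1))\<^sup>2" using c \<delta>(1) by (auto simp: e_def)
  have p: "AE r in lborel. r \<in> {c / 2<..<2 * c} --> coord_period P (L r - s)" by (rule per) (use c in auto)
  have "AE x in lborel. x \<in> G \<and> (x \<in> {c / 2<..<2 * c} --> coord_period P (L x - s))" using G(1) p by eventually_elim blast
  moreover have "c - e < c + e" using e(1) by simp
  ultimately have "\<exists>y\<in>{c - e<..<c + e}. y \<in> G \<and> (y \<in> {c / 2<..<2 * c} --> coord_period P (L y - s))" by (rule AE_interval_ex)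
  then obtain y where y1: "y \<in> {c - e<..<c + e}" and y2: "y \<in> G \<and> (y \<in> {c / 2<..<2 * c} --> coord_period P (L y - s))" by (elim bexE)
  note y = y1 conjunct1[OF y2] conjunct2[OF y2]
  have y': "y \<in> {c / 2<..<2 * c}" using y1 e(1,2) c by auto
  have ae: "AE r in lborel. r \<in> {c - e<..<c + e} --> L r = s + (L y - s)"
   using G(1) p
  proof eventually_elim
   case (elim r)
   show ?case
   proof
    assume r: "r \<in> {c - e<..<c + e}"
    then have r': "r \<in> {c / 2<..<2 * c}" using e c by auto
    have "\<bar>L r - L y\<bar> \<le> K * sqrt \<bar>r - y\<bar>" by (rule G(2)) (use elim(1) r' y(2) y' in auto)
    also have "\<dots> \<le> \<bar>K\<bar> * sqrt \<bar>r - y\<bar>" by (intro mult_right_mono) auto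
    also have "\<dots> \<le> \<bar>K\<bar> * (\<delta> / (\<bar>K\<bar> + 1))"
    proof (rule mult_left_mono)
     have "\<bar>r - y\<bar> \<le> 2 * e" using r y(1) by auto
     then have "\<bar>r - y\<bar> \<le> (\<delta> / (\<bar>K\<bar> + 1))\<^sup>2" using e(3) by linarith
     then show "sqrt \<bar>r - y\<bar> \<le> \<delta> / (\<bar>K\<bar> + 1)" using \<delta>(1) by (intro real_le_lsqrt) auto
    qed simp
    also have "\<dots> < \<delta>" using \<delta>(1) by (simp add: field_simps)
    finally have lt: "\<bar>(L r - s) - (L y - s)\<bar> < \<delta>" by simp
    have "coord_period P ((L r - s) - (L y - s))"
     by (rule coord_period_diff[OF W mp[OF elim(2) r'] mp[OF y(3) y']])
    from \<delta>(2)[OF this lt] show "L r = s + (L y - s)" by simp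
   qed
  qed
  have "0 < c - e" "c - e < c" "c < c + e" using e c by auto
  then show ?thesis
   by (intro exI[of _ "c - e"] exI[of _ "c + e"] exI[of _ "L y - s"] conjI ae mp[OF y(3) y'])
 qed
 define Tc where "Tc c T \<longleftrightarrow> (\<exists>p q. 0 < p \<and> p < c \<and> c < q \<and> coord_period P T \<and> (AE r in lborel. r \<in> {p<..<q} --> L r = s + T))" for c T
 have ex: "\<exists>T. Tc c T" if "0 < c" for c using loc[OF that] unfolding Tc_def by blast
 have un: "T = T'" if T: "Tc c T" and T': "Tc c T'" for c T T'
 proof -
  from T[unfolded Tc_def] obtain p q where a: "0 < p \<and> p < c \<and> c < q \<and> coord_period P T \<and> (AE r in lborel. r \<in> {p<..<q} --> L r = s + T)"
   by (elim exE)
  from T'[unfolded Tc_def] obtain p' q' where a': "0 < p' \<and> p' < c \<and> c < q' \<and> coord_period P T' \<and> (AE r in lborel. r \<in> {p'<..<q'} --> L r = s + T')"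
   by (elim exE)
  note b = conjunct1[OF conjunct2[OF a]] conjunct1[OF conjunct2[OF a']] conjunct1[OF conjunct2[OF conjunct2[OF a]]] conjunct1[OF conjunct2[OF conjunct2[OF a']]]
  have "AE r in lborel. r \<in> {max p p'<..<min q q'} --> T = T'"
   using conjunct2[OF conjunct2[OF conjunct2[OF conjunct2[OF a]]]] conjunct2[OF conjunct2[OF conjunct2[OF conjunct2[OF a']]]] by eventually_elim auto
  moreover have "max p p' < min q q'" using b by simp
  ultimately have "\<exists>r\<in>{max p p'<..<min q q'}. r \<in> {max p p'<..<min q q'} --> T = T'" by (rule AE_interval_ex)
  then show ?thesis by blast
 qed
 define \<tau> where "\<tau> c = (THE T. Tc c T)" for c
 have \<tau>: "Tc c (\<tau> c)" if c: "0 < c" for c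
 proof -
  from ex[OF c] obtain T where T: "Tc c T" by (elim exE)
  show ?thesis unfolding \<tau>_def by (rule theI[of "Tc c", OF T]) (rule un[OF _ T])
 qed
 \<comment> \<open>The local period \<tau> is locally constant, so it has derivative 0 on the convex
   set {0<..}.\<close>
 have conn: "\<tau> c = \<tau> 1" if c: "0 < c" for c
 proof -
  have dz: "(\<tau> has_field_derivative 0) (at x within {0<..})" if x: "x \<in> {0<..}" for x
  proof -
  from x have "0 < x" by simp
  from \<tau>[OF this, unfolded Tc_def] obtain p q where pq0: "0 < p \<and> p < x \<and> x < q \<and> coord_period P (\<tau> x) \<and> (AE r in lborel. r \<in> {p<..<q} --> L r = s + \<tau> x)"
   by (elim exE)
  note pq = conjunct1[OF pq0] conjunct1[OF conjunct2[OF pq0]] conjunct1[OF conjunct2[OF conjunct2[OF pq0]]]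
   conjunct1[OF conjunct2[OF conjunct2[OF conjunct2[OF pq0]]]] conjunct2[OF conjunct2[OF conjunct2[OF conjunct2[OF pq0]]]]
  have eq: "\<tau> x = \<tau> y" if y: "y \<in> {p<..<q}" for y
  proof (rule un[of y])
   have "p < y" "y < q" using y by auto
   then show "Tc y (\<tau> x)" unfolding Tc_def by (intro exI[of _ p] exI[of _ q] conjI pq)
   have "0 < y" using y pq(1) by simp
   then show "Tc y (\<tau> y)" by (rule \<tau>)
  qed
  have "(\<tau> has_field_derivative 0) (at x)"
  proof (rule has_field_derivative_transform_within_open[of "%_. \<tau> x" 0 x "{p<..<q}"])
   show "((%_. \<tau> x) has_field_derivative 0) (at x)" by (rule DERIV_const)
   show "open {p<..<q}" by (rule open_greaterThanLessThan)
   show "x \<in> {p<..<q}" using pq(2,3) by simp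
   show "\<tau> x = \<tau> y" if "y \<in> {p<..<q}" for y using that by (rule eq)
  qed
  then show ?thesis by (rule has_field_derivative_at_within)
  qed
  have "\<exists>m. \<forall>x\<in>{0<..}. \<tau> x = m"
   by (rule has_field_derivative_zero_constant[where s = "{0<..}" and f = \<tau>]) (rule convex_real_interval, rule dz)
  then obtain m where m: "\<forall>x\<in>{0<..}. \<tau> x = m" by (elim exE)
  have "\<tau> c = m" "\<tau> 1 = m" using m c by auto
  then show ?thesis by simp
 qed
 define Sq where "Sq = {(p, q). p \<in> \<rat> \<and> q \<in> \<rat> \<and> (AE r in lborel. r \<in> {p<..<q::real} --> L r = s + \<tau> 1)}"
 have cS: "countable Sq" by (rule countable_subset[of _ "\<rat> \<times> \<rat>"]) (auto simp: Sq_def countable_rat)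
 have "AE r in lborel. \<forall>z\<in>Sq. r \<in> {fst z<..<snd z} --> L r = s + \<tau> 1"
  unfolding AE_ball_countable[OF cS] by (auto simp: Sq_def)
 then have "AE r in lborel. 0 < r --> L r = s + \<tau> 1"
 proof eventually_elim
  case (elim r)
  show ?case
  proof
   assume r: "0 < r"
   have "Tc r (\<tau> 1)" using \<tau>[OF r] conn[OF r] by simp
   from this[unfolded Tc_def] obtain p q where a: "0 < p \<and> p < r \<and> r < q \<and> coord_period P (\<tau> 1) \<and> (AE r in lborel. r \<in> {p<..<q} --> L r = s + \<tau> 1)"
    by (elim exE)
   note pq = conjunct1[OF conjunct2[OF a]] conjunct1[OF conjunct2[OF conjunct2[OF a]]] conjunct2[OF conjunct2[OF conjunct2[OF conjunct2[OF a]]]]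
   obtain p' where p': "p' \<in> \<rat>" "p < p'" "p' < r" using Rats_dense_in_real[OF pq(1)] by blast
   obtain q' where q': "q' \<in> \<rat>" "r < q'" "q' < q" using Rats_dense_in_real[OF pq(2)] by blast
   have "AE r in lborel. r \<in> {p'<..<q'} --> L r = s + \<tau> 1" using pq(3) by eventually_elim (use p' q' in auto)
   then have "(p', q') \<in> Sq" using p' q' by (simp add: Sq_def)
   from bspec[OF elim this] show "L r = s + \<tau> 1" using p' q' by simp
  qed
 qed
 moreover have "coord_period P (\<tau> 1)" using \<tau>[OF zero_less_one, unfolded Tc_def] by (elim exE conjE)
 ultimately show ?thesis by (intro exI[of _ "\<tau> 1"] conjI)
qed

section \<open>Minimization on the cone\<close>

lemma equator_energy_integral:
 assumes d: "d \<ge> 3" and R: "R \<ge> 0" and k: "k \<ge> 0"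
 shows "(\<integral>\<^sup>+r\<in>{0<..<R}. ennreal (k / r\<^sup>2 * (g s)\<^sup>2 * r ^ (d - 1)) \<partial>lborel) = ennreal (k * (g s)\<^sup>2 / real (d - 2) * R ^ (d - 2))"
proof -
 define n where "n = d - 3"
 have n: "d - 2 = n + 1" "d - 1 = n + 2" "real (d - 2) = real n + 1"
 proof -
  have "d = n + 3" using d by (simp add: n_def)
  then show "d - 2 = n + 1" "d - 1 = n + 2" "real (d - 2) = real n + 1" by simp_all
 qed
 let ?F = "%r. k * (g s)\<^sup>2 * r ^ (d - 2) / real (d - 2)"
 let ?f = "%r. k / r\<^sup>2 * (g s)\<^sup>2 * r ^ (d - 1)"
 have "(\<integral>\<^sup>+r\<in>{0<..<R}. ennreal (?f r) \<partial>lborel) = ennreal (?F R - ?F 0)"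
 proof (rule nn_integral_FTC_Ioo[of _ _ "{}"])
  show "continuous_on {0..R} ?F" using d by (intro continuous_intros) auto
  fix r :: real assume "0 < r"
  then show "(?F has_real_derivative ?f r) (at r)"
   using DERIV_cdivide[OF DERIV_cmult[OF DERIV_pow[of "n + 1" r], of "k * (g s)\<^sup>2"], of "real n + 1"]
   unfolding n by (simp add: power_add power2_eq_square add.commute)
 qed (use R k in auto)
 then show ?thesis using d by (simp add: power_0_left)
qed

text \<open>Rescaled by r = R \<rho> and shifted back by T, the restriction to the cone is a
  competitor with boundary value s whose energy does not exceed that of the equator. It is therefore
  a minimizer, and uniqueness makes it constant.\<close>

lemma slice_minimizer:
 fixes w ph g :: "real => real"
 assumes um: "equator_unique_minimizer d k g s" and gm[measurable]: "g \<in> borel_measurable borel"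
  and k: "k \<ge> 0" and d: "d \<ge> 3" and R: "R > 0"
  and wm[measurable]: "w \<in> borel_measurable borel" and phm[measurable]: "ph \<in> borel_measurable borel"
  and flux: "(\<integral>\<^sup>+r\<in>{0<..<R}. ennreal (((w r)\<^sup>2 + k / r\<^sup>2 * (g (ph r))\<^sup>2) * r ^ (d - 1)) \<partial>lborel)
   \<le> ennreal (k * (g s)\<^sup>2 / real (d - 2) * R ^ (d - 2))"
  and L2: "\<And>a. 0 < a ==> a < R ==> \<exists>C\<ge>0. (\<integral>\<^sup>+r\<in>{a<..<R}. ennreal ((w r)\<^sup>2) \<partial>lborel) \<le> ennreal C"
  and per: "\<And>x. (g (x + T))\<^sup>2 = (g x)\<^sup>2"
  and form: "AE r in lborel. r \<in> {0<..<R} --> ph r = s + T - (LBINT x. indicator {r<..<R} x * w x)"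
 shows "AE r in lborel. r \<in> {0<..<R} --> ph r = s + T"
proof -
 define E where "E = k * (g s)\<^sup>2 / real (d - 2)"
 define W where "W r = (LBINT x. indicator {r<..<R} x * w x)" for r
 \<comment> \<open>The continuous representative of ph (R \<rho>) - T; the tail integral vanishes at
   \<rho> = 1, so f 1 = s holds exactly.\<close>
 define f where "f \<rho> = s - W (R * \<rho>)" for \<rho>
 define f' where "f' \<rho> = R * w (R * \<rho>)" for \<rho>
 have f'm[measurable]: "f' \<in> borel_measurable borel" unfolding f'_def[abs_def] by measurable
 have WI: "integrable lborel (%x. indicator {r<..<r'} x * w x)" if rr: "0 < r" "r \<le> r'" "r' \<le> R" for r r'
 proof (cases "r < R")
  case True
  obtain C where C: "C \<ge> 0" "(\<integral>\<^sup>+r\<in>{r<..<R}. ennreal ((w r)\<^sup>2) \<partial>lborel) \<le> ennreal C" using L2[OF rr(1) True] by blast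
  show ?thesis by (rule primitive_holder(1)[OF wm C(2,1)]) (use rr in auto)
 qed (use rr in simp)
 have Wdiff: "W r = (LBINT x. indicator {r<..<r'} x * w x) + W r'" if r: "0 < r" "r \<le> r'" "r' \<le> R" for r r'
 proof -
  have "W r = (LBINT x. indicator {r<..<r'} x * w x + indicator {r'<..<R} x * w x)"
   unfolding W_def
  proof (rule integral_cong_AE)
   show "AE x in lborel. indicator {r<..<R} x * w x = indicator {r<..<r'} x * w x + indicator {r'<..<R} x * w x"
    using AE_lborel_singleton[of r'] by eventually_elim (use r in \<open>auto simp: indicator_def\<close>)
  qed measurable
  also have "\<dots> = (LBINT x. indicator {r<..<r'} x * w x) + W r'"
   unfolding W_def by (rule Bochner_Integration.integral_add) (use WI r in auto)
  finally show ?thesis .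
 qed
 have WR: "W R = 0" by (simp add: W_def)
 have Wc: "continuous_on {0<..R} W"
 proof -
  show "continuous_on {0<..R} W"
   unfolding continuous_on_eq_continuous_within
  proof
   fix x assume x: "x \<in> {0<..R}"
   define a where "a = x / 2"
   have a: "0 < a" "a < R" "a < x" using x by (auto simp: a_def)
   obtain C where C: "C \<ge> 0" "(\<integral>\<^sup>+r\<in>{a<..<R}. ennreal ((w r)\<^sup>2) \<partial>lborel) \<le> ennreal C" using L2[OF a(1,2)] by blast
   have h: "\<bar>W y - W z\<bar> \<le> (1 + C) / 2 * sqrt (z - y)" if "a \<le> y" "y \<le> z" "z \<le> R" for y z
    using primitive_holder(2)[OF wm C(2,1) that] Wdiff[of y z] that a by simp
   have h2: "\<bar>W y - W x\<bar> \<le> (1 + C) / 2 * sqrt \<bar>y - x\<bar>" if "a \<le> y" "y \<le> R" for y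
    using h[of y x] h[of x y] that x a by (cases "y \<le> x") (auto simp: abs_minus_commute)
   show "continuous (at x within {0<..R}) W"
    unfolding continuous_within
   proof (rule Lim_transform_bound[of _ "%y. (1 + C) / 2 * sqrt \<bar>y - x\<bar>", THEN LIM_zero_cancel])
    have "((%y. (1 + C) / 2 * sqrt \<bar>y - x\<bar>) \<longlongrightarrow> (1 + C) / 2 * sqrt \<bar>x - x\<bar>) (at x within {0<..R})"
     by (intro tendsto_intros)
    then show "((%y. (1 + C) / 2 * sqrt \<bar>y - x\<bar>) \<longlongrightarrow> 0) (at x within {0<..R})" by simp
    have "\<forall>\<^sub>F y in at x within {0<..R}. a < y"
     by (rule order_tendstoD(1)[OF tendsto_ident_at a(3)])
    moreover have "\<forall>\<^sub>F y in at x within {0<..R}. y \<in> {0<..R}" by (simp add: eventually_at_filter)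
    ultimately show "\<forall>\<^sub>F y in at x within {0<..R}. norm (W y - W x) \<le> norm ((1 + C) / 2 * sqrt \<bar>y - x\<bar>)"
    proof eventually_elim
     case (elim y)
     then have "\<bar>W y - W x\<bar> \<le> (1 + C) / 2 * sqrt \<bar>y - x\<bar>" using h2[of y] by simp
     then show ?case by simp
    qed
   qed
  qed
 qed
 have fc: "continuous_on {0<..1} f"
 proof -
  have "continuous_on {0<..1} (%\<rho>. W (R * \<rho>))"
   by (rule continuous_on_compose2[OF Wc]) (use R in \<open>auto intro!: continuous_intros simp: mult_left_le\<close>)
  then show ?thesis unfolding f_def[abs_def] by (intro continuous_intros)
 qed
 have f1: "f 1 = s" by (simp add: f_def WR)
 have f'I: "integrable lborel (%x. indicator {\<rho><..<\<rho>'} x * f' x)"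
  and f'W: "(LBINT x. indicator {\<rho><..<\<rho>'} x * f' x) = f \<rho>' - f \<rho>" if \<rho>: "0 < \<rho>" "\<rho> \<le> \<rho>'" "\<rho>' \<le> 1" for \<rho> \<rho>'
 proof -
  have I: "integrable lborel (%x. indicator {R * \<rho><..<R * \<rho>'} x * w x)" by (rule WI) (use \<rho> R in \<open>auto simp: mult_left_le\<close>)
  have e: "indicator {R * \<rho><..<R * \<rho>'} (0 + R * x) * w (0 + R * x) = (1 / R) * (indicator {\<rho><..<\<rho>'} x * f' x)" for x
   using R by (auto simp: indicator_def f'_def)
  have "integrable lborel (%x. (1 / R) * (indicator {\<rho><..<\<rho>'} x * f' x))"
   using lborel_integrable_real_affine[OF I, of R 0] R unfolding e by simp
  then have "integrable lborel (%x. R * ((1 / R) * (indicator {\<rho><..<\<rho>'} x * f' x)))" by (rule integrable_mult_right)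
  then show "integrable lborel (%x. indicator {\<rho><..<\<rho>'} x * f' x)" using R by simp
  have "(LBINT x. indicator {R * \<rho><..<R * \<rho>'} x * w x) = \<bar>R\<bar> *\<^sub>R (LBINT x. (1 / R) * (indicator {\<rho><..<\<rho>'} x * f' x))"
   using lborel_integral_real_affine[of R "%x. indicator {R * \<rho><..<R * \<rho>'} x * w x" 0] R unfolding e by simp
  also have "\<dots> = (LBINT x. indicator {\<rho><..<\<rho>'} x * f' x)" using R by simp
  finally have 1: "(LBINT x. indicator {R * \<rho><..<R * \<rho>'} x * w x) = (LBINT x. indicator {\<rho><..<\<rho>'} x * f' x)" .
  have "W (R * \<rho>) = (LBINT x. indicator {R * \<rho><..<R * \<rho>'} x * w x) + W (R * \<rho>')"
   by (rule Wdiff) (use \<rho> R in \<open>auto simp: mult_left_le\<close>)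
  then show "(LBINT x. indicator {\<rho><..<\<rho>'} x * f' x) = f \<rho>' - f \<rho>" using 1 by (simp add: f_def)
 qed
 have bounds: "\<exists>a b. 0 < a \<and> a \<le> b \<and> b < 1 \<and> K \<subseteq> {a..b}" if K: "compact K" "K \<subseteq> {0<..<1}" for K :: "real set"
 proof (cases "K = {}")
  case True then show ?thesis by (intro exI[of _ "1/2"]) auto
 next
  case False
  obtain a where a: "a \<in> K" "\<forall>x\<in>K. a \<le> x" using compact_attains_inf[OF K(1) False] by blast
  obtain b where b: "b \<in> K" "\<forall>x\<in>K. x \<le> b" using compact_attains_sup[OF K(1) False] by blast
  show ?thesis using a b K(2) by (intro exI[of _ a] exI[of _ b]) auto
 qed
 \<comment> \<open>On compact subintervals of (0, 1) the function f is a primitive of f'; no test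
   function reaches the possible singularity at \<rho> = 0.\<close>
 have wd: "has_weak_deriv {0<..<1} 1 f f'"
  unfolding has_weak_deriv_def
 proof (intro conjI allI impI)
  show "loc_integrable {0<..<1} f"
   unfolding loc_integrable_def set_integrable_def
   by (intro allI impI borel_integrable_compact continuous_on_subset[OF fc]) auto
  show "loc_integrable {0<..<1} f'"
   unfolding loc_integrable_def set_integrable_def
  proof (intro allI impI)
   fix K :: "real set" assume K: "compact K \<and> K \<subseteq> {0<..<1}"
   obtain a b where ab: "0 < a" "a \<le> b" "b < 1" "K \<subseteq> {a..b}" using bounds[of K] K by blast
   have [measurable]: "K \<in> sets borel" using K by (simp add: borel_compact)
   have "integrable lborel (%x. indicator {a / 2<..<1} x * f' x)" by (rule f'I) (use ab in auto)
   then show "integrable lborel (%x. indicator K x *\<^sub>R f' x)"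
   proof (rule Bochner_Integration.integrable_bound)
    show "AE x in lborel. norm (indicator K x *\<^sub>R f' x) \<le> norm (indicator {a / 2<..<1} x * f' x)"
     using ab by (intro AE_I2) (auto simp: indicator_def)
   qed measurable
  qed
  fix \<eta> :: "real => real" assume T: "test_fun {0<..<1} \<eta>"
  obtain K where K: "compact K" "K \<subseteq> {0<..<1}" "\<forall>x. x \<notin> K --> \<eta> x = 0"
   using T unfolding test_fun_def by blast
  obtain a b where ab: "0 < a" "a \<le> b" "b < 1" "K \<subseteq> {a..b}" using bounds[OF K(1,2)] by blast
  define e where "e = a / 2"
  have e: "0 < e" "e < a" using ab by (auto simp: e_def)
  have sup1: "\<eta> x = 0" if "x \<notin> {a..b}" for x using K(3) ab(4) that by blast
  have d\<eta>: "(\<eta> has_real_derivative dir_deriv 1 \<eta> x) (at x)" for x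
  proof -
   have D: "(\<eta> has_derivative (%v. dir_deriv v \<eta> x)) (at x)" by (rule smooth_on_has_derivative[OF test_fun_smooth[OF T]]) simp
   have e1: "dir_deriv h \<eta> x = dir_deriv 1 \<eta> x * h" for h
    using linear_scale[OF has_derivative_linear[OF D], of h 1] by simp
   have e: "(%v. dir_deriv v \<eta> x) = (*) (dir_deriv 1 \<eta> x)" by (rule ext, rule e1)
   show ?thesis unfolding has_field_derivative_def by (rule D[unfolded e])
  qed
  have sup2: "dir_deriv 1 \<eta> x = 0" if x: "x \<notin> {a..b}" for x
  proof (rule DERIV_unique[OF d\<eta>])
   show "(\<eta> has_real_derivative 0) (at x)"
    by (rule has_field_derivative_transform_within_open[of "%_. 0" 0 x "- {a..b}"]) (use x sup1 in auto)
  qed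
  have c\<eta>': "continuous_on UNIV (dir_deriv 1 \<eta>)" by (rule test_fun_continuous[OF test_fun_dir_deriv[OF T]])
  \<comment> \<open>Cutting f' off below e < a leaves its product with \<eta> unchanged and makes it
    integrable on the line.\<close>
  define v where "v x = indicator {e<..<1} x * f' x" for x
  have vi: "integrable lborel v" unfolding v_def[abs_def] by (rule f'I) (use e ab in auto)
  have prim: "(LBINT x. indicator {..r} x * v x) = f r - f e" if r: "r \<in> {a..b}" for r
  proof -
   have "(LBINT x. indicator {..r} x * v x) = (LBINT x. indicator {e<..<r} x * f' x)"
   proof (rule integral_cong_AE)
    show "AE x in lborel. indicator {..r} x * v x = indicator {e<..<r} x * f' x"
     using AE_lborel_singleton[of r] by eventually_elim (use r ab in \<open>auto simp: v_def indicator_def\<close>)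
    show "(%x. indicator {..r} x * v x) \<in> borel_measurable lborel" unfolding v_def by measurable
   qed measurable
   also have "\<dots> = f r - f e" by (rule f'W) (use r e ab in auto)
   finally show ?thesis .
  qed
  have "(LBINT x. \<eta> x *\<^sub>R f' x) = (LBINT x. \<eta> x * v x)"
  proof (intro Bochner_Integration.integral_cong refl)
   fix x show "\<eta> x *\<^sub>R f' x = \<eta> x * v x"
    using sup1[of x] e ab by (cases "x \<in> {a..b}") (auto simp: v_def)
  qed
  also have "\<dots> = - (LBINT r. dir_deriv 1 \<eta> r * (LBINT x. indicator {..r} x * v x))"
   by (rule integration_by_parts_primitive[OF d\<eta> c\<eta>' sup1 sup2 vi])
  also have "(LBINT r. dir_deriv 1 \<eta> r * (LBINT x. indicator {..r} x * v x)) = (LBINT r. dir_deriv 1 \<eta> r * f r - dir_deriv 1 \<eta> r * f e)"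
  proof (intro Bochner_Integration.integral_cong refl)
   fix r show "dir_deriv 1 \<eta> r * (LBINT x. indicator {..r} x * v x) = dir_deriv 1 \<eta> r * f r - dir_deriv 1 \<eta> r * f e"
    using sup2[of r] prim[of r] by (cases "r \<in> {a..b}") (auto simp: right_diff_distrib)
  qed
  also have "\<dots> = (LBINT r. dir_deriv 1 \<eta> r * f r) - (LBINT r. dir_deriv 1 \<eta> r * f e)"
  proof (rule Bochner_Integration.integral_diff)
   have l1: "loc_integrable {0<..<1} f" unfolding loc_integrable_def set_integrable_def
    by (intro allI impI borel_integrable_compact continuous_on_subset[OF fc]) auto
   have l2: "loc_integrable {0<..<1} (%x. f e)" unfolding loc_integrable_def set_integrable_def
    by (intro allI impI borel_integrable_compact continuous_on_const) auto
   show "integrable lborel (%r. dir_deriv 1 \<eta> r * f r)" "integrable lborel (%r. dir_deriv 1 \<eta> r * f e)"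
    using integrable_test_scaleR[OF test_fun_dir_deriv[OF T] l1, of 1] integrable_test_scaleR[OF test_fun_dir_deriv[OF T] l2, of 1] by simp_all
  qed
  \<comment> \<open>The derivative of a test function has mean zero, so the constant of integration
    f e drops out.\<close>
  also have "(LBINT r. dir_deriv 1 \<eta> r * f e) = 0"
   using has_weak_deriv_const[of "{0<..<1}" "1::real" "f e"] T unfolding has_weak_deriv_def by auto
  finally show "(LBINT x. dir_deriv 1 \<eta> x *\<^sub>R f x) = - (LBINT x. \<eta> x *\<^sub>R f' x)" by simp
 qed
 define H where "H r = ennreal (((w r)\<^sup>2 + k / r\<^sup>2 * (g (ph r))\<^sup>2) * r ^ (d - 1)) * indicator {0<..<R} r" for r
 have Hm: "H \<in> borel_measurable borel" unfolding H_def[abs_def] by measurable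
 have form': "AE \<rho> in lborel. \<rho> \<in> {0<..<1} --> ph (R * \<rho>) = f \<rho> + T"
 proof -
  obtain M where M: "{r \<in> space lborel. \<not> (r \<in> {0<..<R} --> ph r = s + T - W r)} \<subseteq> M" "emeasure lborel M = 0" "M \<in> sets lborel"
   by (rule AE_E[OF form[folded W_def]])
  have "AE r in lborel. r \<notin> M" by (rule AE_not_in) (use M in auto)
  moreover have "Measurable.pred borel (%x. x \<notin> M)" using M(3) by simp
  ultimately have "AE \<rho> in lborel. 0 + R * \<rho> \<notin> M" using R by (intro AE_borel_affine) auto
  then show ?thesis
  proof eventually_elim
   case (elim \<rho>)
   show ?case
   proof
    assume "\<rho> \<in> {0<..<1}"
    then have "R * \<rho> \<in> {0<..<R}" using R by auto
    then show "ph (R * \<rho>) = f \<rho> + T" using elim M(1) by (auto simp: f_def)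
   qed
  qed
 qed
 \<comment> \<open>One factor R comes from dr = R d\<rho>, and R^(d-1)/R^2 = R^(d-3) from the weight
   and the quadratic density.\<close>
 have scale: "(\<integral>\<^sup>+r. H r \<partial>lborel) = ennreal (R ^ (d - 2)) * elliptic_energy d k g f f'"
 proof -
  have "(\<integral>\<^sup>+r. H r \<partial>lborel) = ennreal R * (\<integral>\<^sup>+\<rho>. H (0 + R * \<rho>) \<partial>lborel)"
   using nn_integral_real_affine[OF Hm, of R 0] R by simp
  also have "(\<integral>\<^sup>+\<rho>. H (0 + R * \<rho>) \<partial>lborel) = (\<integral>\<^sup>+\<rho>. ennreal (R ^ (d - 3)) * (ennreal (((f' \<rho>)\<^sup>2 + k / \<rho>\<^sup>2 * (g (f \<rho>))\<^sup>2) * \<rho> ^ (d - 1)) * indicator {0<..<1} \<rho>) \<partial>lborel)"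
  proof (rule nn_integral_cong_AE)
   show "AE \<rho> in lborel. H (0 + R * \<rho>) = ennreal (R ^ (d - 3)) * (ennreal (((f' \<rho>)\<^sup>2 + k / \<rho>\<^sup>2 * (g (f \<rho>))\<^sup>2) * \<rho> ^ (d - 1)) * indicator {0<..<1} \<rho>)"
    using form'
   proof eventually_elim
    case (elim \<rho>)
    show ?case
    proof (cases "\<rho> \<in> {0<..<1}")
     case True
     have p: "R ^ (d - 1) = R ^ (d - 3) * R\<^sup>2"
     proof -
      have "d - 1 = (d - 3) + 2" using d by simp
      then show ?thesis by (simp only: power_add)
     qed
     have ph': "(g (ph (R * \<rho>)))\<^sup>2 = (g (f \<rho>))\<^sup>2" using elim True per[of "f \<rho>"] by simp
     have q1: "((w (R * \<rho>))\<^sup>2 + k / (R * \<rho>)\<^sup>2 * (g (f \<rho>))\<^sup>2) * R\<^sup>2 = (f' \<rho>)\<^sup>2 + k / \<rho>\<^sup>2 * (g (f \<rho>))\<^sup>2"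
      using R True by (simp add: f'_def field_simps power2_eq_square)
     have q2: "(R * \<rho>) ^ (d - 1) = R\<^sup>2 * (R ^ (d - 3) * \<rho> ^ (d - 1))"
      by (simp only: power_mult_distrib p mult_ac)
     have "((w (R * \<rho>))\<^sup>2 + k / (R * \<rho>)\<^sup>2 * (g (ph (R * \<rho>)))\<^sup>2) * (R * \<rho>) ^ (d - 1)
      = (((w (R * \<rho>))\<^sup>2 + k / (R * \<rho>)\<^sup>2 * (g (f \<rho>))\<^sup>2) * R\<^sup>2) * (R ^ (d - 3) * \<rho> ^ (d - 1))"
      unfolding q2 ph' by (simp only: mult.assoc)
     also have "\<dots> = R ^ (d - 3) * (((f' \<rho>)\<^sup>2 + k / \<rho>\<^sup>2 * (g (f \<rho>))\<^sup>2) * \<rho> ^ (d - 1))"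
      unfolding q1 by (simp only: mult_ac)
     finally have "((w (R * \<rho>))\<^sup>2 + k / (R * \<rho>)\<^sup>2 * (g (ph (R * \<rho>)))\<^sup>2) * (R * \<rho>) ^ (d - 1)
      = R ^ (d - 3) * (((f' \<rho>)\<^sup>2 + k / \<rho>\<^sup>2 * (g (f \<rho>))\<^sup>2) * \<rho> ^ (d - 1))" .
     then show ?thesis using True R k by (simp add: H_def ennreal_mult[symmetric])
    next
     case False
     then have "R * \<rho> \<notin> {0<..<R}" using R by (auto simp: zero_less_mult_iff)
     then show ?thesis using False by (simp add: H_def)
    qed
   qed
  qed
  also have "\<dots> = ennreal (R ^ (d - 3)) * elliptic_energy d k g f f'"
   unfolding elliptic_energy_def
  proof (rule nn_integral_cmult)
   have "(%\<rho>. indicator {0<..<1} \<rho> *\<^sub>R f \<rho>) \<in> borel_measurable borel"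
    by (rule borel_measurable_continuous_on_indicator) (auto intro: continuous_on_subset[OF fc])
   then have [measurable]: "(%\<rho>. indicator {0<..<1} \<rho> * f \<rho>) \<in> borel_measurable borel" by simp
   have "(%\<rho>. ennreal (((f' \<rho>)\<^sup>2 + k / \<rho>\<^sup>2 * (g (indicator {0<..<1} \<rho> * f \<rho>))\<^sup>2) * \<rho> ^ (d - 1)) * indicator {0<..<1} \<rho>) \<in> borel_measurable lborel" by measurable
   also have "(%\<rho>. ennreal (((f' \<rho>)\<^sup>2 + k / \<rho>\<^sup>2 * (g (indicator {0<..<1} \<rho> * f \<rho>))\<^sup>2) * \<rho> ^ (d - 1)) * indicator {0<..<1} \<rho>)
    = (%\<rho>. ennreal (((f' \<rho>)\<^sup>2 + k / \<rho>\<^sup>2 * (g (f \<rho>))\<^sup>2) * \<rho> ^ (d - 1)) * indicator {0<..<1} \<rho>)"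
    by (auto simp: indicator_def)
   finally show "(%\<rho>. ennreal (((f' \<rho>)\<^sup>2 + k / \<rho>\<^sup>2 * (g (f \<rho>))\<^sup>2) * \<rho> ^ (d - 1)) * indicator {0<..<1} \<rho>) \<in> borel_measurable lborel" .
  qed
  also have "ennreal R * (ennreal (R ^ (d - 3)) * elliptic_energy d k g f f') = ennreal (R ^ (d - 2)) * elliptic_energy d k g f f'"
  proof -
   have "d - 2 = Suc (d - 3)" using d by simp
   then have "R * R ^ (d - 3) = R ^ (d - 2)" by (simp only: power_Suc)
   then show ?thesis using R by (simp add: mult.assoc[symmetric] ennreal_mult[symmetric])
  qed
  finally show ?thesis .
 qed
 have en: "elliptic_energy d k g f f' \<le> ennreal E"
 proof -
  have "ennreal (R ^ (d - 2)) * elliptic_energy d k g f f' \<le> ennreal (R ^ (d - 2)) * ennreal E"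
   using flux scale R k unfolding H_def E_def by (simp add: ennreal_mult[symmetric] mult.commute)
  then have "ennreal (1 / R ^ (d - 2)) * (ennreal (R ^ (d - 2)) * elliptic_energy d k g f f') \<le> ennreal (1 / R ^ (d - 2)) * (ennreal (R ^ (d - 2)) * ennreal E)"
   by (rule mult_left_mono) simp
  moreover have "ennreal (1 / R ^ (d - 2)) * ennreal (R ^ (d - 2)) = 1" using R by (simp add: ennreal_mult[symmetric])
  ultimately show ?thesis by (simp add: mult.assoc[symmetric])
 qed
 have eq: "elliptic_energy d k g (%r. s) (%r. 0) = ennreal E"
  using equator_energy_integral[OF d zero_le_one k, of g s] by (simp add: elliptic_energy_def E_def)
 have FS: "F_space d s f f'"
  unfolding F_space_def
 proof (intro conjI fc wd f1)
  have "(\<integral>\<^sup>+r\<in>{0<..<1}. ennreal ((f' r)\<^sup>2 * r ^ (d - 1)) \<partial>lborel) \<le> elliptic_energy d k g f f'"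
   unfolding elliptic_energy_def
  proof (rule nn_integral_mono)
   fix r
   have "(f' r)\<^sup>2 * r ^ (d - 1) \<le> ((f' r)\<^sup>2 + k / r\<^sup>2 * (g (f r))\<^sup>2) * r ^ (d - 1)" if "r \<in> {0<..<1}"
    using that k by (intro mult_right_mono) auto
   then show "ennreal ((f' r)\<^sup>2 * r ^ (d - 1)) * indicator {0<..<1} r \<le> ennreal (((f' r)\<^sup>2 + k / r\<^sup>2 * (g (f r))\<^sup>2) * r ^ (d - 1)) * indicator {0<..<1} r"
    by (auto simp: indicator_def intro!: ennreal_leI)
  qed
  also note en
  also have "ennreal E < \<infinity>" by simp
  finally show "(\<integral>\<^sup>+r\<in>{0<..<1}. ennreal ((f' r)\<^sup>2 * r ^ (d - 1)) \<partial>lborel) < \<infinity>" .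
 qed
 have "is_minimizer d k g s f f'"
  unfolding is_minimizer_def
 proof (intro conjI allI impI FS)
  fix \<psi> \<psi>r assume "F_space d s \<psi> \<psi>r"
  then have "elliptic_energy d k g (%r. s) (%r. 0) \<le> elliptic_energy d k g \<psi> \<psi>r"
   using um unfolding equator_unique_minimizer_def is_minimizer_def by blast
  then show "elliptic_energy d k g f f' \<le> elliptic_energy d k g \<psi> \<psi>r" using en eq by simp
 qed
 then have fs: "\<forall>\<rho>\<in>{0<..1}. f \<rho> = s" using um unfolding equator_unique_minimizer_def by blast
 show ?thesis
  using form
 proof eventually_elim
  case (elim r)
  show ?case
  proof
   assume r: "r \<in> {0<..<R}"
   then have "r / R \<in> {0<..1}" by auto
   then have "f (r / R) = s" using fs by blast
   then have "W r = 0" using R by (simp add: f_def)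
   then show "ph r = s + T" using elim r by (simp add: W_def)
  qed
 qed
qed

section \<open>Assembly of the implications\<close>

lemma minimizer_implies_uniqueness:
 fixes P :: "real => real^'m => real^'n" and X :: "real^'d => real^'m"
 assumes W: "warped_coordinates N g P" and X: "eigenmap k X"
  and gd: "\<And>x. (g has_real_derivative deriv g x) (at x)"
  and gc: "continuous_on UNIV (deriv g)"
  and gs: "deriv g s = 0" and g0: "g s \<noteq> 0" and kpos: "k > 0" and d3: "CARD('d) \<ge> 3"
  and um: "equator_unique_minimizer CARD('d) k g s"
 shows "equator_unique_weak_solution P X k g s"
proof -
 have k0': "k \<ge> 0" using kpos by simp
 have uniq: "\<exists>T. coord_period P T \<and> (AE p in lborel. p \<in> {0<..} \<times> {0<..} --> \<phi> p = s + T)"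
  if ws: "weak_solution P X k g (%r. s) (%r. 0) \<phi> \<phi>r \<phi>t" and EI: "energy_inequality CARD('d) k g \<phi> \<phi>r \<phi>t" for \<phi> \<phi>r \<phi>t
 proof -
  define E0 where "E0 = k * (g s)\<^sup>2 / real (CARD('d) - 2)"
  note a1 = ws[unfolded weak_solution_def]
  note a2 = conjunct2[OF a1]
  note a3 = conjunct2[OF a2]
  note a4 = conjunct2[OF a3]
  note a5 = conjunct2[OF a4]
  note a6 = conjunct2[OF a5]
  note a7 = conjunct2[OF a6]
  note \<phi>m = conjunct1[OF a1] and \<phi>rm = conjunct1[OF a2] and \<phi>tm = conjunct1[OF a3]
   and wr = conjunct1[OF a4] and wt = conjunct1[OF a5] and w0 = conjunct1[OF a6] and ini = conjunct1[OF a7]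
  have att: "weakly_tendsto_initially (%(x, t). equivariant_map P X (%r. \<phi> (r, t)) x) (equivariant_map P X (%r. s))"
   using conjunct2[OF conjunct2[OF a7]] unfolding attains_data_def by (elim exE conjE)
  have gm: "g \<in> borel_measurable borel"
   by (rule borel_measurable_continuous_onI, rule continuous_at_imp_continuous_on, rule ballI, rule DERIV_isCont, rule gd)
  have m0: "(%r::real. (r, 0::real)) \<in> borel \<rightarrow>\<^sub>M borel" by (intro borel_measurable_continuous_onI continuous_intros)
  \<comment> \<open>By convention \<phi>r at t = 0 is a weak derivative of the constant data, so the
    initial energy can be computed.\<close>
  have z: "AE r in lborel. 0 < r --> \<phi>r (r, 0) = 0"
   by (rule weak_deriv_const_unique[OF w0 measurable_compose[OF m0 \<phi>rm]])
  have e0: "energy CARD('d) k g \<phi> \<phi>r \<phi>t 0 R \<le> ennreal (E0 * R ^ (CARD('d) - 2))" if R: "R > 0" for R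
  proof -
   have "energy CARD('d) k g \<phi> \<phi>r \<phi>t 0 R = (\<integral>\<^sup>+r\<in>{0<..<R}. ennreal (k / r\<^sup>2 * (g s)\<^sup>2 * r ^ (CARD('d) - 1)) \<partial>lborel)"
    unfolding energy_def
   proof (rule nn_integral_cong_AE)
    show "AE r in lborel. ennreal (((\<phi>r (r, 0))\<^sup>2 + k / r\<^sup>2 * (g (\<phi> (r, 0)))\<^sup>2 + (\<phi>t (r, 0))\<^sup>2) * r ^ (CARD('d) - 1)) * indicator {0<..<R} r
     = ennreal (k / r\<^sup>2 * (g s)\<^sup>2 * r ^ (CARD('d) - 1)) * indicator {0<..<R} r"
     using z by eventually_elim (use ini in \<open>auto simp: indicator_def\<close>)
   qed
   also have "\<dots> = ennreal (E0 * R ^ (CARD('d) - 2))"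
    unfolding E0_def by (rule equator_energy_integral[OF d3 _ k0']) (use R in simp)
   finally show ?thesis by simp
  qed
  have E0n: "E0 \<ge> 0" by (simp add: E0_def k0')
  interpret equator_energy_solution "CARD('d)" k E0 g \<phi> \<phi>r \<phi>t
   by (rule equator_energy_solution.intro[OF \<phi>m \<phi>rm \<phi>tm gm wr wt EI e0 E0n k0'])
  have per: "AE r in lborel. r \<in> {a<..<b} --> coord_period P (trace r - s)" if ab: "0 < a" "a < b" for a b
  proof (rule weak_initial_trace[OF W X g0 trace_measurable ab _ att initial_trace[OF ab]])
   have "0 \<le> E0 * (b + 1 + 1) ^ (CARD('d) - 2) / a ^ (CARD('d) - 1)"
    using E0n ab by (intro divide_nonneg_nonneg mult_nonneg_nonneg zero_le_power) auto
   moreover have "0 \<le> y ==> 0 \<le> 2 * ((1 + y) / 2)" for y :: real by simp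
   ultimately show "0 \<le> 2 * holder_const a (b + 1)" unfolding holder_const_def by blast
  qed
  have hol: "\<exists>K G. (AE x in lborel. x \<in> G) \<and>
   (\<forall>x\<in>G \<inter> {a<..<b}. \<forall>y\<in>G \<inter> {a<..<b}. \<bar>trace x - trace y\<bar> \<le> K * sqrt \<bar>x - y\<bar>)" if ab: "0 < a" "a < b" for a b
   by (rule exI[of _ "holder_const a b"], rule trace_holder[OF ab])
  have "\<exists>T. coord_period P T \<and> (AE r in lborel. 0 < r --> trace r = s + T)"
   by (rule period_valued_const[where L = trace, OF W]) (rule per hol; assumption)+
  then obtain T where T0: "coord_period P T \<and> (AE r in lborel. 0 < r --> trace r = s + T)"
   by (elim exE)
  note T = conjunct1[OF T0] and tr = conjunct2[OF T0]
  obtain i :: "real^'d" where "i \<in> Basis" using nonempty_Basis by blast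
  then have i: "i \<in> sphere 0 1" by simp
  obtain j where j: "dir_deriv j (%x. X (sgn x)) i \<noteq> 0" "dir_deriv j (%x. X (sgn x)) i \<bullet> X i = 0"
   by (rule eigenmap_tangent[OF X kpos i])
  \<comment> \<open>The minimization argument shifts \<phi> by T; the energy is unaffected because
    g^2 has the period T.\<close>
  have gT: "(g (x + T))\<^sup>2 = (g x)\<^sup>2" for x
   by (rule coord_period_g[OF W T eigenmap_sphere[OF X i] j(2,1)])
  \<comment> \<open>Equality almost everywhere on almost every characteristic amounts to equality
    almost everywhere in the quadrant.\<close>
  have "AE R in lborel. AE r in lborel. 0 < r \<and> 0 < R - r --> \<phi> (r, R - r) = s + T"
   using char_formula tr
  proof eventually_elim
   case (elim R)
   show ?case
   proof (cases "R > 0")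
    case True
    have phm: "(%r. \<phi> (r, R - r)) \<in> borel_measurable borel" using slice_measurable(2)[where c = 1 and R = R] by simp
    have "AE r in lborel. r \<in> {0<..<R} --> \<phi> (r, R - r) = s + T"
    proof (rule slice_minimizer[OF um gm k0' d3 True slice_measurable(1)[where c = 1 and R = R] phm _ _ gT])
     show "(\<integral>\<^sup>+r\<in>{0<..<R}. ennreal (((slice_deriv 1 r R)\<^sup>2 + k / r\<^sup>2 * (g (\<phi> (r, R - r)))\<^sup>2) * r ^ (CARD('d) - 1)) \<partial>lborel)
      \<le> ennreal (k * (g s)\<^sup>2 / real (CARD('d) - 2) * R ^ (CARD('d) - 2))"
      using flux_bound[OF True] unfolding E0_def .
     show "\<exists>C\<ge>0. (\<integral>\<^sup>+r\<in>{a<..<R}. ennreal ((slice_deriv 1 r R)\<^sup>2) \<partial>lborel) \<le> ennreal C" if a: "0 < a" "a < R" for a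
     proof (intro exI[of _ "E0 * R ^ (CARD('d) - 2) / a ^ (CARD('d) - 1)"] conjI slice_deriv_L2_char[OF a])
      show "0 \<le> E0 * R ^ (CARD('d) - 2) / a ^ (CARD('d) - 1)"
       using E0n a True by (intro divide_nonneg_nonneg mult_nonneg_nonneg zero_le_power) auto
     qed
     have t: "trace R = s + T" by (rule mp[OF elim(2) True])
     show "AE r in lborel. r \<in> {0<..<R} --> \<phi> (r, R - r) = s + T - (LBINT x. indicator {r<..<R} x * slice_deriv 1 x R)"
      using mp[OF elim(1) True] unfolding t tail_def .
    qed
    then show ?thesis by eventually_elim auto
   next
    case False
    then have "0 < r \<and> 0 < R - r --> \<phi> (r, R - r) = s + T" for r by linarith
    then show ?thesis by (intro AE_I2)
   qed
  qed
  then have *: "AE R in lborel. AE r in lborel. (r, R - r) \<in> {0<..} \<times> {0<..} --> \<phi> (r, R - r) = s + T" by simp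
  have Qm: "{p. p \<in> {0<..} \<times> {0<..} --> \<phi> p = s + T} \<in> sets borel"
  proof -
   have 1: "\<phi> -` {s + T} \<inter> space borel \<in> sets borel" by (rule measurable_sets[OF \<phi>m]) simp
   have 2: "open ({0<..} \<times> {0<..} :: (real \<times> real) set)" by (intro open_Times open_greaterThan)
   have e: "{p. p \<in> {0<..} \<times> {0<..} --> \<phi> p = s + T} = - ({0<..} \<times> {0<..}) \<union> (\<phi> -` {s + T} \<inter> space borel)" by auto
   show ?thesis unfolding e by (rule sets.Un[OF borel_comp[OF borel_open[OF 2]] 1])
  qed
  show ?thesis by (rule exI[of _ T], rule conjI[OF T AE_characteristics(1)[OF Qm *]])
 qed
 show ?thesis
  unfolding equator_unique_weak_solution_def
  by (intro conjI allI impI equator_weak_solution[OF W X gd gc gs k0' d3]) (elim conjE, rule uniq, assumption+)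
qed

theorem theorem2p2:
  fixes N :: "(real^'n) set"
    and g :: "real \<Rightarrow> real"
    and P :: "real \<Rightarrow> real^'m \<Rightarrow> real^'n"
    and X :: "real^'d \<Rightarrow> real^'m"
    and l :: nat
    and k \<phi>s :: real
  assumes "CARD('d) \<ge> 4"
    and "smooth_on UNIV g"
    and "\<And>s. g (- s) = - g s"
    and "deriv g 0 = 1"
    and "warped_coordinates N g P"
    and "\<phi>s > 0"
    and "deriv g \<phi>s = 0"
    and "\<And>s. 0 < s \<Longrightarrow> deriv g s = 0 \<Longrightarrow> \<phi>s \<le> s"
    and "l \<ge> 1"
    and "k = real l * (real l + real CARD('d) - 2)"
    and "eigenmap k X"
  shows "(equator_unique_minimizer CARD('d) k g \<phi>s \<longrightarrow> equator_unique_weak_solution P X k g \<phi>s)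
       \<and> (equator_unique_weak_solution P X k g \<phi>s \<longrightarrow> no_smooth_profile P X k g \<phi>s)"
proof -
 have gd: "(g has_real_derivative deriv g x) (at x)" for x by (rule smooth_real_derivs(1)[OF assms(2)])
 have gc: "continuous_on UNIV (deriv g)" by (rule smooth_real_derivs(2)[OF assms(2)])
 have d3: "CARD('d) \<ge> 3" using assms(1) by simp
 have "real CARD('d) \<ge> 4" using assms(1) by simp
 then have p: "real l + real CARD('d) - 2 > 0" using of_nat_0_le_iff[of l, where 'a = real] by linarith
 \<comment> \<open>The assumption l \<ge> 1 excludes k = 0, the case of constant eigenmaps.\<close>
 have k0: "k > 0" unfolding assms(10) by (rule mult_pos_pos[OF _ p]) (use assms(9) in simp)
 have g00: "g 0 = 0" using assms(3)[of 0] by simp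
 \<comment> \<open>If g vanished at \<phi>s as it does at 0, the mean value theorem would give a
   zero of g' in (0, \<phi>s), against the minimality of \<phi>s.\<close>
 have g0: "g \<phi>s \<noteq> 0"
 proof
  assume z: "g \<phi>s = 0"
  obtain x where x: "0 < x" "x < \<phi>s" "g \<phi>s - g 0 = (\<phi>s - 0) * deriv g x"
   using MVT2[OF assms(6), of g "deriv g"] gd by blast
  then have "deriv g x = 0" using z g00 assms(6) by simp
  then show False using assms(8)[OF x(1)] x(2) by simp
 qed
 show ?thesis
 proof (intro conjI impI)
  assume "equator_unique_minimizer CARD('d) k g \<phi>s"
  then show "equator_unique_weak_solution P X k g \<phi>s"
   by (rule minimizer_implies_uniqueness[OF assms(5,11) gd gc assms(7) g0 k0 d3])
 next
  assume "equator_unique_weak_solution P X k g \<phi>s"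
  then show "no_smooth_profile P X k g \<phi>s"
   by (rule profile_contradicts_uniqueness[OF assms(5,11) gd gc assms(7) g0 k0 d3])
 qed
qed

end
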